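(* Let $n\ge 2$ and let $D_n=\langle a,b\mid a^n=b^2=1,\ bab=a^{-1}\rangle$ be the dihedral group of order $2n$. Let $\mathcal{M}=CM(D_n,X,p)$ be a reflexible regular Cayley map for $D_n$ of valency $d=|X|$. If $d=2$, then $\mathcal{M}$ is isomorphic to $CM(D_n,\{b,ab\},(b,ab))$. If $d=3$, then $\mathcal{M}$ is isomorphic to $CM(D_2,\{b,ab,a\},(b,ab,a))$, to $CM(D_3,\{b,ab,a^2b\},(b,ab,a^2b))$, or to $CM(D_4,\{b,a,a^{-1}\},(b,a,a^{-1}))$. If $d\ge 4$, then $\mathcal{M}$ is isomorphic to one of the following maps (in each case $X_i$ is the set of entries of the cycle $p_i$): (1) $\mathcal{M}_1=CM(D_n,X_1,p_1)$ with $p_1=(b,\ ab,\ a^{\ell+1}b,\ a^{\ell^2+\ell+1}b,\ \ldots,\ a^{\ell^{d-2}+\ell^{d-3}+\cdots+1}b)$ (i.e. the $k$-th entry, $k=0,\dots,d-1$, is $a^{1+\ell+\cdots+\ell^{k-1}}b$), for some integer $\ell$ with $\ell^2\equiv 1\pmod n$, where $d$ is the smallest positive integer with $\ell^{d-1}+\ell^{d-2}+\cdots+1\equiv 0\pmod n$; (2) $n$ is even and $\mathcal{M}_2=CM(D_n,X_2,p_2)$ with $p_2=(b,a,a^2b,a^3,a^4b,\ldots,a^{n-2}b,a^{n-1})$ (the $k$-th entry, $k=0,\dots,n-1$, is $a^kb$ for $k$ even and $a^k$ for $k$ odd); (3) $n=2m$ is a multiple of $8$ and $\mathcal{M}_3=CM(D_n,X_3,p_3)$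 with $p_3=(b,a,a^{m+2}b,a^3,a^4b,\ldots,a^{m-2}b,a^{n-1})$ (the $k$-th entry, $k=0,\dots,n-1$, is $a^{k+(k/2)m}b$ for $k$ even and $a^k$ for $k$ odd); (4) $n=3k$ for some positive integer $k$ and $\mathcal{M}_4=CM(D_n,X_4,p_4)$ with $p_4=(a^{-1},a,b,a^2b)$; (5) $n=2m=8k+4$ for some positive integer $k$ and $\mathcal{M}_5=CM(D_n,X_5,p_5)$ with $p_5=(a^{-1},a,b,a^{m+1},a^{m-1},a^{m+2}b)$; (6) $n=2m=4k+2$ for some positive integer $k$ and $\mathcal{M}_6=CM(D_n,X_6,p_6)$ with $p_6=(b,a^{m-2}b,a,a^{-2}b,a^mb,a^{-1})$. Furthermore, all the Cayley maps $\mathcal{M}_1,\dots,\mathcal{M}_6$ listed above (under the stated conditions) are reflexible regular Cayley maps.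
   Context: For a finite group $G$ and a generating set $X\subseteq G\setminus\{1_G\}$ with $X=X^{-1}$, the Cayley graph $C(G,X)$ has vertex set $G$ with $g,h$ adjacent iff $g^{-1}h\in X$. For a cyclic permutation $p$ of $X$, the Cayley map $CM(G,X,p)$ is the embedding of $C(G,X)$ into an orientable surface in which the cyclic order of the edges $\{g,gx\}$, $x\in X$, around every vertex $g$ is given by $p$. A map automorphism is a graph automorphism extending to a homeomorphism of the surface. The map is regular if its group of orientation-preserving automorphisms acts transitively (hence regularly) on arcs (incident vertex-edge pairs), and reflexible if moreover it admits an orientation-reversing automorphism. The valency of $CM(G,X,p)$ is $|X|$. Isomorphism means isomorphism of maps. *)

theory Defs
  imports "HOL-Algebra.Generated_Groups" "HOL-Combinatorics.Cycles"
    "HOL-Combinatorics.Orbits" "HOL-Number_Theory.Cong"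
begin

text \<open>
  A cellular embedding of a simple graph in an oriented surface is represented by its rotation
  system: \<open>rot M v w\<close> is the neighbour of \<open>v\<close> such that, in the cyclic order around \<open>v\<close> induced by
  the orientation, the edge \<open>{v, rot M v w}\<close> is the successor of the edge \<open>{v, w}\<close>.
\<close>

record 'v omap =
  verts :: "'v set"
  adj :: "'v \<Rightarrow> 'v \<Rightarrow> bool"
  rot :: "'v \<Rightarrow> 'v \<Rightarrow> 'v"

definition arcs :: "'v omap \<Rightarrow> ('v \<times> 'v set) set" where
  "arcs M = {(v, {v, w}) | v w. v \<in> verts M \<and> w \<in> verts M \<and> adj M v w}"

definition graph_iso :: "'v omap \<Rightarrow> 'w omap \<Rightarrow> ('v \<Rightarrow> 'w) \<Rightarrow> bool" where
  "graph_iso M N f \<longleftrightarrow> bij_betw f (verts M) (verts N) \<and>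
     (\<forall>v \<in> verts M. \<forall>w \<in> verts M. adj M v w \<longleftrightarrow> adj N (f v) (f w))"

text \<open>
  A graph isomorphism extends to an orientation-preserving (orientation-reversing) homeomorphism
  of the surfaces iff it carries the cyclic order around each vertex to the cyclic order
  (to the inverse of the cyclic order) around its image.
\<close>

definition pres_iso :: "'v omap \<Rightarrow> 'w omap \<Rightarrow> ('v \<Rightarrow> 'w) \<Rightarrow> bool" where
  "pres_iso M N f \<longleftrightarrow> graph_iso M N f \<and>
     (\<forall>v \<in> verts M. \<forall>w \<in> verts M. adj M v w \<longrightarrow> f (rot M v w) = rot N (f v) (f w))"

definition rev_iso :: "'v omap \<Rightarrow> 'w omap \<Rightarrow> ('v \<Rightarrow> 'w) \<Rightarrow> bool" where
  "rev_iso M N f \<longleftrightarrow> graph_iso M N f \<and>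
     (\<forall>v \<in> verts M. \<forall>w \<in> verts M. adj M v w \<longrightarrow> rot N (f v) (f (rot M v w)) = f w)"

definition map_isomorphic :: "'v omap \<Rightarrow> 'w omap \<Rightarrow> bool" (infix \<open>\<simeq>\<^sub>m\<close> 50) where
  "M \<simeq>\<^sub>m N \<longleftrightarrow> (\<exists>f. pres_iso M N f \<or> rev_iso M N f)"

definition regular_map :: "'v omap \<Rightarrow> bool" where
  "regular_map M \<longleftrightarrow> (\<forall>(v, e) \<in> arcs M. \<forall>(v', e') \<in> arcs M.
     \<exists>f. pres_iso M M f \<and> f v = v' \<and> f ` e = e')"

definition reflexible_regular_map :: "'v omap \<Rightarrow> bool" where
  "reflexible_regular_map M \<longleftrightarrow> regular_map M \<and> (\<exists>f. rev_iso M M f)"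

definition CM :: "('g, 'r) monoid_scheme \<Rightarrow> 'g set \<Rightarrow> ('g \<Rightarrow> 'g) \<Rightarrow> 'g omap" where
  "CM G X p = \<lparr>
     verts = carrier G,
     adj = (\<lambda>g h. g \<in> carrier G \<and> h \<in> carrier G \<and> inv\<^bsub>G\<^esub> g \<otimes>\<^bsub>G\<^esub> h \<in> X),
     rot = (\<lambda>g h. g \<otimes>\<^bsub>G\<^esub> p (inv\<^bsub>G\<^esub> g \<otimes>\<^bsub>G\<^esub> h)) \<rparr>"

definition cayley_map_data :: "('g, 'r) monoid_scheme \<Rightarrow> 'g set \<Rightarrow> ('g \<Rightarrow> 'g) \<Rightarrow> bool" where
  "cayley_map_data G X p \<longleftrightarrow> group G \<and> finite (carrier G) \<and>
     X \<subseteq> carrier G - {\<one>\<^bsub>G\<^esub>} \<and> (\<lambda>x. inv\<^bsub>G\<^esub> x) ` X = X \<and> generate G X = carrier G \<and>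
     p permutes X \<and> cyclic_on p X"

definition reflexible_regular_CM :: "('g, 'r) monoid_scheme \<Rightarrow> 'g set \<Rightarrow> ('g \<Rightarrow> 'g) \<Rightarrow> bool" where
  "reflexible_regular_CM G X p \<longleftrightarrow> cayley_map_data G X p \<and> reflexible_regular_map (CM G X p)"

text \<open>
  The maps of the classification are given by a cycle \<open>p = (x\<^sub>0, \<dots>, x\<^sub>d\<^sub>-\<^sub>1)\<close> written as a list, with
  \<open>X\<close> its set of entries. Since \<^const>\<open>cycle_of_list\<close> is a cyclic permutation only for lists without
  repetitions, this requirement is part of the claim that such a list defines a Cayley map.
\<close>

definition CM_cycle :: "('g, 'r) monoid_scheme \<Rightarrow> 'g list \<Rightarrow> 'g omap" where
  "CM_cycle G xs = CM G (set xs) (cycle_of_list xs)"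

definition reflexible_regular_CM_cycle :: "('g, 'r) monoid_scheme \<Rightarrow> 'g list \<Rightarrow> bool" where
  "reflexible_regular_CM_cycle G xs \<longleftrightarrow>
     cycle xs \<and> reflexible_regular_CM G (set xs) (cycle_of_list xs)"

text \<open>
  The dihedral group of order \<open>2n\<close>; the pair \<open>(i, e)\<close> stands for \<open>a\<^sup>i\<close> if \<open>e\<close> is false and for
  \<open>a\<^sup>ib\<close> if \<open>e\<close> is true.
\<close>

definition dihedral :: "nat \<Rightarrow> (int \<times> bool) monoid" where
  "dihedral n = \<lparr>
     carrier = {0..<int n} \<times> UNIV,
     monoid.mult = (\<lambda>(i, e) (j, f). ((if e then i - j else i + j) mod int n, e \<noteq> f)),
     one = (0, False) \<rparr>"

definition dih_a :: "nat \<Rightarrow> int \<times> bool" where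
  "dih_a n = (1 mod int n, False)"

definition dih_b :: "int \<times> bool" where
  "dih_b = (0, True)"

definition apow :: "nat \<Rightarrow> int \<Rightarrow> int \<times> bool" where
  "apow n k = dih_a n [^]\<^bsub>dihedral n\<^esub> k"

definition apow_b :: "nat \<Rightarrow> int \<Rightarrow> int \<times> bool" where
  "apow_b n k = dih_a n [^]\<^bsub>dihedral n\<^esub> k \<otimes>\<^bsub>dihedral n\<^esub> dih_b"

lemma group_dihedral:
  assumes "n > 0" shows "group (dihedral n)"
proof (rule groupI)
  fix x y assume "x \<in> carrier (dihedral n)" "y \<in> carrier (dihedral n)"
  then show "x \<otimes>\<^bsub>dihedral n\<^esub> y \<in> carrier (dihedral n)"
    using assms by (auto simp: dihedral_def split: prod.splits)
next
  show "\<one>\<^bsub>dihedral n\<^esub> \<in> carrier (dihedral n)"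
    using assms by (auto simp: dihedral_def)
next
  fix x y z
  show "x \<otimes>\<^bsub>dihedral n\<^esub> y \<otimes>\<^bsub>dihedral n\<^esub> z = x \<otimes>\<^bsub>dihedral n\<^esub> (y \<otimes>\<^bsub>dihedral n\<^esub> z)"
    by (auto simp: dihedral_def mod_simps algebra_simps split: prod.splits)
next
  fix x assume x: "x \<in> carrier (dihedral n)"
  then show "\<one>\<^bsub>dihedral n\<^esub> \<otimes>\<^bsub>dihedral n\<^esub> x = x"
    by (auto simp: dihedral_def)
  obtain i e where [simp]: "x = (i, e)" by fastforce
  have "(if e then (i, e) else (- i mod int n, False)) \<otimes>\<^bsub>dihedral n\<^esub> x = \<one>\<^bsub>dihedral n\<^esub>"
    by (auto simp: dihedral_def mod_simps)
  moreover have "(if e then (i, e) else (- i mod int n, False)) \<in> carrier (dihedral n)"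
    using x assms by (auto simp: dihedral_def)
  ultimately show "\<exists>y \<in> carrier (dihedral n). y \<otimes>\<^bsub>dihedral n\<^esub> x = \<one>\<^bsub>dihedral n\<^esub>"
    by blast
qed

lemma order_dihedral: "order (dihedral n) = 2 * n"
  by (simp add: order_def dihedral_def card_cartesian_product)

lemma dih_gens_closed:
  assumes "n > 0" shows "dih_a n \<in> carrier (dihedral n)" "dih_b \<in> carrier (dihedral n)"
  using assms by (auto simp: dihedral_def dih_a_def dih_b_def)

lemma dih_a_nat_pow: "dih_a n [^]\<^bsub>dihedral n\<^esub> (k::nat) = (int k mod int n, False)" if "n > 0"
proof (induction k)
  case 0
  show ?case by (simp add: nat_pow_def dihedral_def)
next
  case (Suc k)
  then show ?case
    by (simp add: nat_pow_def dihedral_def dih_a_def mod_simps algebra_simps)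
qed

lemma apow_eq: "apow n k = (k mod int n, False)" if n: "n > 0"
proof -
  interpret group "dihedral n" using n by (rule group_dihedral)
  show ?thesis
  proof (cases "k \<ge> 0")
    case True
    then obtain m where "k = int m" by (metis nat_eq_iff)
    then show ?thesis using dih_a_nat_pow[OF n] by (simp add: apow_def int_pow_int)
  next
    case False
    then obtain m where m: "k = - int m" by (metis int_cases2 of_nat_0_le_iff)
    have "inv\<^bsub>dihedral n\<^esub> (int m mod int n, False) = (k mod int n, False)"
      using n by (intro inv_equality) (auto simp: dihedral_def m mod_simps)
    then show ?thesis
      using dih_a_nat_pow[OF n] dih_gens_closed[OF n] m by (simp add: apow_def int_pow_neg int_pow_int)
  qed
qed

lemma apow_b_eq: "apow_b n k = (k mod int n, True)" if "n > 0"
  using apow_eq[OF that, of k] unfolding apow_b_def apow_def by (simp add: dihedral_def dih_b_def)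

lemma dihedral_relations:
  assumes "n > 0"
  shows "dih_a n [^]\<^bsub>dihedral n\<^esub> n = \<one>\<^bsub>dihedral n\<^esub>"
    and "dih_b \<otimes>\<^bsub>dihedral n\<^esub> dih_b = \<one>\<^bsub>dihedral n\<^esub>"
    and "dih_b \<otimes>\<^bsub>dihedral n\<^esub> dih_a n \<otimes>\<^bsub>dihedral n\<^esub> dih_b = inv\<^bsub>dihedral n\<^esub> (dih_a n)"
proof -
  interpret group "dihedral n" using assms by (rule group_dihedral)
  show "dih_a n [^]\<^bsub>dihedral n\<^esub> n = \<one>\<^bsub>dihedral n\<^esub>"
    using assms by (simp add: dih_a_nat_pow) (simp add: dihedral_def)
  show "dih_b \<otimes>\<^bsub>dihedral n\<^esub> dih_b = \<one>\<^bsub>dihedral n\<^esub>"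
    by (simp add: dihedral_def dih_b_def)
  show "dih_b \<otimes>\<^bsub>dihedral n\<^esub> dih_a n \<otimes>\<^bsub>dihedral n\<^esub> dih_b = inv\<^bsub>dihedral n\<^esub> (dih_a n)"
    using assms
    by (intro inv_equality[symmetric]) (auto simp: dihedral_def dih_a_def dih_b_def mod_simps)
qed

lemma generate_dihedral:
  assumes n: "n > 0"
  shows "generate (dihedral n) {dih_a n, dih_b} = carrier (dihedral n)"
proof -
  interpret group "dihedral n" using n by (rule group_dihedral)
  have sub: "{dih_a n, dih_b} \<subseteq> carrier (dihedral n)" using dih_gens_closed[OF n] by auto
  have sg: "subgroup (generate (dihedral n) {dih_a n, dih_b}) (dihedral n)"
    using sub by (rule generate_is_subgroup)
  have r: "apow n k \<in> generate (dihedral n) {dih_a n, dih_b}" for k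
    unfolding apow_def by (rule subgroup_int_pow_closed[OF sg]) (auto intro: generate.incl)
  have s: "apow_b n k \<in> generate (dihedral n) {dih_a n, dih_b}" for k
    using r[of k] unfolding apow_b_def apow_def by (auto intro: generate.eng generate.incl)
  have "carrier (dihedral n) \<subseteq> generate (dihedral n) {dih_a n, dih_b}"
  proof
    fix x assume x: "x \<in> carrier (dihedral n)"
    obtain i e where ie: "x = (i, e)" by fastforce
    then show "x \<in> generate (dihedral n) {dih_a n, dih_b}"
      using x r[of i] s[of i] n by (cases e) (auto simp: apow_eq apow_b_eq dihedral_def)
  qed
  then show ?thesis using generate_incl[OF sub] by blast
qed

definition least_geom_sum_zero :: "nat \<Rightarrow> int \<Rightarrow> nat \<Rightarrow> bool" where
  "least_geom_sum_zero n l d \<longleftrightarrow> d > 0 \<and> [(\<Sum>i<d. l ^ i) = 0] (mod int n) \<and>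
     (\<forall>j. 0 < j \<and> j < d \<longrightarrow> \<not> [(\<Sum>i<j. l ^ i) = 0] (mod int n))"

definition cyc1 :: "nat \<Rightarrow> int \<Rightarrow> nat \<Rightarrow> (int \<times> bool) list" where
  "cyc1 n l d = map (\<lambda>k. apow_b n (\<Sum>i<k. l ^ i)) [0..<d]"

definition cyc2 :: "nat \<Rightarrow> (int \<times> bool) list" where
  "cyc2 n = map (\<lambda>k. if even k then apow_b n (int k) else apow n (int k)) [0..<n]"

definition cyc3 :: "nat \<Rightarrow> nat \<Rightarrow> (int \<times> bool) list" where
  "cyc3 n m = map (\<lambda>k. if even k then apow_b n (int (k + (k div 2) * m)) else apow n (int k)) [0..<n]"

definition cyc4 :: "nat \<Rightarrow> (int \<times> bool) list" where
  "cyc4 n = [apow n (- 1), apow n 1, apow_b n 0, apow_b n 2]"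

definition cyc5 :: "nat \<Rightarrow> nat \<Rightarrow> (int \<times> bool) list" where
  "cyc5 n m = [apow n (- 1), apow n 1, apow_b n 0,
     apow n (int m + 1), apow n (int m - 1), apow_b n (int m + 2)]"

definition cyc6 :: "nat \<Rightarrow> nat \<Rightarrow> (int \<times> bool) list" where
  "cyc6 n m = [apow_b n 0, apow_b n (int m - 2), apow n 1, apow_b n (- 2), apow_b n (int m), apow n (- 1)]"

end

theory Submission
  imports Defs
begin

text \<open>
  Number the entries of the cycle \<open>p\<close> by integers modulo \<open>d\<close>. An orientation-preserving automorphism
  \<open>F\<close> acts at each vertex \<open>g\<close> by \<open>F(g x\<^sub>i) = F(g) x\<^sub>i\<^sub>+\<^sub>P\<^sub>(\<^sub>g\<^sub>)\<close>, so the rotations about the vertex \<open>1\<close>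
  form a family of skew morphisms; an orientation-reversing automorphism reverses the indices instead.

  If \<open>X\<close> consists of reflections, a rotation about \<open>1\<close> multiplies all differences of exponents by a
  constant \<open>\<ell>\<close>, and the mirror symmetry gives \<open>\<ell>\<^sup>2 = 1\<close>: this is the first family. Otherwise, factoring
  out the core of the rotation subgroup leaves a system in which two different places where a reflection
  is followed by a rotation would produce a translation of \<open>X\<close>; hence the indices of the reflections
  form one of four periodic patterns (one in two, one in three, two in three, two in four), and these
  lift to the original map. For each pattern the mirror symmetry determines \<open>X\<close> up to an
  affine automorphism of the dihedral group. Conversely, the listed maps have an explicit rotation about
  \<open>1\<close> and a group automorphism that reverses the cycle.
\<close>

section \<open>Skew morphisms of dihedral groups\<close>

text \<open>\<open>F t\<close> is not a homomorphism and \<open>P t\<close> varies from vertex to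
  vertex, so ordinary automorphism arguments fail. The handle is that rotations commute and
  reflections invert them: words of length two in \<open>X\<close> coincide in many ways, and each
  coincidence can be moved by \<open>F t\<close> to shifted indices, where the types of the factors
  may have changed. An element \<open>a^c\<close> at which \<open>F 1\<close> rotates by exactly one
  step, with a rotation as image, lies in the core. When the core is trivial, such an element is
  trivial and its two representations have equal indices. Exponents and indices are kept as integers
  and every equation is a congruence. A quotient then replaces \<open>n\<close> and \<open>d\<close>
  by divisors and leaves \<open>x\<close>, \<open>chi\<close>, \<open>F\<close>, \<open>P\<close>
  untouched; the patterns speak of indices modulo 2, 3 or 4 only, so they hold upstairs without any
  lifting argument. Regularity alone leaves scalars free, such as the factor by which the rotation
  acts on the core. The mirror conjugates the rotation to its inverse, which makes these scalars
  square to one where they act; this is what pins down the exponents.\<close>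

lemma dvd_comb1: "(m::int) dvd x \<Longrightarrow> z = a * x \<Longrightarrow> m dvd z"
  by simp

text \<open>Together with the other arities this is a certificate rule: a congruence is derived by
  exhibiting it as an explicit integer combination of known ones, and the simplifier only has to
  check a polynomial identity.\<close>

lemma dvd_comb2: "(m::int) dvd x \<Longrightarrow> m dvd y \<Longrightarrow> z = a * x + b * y \<Longrightarrow> m dvd z"
  by simp

lemma dvd_comb3: "(m::int) dvd x \<Longrightarrow> m dvd y \<Longrightarrow> m dvd w \<Longrightarrow> z = a * x + b * y + c * w \<Longrightarrow> m dvd z"
  by simp

lemma dvd_comb4: "(m::int) dvd x \<Longrightarrow> m dvd y \<Longrightarrow> m dvd w \<Longrightarrow> m dvd v \<Longrightarrow>
    z = a * x + b * y + c * w + e * v \<Longrightarrow> m dvd z"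
  by simp

lemma dvd_comb5: "(m::int) dvd x \<Longrightarrow> m dvd y \<Longrightarrow> m dvd w \<Longrightarrow> m dvd v \<Longrightarrow> m dvd u \<Longrightarrow>
    z = a * x + b * y + c * w + e * v + f * u \<Longrightarrow> m dvd z"
  by simp

text \<open>
  Elements of the infinite dihedral group are pairs \<open>(i, e)\<close>, read as in \<^const>\<open>dihedral\<close>; the
  dihedral group of order \<open>2n\<close> is its quotient by the congruence \<open>dih_eq n\<close>. Passing to a quotient
  of the dihedral group then amounts to replacing \<open>n\<close> by a divisor.
\<close>

definition dmul :: "int \<times> bool \<Rightarrow> int \<times> bool \<Rightarrow> int \<times> bool" where
  "dmul g h = (if snd g then fst g - fst h else fst g + fst h, snd g \<noteq> snd h)"

definition dih_eq :: "int \<Rightarrow> int \<times> bool \<Rightarrow> int \<times> bool \<Rightarrow> bool" where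
  "dih_eq n g h \<longleftrightarrow> snd g = snd h \<and> n dvd fst g - fst h"

lemma dmul_assoc: "dmul (dmul g h) k = dmul g (dmul h k)"
  by (auto simp: dmul_def)

lemma dmul_one [simp]: "dmul (0, False) g = g" "dmul g (0, False) = g"
  by (cases g; auto simp: dmul_def)+

lemma dmul_rot [simp]: "dmul (i, False) (j, e) = (i + j, e)"
  by (simp add: dmul_def)

lemma dmul_ref [simp]: "dmul (i, True) (j, e) = (i - j, \<not> e)"
  by (simp add: dmul_def)

lemma dih_eq_refl [simp]: "dih_eq n g g"
  by (simp add: dih_eq_def)

lemma dih_eq_sym: "dih_eq n g h \<Longrightarrow> dih_eq n h g"
  by (auto simp: dih_eq_def dvd_diff_commute)

lemma dih_eq_trans [trans]: "dih_eq n g h \<Longrightarrow> dih_eq n h k \<Longrightarrow> dih_eq n g k"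
  unfolding dih_eq_def by (metis (no_types, lifting) diff_add_cancel add_diff_eq dvd_add)

lemma dih_eq_rot [simp]: "dih_eq n (a, e) (b, f) \<longleftrightarrow> e = f \<and> n dvd a - b"
  by (simp add: dih_eq_def)

lemma dih_eq_dmul: "dih_eq n g g' \<Longrightarrow> dih_eq n h h' \<Longrightarrow> dih_eq n (dmul g h) (dmul g' h')"
proof -
  assume "dih_eq n g g'" "dih_eq n h h'"
  then have *: "n dvd fst g - fst g'" "n dvd fst h - fst h'" and "snd g = snd g'" "snd h = snd h'"
    by (simp_all add: dih_eq_def)
  moreover have "n dvd (fst g + fst h) - (fst g' + fst h')"
    using * by (rule dvd_comb2[where a = 1 and b = 1]) simp
  moreover have "n dvd (fst g - fst h) - (fst g' - fst h')"
    using * by (rule dvd_comb2[where a = 1 and b = "-1"]) simp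
  ultimately show ?thesis by (simp add: dih_eq_def dmul_def)
qed

lemma dih_eq_dmul_cancel_left: "dih_eq n (dmul g h) (dmul g h') \<longleftrightarrow> dih_eq n h h'"
  unfolding dih_eq_def dmul_def by (auto simp: dvd_diff_commute)

text \<open>
  \<open>F t\<close> is the automorphism that fixes the vertex \<open>1\<close> and maps \<open>x i\<close> to \<open>x (i + t)\<close>, \<open>P t g\<close> is the
  amount by which it rotates the arcs at \<open>g\<close>, and \<open>x (chi i)\<close> is the inverse of \<open>x i\<close>.
\<close>

locale skew =
  fixes n d :: int and x :: "int \<Rightarrow> int \<times> bool" and chi :: "int \<Rightarrow> int"
    and F :: "int \<Rightarrow> int \<times> bool \<Rightarrow> int \<times> bool" and P :: "int \<Rightarrow> int \<times> bool \<Rightarrow> int"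
  assumes n_pos: "0 < n" and d_pos: "0 < d"
    and x_eq: "\<And>i j. dih_eq n (x i) (x j) \<longleftrightarrow> d dvd i - j"
    and chi_inv: "\<And>i. dih_eq n (dmul (x i) (x (chi i))) (0, False)"
    and F_cong: "\<And>t g h. dih_eq n g h \<Longrightarrow> dih_eq n (F t g) (F t h)"
    and P_cong: "\<And>t g h. dih_eq n g h \<Longrightarrow> d dvd P t g - P t h"
    and F_one: "\<And>t. dih_eq n (F t (0, False)) (0, False)"
    and P_one: "\<And>t. d dvd P t (0, False) - t"
    and F_step: "\<And>t g i. dih_eq n (F t (dmul g (x i))) (dmul (F t g) (x (i + P t g)))"
    and P_step: "\<And>t g i. d dvd P t (dmul g (x i)) - (chi (i + P t g) - chi i)"
    and gen: "\<And>Q g. (\<And>g h. dih_eq n g h \<Longrightarrow> Q g \<Longrightarrow> Q h) \<Longrightarrow> Q (0, False) \<Longrightarrow>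
                (\<And>g i. Q g \<Longrightarrow> Q (dmul g (x i))) \<Longrightarrow> Q g"
begin

abbreviation eqv :: "int \<times> bool \<Rightarrow> int \<times> bool \<Rightarrow> bool" (infix \<open>\<approx>\<close> 50) where
  "g \<approx> h \<equiv> dih_eq n g h"

abbreviation s :: "int \<Rightarrow> int" where "s i \<equiv> fst (x i)"

abbreviation rho :: "int \<Rightarrow> bool" where "rho i \<equiv> snd (x i)"

lemma s_cong: "d dvd i - j \<Longrightarrow> n dvd s i - s j"
  using x_eq[of i j] by (simp add: dih_eq_def)

lemma rho_cong: "d dvd i - j \<Longrightarrow> rho i = rho j"
  using x_eq[of i j] by (simp add: dih_eq_def)

lemma x_cong: "d dvd i - j \<Longrightarrow> x i \<approx> x j"
  using x_eq by blast

lemma x_inj: "x i \<approx> x j \<Longrightarrow> d dvd i - j"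
  using x_eq by blast

lemma eq_index: "rho i = rho j \<Longrightarrow> n dvd s i - s j \<Longrightarrow> d dvd i - j"
  by (intro x_inj) (simp add: dih_eq_def)

lemma rho_chi [simp]: "rho (chi i) = rho i"
  using chi_inv[of i] by (auto simp: dih_eq_def dmul_def)

lemma s_chi: "\<not> rho i \<Longrightarrow> n dvd s i + s (chi i)"
  using chi_inv[of i] by (auto simp: dih_eq_def dmul_def)

lemma chi_refl: "rho i \<Longrightarrow> d dvd chi i - i"
  using chi_inv[of i] by (intro x_inj) (auto simp: dih_eq_def dmul_def dvd_diff_commute)

lemma chi_eqI: "\<not> rho i \<Longrightarrow> \<not> rho j \<Longrightarrow> n dvd s i + s j \<Longrightarrow> d dvd chi i - j"
proof -
  assume "\<not> rho i" "\<not> rho j" "n dvd s i + s j"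
  from this(3) s_chi[OF this(1)] have "n dvd s (chi i) - s j"
    by (rule dvd_comb2[where a = "-1" and b = 1]) simp
  with \<open>\<not> rho i\<close> \<open>\<not> rho j\<close> show ?thesis by (intro eq_index) auto
qed

lemma chi_chi: "d dvd chi (chi i) - i"
proof (cases "rho i")
  case True
  then have "d dvd chi (chi i) - chi i" "d dvd chi i - i" by (simp_all add: chi_refl)
  then show ?thesis by (rule dvd_comb2[where a = 1 and b = 1]) simp
next
  case False
  then show ?thesis using s_chi[of i] by (intro chi_eqI) (auto simp: add.commute)
qed

lemma chi_cong: "d dvd i - j \<Longrightarrow> d dvd chi i - chi j"
proof -
  assume ij: "d dvd i - j"
  show ?thesis
  proof (cases "rho i")
    case True
    then have "rho j" using rho_cong[OF ij] by simp
    from chi_refl[OF True] chi_refl[OF this] ij show ?thesis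
      by (rule dvd_comb3[where a = 1 and b = "-1" and c = 1]) simp
  next
    case False
    then have "\<not> rho j" using rho_cong[OF ij] by simp
    from s_chi[OF this] s_cong[OF ij] have "n dvd s i + s (chi j)"
      by (rule dvd_comb2[where a = 1 and b = 1]) simp
    with False show ?thesis by (intro chi_eqI) (auto simp: \<open>\<not> rho j\<close>)
  qed
qed

lemma chi_inject: "d dvd chi i - chi j \<Longrightarrow> d dvd i - j"
  using chi_cong[of "chi i" "chi j"] chi_chi[of i] chi_chi[of j]
    dvd_comb3[of d "chi (chi i) - chi (chi j)" "chi (chi i) - i" "chi (chi j) - j" "i - j" 1 "-1" 1]
  by simp

lemma chi_swap: "d dvd chi i - j \<Longrightarrow> d dvd chi j - i"
  using chi_cong[of "chi i" j] chi_chi[of i]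
    dvd_comb2[of d "chi (chi i) - chi j" "chi (chi i) - i" "chi j - i" "-1" 1]
  by simp

text \<open>The step equations determine \<open>F t\<close> and \<open>P t\<close> recursively along
  words in \<open>X\<close>, so agreement at 1 propagates by the induction rule \<open>gen\<close>.
  The following identities are proved in the same way.\<close>

lemma FP_index:
  assumes "d dvd t - t'"
  shows "F t g \<approx> F t' g \<and> d dvd P t g - P t' g"
proof (induction g rule: gen)
  case (1 g h)
  have "F t h \<approx> F t' h"
    using 1 F_cong[OF 1(1)] by (metis dih_eq_sym dih_eq_trans)
  moreover have "d dvd P t h - P t' h"
    using conjunct2[OF 1(2)] P_cong[OF 1(1), of t] P_cong[OF 1(1), of t']
    by (rule dvd_comb3[where a = 1 and b = "-1" and c = 1]) simp
  ultimately show ?case by simp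
next
  case 2
  have "F t (0, False) \<approx> F t' (0, False)" by (metis F_one dih_eq_sym dih_eq_trans)
  moreover have "d dvd P t (0, False) - P t' (0, False)"
    using P_one[of t] P_one[of t'] assms
    by (rule dvd_comb3[where a = 1 and b = "-1" and c = 1]) simp
  ultimately show ?case by simp
next
  case (3 g i)
  let ?a = "i + P t g" and ?b = "i + P t' g"
  have ab: "d dvd ?a - ?b" using 3 by simp
  have "F t (dmul g (x i)) \<approx> dmul (F t g) (x ?a)" by (rule F_step)
  also have "dmul (F t g) (x ?a) \<approx> dmul (F t' g) (x ?b)"
    using 3 x_cong[OF ab] by (intro dih_eq_dmul) auto
  also have "\<dots> \<approx> F t' (dmul g (x i))" by (rule dih_eq_sym, rule F_step)
  finally have "F t (dmul g (x i)) \<approx> F t' (dmul g (x i))" .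
  moreover have "d dvd P t (dmul g (x i)) - P t' (dmul g (x i))"
    using P_step[of t g i] P_step[of t' g i] chi_cong[OF ab]
    by (rule dvd_comb3[where a = 1 and b = "-1" and c = 1]) simp
  ultimately show ?case by simp
qed

lemma F_index: "d dvd t - t' \<Longrightarrow> g \<approx> h \<Longrightarrow> F t g \<approx> F t' h"
  using FP_index F_cong dih_eq_trans by blast

lemma P_index: "d dvd t - t' \<Longrightarrow> g \<approx> h \<Longrightarrow> d dvd P t g - P t' h"
  using FP_index[of t t' g] P_cong[of g h t']
    dvd_comb2[of d "P t g - P t' g" "P t' g - P t' h" "P t g - P t' h" 1 1]
  by simp

text \<open>This is the skew morphism identity. Seen from the vertex \<open>g\<close>, the
  automorphism \<open>F t\<close> followed by the translation that brings \<open>F t g\<close> back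
  to 1 fixes 1 and rotates there by \<open>P t g\<close>, so it acts as
  \<open>F (P t g)\<close>.\<close>

lemma FP_mult: "F t (dmul g h) \<approx> dmul (F t g) (F (P t g) h) \<and>
    d dvd P t (dmul g h) - P (P t g) h"
proof (induction h rule: gen)
  case (1 h k)
  have e: "dmul g h \<approx> dmul g k" using 1 by (intro dih_eq_dmul) auto
  have "F t (dmul g k) \<approx> F t (dmul g h)" by (rule dih_eq_sym, rule F_cong[OF e])
  also have "\<dots> \<approx> dmul (F t g) (F (P t g) h)" using 1 by simp
  also have "\<dots> \<approx> dmul (F t g) (F (P t g) k)"
    using F_cong[OF 1(1)] by (intro dih_eq_dmul) auto
  finally have "F t (dmul g k) \<approx> dmul (F t g) (F (P t g) k)" .
  moreover have "d dvd P t (dmul g k) - P (P t g) k"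
    using conjunct2[OF 1(2)] P_cong[OF e, of t] P_cong[OF 1(1), of "P t g"]
    by (rule dvd_comb3[where a = 1 and b = "-1" and c = 1]) simp
  ultimately show ?case by simp
next
  case 2
  have "dmul (F t g) (F (P t g) (0, False)) \<approx> dmul (F t g) (0, False)"
    by (intro dih_eq_dmul F_one) auto
  moreover have "d dvd P t g - P (P t g) (0, False)"
    using P_one[of "P t g"] by (simp add: dvd_diff_commute)
  ultimately show ?case by (simp add: dih_eq_sym)
next
  case (3 h i)
  let ?a = "i + P t (dmul g h)" and ?b = "i + P (P t g) h"
  have ab: "d dvd ?a - ?b" using 3 by simp
  have "F t (dmul (dmul g h) (x i)) \<approx> dmul (F t (dmul g h)) (x ?a)" by (rule F_step)
  also have "\<dots> \<approx> dmul (dmul (F t g) (F (P t g) h)) (x ?b)"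
    using 3 x_cong[OF ab] by (intro dih_eq_dmul) auto
  also have "\<dots> = dmul (F t g) (dmul (F (P t g) h) (x ?b))" by (simp add: dmul_assoc)
  also have "\<dots> \<approx> dmul (F t g) (F (P t g) (dmul h (x i)))"
    by (intro dih_eq_dmul dih_eq_refl dih_eq_sym[OF F_step])
  finally have "F t (dmul g (dmul h (x i))) \<approx> dmul (F t g) (F (P t g) (dmul h (x i)))"
    by (simp add: dmul_assoc)
  moreover have "d dvd P t (dmul g (dmul h (x i))) - P (P t g) (dmul h (x i))"
    using P_step[of t "dmul g h" i] P_step[of "P t g" h i] chi_cong[OF ab]
    unfolding dmul_assoc by (rule dvd_comb3[where a = 1 and b = "-1" and c = 1]) simp
  ultimately show ?case by simp
qed

lemmas F_mult = FP_mult[THEN conjunct1] and P_mult = FP_mult[THEN conjunct2]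

lemma F_x: "F t (x i) \<approx> x (i + t)"
proof -
  have "F t (dmul (0, False) (x i)) \<approx> dmul (F t (0, False)) (x (i + P t (0, False)))"
    by (rule F_step)
  also have "\<dots> \<approx> dmul (0, False) (x (i + t))"
    using P_one[of t] by (intro dih_eq_dmul F_one x_cong) simp
  finally show ?thesis by simp
qed

lemma P_x: "d dvd P t (x i) - (chi (i + t) - chi i)"
proof -
  have "d dvd P t (x i) - (chi (i + P t (0, False)) - chi i)"
    using P_step[of t "(0, False)" i] by simp
  moreover have "d dvd chi (i + P t (0, False)) - chi (i + t)"
    using P_one[of t] by (intro chi_cong) simp
  ultimately show ?thesis by (rule dvd_comb2[where a = 1 and b = 1]) simp
qed

text \<open>Composition of two rotations about 1. The amounts add along the orbit of
  \<open>g\<close>: the second rotation is felt at the image \<open>F t g\<close>.\<close>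

lemma FP_add: "F (u + t) g \<approx> F u (F t g) \<and> d dvd P (u + t) g - (P t g + P u (F t g))"
proof (induction g rule: gen)
  case (1 g h)
  have e: "F t g \<approx> F t h" by (rule F_cong[OF 1(1)])
  have "F (u + t) h \<approx> F (u + t) g" by (rule dih_eq_sym, rule F_cong[OF 1(1)])
  also have "\<dots> \<approx> F u (F t g)" using 1 by simp
  also have "\<dots> \<approx> F u (F t h)" by (rule F_cong[OF e])
  finally have "F (u + t) h \<approx> F u (F t h)" .
  moreover have "d dvd P (u + t) h - (P t h + P u (F t h))"
    using conjunct2[OF 1(2)] P_cong[OF 1(1), of "u + t"] P_cong[OF 1(1), of t] P_cong[OF e, of u]
    by (rule dvd_comb4[where a = 1 and b = "-1" and c = 1 and e = 1]) simp
  ultimately show ?case by simp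
next
  case 2
  have "F (u + t) (0, False) \<approx> (0, False)" by (rule F_one)
  also have "(0, False) \<approx> F u (0, False)" by (rule dih_eq_sym, rule F_one)
  also have "F u (0, False) \<approx> F u (F t (0, False))" by (rule F_cong, rule dih_eq_sym, rule F_one)
  finally have "F (u + t) (0, False) \<approx> F u (F t (0, False))" .
  moreover have "d dvd P (u + t) (0, False) - (P t (0, False) + P u (F t (0, False)))"
    using P_one[of "u + t"] P_one[of t] P_one[of u] P_cong[OF F_one, of u t]
    by (rule dvd_comb4[where a = 1 and b = "-1" and c = "-1" and e = "-1"]) simp
  ultimately show ?case by simp
next
  case (3 g i)
  let ?a = "i + P (u + t) g" and ?b = "i + P t g"
  have ab: "d dvd ?a - (?b + P u (F t g))" using 3 by (simp add: algebra_simps)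
  have "F (u + t) (dmul g (x i)) \<approx> dmul (F (u + t) g) (x ?a)" by (rule F_step)
  also have "\<dots> \<approx> dmul (F u (F t g)) (x (?b + P u (F t g)))"
    using 3 x_cong[OF ab] by (intro dih_eq_dmul) auto
  also have "\<dots> \<approx> F u (dmul (F t g) (x ?b))" by (rule dih_eq_sym, rule F_step)
  also have "\<dots> \<approx> F u (F t (dmul g (x i)))" by (rule F_cong, rule dih_eq_sym, rule F_step)
  finally have "F (u + t) (dmul g (x i)) \<approx> F u (F t (dmul g (x i)))" .
  moreover have "d dvd P (u + t) (dmul g (x i)) - (P t (dmul g (x i)) + P u (F t (dmul g (x i))))"
  proof -
    have e: "d dvd P u (F t (dmul g (x i))) - (chi (?b + P u (F t g)) - chi ?b)"
      using P_step[of u "F t g" ?b] P_cong[OF F_step[of t g i], of u]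
      by (rule dvd_comb2[where a = 1 and b = 1]) simp
    show ?thesis
      using P_step[of "u + t" g i] chi_cong[OF ab] P_step[of t g i] e
      by (rule dvd_comb4[where a = 1 and b = 1 and c = "-1" and e = "-1"]) simp
  qed
  ultimately show ?case by simp
qed

lemmas F_add = FP_add[THEN conjunct1] and P_add = FP_add[THEN conjunct2]

lemma FP_zero: "F 0 g \<approx> g \<and> d dvd P 0 g"
proof (induction g rule: gen)
  case (1 g h)
  have "F 0 h \<approx> h" using 1 F_cong[OF 1(1), of 0] by (metis dih_eq_sym dih_eq_trans)
  moreover have "d dvd P 0 h" using conjunct2[OF 1(2)] P_cong[OF 1(1), of 0]
    by (rule dvd_comb2[where a = 1 and b = "-1"]) simp
  ultimately show ?case by simp
next
  case 2
  show ?case using F_one[of 0] P_one[of 0] by simp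
next
  case (3 g i)
  have "F 0 (dmul g (x i)) \<approx> dmul (F 0 g) (x (i + P 0 g))" by (rule F_step)
  also have "\<dots> \<approx> dmul g (x i)" using 3 by (intro dih_eq_dmul x_cong) auto
  finally have "F 0 (dmul g (x i)) \<approx> dmul g (x i)" .
  moreover have "d dvd P 0 (dmul g (x i))"
  proof -
    have "d dvd chi (i + P 0 g) - chi i" using 3 by (intro chi_cong) simp
    with P_step[of 0 g i] show ?thesis by (rule dvd_comb2[where a = 1 and b = 1]) simp
  qed
  ultimately show ?case by simp
qed

lemma F_x2: "F t (dmul (x i) (x j)) \<approx> dmul (x (i + t)) (x (j + chi (i + t) - chi i))"
proof -
  have "F t (dmul (x i) (x j)) \<approx> dmul (F t (x i)) (x (j + P t (x i)))" by (rule F_step)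
  also have "\<dots> \<approx> dmul (x (i + t)) (x (j + chi (i + t) - chi i))"
    using P_x[of t i] by (intro dih_eq_dmul F_x x_cong) (simp add: algebra_simps)
  finally show ?thesis .
qed

lemma P_x2: "d dvd P t (dmul (x i) (x j)) - (chi (j + chi (i + t) - chi i) - chi j)"
proof -
  have "d dvd chi (j + P t (x i)) - chi (j + chi (i + t) - chi i)"
    using P_x[of t i] by (intro chi_cong) (simp add: algebra_simps)
  with P_step[of t "x i" j] show ?thesis by (rule dvd_comb2[where a = 1 and b = 1]) simp
qed

text \<open>The main computational device. A coincidence of two words of length two is moved by
  \<open>F t\<close>; the second indices are corrected through \<open>chi\<close> because the
  automorphism rotates by \<open>chi (i + t) - chi i\<close> at the end of the first arc.\<close>

lemma transfer2:
  assumes "dmul (x i) (x j) \<approx> dmul (x k) (x l)"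
  shows "dmul (x (i + t)) (x (j + chi (i + t) - chi i)) \<approx>
    dmul (x (k + t)) (x (l + chi (k + t) - chi k))"
  using F_cong[OF assms, of t] F_x2[of t i j] F_x2[of t k l] by (metis dih_eq_sym dih_eq_trans)

end

section \<open>The core of the rotation subgroup and its quotient\<close>

lemma exists_generator:
  fixes n :: int and N :: "int \<Rightarrow> bool"
  assumes "0 < n" "N n" and add: "\<And>a b. N a \<Longrightarrow> N b \<Longrightarrow> N (a + b)"
    and minus: "\<And>a. N a \<Longrightarrow> N (- a)"
  obtains k where "0 < k" "\<And>c. N c \<longleftrightarrow> k dvd c"
proof -
  define m where "m = (LEAST m::nat. 0 < m \<and> N (int m))"
  have ex: "0 < nat n \<and> N (int (nat n))" using assms by simp
  then have m: "0 < m" "N (int m)" unfolding m_def by (metis (mono_tags, lifting) LeastI)+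
  have least: "m \<le> j" if "0 < j" "N (int j)" for j
    unfolding m_def using that by (simp add: Least_le)
  have mult: "N (int m * int j)" for j
  proof (induction j)
    case 0
    then show ?case using add[OF m(2) minus[OF m(2)]] by simp
  next
    case (Suc j)
    then show ?case using add[OF m(2), of "int m * int j"] by (simp add: algebra_simps)
  qed
  have multi: "N (int m * j)" for j
  proof (cases "0 \<le> j")
    case True
    then show ?thesis using mult[of "nat j"] by simp
  next
    case False
    then show ?thesis using minus[OF mult[of "nat (- j)"]] by simp
  qed
  have "N c \<longleftrightarrow> int m dvd c" for c
  proof
    assume c: "N c"
    have "N (c + - (int m * (c div int m)))" by (rule add[OF c minus[OF multi]])
    then have N: "N (c mod int m)" by (simp add: minus_mult_div_eq_mod)
    have "c mod int m = 0"
    proof (rule ccontr)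
      assume "c mod int m \<noteq> 0"
      moreover have "0 \<le> c mod int m" using m by simp
      ultimately have pos: "0 < c mod int m" by linarith
      then have "m \<le> nat (c mod int m)" using N by (intro least) auto
      moreover have "c mod int m < int m" using m by simp
      ultimately show False using pos by linarith
    qed
    then show "int m dvd c" by auto
  next
    assume "int m dvd c"
    then show "N c" using multi by auto
  qed
  then show ?thesis using that[of "int m"] m by simp
qed

lemma dvd_diff_cong: "(m::int) dvd a - b \<Longrightarrow> m dvd a - c \<longleftrightarrow> m dvd b - c"
  using dvd_add_right_iff[of m "a - b" "b - c"] by simp

lemma dvd_diff_trans: "(m::int) dvd a - b \<Longrightarrow> m dvd b - c \<Longrightarrow> m dvd a - c"
  using dvd_diff_cong by blast

context skew
begin

text \<open>\<open>inN c\<close> says that \<open>a\<^sup>c\<close> lies in the core of the group of rotations.\<close>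

definition inN :: "int \<Rightarrow> bool" where
  "inN c \<longleftrightarrow> \<not> snd (F 1 (c, False)) \<and> d dvd P 1 (c, False) - 1"

lemma inN_cong: "n dvd c - c' \<Longrightarrow> inN c \<longleftrightarrow> inN c'"
proof -
  assume "n dvd c - c'"
  then have e: "(c, False) \<approx> (c', False)" by simp
  have "d dvd P 1 (c, False) - 1 \<longleftrightarrow> d dvd P 1 (c', False) - 1"
    by (rule dvd_diff_cong[OF P_cong[OF e]])
  then show ?thesis using F_cong[OF e, of 1] by (simp add: inN_def dih_eq_def)
qed

lemma F_rot_add:
  assumes "F t (c, False) \<approx> (e, False)" "d dvd P t (c, False) - t'" "F t' (c', False) \<approx> (e', False)"
  shows "F t (c + c', False) \<approx> (e + e', False)" and "d dvd P t (c + c', False) - P t' (c', False)"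
proof -
  have "F t (dmul (c, False) (c', False)) \<approx> dmul (F t (c, False)) (F (P t (c, False)) (c', False))"
    by (rule F_mult)
  also have "\<dots> \<approx> dmul (e, False) (e', False)"
    by (intro dih_eq_dmul assms(1) dih_eq_trans[OF F_index assms(3)] assms(2) dih_eq_refl)
  finally show "F t (c + c', False) \<approx> (e + e', False)" by simp
  have "d dvd P t (dmul (c, False) (c', False)) - P (P t (c, False)) (c', False)" by (rule P_mult)
  moreover have "d dvd P (P t (c, False)) (c', False) - P t' (c', False)"
    by (intro P_index assms(2) dih_eq_refl)
  ultimately show "d dvd P t (c + c', False) - P t' (c', False)"
    using dvd_diff_trans by simp
qed

lemma inN_F: "inN c \<Longrightarrow> F 1 (c, False) \<approx> (fst (F 1 (c, False)), False)"
  by (simp add: inN_def dih_eq_def)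

lemma inN_add:
  assumes "inN c" "inN c'"
  shows "inN (c + c')"
  using F_rot_add[OF inN_F[OF assms(1)] _ inN_F[OF assms(2)]] assms
    dvd_diff_trans[of d "P 1 (c + c', False)" "P 1 (c', False)" 1]
  by (simp add: inN_def dih_eq_def)

lemma inN_0: "inN 0"
  using F_one[of 1] P_one[of 1] by (simp add: inN_def dih_eq_def)

lemma inN_n: "inN n"
  using inN_cong[of n 0] inN_0 by simp

lemma inN_mult_nat: "inN c \<Longrightarrow> inN (int l * c)"
  by (induction l) (auto simp: inN_0 algebra_simps intro: inN_add)

lemma inN_minus: "inN c \<Longrightarrow> inN (- c)"
proof -
  assume "inN c"
  then have "inN (int (nat (n - 1)) * c)" by (rule inN_mult_nat)
  then show ?thesis using n_pos inN_cong[of "(n - 1) * c" "- c"] by (simp add: algebra_simps)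
qed

lemma inN_generator:
  obtains k where "0 < k" "k dvd n" "\<And>c. inN c \<longleftrightarrow> k dvd c"
  using exists_generator[of n inN] n_pos inN_n inN_add inN_minus by metis

lemma inN_mult: "inN c \<Longrightarrow> inN (l * c)"
  by (metis inN_generator dvd_mult)

lemma F1_mult_nat:
  assumes "inN c" "F 1 (c, False) \<approx> (v, False)"
  shows "F 1 (int l * c, False) \<approx> (int l * v, False)"
proof (induction l)
  case 0
  then show ?case using F_one[of 1] by simp
next
  case (Suc l)
  have "d dvd P 1 (c, False) - 1" using assms(1) by (simp add: inN_def)
  from F_rot_add(1)[OF assms(2) this Suc] show ?case by (simp add: algebra_simps)
qed

lemma F1_mult:
  assumes "inN c" "F 1 (c, False) \<approx> (v, False)"
  shows "F 1 (l * c, False) \<approx> (l * v, False)"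
proof -
  define l' where "l' = nat (l mod n)"
  have l': "n dvd l - int l'" using n_pos by (simp add: l'_def mod_eq_dvd_iff[symmetric])
  have "F 1 (l * c, False) \<approx> F 1 (int l' * c, False)"
    using l' by (intro F_cong) (simp add: left_diff_distrib[symmetric])
  also have "\<dots> \<approx> (int l' * v, False)" by (rule F1_mult_nat[OF assms])
  also have "(int l' * v, False) \<approx> (l * v, False)"
    using l' by (simp add: left_diff_distrib[symmetric] dvd_diff_commute)
  finally show ?thesis .
qed

text \<open>The core is cyclic with a generator \<open>k\<close> dividing \<open>n\<close>, and
  \<open>F 1\<close> is additive on it. Since \<open>n / k\<close> annihilates \<open>k\<close>, it
  annihilates the image of \<open>k\<close> too, so this image is a multiple of \<open>k\<close>;
  its factor serves for the whole core.\<close>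

lemma ex_scalar: "\<exists>r. \<forall>c. inN c \<longrightarrow> F 1 (c, False) \<approx> (r * c, False)"
proof -
  obtain k where k: "0 < k" "k dvd n" "\<And>c. inN c \<longleftrightarrow> k dvd c" by (rule inN_generator) blast
  define v where "v = fst (F 1 (k, False))"
  have kN: "inN k" by (simp add: k)
  have Fk: "F 1 (k, False) \<approx> (v, False)" using inN_F[OF kN] by (simp add: v_def)
  obtain q where q: "n = k * q" using k(2) by auto
  have "F 1 (q * k, False) \<approx> (q * v, False)" by (rule F1_mult[OF kN Fk])
  moreover have "F 1 (q * k, False) \<approx> (0, False)"
    using dih_eq_trans[OF F_cong F_one, of "(q * k, False)" 1] q by (simp add: mult.commute)
  ultimately have "(0, False) \<approx> (q * v, False)" by (metis dih_eq_sym dih_eq_trans)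
  then have "k dvd v" using n_pos q by (auto simp: mult.commute)
  then obtain r where r: "v = r * k" by (metis dvdE mult.commute)
  have "F 1 (c, False) \<approx> (r * c, False)" if "inN c" for c
  proof -
    have "k dvd c" using that k(3) by simp
    then obtain l where l: "c = l * k" by (metis dvdE mult.commute)
    have "F 1 (l * k, False) \<approx> (l * v, False)" by (rule F1_mult[OF kN Fk])
    then show ?thesis by (simp add: l r algebra_simps)
  qed
  then show ?thesis by blast
qed

text \<open>The scalar is determined only modulo the order of the core, hence the choice.\<close>

definition nr :: int where
  "nr = (SOME r. \<forall>c. inN c \<longrightarrow> F 1 (c, False) \<approx> (r * c, False))"

lemma F1_scalar: "inN c \<Longrightarrow> F 1 (c, False) \<approx> (nr * c, False)"
  using someI_ex[OF ex_scalar] unfolding nr_def by blast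

lemma FP_scalar_nat:
  assumes "inN c"
  shows "F (int t) (c, False) \<approx> (nr ^ t * c, False) \<and> d dvd P (int t) (c, False) - int t"
proof (induction t)
  case 0
  then show ?case using FP_zero[of "(c, False)"] by simp
next
  case (Suc t)
  let ?c = "nr ^ t * c"
  have N: "inN ?c" by (rule inN_mult[OF assms])
  have "F (1 + int t) (c, False) \<approx> F 1 (F (int t) (c, False))" by (rule F_add)
  also have "\<dots> \<approx> F 1 (?c, False)" using Suc by (intro F_cong) simp
  also have "\<dots> \<approx> (nr * ?c, False)" by (rule F1_scalar[OF N])
  finally have 1: "F (1 + int t) (c, False) \<approx> (nr * ?c, False)" .
  have "d dvd P 1 (F (int t) (c, False)) - P 1 (?c, False)" using Suc by (intro P_cong) simp
  moreover have "d dvd P 1 (?c, False) - 1" using N by (simp add: inN_def)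
  ultimately have 2: "d dvd P (1 + int t) (c, False) - (1 + int t)"
    using P_add[of 1 "int t" "(c, False)"] conjunct2[OF Suc]
    by (rule dvd_comb4[where a = 1 and b = 1 and c = 1 and e = 1]) simp
  show ?case using 1 2 by (simp add: algebra_simps)
qed

lemma F_scalar: "inN c \<Longrightarrow> F t (c, False) \<approx> (nr ^ nat (t mod d) * c, False)"
  and P_scalar: "inN c \<Longrightarrow> d dvd P t (c, False) - t"
proof -
  assume c: "inN c"
  define t' where "t' = nat (t mod d)"
  have t': "d dvd t - int t'" using d_pos by (simp add: t'_def mod_eq_dvd_iff[symmetric])
  note * = FP_scalar_nat[OF c, of t'] FP_index[OF t', of "(c, False)"]
  show "F t (c, False) \<approx> (nr ^ nat (t mod d) * c, False)"
    using * unfolding t'_def[symmetric] by (blast intro: dih_eq_trans)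
  show "d dvd P t (c, False) - t"
    using conjunct2[OF *(1)] conjunct2[OF *(2)] t'
    by (rule dvd_comb3[where a = 1 and b = 1 and c = "-1"]) simp
qed

text \<open>The subgroup generated by \<open>a\<^sup>m\<close> is normal in the whole group, so it can be factored out.\<close>

lemma FP_quotient:
  assumes N: "inN m" and "m dvd n" and gh: "dih_eq m g h"
  shows "dih_eq m (F t g) (F t h)" and "d dvd P t g - P t h"
proof -
  define c where "c = fst g - fst h"
  have c: "inN c" using gh inN_mult[OF N] by (auto simp: dih_eq_def c_def mult.commute)
  have g: "g = dmul (c, False) h" using gh by (cases g; cases h) (auto simp: dih_eq_def c_def)
  have mn: "dih_eq m u v" if "u \<approx> v" for u v
    using that assms(2) by (auto simp: dih_eq_def intro: dvd_trans)
  have "F t g \<approx> dmul (F t (c, False)) (F (P t (c, False)) h)" unfolding g by (rule F_mult)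
  also have "\<dots> \<approx> dmul (nr ^ nat (t mod d) * c, False) (F t h)"
    by (intro dih_eq_dmul F_scalar F_index P_scalar c dih_eq_refl)
  finally have "dih_eq m (F t g) (dmul (nr ^ nat (t mod d) * c, False) (F t h))" by (rule mn)
  also have "dih_eq m (dmul (nr ^ nat (t mod d) * c, False) (F t h)) (F t h)"
    using gh by (cases "F t h") (auto simp: dih_eq_def c_def)
  finally show "dih_eq m (F t g) (F t h)" .
  have "d dvd P (P t (c, False)) h - P t h" by (intro P_index P_scalar c dih_eq_refl)
  with P_mult[of t "(c, False)" h] show "d dvd P t g - P t h"
    unfolding g by (rule dvd_comb2[where a = 1 and b = 1]) simp
qed

lemma x_quotient_shift:
  assumes "inN m" "m dvd n" "dih_eq m (x i) (x j)"
  shows "dih_eq m (x (i + t)) (x (j + t))"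
proof -
  have mn: "dih_eq m u v" if "u \<approx> v" for u v
    using that assms(2) by (auto simp: dih_eq_def intro: dvd_trans)
  have "dih_eq m (F t (x i)) (F t (x j))" by (rule FP_quotient(1)[OF assms])
  then show ?thesis using mn[OF F_x[of t i]] mn[OF F_x[of t j]] by (metis dih_eq_sym dih_eq_trans)
qed

text \<open>Every \<open>F t\<close> maps core elements to rotations, whereas
  \<open>F (i - j)\<close> takes \<open>x j\<close> to the reflection \<open>x i\<close>.\<close>

lemma rotation_notin_N:
  assumes "\<not> rho j" "rho i"
  shows "\<not> inN (s j)"
proof
  assume N: "inN (s j)"
  have "x j = (s j, False)" using assms by (simp add: prod_eq_iff)
  then have "F (i - j) (x j) \<approx> (nr ^ nat ((i - j) mod d) * s j, False)" using F_scalar[OF N] by simp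
  moreover have "F (i - j) (x j) \<approx> x i" using F_x[of "i - j" j] by simp
  ultimately show False using assms by (simp add: dih_eq_def)
qed

text \<open>Entries of the cycle may become equal modulo \<open>k\<close>. The indices
  \<open>p\<close> with \<open>x p\<close> congruent to \<open>x 0\<close> form a group of integers
  containing \<open>d\<close>, and its generator \<open>e\<close> is the new valency.\<close>

lemma quotient_skew:
  assumes k: "0 < k" "inN k" "k dvd n"
  shows "\<exists>e. e dvd d \<and> skew k e x chi F P"
proof -
  have mn: "dih_eq k u v" if "u \<approx> v" for u v
    using that k(3) by (auto simp: dih_eq_def intro: dvd_trans)
  define N where "N p \<longleftrightarrow> dih_eq k (x 0) (x p)" for p
  have shift: "dih_eq k (x (i + t)) (x (j + t))" if "dih_eq k (x i) (x j)" for i j t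
    using x_quotient_shift[OF k(2,3) that] .
  have N: "N d" unfolding N_def by (rule mn, rule x_cong) simp
  have Nadd: "N (p + q)" if "N p" "N q" for p q
  proof -
    have "dih_eq k (x (0 + p)) (x (q + p))" using that(2) unfolding N_def by (rule shift)
    then show ?thesis using that(1) unfolding N_def by (simp add: add.commute dih_eq_trans)
  qed
  have Nminus: "N (- p)" if "N p" for p
    using shift[of 0 p "-p"] that unfolding N_def by (simp add: dih_eq_sym)
  obtain e where e: "0 < e" "\<And>p. N p \<longleftrightarrow> e dvd p"
    using exists_generator[of d N] d_pos N Nadd Nminus by metis
  have ed: "e dvd d" using N e by simp
  have xe: "dih_eq k (x i) (x j) \<longleftrightarrow> e dvd i - j" for i j
  proof -
    have "dih_eq k (x i) (x j) \<longleftrightarrow> N (j - i)"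
      using shift[of i j "-i"] shift[of 0 "j - i" i] unfolding N_def by auto
    then show ?thesis by (simp add: e dvd_diff_commute)
  qed
  have ed': "e dvd z" if "d dvd z" for z using that ed dvd_trans by blast
  have "skew k e x chi F P"
  proof
    show "0 < k" "0 < e" by fact+
    show "dih_eq k (x i) (x j) \<longleftrightarrow> e dvd i - j" for i j by (rule xe)
    show "dih_eq k (dmul (x i) (x (chi i))) (0, False)" for i by (rule mn, rule chi_inv)
    show "dih_eq k (F t g) (F t h)" "e dvd P t g - P t h" if "dih_eq k g h" for t g h
      using FP_quotient[OF k(2,3) that] ed' by auto
    show "dih_eq k (F t (0, False)) (0, False)" for t by (rule mn, rule F_one)
    show "e dvd P t (0, False) - t" for t by (rule ed', rule P_one)
    show "dih_eq k (F t (dmul g (x i))) (dmul (F t g) (x (i + P t g)))" for t g i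
      by (rule mn, rule F_step)
    show "e dvd P t (dmul g (x i)) - (chi (i + P t g) - chi i)" for t g i
      by (rule ed', rule P_step)
    show "Q g" if "\<And>g h. dih_eq k g h \<Longrightarrow> Q g \<Longrightarrow> Q h" "Q (0, False)"
      "\<And>g i. Q g \<Longrightarrow> Q (dmul g (x i))" for Q g
      by (rule gen[of Q]) (use that mn in blast)+
  qed
  with ed show ?thesis by blast
qed

end

section \<open>Distribution of the reflections\<close>

text \<open>Besides the positions of the reflections, the pattern records that inversion acts on the
  indices modulo \<open>p\<close> as the reflection about \<open>i0\<close>.\<close>

definition one_in_p :: "int \<Rightarrow> (int \<Rightarrow> int \<times> bool) \<Rightarrow> (int \<Rightarrow> int) \<Rightarrow> int \<Rightarrow> bool" where
  "one_in_p p x chi i0 \<longleftrightarrow> (\<forall>i. snd (x i) \<longleftrightarrow> p dvd i - i0) \<and>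
     (\<forall>i. p dvd chi i + i - 2 * i0)"

definition two_in_3 :: "(int \<Rightarrow> int \<times> bool) \<Rightarrow> int \<Rightarrow> bool" where
  "two_in_3 x i0 \<longleftrightarrow> (\<forall>i. snd (x i) \<longleftrightarrow> \<not> 3 dvd i - i0 - 2)"

text \<open>The last clause says that inversion swaps the two classes of rotations,
  \<open>i0 + 2\<close> and \<open>i0 + 3\<close> modulo 4.\<close>

definition two_in_4 :: "(int \<Rightarrow> int \<times> bool) \<Rightarrow> (int \<Rightarrow> int) \<Rightarrow> int \<Rightarrow> bool" where
  "two_in_4 x chi i0 \<longleftrightarrow> (\<forall>i. snd (x i) \<longleftrightarrow> 4 dvd i - i0 \<or> 4 dvd i - i0 - 1) \<and>
     (\<forall>i. \<not> snd (x i) \<longrightarrow> 4 dvd chi i + i - 2 * i0 - 5)"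

text \<open>A cyclic group has at most one element of order two.\<close>

lemma half_unique:
  fixes d h h' :: int
  assumes "d dvd 2 * h" "\<not> d dvd h" "d dvd 2 * h'" "\<not> d dvd h'"
  shows "d dvd h - h'"
proof -
  obtain q q' where q: "2 * h = d * q" "2 * h' = d * q'" using assms(1,3) by (auto elim!: dvdE)
  have "odd q" "odd q'"
    using assms(2,4) q by (auto elim!: evenE simp: algebra_simps)
  then obtain r where "q - q' = 2 * r" by (meson dvdE odd_even_add even_diff dvd_add_right_iff)
  then have "2 * (h - h') = 2 * (d * r)" using q by (simp add: algebra_simps flip: distrib_left)
  then have "h - h' = d * r" by (metis mult_left_cancel zero_neq_numeral)
  then show ?thesis by simp
qed

context skew
begin

lemma dmul_x_ref: "rho i \<Longrightarrow> dmul (x i) (x j) = (s i - s j, \<not> rho j)"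
  by (simp add: dmul_def)

lemma dmul_x_rot: "\<not> rho i \<Longrightarrow> dmul (x i) (x j) = (s i + s j, rho j)"
  by (simp add: dmul_def)

lemma x_rot: "\<not> rho i \<Longrightarrow> x i = (s i, False)" and x_ref: "rho i \<Longrightarrow> x i = (s i, True)"
  by (simp_all add: prod_eq_iff)

lemma chi_chi_cong: "d dvd j - chi i \<Longrightarrow> d dvd chi j - i"
  using chi_cong[of j "chi i"] chi_chi[of i] dvd_diff_trans by blast

text \<open>A reflection inverts rotations, so \<open>x i\<close> times \<open>x j\<close> equals
  the inverse of \<open>x j\<close> times \<open>x i\<close>. The lemma is this relation moved by
  \<open>F t\<close>, simplified with \<open>chi i = i\<close> and
  \<open>chi (chi j) = j\<close>.\<close>

lemma ref_rot_transfer: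
  assumes "rho i" "\<not> rho j"
  shows "dmul (x (i + t)) (x (j - i + chi (i + t))) \<approx> dmul (x (chi j + t)) (x (i - j + chi (chi j + t)))"
proof -
  have "n dvd s i - s j - (s (chi j) + s i)"
    using s_chi[OF assms(2)] by (rule dvd_comb1[where a = "-1"]) simp
  then have "dmul (x i) (x j) \<approx> dmul (x (chi j)) (x i)"
    using assms by (simp add: dmul_x_ref dmul_x_rot)
  from transfer2[OF this, of t]
  have "dmul (x (i + t)) (x (j + chi (i + t) - chi i)) \<approx>
      dmul (x (chi j + t)) (x (i + chi (chi j + t) - chi (chi j)))" .
  moreover have "x (j + chi (i + t) - chi i) \<approx> x (j - i + chi (i + t))"
    by (rule x_cong, rule dvd_comb1[OF chi_refl[OF assms(1)], where a = "-1"]) simp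
  moreover have "x (i + chi (chi j + t) - chi (chi j)) \<approx> x (i - j + chi (chi j + t))"
    by (rule x_cong, rule dvd_comb1[OF chi_chi[of j], where a = "-1"]) simp
  ultimately show ?thesis by (meson dih_eq_dmul dih_eq_refl dih_eq_sym dih_eq_trans)
qed

lemma rot_rot_transfer:
  assumes "\<not> rho j" "\<not> rho k"
  shows "dmul (x (j + t)) (x (k + chi (j + t) - chi j)) \<approx> dmul (x (k + t)) (x (j + chi (k + t) - chi k))"
  using assms by (intro transfer2) (simp add: dmul_x_rot)

lemma ref_pair:
  assumes "rho i" "rho i'"
  shows "F t (s i - s i', False) \<approx> dmul (x (i + t)) (x (i' - i + chi (i + t)))"
    and "d dvd P t (s i - s i', False) - (chi (i' - i + chi (i + t)) - i')"
proof -
  have e: "dmul (x i) (x i') = (s i - s i', False)" using assms by (simp add: dmul_x_ref)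
  have c: "d dvd (i' + chi (i + t) - chi i) - (i' - i + chi (i + t))"
    by (rule dvd_comb1[OF chi_refl[OF assms(1)], where a = "-1"]) simp
  show "F t (s i - s i', False) \<approx> dmul (x (i + t)) (x (i' - i + chi (i + t)))"
    using dih_eq_trans[OF F_x2[of t i i', unfolded e] dih_eq_dmul[OF dih_eq_refl x_cong[OF c]]] .
  show "d dvd P t (s i - s i', False) - (chi (i' - i + chi (i + t)) - i')"
    using P_x2[of t i i', unfolded e] chi_cong[OF c] chi_refl[OF assms(2)]
    by (rule dvd_comb3[where a = 1 and b = 1 and c = "-1"]) simp
qed

lemma ref_pair_ref:
  assumes "rho i" "rho i'" "rho (i + t)"
  shows "F t (s i - s i', False) \<approx> dmul (x (i + t)) (x (i' + t))"
    and "d dvd P t (s i - s i', False) - (chi (i' + t) - i')"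
proof -
  have c: "d dvd (i' - i + chi (i + t)) - (i' + t)"
    by (rule dvd_comb1[OF chi_refl[OF assms(3)], where a = 1]) simp
  show "F t (s i - s i', False) \<approx> dmul (x (i + t)) (x (i' + t))"
    using dih_eq_trans[OF ref_pair(1)[OF assms(1,2)] dih_eq_dmul[OF dih_eq_refl x_cong[OF c]]] .
  show "d dvd P t (s i - s i', False) - (chi (i' + t) - i')"
    using ref_pair(2)[OF assms(1,2), of t] chi_cong[OF c]
    by (rule dvd_comb2[where a = 1 and b = 1]) simp
qed

text \<open>\<open>chi\<close> fixes the indices of reflections. If both factors remain reflections
  after one step, the corrections by \<open>chi\<close> cancel and the product is rotated by exactly
  one step.\<close>

lemma ref_pairs_N:
  assumes "rho i" "rho (i + 1)" "rho i'" "rho (i' + 1)"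
  shows "inN (s i - s i')"
proof -
  have "d dvd P 1 (s i - s i', False) - 1"
    using ref_pair_ref(2)[OF assms(1,3,2)] chi_refl[OF assms(4)]
    by (rule dvd_comb2[where a = 1 and b = 1]) simp
  moreover have "\<not> snd (F 1 (s i - s i', False))"
    using ref_pair_ref(1)[OF assms(1,3,2)] assms by (simp add: dih_eq_def dmul_def)
  ultimately show ?thesis by (simp add: inN_def)
qed

text \<open>The rotation amount at the product depends only on the two offsets
  \<open>chi (i + 1) - i\<close> and \<open>chi (i' + 1) - i'\<close>; when they agree, applying
  \<open>chi\<close> twice leaves exactly one step.\<close>

lemma boundary_N:
  assumes "rho i" "\<not> rho (i + 1)" "rho i'" "\<not> rho (i' + 1)"
    and "d dvd (chi (i + 1) - i) - (chi (i' + 1) - i')"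
  shows "inN (s i - s i')"
proof -
  have c: "d dvd (i' - i + chi (i + 1)) - chi (i' + 1)"
    using assms(5) by (rule dvd_comb1[where a = 1]) simp
  have "d dvd P 1 (s i - s i', False) - 1"
    using ref_pair(2)[OF assms(1,3), of 1] chi_chi_cong[OF c]
    by (rule dvd_comb2[where a = 1 and b = 1]) simp
  moreover have "\<not> snd (F 1 (s i - s i', False))"
    using ref_pair(1)[OF assms(1,3), of 1] assms rho_cong[OF c] by (simp add: dih_eq_def dmul_def)
  ultimately show ?thesis by (simp add: inN_def)
qed

lemma cyclic_step_dec:
  assumes "Q a" and step: "\<And>j. Q j \<Longrightarrow> Q (j - 1)" and cong: "\<And>i j. d dvd i - j \<Longrightarrow> Q i \<Longrightarrow> Q j"
  shows "Q j"
proof -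
  have *: "Q (a - int m)" for m
  proof (induction m)
    case (Suc m)
    then show ?case using step[of "a - int m"] by (simp add: algebra_simps)
  qed (simp add: assms)
  have "d dvd (a - int (nat ((a - j) mod d))) - j"
    using d_pos by (simp add: mod_eq_dvd_iff[symmetric] mod_diff_right_eq)
  with * show ?thesis by (rule cong[rotated])
qed

lemma cyclic_step_inc:
  assumes "Q a" and step: "\<And>j. Q j \<Longrightarrow> Q (j + 1)" and cong: "\<And>i j. d dvd i - j \<Longrightarrow> Q i \<Longrightarrow> Q j"
  shows "Q j"
proof -
  have *: "Q (a + int m)" for m
  proof (induction m)
    case (Suc m)
    then show ?case using step[of "a + int m"] by (simp add: algebra_simps)
  qed (simp add: assms)
  have "d dvd (a + int (nat ((j - a) mod d))) - j"
    using d_pos by (simp add: mod_eq_dvd_iff[symmetric] mod_add_right_eq)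
  with * show ?thesis by (rule cong[rotated])
qed

lemma exists_boundary:
  assumes "rho y" "\<not> rho z"
  obtains i where "rho i" "\<not> rho (i + 1)"
  using cyclic_step_inc[of rho y z] assms rho_cong by blast

end

section \<open>Trivial core: transitions from reflections to rotations\<close>

locale core_free = skew +
  assumes core_triv: "\<And>c. inN c \<Longrightarrow> n dvd c"
    and ex_ref: "\<exists>i. rho i" and ex_rot: "\<exists>i. \<not> rho i"
begin

definition bd :: "int \<Rightarrow> bool" where "bd i \<longleftrightarrow> rho i \<and> \<not> rho (i + 1)"

lemma ex_bd: "\<exists>i. bd i"
  using exists_boundary ex_ref ex_rot unfolding bd_def by metis

lemma d_not_1: "\<not> d dvd 1"
proof
  assume "d dvd 1"
  then have "rho i = rho j" for i j by (intro rho_cong) (meson dvd_trans one_dvd)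
  then show False using ex_ref ex_rot by blast
qed

lemma ref_pair_unique:
  assumes "rho i" "rho (i + 1)" "rho j" "rho (j + 1)"
  shows "d dvd i - j"
  using core_triv[OF ref_pairs_N[OF assms]] assms by (intro eq_index) auto

lemma no_three_ref: "rho i \<Longrightarrow> rho (i + 1) \<Longrightarrow> \<not> rho (i + 2)"
  using ref_pair_unique[of i "i + 1"] d_not_1 by (auto simp: add.assoc)

lemma bd_unique:
  assumes "bd i" "bd j" "d dvd (chi (i + 1) - i) - (chi (j + 1) - j)"
  shows "d dvd i - j"
  using core_triv[OF boundary_N[of i j]] assms by (intro eq_index) (auto simp: bd_def)

text \<open>Otherwise the mixed relation at the boundary, moved by one step, is an equality of
  products of two rotations. It yields \<open>chi (i + 2) = chi (i + 1) + 1\<close>, so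
  \<open>F 1\<close> rotates by one step at \<open>x (i + 1)\<close> and this rotation would lie in
  the core.\<close>

lemma bd_chi:
  assumes "bd i"
  shows "rho (chi (i + 1) + 1)"
proof (rule ccontr)
  let ?c = "chi (i + 1)"
  assume c: "\<not> rho (?c + 1)"
  have i: "rho i" "\<not> rho (i + 1)" using assms by (auto simp: bd_def)
  have "dmul (x (i + 1)) (x (1 + ?c)) \<approx> dmul (x (?c + 1)) (x (- 1 + chi (?c + 1)))"
    using ref_rot_transfer[OF i, of 1] by simp
  then have *: "\<not> rho (chi (?c + 1) - 1)" "n dvd s (i + 1) + s (?c + 1) - (s (?c + 1) + s (chi (?c + 1) - 1))"
    using i c by (simp_all add: dmul_x_rot algebra_simps)
  then have "d dvd (i + 1) - (chi (?c + 1) - 1)" using i by (intro eq_index) auto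
  then have e: "d dvd (i + 2) - chi (?c + 1)" by (simp add: algebra_simps)
  then have e': "d dvd chi (i + 2) - (?c + 1)" by (rule chi_chi_cong)
  have r: "\<not> rho (i + 2)" using rho_cong[OF e] c by simp
  have x1: "x (i + 1) = (s (i + 1), False)" using i by (intro x_rot) auto
  have two: "i + 1 + 1 = i + 2" by simp
  have "\<not> snd (F 1 (x (i + 1)))" using F_x[of 1 "i + 1", unfolded two] r by (simp add: dih_eq_def)
  moreover have "d dvd P 1 (x (i + 1)) - 1"
    using P_x[of 1 "i + 1", unfolded two] e' by (rule dvd_comb2[where a = 1 and b = 1]) simp
  ultimately have "inN (s (i + 1))" unfolding inN_def x1[symmetric] by simp
  then show False using rotation_notin_N i by blast
qed


end

context skew
begin

lemma F_multiple:
  assumes "F g v \<approx> v"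
  shows "F (int l * g) v \<approx> v \<and> d dvd P (int l * g) v - int l * P g v"
proof (induction l)
  case 0
  then show ?case using FP_zero[of v] by simp
next
  case (Suc l)
  have "F (int l * g + g) v \<approx> F (int l * g) (F g v)" by (rule F_add)
  also have "\<dots> \<approx> F (int l * g) v" by (rule F_cong[OF assms])
  also have "\<dots> \<approx> v" using Suc by simp
  finally have 1: "F (int l * g + g) v \<approx> v" .
  have "d dvd P (int l * g + g) v - (P g v + int l * P g v)"
    using P_add[of "int l * g" g v] P_cong[OF assms, of "int l * g"] conjunct2[OF Suc]
    by (rule dvd_comb3[where a = 1 and b = 1 and c = 1]) simp
  with 1 show ?case by (simp add: algebra_simps)
qed

text \<open>The iterates of \<open>F g\<close> rotate at the fixed point \<open>v\<close> by
  multiples of \<open>P g v\<close>, and the iterate of order \<open>d / g\<close> is trivial. Hence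
  \<open>g\<close> divides \<open>P g v\<close>, so \<open>F (P g v)\<close> is a power of
  \<open>F g\<close> and fixes \<open>w\<close>; now the skew morphism identity applies.\<close>

lemma F_fix_mult:
  assumes "0 < g" "g dvd d" "F g v \<approx> v" "F g w \<approx> w"
  shows "F g (dmul v w) \<approx> dmul v w"
proof -
  obtain q where q: "d = g * q" using assms(2) by auto
  then have qp: "0 < q" using d_pos assms(1) by (simp add: zero_less_mult_iff)
  have "d dvd P (int (nat q) * g) v - int (nat q) * P g v" using F_multiple[OF assms(3)] by blast
  moreover have "d dvd P (int (nat q) * g) v - P 0 v"
    using q qp by (intro P_index) (auto simp: mult.commute)
  ultimately have "d dvd q * P g v"
    using conjunct2[OF FP_zero[of v]]
    by (rule dvd_comb3[where a = "-1" and b = 1 and c = 1]) (use qp in simp)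
  then have "g dvd P g v" using q qp by (simp add: mult.commute)
  then obtain l where l: "P g v = g * l" by auto
  define l' where "l' = nat (l mod d)"
  have l': "d dvd l - int l'" using d_pos by (simp add: l'_def mod_eq_dvd_iff[symmetric])
  have "F (P g v) w \<approx> F (int l' * g) w"
    using l' by (intro F_index) (auto simp: l mult.commute[of g] left_diff_distrib[symmetric])
  also have "\<dots> \<approx> w" using F_multiple[OF assms(4)] by blast
  finally have "F (P g v) w \<approx> w" .
  then have "dmul (F g v) (F (P g v) w) \<approx> dmul v w" by (intro dih_eq_dmul assms(3))
  with F_mult[of g v w] show ?thesis by (rule dih_eq_trans)
qed

text \<open>The products in \<open>V\<close> follow an arc and then the predecessor of the returning
  arc. They generate all words of length two, so a period \<open>c\<close> of them gives a rotation
  \<open>F c\<close> that fixes every \<open>x 0 x j\<close>. Computing its image by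
  \<open>F_x2\<close> instead shows that a left multiplication shifts the cycle.\<close>

lemma translation_of_period:
  assumes V: "\<And>m. dmul (x (m + c)) (x (chi (m + c) - 1)) \<approx> dmul (x m) (x (chi m - 1))"
  shows "x (j + (chi c - chi 0)) \<approx> dmul (dmul (x (chi c)) (x 0)) (x j)"
proof -
  define N where "N p \<longleftrightarrow> (\<forall>m. dmul (x (m + p)) (x (chi (m + p) - 1)) \<approx> dmul (x m) (x (chi m - 1)))" for p
  have Nd: "N d" unfolding N_def
  proof
    fix m
    have "d dvd chi (m + d) - chi m" by (rule chi_cong) simp
    then show "dmul (x (m + d)) (x (chi (m + d) - 1)) \<approx> dmul (x m) (x (chi m - 1))"
      by (intro dih_eq_dmul x_cong) auto
  qed
  have Nadd: "N (p + q)" if p: "N p" and q: "N q" for p q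
    unfolding N_def
  proof
    fix m
    show "dmul (x (m + (p + q))) (x (chi (m + (p + q)) - 1)) \<approx> dmul (x m) (x (chi m - 1))"
      using p[unfolded N_def, rule_format, of "m + q"] q[unfolded N_def, rule_format, of m]
      by (simp add: algebra_simps) (rule dih_eq_trans)
  qed
  have Nminus: "N (- p)" if p: "N p" for p
    unfolding N_def
  proof
    fix m
    show "dmul (x (m + - p)) (x (chi (m + - p) - 1)) \<approx> dmul (x m) (x (chi m - 1))"
      using p[unfolded N_def, rule_format, of "m - p"] by (simp add: dih_eq_sym)
  qed
  \<comment> \<open>The exact period \<open>g\<close> divides \<open>d\<close>, as
    \<open>F_fix_mult\<close> demands; \<open>F c\<close> is then a power of
    \<open>F g\<close>.\<close>
  obtain g where g: "0 < g" "\<And>p. N p \<longleftrightarrow> g dvd p"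
    using exists_generator[of d N] d_pos Nd Nadd Nminus by metis
  have gd: "g dvd d" and gc: "g dvd c" using g Nd V by (auto simp: N_def)
  have gN: "N g" using g by simp
  have fixV: "F g (dmul (x m) (x (chi m - 1))) \<approx> dmul (x m) (x (chi m - 1))" for m
    using dih_eq_trans[OF F_x2[of g m "chi m - 1"]] gN[unfolded N_def, rule_format, of m] by simp
  \<comment> \<open>Walk \<open>j\<close> downwards from \<open>chi i\<close>, where the product is
    trivial: multiplication by the product of \<open>V\<close> at \<open>chi j\<close> replaces
    \<open>x j\<close> by \<open>x (j - 1)\<close>.\<close>
  have fix2: "F g (dmul (x i) (x j)) \<approx> dmul (x i) (x j)" for i j
  proof (rule cyclic_step_dec[of "\<lambda>j. F g (dmul (x i) (x j)) \<approx> dmul (x i) (x j)" "chi i"])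
    have "F g (dmul (x i) (x (chi i))) \<approx> F g (0, False)" by (rule F_cong, rule chi_inv)
    also have "\<dots> \<approx> (0, False)" by (rule F_one)
    also have "\<dots> \<approx> dmul (x i) (x (chi i))" by (rule dih_eq_sym, rule chi_inv)
    finally show "F g (dmul (x i) (x (chi i))) \<approx> dmul (x i) (x (chi i))" .
  next
    fix j assume j: "F g (dmul (x i) (x j)) \<approx> dmul (x i) (x j)"
    let ?w = "dmul (x (chi j)) (x (chi (chi j) - 1))"
    have e: "dmul (dmul (x i) (x j)) ?w \<approx> dmul (x i) (x (j - 1))"
    proof -
      have "dmul (dmul (x i) (x j)) ?w = dmul (x i) (dmul (dmul (x j) (x (chi j))) (x (chi (chi j) - 1)))"
        by (simp add: dmul_assoc)
      also have "\<dots> \<approx> dmul (x i) (dmul (0, False) (x (j - 1)))"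
        using chi_chi[of j] by (intro dih_eq_dmul dih_eq_refl chi_inv x_cong) simp
      finally show ?thesis by simp
    qed
    have "F g (dmul (dmul (x i) (x j)) ?w) \<approx> dmul (dmul (x i) (x j)) ?w"
      by (rule F_fix_mult[OF g(1) gd j fixV])
    then show "F g (dmul (x i) (x (j - 1))) \<approx> dmul (x i) (x (j - 1))"
      using e F_cong[OF e, of g] by (metis dih_eq_sym dih_eq_trans)
  next
    fix j k assume "d dvd j - k" and j: "F g (dmul (x i) (x j)) \<approx> dmul (x i) (x j)"
    then have e: "dmul (x i) (x j) \<approx> dmul (x i) (x k)" by (intro dih_eq_dmul x_cong) auto
    show "F g (dmul (x i) (x k)) \<approx> dmul (x i) (x k)"
      using e F_cong[OF e, of g] j by (metis dih_eq_sym dih_eq_trans)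
  qed
  obtain l where l: "c = g * l" using gc by auto
  define l' where "l' = nat (l mod d)"
  have l': "d dvd l - int l'" using d_pos by (simp add: l'_def mod_eq_dvd_iff[symmetric])
  have "F c (dmul (x 0) (x j)) \<approx> F (int l' * g) (dmul (x 0) (x j))"
    using l' by (intro F_index) (auto simp: l mult.commute[of g] left_diff_distrib[symmetric])
  also have "\<dots> \<approx> dmul (x 0) (x j)" using F_multiple[OF fix2] by blast
  finally have "dmul (x c) (x (j + chi c - chi 0)) \<approx> dmul (x 0) (x j)"
    using F_x2[of c 0 j] by (simp, metis dih_eq_sym dih_eq_trans)
  then have *: "dmul (x (chi c)) (dmul (x c) (x (j + chi c - chi 0))) \<approx> dmul (x (chi c)) (dmul (x 0) (x j))"
    by (simp add: dih_eq_dmul_cancel_left)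
  have "dmul (x (chi c)) (x c) \<approx> dmul (x (chi c)) (x (chi (chi c)))"
    using chi_chi[of c] by (intro dih_eq_dmul x_cong) (simp_all add: dvd_diff_commute)
  also have "\<dots> \<approx> (0, False)" by (rule chi_inv)
  finally have "dmul (dmul (x (chi c)) (x c)) (x (j + chi c - chi 0)) \<approx> dmul (0, False) (x (j + chi c - chi 0))"
    by (intro dih_eq_dmul) auto
  with * show ?thesis
    by (simp add: dmul_assoc algebra_simps) (metis dih_eq_sym dih_eq_trans)
qed

text \<open>Write \<open>a^c\<close> as the product of the reflections \<open>x (j + h)\<close> and
  \<open>x j\<close>. If \<open>F t\<close> leads from there to rotations, the translation by
  \<open>h\<close> moves inverse indices backwards, and the exponents of the two image factors add
  up to \<open>- c\<close> instead of \<open>c\<close>.\<close>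

lemma translation_rotation:
  assumes tr: "\<And>j. x (j + h) \<approx> dmul (c, False) (x j)" and "rho j" "\<not> rho (j + t)"
  shows "F t (c, False) \<approx> (- c, False)" and "d dvd 2 * h \<Longrightarrow> d dvd P t (c, False) - t"
proof -
  have rho: "rho (j + h) = rho j" and sh: "n dvd s (j + h) - (c + s j)" for j
    using tr[of j] by (auto simp: dih_eq_def dmul_def)
  have chih: "d dvd chi (j + h) - (chi j - h)" if "\<not> rho j" for j
  proof (rule chi_eqI)
    show "\<not> rho (j + h)" using that by (simp add: rho)
    show "\<not> rho (chi j - h)" using that rho[of "chi j - h"] by simp
    show "n dvd s (j + h) + s (chi j - h)"
      using sh[of j] sh[of "chi j - h"] s_chi[OF that]
      by (rule dvd_comb3[where a = 1 and b = "-1" and c = 1]) simp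
  qed
  have e: "(s (j + h) - s j, False) \<approx> (c, False)" using sh[of j] by (simp add: algebra_simps)
  have r: "rho (j + h)" using rho assms(2) by simp
  have c: "d dvd (j - (j + h) + chi (j + h + t)) - (chi (j + t) - h - h)"
    using chih[OF assms(3)] by (rule dvd_comb1[where a = 1]) (simp add: algebra_simps)
  have "F t (c, False) \<approx> F t (s (j + h) - s j, False)" by (rule dih_eq_sym, rule F_cong[OF e])
  also have "\<dots> \<approx> dmul (x (j + h + t)) (x (j - (j + h) + chi (j + h + t)))"
    by (rule ref_pair(1)[OF r assms(2)])
  also have "\<dots> \<approx> dmul (x (j + h + t)) (x (chi (j + t) - h - h))"
    by (intro dih_eq_dmul dih_eq_refl x_cong c)
  also have "\<dots> \<approx> (- c, False)"
  proof -
    have "rho (j + h + t) = rho (j + t)" "rho (chi (j + t) - h - h) = rho (j + t)"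
      using rho[of "j + t"] rho[of "chi (j + t) - h"] rho[of "chi (j + t) - h - h"]
      by (simp_all add: algebra_simps)
    moreover have "n dvd s (j + h + t) + s (chi (j + t) - h - h) - - c"
      using sh[of "j + t"] sh[of "chi (j + t) - h"] sh[of "chi (j + t) - h - h"] s_chi[OF assms(3)]
      by (rule dvd_comb4[where a = 1 and b = "-1" and c = "-1" and e = 1]) (simp add: algebra_simps)
    ultimately show ?thesis using assms(3) by (simp add: dmul_x_rot)
  qed
  finally show "F t (c, False) \<approx> (- c, False)" .
  assume h: "d dvd 2 * h"
  from c h have "d dvd (j - (j + h) + chi (j + h + t)) - chi (j + t)"
    by (rule dvd_comb2[where a = 1 and b = "-1"]) simp
  from chi_chi_cong[OF this] ref_pair(2)[OF r assms(2), of t] P_cong[OF e, of t]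
  show "d dvd P t (c, False) - t"
    by (rule dvd_comb3[where a = 1 and b = 1 and c = "-1"]) simp
qed

end

context core_free
begin

text \<open>The mixed relation at a boundary rewrites \<open>x m x (chi m + 1)\<close> as a product
  of the family in \<open>translation_of_period\<close>, taken at \<open>m\<close> plus the offset
  of the boundary. Two boundaries rewrite the same word, so the difference of their offsets is a
  period.\<close>

lemma boundary_period:
  assumes i: "bd i" and j: "bd j"
  defines "c \<equiv> (chi (i + 1) - i) - (chi (j + 1) - j)"
  shows "dmul (x (m + c)) (x (chi (m + c) - 1)) \<approx> dmul (x m) (x (chi m - 1))"
proof -
  have E: "dmul (x m) (x (1 + chi m)) \<approx>
      dmul (x (m + (chi (k + 1) - k))) (x (chi (m + (chi (k + 1) - k)) - 1))" if "bd k" for k m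
  proof -
    have "rho k" "\<not> rho (k + 1)" using that by (auto simp: bd_def)
    from ref_rot_transfer[OF this, of "m - k"] show ?thesis by (simp add: algebra_simps)
  qed
  let ?m = "m - (chi (j + 1) - j)"
  have e: "?m + (chi (i + 1) - i) = m + c" "?m + (chi (j + 1) - j) = m" by (simp_all add: c_def)
  from E[OF i, of ?m] E[OF j, of ?m] show ?thesis unfolding e by (metis dih_eq_sym dih_eq_trans)
qed

text \<open>
  Two boundaries with different offsets yield a translation of \<open>X\<close> by an element of the group.
\<close>

lemma two_boundaries:
  assumes i: "bd i" and j: "bd j" and ij: "\<not> d dvd i - j"
    and not_alt: "\<not> (\<forall>k. rho k \<longrightarrow> rho (k + 2))"
  defines "c \<equiv> (chi (i + 1) - i) - (chi (j + 1) - j)"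
  defines "h \<equiv> chi c - chi 0"
  shows "\<not> d dvd h" "d dvd 2 * h" "\<And>k. rho (k + h) = (\<not> rho k)"
proof -
  have c: "\<not> d dvd c" using bd_unique[OF i j] ij by (auto simp: c_def)
  then show h: "\<not> d dvd h" using chi_inject[of c 0] by (auto simp: h_def)
  define u where "u = dmul (x (chi c)) (x 0)"
  have tr: "x (k + h) \<approx> dmul u (x k)" for k
    unfolding h_def u_def
    by (rule translation_of_period) (rule boundary_period[OF i j, folded c_def])
  \<comment> \<open>If the translation were by a rotation \<open>a^v\<close>, then
    \<open>F 1\<close> would invert it at the boundary. Either \<open>2 * v\<close> vanishes and
    \<open>a^v\<close> lies in the trivial core, or \<open>F 2\<close> fixes \<open>a^v\<close>, so
    that no reflection can be two places before a rotation, against \<open>not_alt\<close>.\<close>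
  have u: "snd u"
  proof (rule ccontr)
    assume "\<not> snd u"
    then obtain v where v: "u = (v, False)" by (cases u) auto
    have tr': "x (k + h) \<approx> dmul (v, False) (x k)" for k using tr v by simp
    have trm: "x (k + - h) \<approx> dmul (- v, False) (x k)" for k
    proof -
      have "dmul (v, False) (x (k - h)) \<approx> x k" using dih_eq_sym[OF tr'[of "k - h"]] by simp
      then have "dmul (- v, False) (dmul (v, False) (x (k - h))) \<approx> dmul (- v, False) (x k)"
        by (simp only: dih_eq_dmul_cancel_left)
      then show ?thesis by (simp add: dmul_assoc[symmetric])
    qed
    have ib: "rho i" "\<not> rho (i + 1)" using i by (auto simp: bd_def)
    have F1: "F 1 (v, False) \<approx> (- v, False)" by (rule translation_rotation(1)[OF tr' ib])
    show False
    proof (cases "n dvd 2 * v")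
      case True
      have "x (0 + h + h) \<approx> dmul (v, False) (dmul (v, False) (x 0))"
        using dih_eq_trans[OF tr'[of "0 + h"] dih_eq_dmul[OF dih_eq_refl tr'[of 0]]] .
      also have "\<dots> \<approx> x 0" using True by (simp add: dih_eq_def dmul_def)
      finally have "d dvd 2 * h" using x_inj by fastforce
      then have "d dvd P 1 (v, False) - 1" by (rule translation_rotation(2)[OF tr' ib])
      then have "inN v" using F1 by (simp add: inN_def dih_eq_def)
      then have "n dvd v" by (rule core_triv)
      then have "dmul (v, False) (x 0) \<approx> x 0" by (simp add: dih_eq_def dmul_def)
      with tr'[of 0] have "x (0 + h) \<approx> x 0" by (rule dih_eq_trans)
      then show False using x_inj h by fastforce
    next
      case False
      have Fm: "F 1 (- v, False) \<approx> (v, False)"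
        using translation_rotation(1)[OF trm ib] by simp
      have "F (1 + 1) (v, False) \<approx> F 1 (F 1 (v, False))" by (rule F_add)
      also have "\<dots> \<approx> F 1 (- v, False)" by (rule F_cong[OF F1])
      also have "\<dots> \<approx> (v, False)" by (rule Fm)
      finally have F2: "F 2 (v, False) \<approx> (v, False)" by simp
      have "rho (k + 2)" if "rho k" for k
      proof (rule ccontr)
        assume "\<not> rho (k + 2)"
        from translation_rotation(1)[OF tr' that this] F2 have "(v, False) \<approx> (- v, False)"
          by (metis dih_eq_sym dih_eq_trans)
        then show False using False by simp
      qed
      then show False using not_alt by blast
    qed
  qed
  show "rho (k + h) = (\<not> rho k)" for k using tr[of k] u by (auto simp: dih_eq_def dmul_def)
  obtain v where v: "u = (v, True)" using u by (cases u) auto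
  have "x (0 + h + h) \<approx> dmul u (dmul u (x 0))"
    using dih_eq_trans[OF tr[of "0 + h"] dih_eq_dmul[OF dih_eq_refl tr[of 0]]] .
  also have "\<dots> = x 0" by (cases "x 0") (simp add: v)
  finally show "d dvd 2 * h" using x_inj by fastforce
qed

text \<open>With two boundaries, a shift by the element \<open>h\<close> of order two modulo
  \<open>d\<close> exchanges reflections and rotations. Only two boundaries can exist, and runs of
  either type have length at most two; this forces \<open>d\<close> to divide 2, 3 or 4, and each of
  these is excluded.\<close>

lemma bd_single:
  assumes not_alt: "\<not> (\<forall>k. rho k \<longrightarrow> rho (k + 2))"
    and i: "bd i" and j: "bd j"
  shows "d dvd i - j"
proof (rule ccontr)
  assume ij: "\<not> d dvd i - j"
  define c where "c k = (chi (i + 1) - i) - (chi (k + 1) - k)" for k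
  define h where "h = chi (c j) - chi 0"
  note tb = two_boundaries[OF i j ij not_alt, folded c_def, folded h_def]
  \<comment> \<open>Every boundary other than \<open>i\<close> produces an element of order two
    modulo \<open>d\<close>. There is only one such element and \<open>chi\<close> is injective, so
    the offset of a third boundary equals that of \<open>j\<close>.\<close>
  have only: "d dvd k - i \<or> d dvd k - j" if k: "bd k" for k
  proof (rule ccontr)
    assume "\<not> (d dvd k - i \<or> d dvd k - j)"
    then have ik: "\<not> d dvd i - k" and jk: "\<not> d dvd j - k" by (auto simp: dvd_diff_commute)
    note tb' = two_boundaries[OF i k ik not_alt, folded c_def]
    have "d dvd (chi (c j) - chi 0) - (chi (c k) - chi 0)"
      using tb(2)[unfolded h_def] tb(1)[unfolded h_def] tb'(2,1) by (rule half_unique)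
    then have "d dvd c j - c k" using chi_inject[of "c j" "c k"] by simp
    then have "d dvd (chi (k + 1) - k) - (chi (j + 1) - j)"
      by (rule dvd_comb1[where a = 1]) (simp add: c_def)
    then show False using bd_unique[OF k j] jk by (simp add: dvd_diff_commute)
  qed
  \<comment> \<open>The shift by \<open>h\<close> turns the rotation after \<open>b\<close> into a
    reflection, whose run ends here or one place later.\<close>
  have next_bd: "bd (b + 1 + h) \<or> bd (b + 2 + h)" if "bd b" for b
  proof -
    have b: "rho b" "\<not> rho (b + 1)" using that by (auto simp: bd_def)
    have r1: "rho (b + 1 + h)" using b tb(3)[of "b + 1"] by simp
    show ?thesis
    proof (cases "rho (b + 2)")
      case True
      then have "\<not> rho (b + 1 + h + 1)" using tb(3)[of "b + 2"] by (simp add: algebra_simps)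
      then show ?thesis using r1 by (simp add: bd_def)
    next
      case False
      then have r2: "rho (b + 1 + h + 1)" using tb(3)[of "b + 2"] by (simp add: algebra_simps)
      from no_three_ref[OF r1 r2] have "\<not> rho (b + 2 + h + 1)" by (simp add: algebra_simps)
      then show ?thesis using r2 by (simp add: bd_def algebra_simps)
    qed
  qed
  have d2: "\<not> d dvd 2"
  proof
    assume d: "d dvd 2"
    have "rho i" "\<not> rho (i + 1)" "rho j" using i j by (auto simp: bd_def)
    then have "\<not> d dvd j - (i + 1)" using rho_cong by blast
    moreover have "d dvd j - i \<or> d dvd j - (i + 1)"
    proof (cases "even (j - i)")
      case True
      then show ?thesis using d dvd_trans by blast
    next
      case False
      then have "2 dvd j - (i + 1)" by simp
      then show ?thesis using d dvd_trans by blast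
    qed
    ultimately show False using ij by (simp add: dvd_diff_commute)
  qed
  have d3: "\<not> d dvd 3"
  proof
    assume d: "d dvd 3"
    have "d dvd h" using tb(2) d by (rule dvd_comb2[where a = "-1" and b = h]) simp
    then show False using tb(1) by simp
  qed
  have step: "d dvd b + 1 + h - b' \<or> d dvd b + 2 + h - b'"
    if b: "bd b" "bd b'" "\<not> d dvd b - b'" and only: "\<And>k. bd k \<Longrightarrow> d dvd k - b \<or> d dvd k - b'" for b b'
  proof -
    from next_bd[OF b(1)] show ?thesis
    proof
      assume n1: "bd (b + 1 + h)"
      have "\<not> d dvd b + 1 + h - b"
      proof
        assume "d dvd b + 1 + h - b"
        from this tb(2) have "d dvd 2" by (rule dvd_comb2[where a = 2 and b = "-1"]) simp
        then show False using d2 by simp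
      qed
      then show ?thesis using only[OF n1] by blast
    next
      assume n2: "bd (b + 2 + h)"
      \<comment> \<open>In this case \<open>d\<close> divides 4 and the types at \<open>b\<close>,
        ..., \<open>b + 3\<close> are all known; they leave no room for the second boundary.\<close>
      have "\<not> d dvd b + 2 + h - b"
      proof
        assume h2: "d dvd b + 2 + h - b"
        have br: "rho b" "\<not> rho (b + 1)" using b by (auto simp: bd_def)
        have b2: "\<not> rho (b + 2)"
          using tb(3)[of "b + 2"] rho_cong[of "b + 2 + h" b] h2 br by simp
        have b3: "rho (b + 3)"
        proof -
          have "d dvd (b + 1 + h) - (b + 3)" using h2 tb(2)
            by (rule dvd_comb2[where a = "-1" and b = 1]) simp
          from rho_cong[OF this] show ?thesis using tb(3)[of "b + 1"] br by simp
        qed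
        have d4: "d dvd 4" using h2 tb(2) by (rule dvd_comb2[where a = 2 and b = "-1"]) simp
        define r where "r = (b' - b) mod 4"
        have r: "d dvd b' - (b + r)"
        proof -
          have "4 dvd b' - (b + r)"
            unfolding r_def by (metis diff_diff_eq dvd_minus_mod)
          then show ?thesis using d4 dvd_trans by blast
        qed
        have "r = 0 \<or> r = 1 \<or> r = 2 \<or> r = 3" unfolding r_def by presburger
        moreover have "rho b'" "\<not> rho (b' + 1)" using b by (auto simp: bd_def)
        moreover have "d dvd (b' + 1) - b" if "r = 3"
          using r d4 unfolding that by (rule dvd_comb2[where a = 1 and b = 1]) simp
        ultimately show False using br b2 b3 r rho_cong[OF r] rho_cong[of "b' + 1" b] b(3)
          by (auto simp: dvd_diff_commute)
      qed
      then show ?thesis using only[OF n2] by blast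
    qed
  qed
  have A: "d dvd i + 1 + h - j \<or> d dvd i + 2 + h - j" using step[OF i j ij only] .
  have B: "d dvd j + 1 + h - i \<or> d dvd j + 2 + h - i"
    using step[OF j i] ij only by (metis dvd_diff_commute)
  from A B consider
      (1) "d dvd i + 1 + h - j" "d dvd j + 1 + h - i"
    | (2) "d dvd i + 1 + h - j" "d dvd j + 2 + h - i"
    | (3) "d dvd i + 2 + h - j" "d dvd j + 1 + h - i"
    | (4) "d dvd i + 2 + h - j" "d dvd j + 2 + h - i" by blast
  then show False
  proof cases
    case 1
    from this tb(2) have "d dvd 2" by (rule dvd_comb3[where a = 1 and b = 1 and c = "-1"]) simp
    then show False using d2 by simp
  next
    case 2
    from this tb(2) have "d dvd 3" by (rule dvd_comb3[where a = 1 and b = 1 and c = "-1"]) simp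
    then show False using d3 by simp
  next
    case 3
    from this tb(2) have "d dvd 3" by (rule dvd_comb3[where a = 1 and b = 1 and c = "-1"]) simp
    then show False using d3 by simp
  next
    case 4
    from this tb(2) have d4: "d dvd 4" by (rule dvd_comb3[where a = 1 and b = 1 and c = "-1"]) simp
    have "d dvd 2 * 2" using d4 by simp
    from half_unique[OF tb(2,1) this d2] have "d dvd h - 2" .
    from this 4(1) d4 have "d dvd i - j" by (rule dvd_comb3[where a = "-1" and b = 1 and c = "-1"]) simp
    then show False using ij by simp
  qed
qed

end

section \<open>Cycles with a single transition per period\<close>

context skew
begin

text \<open>A self-inverse rotation in \<open>X\<close> has twice its exponent divisible by
  \<open>n\<close>, and it is nontrivial because 0 lies in the core while rotations of
  \<open>X\<close> do not. So both exponents are the half of \<open>n\<close>.\<close>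

lemma involution_unique:
  assumes "rho i" "\<not> rho j" "\<not> rho k" "d dvd chi j - j" "d dvd chi k - k"
  shows "d dvd j - k"
proof -
  have half: "n dvd 2 * s j" "\<not> n dvd s j" if "\<not> rho j" "d dvd chi j - j" for j
  proof -
    show "n dvd 2 * s j" using s_chi[OF that(1)] s_cong[OF that(2)]
      by (rule dvd_comb2[where a = 1 and b = "-1"]) simp
    show "\<not> n dvd s j" using rotation_notin_N[OF that(1) assms(1)] inN_cong[of "s j" 0] inN_0 by auto
  qed
  have "n dvd s j - s k" by (rule half_unique) (use half assms in blast)+
  then show ?thesis using assms by (intro eq_index) auto
qed

text \<open>Commuting two rotations and moving the first to the only reflection gives the index
  equation \<open>pair\<close>. For \<open>d\<close> at least 4 it makes \<open>chi j - j\<close>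
  the same element of order two at every rotation; the rotation at this distance from
  \<open>i\<close> would then have the reflection \<open>x i\<close> as its inverse.\<close>

lemma single_ref:
  assumes Y: "\<And>y. rho y \<longleftrightarrow> d dvd y - i" and d1: "\<not> d dvd 1"
  shows "one_in_p 2 x chi i \<or> one_in_p 3 x chi i"
proof -
  have pair: "d dvd (j + k) - (chi j + chi k)"
    if j: "\<not> rho j" and k: "\<not> rho k" and kj: "\<not> d dvd k - j" and kc: "\<not> d dvd k - chi j" for j k
  proof -
    have i: "rho i" using Y by simp
    let ?a = "k + chi i - chi j" and ?c = "k + i - j"
    let ?b = "j + chi ?c - chi k"
    have "dmul (x (j + (i - j))) (x (k + chi (j + (i - j)) - chi j)) \<approx>
        dmul (x (k + (i - j))) (x (j + chi (k + (i - j)) - chi k))" by (rule rot_rot_transfer[OF j k])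
    then have e: "dmul (x i) (x ?a) \<approx> dmul (x ?c) (x ?b)" by (simp add: algebra_simps)
    have c: "\<not> rho ?c" using kj by (simp add: Y)
    have "d dvd ?a - i \<longleftrightarrow> d dvd (k - chi j)"
      using dvd_add_right_iff[OF chi_refl[OF i], of "k - chi j"] by (simp add: algebra_simps)
    then have a: "\<not> rho ?a" using kc by (simp add: Y)
    have b: "rho ?b" and "n dvd (s i - s ?a) - (s ?c + s ?b)"
      using e i a c by (simp_all add: dmul_x_ref dmul_x_rot)
    have bi: "d dvd ?b - i" using b Y by simp
    have "n dvd s ?a + s ?c"
      using \<open>n dvd (s i - s ?a) - (s ?c + s ?b)\<close> s_cong[OF bi]
      by (rule dvd_comb2[where a = "-1" and b = "-1"]) simp
    then have "d dvd chi ?a - ?c" using a c by (intro chi_eqI)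
    from chi_swap[OF this] bi chi_refl[OF i] show ?thesis
      by (rule dvd_comb3[where a = "-1" and b = 1 and c = "-1"]) simp
  qed
  have i: "rho i" using Y by simp
  show ?thesis
  proof (cases "d = 2")
    case True
    have "2 dvd chi k + k - 2 * i" for k
      using Y[of k] Y[of "chi k"] True by auto
    then show ?thesis using Y True by (simp add: one_in_p_def)
  next
    case False
    have "d \<noteq> 1" using d1 by auto
    then have d3: "3 \<le> d" using False d_pos by linarith
    have small: "\<not> d dvd m" if "0 < m" "m < d" for m using that zdvd_not_zless by blast
    have Z: "\<not> rho (i + m)" if "0 < m" "m < d" for m using small[OF that] Y by simp
    have nofix: "\<not> d dvd chi j - j" if j: "\<not> rho j" for j
    proof
      assume f: "d dvd chi j - j"
      obtain k where k: "\<not> rho k" "\<not> d dvd k - j"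
      proof (cases "d dvd (i + 1) - j")
        case True
        have "\<not> d dvd (i + 2) - j"
        proof
          assume "d dvd (i + 2) - j"
          from this True have "d dvd 1" by (rule dvd_comb2[where a = 1 and b = "-1"]) simp
          then show False using d1 by simp
        qed
        then show ?thesis using that[of "i + 2"] Z[of 2] d3 by simp
      next
        case False
        then show ?thesis using that[of "i + 1"] Z[of 1] d3 by simp
      qed
      have "\<not> d dvd k - chi j"
      proof
        assume "d dvd k - chi j"
        from this f have "d dvd k - j" by (rule dvd_diff_trans)
        then show False using k by simp
      qed
      from pair[OF j k this] f have "d dvd chi k - k"
        by (rule dvd_comb2[where a = "-1" and b = "-1"]) simp
      from involution_unique[OF i j k(1) f this] k(2) show False by (simp add: dvd_diff_commute)
    qed
    show ?thesis
    proof (cases "d = 3")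
      case True
      have "3 dvd chi k + k - 2 * i" for k
      proof (cases "rho k")
        case True
        then have "rho (chi k)" by simp
        with True have "3 dvd k - i" "3 dvd chi k - i" using Y \<open>d = 3\<close> by simp_all
        then show ?thesis by presburger
      next
        case False
        then have "\<not> 3 dvd chi k - i" "\<not> 3 dvd k - i" using Y[of "chi k"] Y[of k] True by simp_all
        moreover have "\<not> 3 dvd chi k - k" using nofix[OF False] True by simp
        ultimately show ?thesis by presburger
      qed
      then show ?thesis using Y True by (simp add: one_in_p_def)
    next
      case False
      then have d4: "4 \<le> d" using d3 by linarith
      have half: "d dvd 2 * (chi j - j)" if j: "\<not> rho j" for j
      proof -
        \<comment> \<open>Of three consecutive rotations one differs from both \<open>j\<close> and
          \<open>chi j\<close>. Adding \<open>pair\<close> for it and for its inverse cancels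
          everything but \<open>2 * (chi j - j)\<close>.\<close>
        have "\<exists>m\<in>{1,2,3}. \<not> d dvd (i + m) - j \<and> \<not> d dvd (i + m) - chi j"
        proof (rule ccontr)
          assume "\<not> ?thesis"
          then have *: "d dvd (i + m) - j \<or> d dvd (i + m) - chi j" if "m \<in> {1,2,3}" for m
            using that by blast
          have diff: "\<not> (d dvd (i + m) - c \<and> d dvd (i + m') - c)" if "0 < m - m'" "m - m' < d" for m m' c
          proof
            assume a: "d dvd (i + m) - c \<and> d dvd (i + m') - c"
            from conjunct1[OF a] conjunct2[OF a] have "d dvd m - m'"
              by (rule dvd_comb2[where a = 1 and b = "-1"]) simp
            then show False using small that by blast
          qed
          show False using *[of 1] *[of 2] *[of 3] diff[of 2 1] diff[of 3 1] diff[of 3 2] d4 by auto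
        qed
        then obtain m where m: "m \<in> {1,2,3}" "\<not> d dvd (i + m) - j" "\<not> d dvd (i + m) - chi j" by blast
        let ?k = "i + m"
        have k: "\<not> rho ?k" using Z[of m] m d4 by auto
        have k1: "\<not> d dvd chi ?k - j"
          using chi_chi_cong[of j ?k] m(3) by (auto simp: dvd_diff_commute)
        have k2: "\<not> d dvd chi ?k - chi j" using chi_inject m(2) by blast
        have "\<not> rho (chi ?k)" using k by simp
        from pair[OF j k m(2,3)] pair[OF j this k1 k2] chi_chi[of ?k]
        show ?thesis by (rule dvd_comb3[where a = "-1" and b = "-1" and c = "-1"]) simp
      qed
      define w where "w = chi (i + 1) - (i + 1)"
      have r1: "\<not> rho (i + 1)" using Z[of 1] d4 by simp
      have w: "d dvd 2 * w" "\<not> d dvd w" using half[OF r1] nofix[OF r1] by (simp_all add: w_def)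
      have rw: "\<not> rho (i + w)" using Y w(2) by simp
      have "d dvd (chi (i + w) - (i + w)) - w"
        by (rule half_unique[OF half[OF rw] nofix[OF rw] w])
      from this w(1) have "d dvd chi (i + w) - i" by (rule dvd_comb2[where a = 1 and b = 1]) simp
      then have "rho (chi (i + w))" using Y by simp
      then show ?thesis using rw by simp
    qed
  qed
qed

text \<open>The hypothesis \<open>bc\<close> pins \<open>chi (a + 2)\<close> to
  \<open>a - 1\<close>. If \<open>d\<close> is at least 5, \<open>x (a - 2)\<close> is a rotation
  too. The boundary relation moved back by one step then has two rotations on one side; swapping
  them and stepping forward puts a reflection at the index \<open>?b\<close>, and neither
  \<open>a\<close> nor \<open>a + 1\<close> is possible for it.\<close>

lemma double_ref:
  assumes Y: "\<And>y. rho y \<longleftrightarrow> d dvd y - a \<or> d dvd y - (a + 1)" and ex_rot: "\<not> rho z"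
    and d1: "\<not> d dvd 1" and bc: "rho (chi (a + 2) + 1)"
  shows "two_in_3 x a \<or> two_in_4 x chi a"
proof -
  have "d \<noteq> 2"
  proof
    assume "d = 2"
    then have "rho z" unfolding Y by presburger
    then show False using ex_rot by simp
  qed
  moreover have "d \<noteq> 1" using d1 by auto
  ultimately have d3: "3 \<le> d" using d_pos by linarith
  have small: "\<not> d dvd m" if "0 < m" "m < d" for m using that zdvd_not_zless by blast
  have r0: "rho a" "rho (a + 1)" using Y by auto
  have r2: "\<not> rho (a + 2)"
    using small[of 2] small[of 1] d3 by (simp add: Y)
  have c2: "d dvd chi (a + 2) - (a - 1)"
  proof -
    have "\<not> rho (chi (a + 2))" using r2 by simp
    then have "\<not> d dvd chi (a + 2) - a" using Y by blast
    then show ?thesis using bc unfolding Y by (auto simp: algebra_simps)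
  qed
  show ?thesis
  proof (cases "d = 3")
    case True
    have "rho i \<longleftrightarrow> \<not> 3 dvd i - a - 2" for i unfolding Y True by presburger
    then show ?thesis by (simp add: two_in_3_def)
  next
    case False
    show ?thesis
    proof (cases "d = 4")
      case True
      have "4 dvd chi i + i - 2 * a - 5" if "\<not> rho i" for i
      proof -
        have "4 dvd i - (a + 2) \<or> 4 dvd i - (a - 1)" using that unfolding Y True by presburger
        then show ?thesis
        proof
          assume "4 dvd i - (a + 2)"
          moreover from this have "d dvd chi i - chi (a + 2)" using True by (intro chi_cong) simp
          from this c2 have "4 dvd chi i - (a - 1)" unfolding True by (rule dvd_diff_trans)
          ultimately show ?thesis by presburger
        next
          assume i: "4 dvd i - (a - 1)"
          then have "d dvd chi i - chi (a - 1)" using True by (intro chi_cong) simp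
          from this chi_swap[OF c2] have "4 dvd chi i - (a + 2)" unfolding True by (rule dvd_diff_trans)
          with i show ?thesis by presburger
        qed
      qed
      then show ?thesis using Y True by (auto simp: two_in_4_def algebra_simps)
    next
      case False
      with \<open>d \<noteq> 3\<close> have d5: "5 \<le> d" using d3 by linarith
      have rm: "\<not> rho (a - 2)"
        using small[of 2] small[of 3] d5 by (simp add: Y)
      let ?g = "chi (a - 2) - 1"
      have "dmul (x (a + 1 + -1)) (x (a + 2 - (a + 1) + chi (a + 1 + -1))) \<approx>
          dmul (x (chi (a + 2) + -1)) (x (a + 1 - (a + 2) + chi (chi (a + 2) + -1)))"
        by (rule ref_rot_transfer[OF r0(2) r2])
      then have e: "dmul (x a) (x (1 + chi a)) \<approx> dmul (x (chi (a + 2) - 1)) (x (chi (chi (a + 2) - 1) - 1))"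
        by (simp add: algebra_simps)
      have i1: "d dvd (1 + chi a) - (a + 1)" using chi_refl[OF r0(1)] by simp
      have i2: "d dvd (chi (a + 2) - 1) - (a - 2)" using c2 by (simp add: algebra_simps)
      have i3: "d dvd (chi (chi (a + 2) - 1) - 1) - ?g" using chi_cong[OF i2] by simp
      have e1: "dmul (x a) (x (a + 1)) \<approx> dmul (x (a - 2)) (x ?g)"
        using e dih_eq_dmul[OF dih_eq_refl x_cong[OF i1], of "x a"] dih_eq_dmul[OF x_cong[OF i2] x_cong[OF i3]]
        by (metis dih_eq_sym dih_eq_trans)
      then have g: "\<not> rho ?g" and sg: "n dvd (s a - s (a + 1)) - (s (a - 2) + s ?g)"
        using r0 rm by (simp_all add: dmul_x_ref dmul_x_rot)
      have "dmul (x (a - 2)) (x ?g) \<approx> dmul (x ?g) (x (a - 2))"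
        using rm g by (simp add: dmul_x_rot add.commute)
      with e1 have "dmul (x a) (x (a + 1)) \<approx> dmul (x ?g) (x (a - 2))" by (rule dih_eq_trans)
      from transfer2[OF this, of 1]
      have e2: "dmul (x (a + 1)) (x (a + 1 + chi (a + 1) - chi a)) \<approx>
          dmul (x (chi (a - 2))) (x (a - 2 + chi (chi (a - 2)) - chi ?g))" by simp
      let ?b = "a - 2 + chi (chi (a - 2)) - chi ?g"
      have j1: "d dvd (a + 1 + chi (a + 1) - chi a) - (a + 2)"
        using chi_refl[OF r0(2)] chi_refl[OF r0(1)]
        by (rule dvd_comb2[where a = 1 and b = "-1"]) simp
      have "dmul (x (a + 1)) (x (a + 2)) \<approx> dmul (x (chi (a - 2))) (x ?b)"
        by (rule dih_eq_trans[OF dih_eq_sym[OF dih_eq_dmul[OF dih_eq_refl x_cong[OF j1]]] e2])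
      then have b: "rho ?b" and sb: "n dvd (s (a + 1) - s (a + 2)) - (s (chi (a - 2)) + s ?b)"
        using r0 r2 rm by (simp_all add: dmul_x_ref dmul_x_rot)
      have False
      proof (cases "d dvd ?b - a")
        case True
        have "n dvd s (a + 2) + s ?g"
          using sg sb s_cong[OF True] s_chi[OF rm]
          by (rule dvd_comb4[where a = "-1" and b = "-1" and c = "-1" and e = "-1"]) simp
        then have "d dvd chi (a + 2) - ?g" using r2 g by (intro chi_eqI)
        from this c2 have "d dvd chi (a - 2) - a"
          by (rule dvd_comb2[where a = "-1" and b = 1]) simp
        then have "rho (chi (a - 2))" using Y by blast
        then show False using rm by simp
      next
        case False
        then have b1: "d dvd ?b - (a + 1)" using b Y by blast
        have "n dvd s (a + 2) - s (a - 2)"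
          using sb s_cong[OF b1] s_chi[OF rm]
          by (rule dvd_comb3[where a = "-1" and b = "-1" and c = "-1"]) simp
        then have "d dvd (a + 2) - (a - 2)" using r2 rm by (intro eq_index) auto
        then show False using small[of 4] d5 by simp
      qed
      then show ?thesis ..
    qed
  qed
qed

definition pattern :: "int \<Rightarrow> bool" where
  "pattern i \<longleftrightarrow> one_in_p 2 x chi i \<or> one_in_p 3 x chi i \<or> two_in_3 x i \<or> two_in_4 x chi i"

end

text \<open>Either reflections recur at distance two and the types alternate, or there is one
  boundary per period, preceded by a run of one or two reflections since three never follow each
  other.\<close>

lemma (in core_free) core_free_pattern: "\<exists>i. pattern i"
proof (cases "\<forall>k. rho k \<longrightarrow> rho (k + 2)")
  case True
  obtain i where i: "rho i" "\<not> rho (i + 1)" using ex_bd bd_def by auto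
  have alt: "rho b" if ra: "rho a" and ab: "2 dvd b - a" for a b
  proof -
    obtain q where q: "b = a + 2 * q" using ab by (metis dvdE diff_add_cancel add.commute)
    have *: "rho (a + 2 * int m)" for m
    proof (induction m)
      case (Suc m)
      then show ?case using True[rule_format, of "a + 2 * int m"] by (simp add: algebra_simps)
    qed (simp add: ra)
    have "d dvd q - int (nat (q mod d))" using d_pos by (simp add: mod_eq_dvd_iff[symmetric])
    then have "d dvd b - (a + 2 * int (nat (q mod d)))"
      by (rule dvd_comb1[where a = 2]) (simp add: q)
    then show ?thesis using rho_cong * by blast
  qed
  have Y: "rho j \<longleftrightarrow> 2 dvd j - i" for j
  proof
    assume j: "rho j"
    show "2 dvd j - i"
    proof (rule ccontr)
      assume "\<not> 2 dvd j - i"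
      then have "2 dvd (i + 1) - j" by presburger
      then show False using alt[OF j] i by blast
    qed
  qed (rule alt[OF i(1)])
  have "2 dvd chi k + k - 2 * i" for k using Y[of k] Y[of "chi k"] by auto
  then have "one_in_p 2 x chi i" using Y by (simp add: one_in_p_def)
  then show ?thesis unfolding pattern_def by blast
next
  case False
  obtain i where i: "bd i" using ex_bd by blast
  have single: "d dvd j - i" if "bd j" for j using bd_single[OF False that i] .
  show ?thesis
  proof (cases "rho (i - 1)")
    case False
    have "rho y \<longleftrightarrow> d dvd y - i" for y
    proof
      assume y: "rho y"
      show "d dvd y - i"
      proof (cases "rho (y + 1)")
        case True
        then have "bd (y + 1)" using no_three_ref[OF y] by (simp add: bd_def add.assoc)
        then have "d dvd y - (i - 1)" using single[of "y + 1"] by (simp add: algebra_simps)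
        then show ?thesis using rho_cong y False by blast
      qed (use single y in \<open>simp add: bd_def\<close>)
    next
      assume "d dvd y - i"
      then show "rho y" using rho_cong i by (auto simp: bd_def)
    qed
    from single_ref[OF this d_not_1] show ?thesis unfolding pattern_def by blast
  next
    case True
    have Y: "rho y \<longleftrightarrow> d dvd y - (i - 1) \<or> d dvd y - (i - 1 + 1)" for y
    proof
      assume y: "rho y"
      show "d dvd y - (i - 1) \<or> d dvd y - (i - 1 + 1)"
      proof (cases "rho (y + 1)")
        case True
        then have "bd (y + 1)" using no_three_ref[OF y] by (simp add: bd_def add.assoc)
        then have "d dvd y - (i - 1)" using single[of "y + 1"] by (simp add: algebra_simps)
        then show ?thesis by blast
      qed (use single y in \<open>simp add: bd_def\<close>)
    next
      assume "d dvd y - (i - 1) \<or> d dvd y - (i - 1 + 1)"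
      then show "rho y" using rho_cong[of y i] rho_cong[of y "i - 1"] i True by (auto simp: bd_def)
    qed
    have "rho (chi (i - 1 + 2) + 1)" using bd_chi[OF i] by (simp add: algebra_simps)
    moreover obtain z where "\<not> rho z" using ex_rot by blast
    ultimately show ?thesis using double_ref[OF Y _ d_not_1] unfolding pattern_def by blast
  qed
qed

text \<open>The quotient by the core may have a nontrivial core again, so the division is repeated;
  \<open>n\<close> decreases strictly. The conclusion mentions neither \<open>n\<close> nor
  \<open>d\<close>, and thus passes back unchanged.\<close>

theorem skew_pattern:
  assumes "skew n d x chi F P" "snd (x i)" "\<not> snd (x j)"
  shows "\<exists>i. skew.pattern x chi i"
  using assms
proof (induction "nat n" arbitrary: n d rule: less_induct)
  case less
  interpret skew n d x chi F P by fact
  obtain k where k: "0 < k" "k dvd n" "\<And>c. inN c \<longleftrightarrow> k dvd c" by (rule inN_generator) blast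
  show ?case
  proof (cases "k = n")
    case True
    interpret core_free n d x chi F P
      by unfold_locales (use k True less.prems in auto)
    show ?thesis by (rule core_free_pattern)
  next
    case False
    then have "k < n" using zdvd_imp_le[OF k(2) n_pos] by simp
    then have "nat k < nat n" using n_pos by simp
    moreover obtain e where "skew k e x chi F P" using quotient_skew[of k] k by auto
    ultimately show ?thesis using less.hyps less.prems by blast
  qed
qed

section \<open>Consequences of the mirror symmetry\<close>

lemma dih_eq_eucl: "dih_eq n g h \<Longrightarrow> dih_eq n g k \<Longrightarrow> dih_eq n h k"
  using dih_eq_sym dih_eq_trans by blast

text \<open>In a cyclic group, an element killed by the annihilator of \<open>c\<close> is a
  multiple of \<open>c\<close>. This turns images under \<open>F\<close> into scalars.\<close>

lemma dvd_scalar: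
  fixes n c c' :: int
  assumes "0 < n" and "\<And>m. n dvd m * c \<Longrightarrow> n dvd m * c'"
  obtains z where "n dvd c' - z * c"
proof -
  define g where "g = gcd n c"
  have g: "g dvd n" "g dvd c" "0 < g" using assms(1) by (simp_all add: g_def)
  then obtain m where m: "n = g * m" by auto
  then have mp: "0 < m" using g(3) assms(1) by (simp add: zero_less_mult_iff)
  have "n dvd m * c" using g(2) m by (auto simp: mult.commute)
  then have "n dvd m * c'" by (rule assms(2))
  then have "g dvd c'" using m mp by (simp add: mult.commute)
  then obtain w where w: "c' = g * w" by auto
  obtain u v where uv: "u * n + v * c = g" using bezout_int[of n c] by (auto simp: g_def)
  have "c' - (w * v) * c = n * (w * u)" unfolding w uv[symmetric] by (simp add: algebra_simps)
  then show ?thesis using that[of "w * v"] by simp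
qed

context skew
begin

lemma nat_rep_n: "n dvd l - int (nat (l mod n))"
  using n_pos by (simp add: mod_eq_dvd_iff[symmetric])

lemma nat_rep_d: "d dvd l - int (nat (l mod d))"
  using d_pos by (simp add: mod_eq_dvd_iff[symmetric])

lemma F_rot_mult_nat:
  assumes "F t (c, False) \<approx> (c', False)" "d dvd P t (c, False) - t"
  shows "F t (int l * c, False) \<approx> (int l * c', False) \<and> d dvd P t (int l * c, False) - t"
proof (induction l)
  case 0
  then show ?case using F_one[of t] P_one[of t] by simp
next
  case (Suc l)
  note * = F_rot_add[OF assms conjunct1[OF Suc]]
  have "d dvd P t (c + int l * c, False) - t" using *(2) conjunct2[OF Suc] by (rule dvd_diff_trans)
  with *(1) show ?case by (simp add: algebra_simps)
qed

lemma F_rot_mult: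
  assumes "F t (c, False) \<approx> (c', False)" "d dvd P t (c, False) - t"
  shows "F t (l * c, False) \<approx> (l * c', False)" "d dvd P t (l * c, False) - t"
proof -
  define l' where "l' = nat (l mod n)"
  have l': "n dvd l - int l'" unfolding l'_def by (rule nat_rep_n)
  have e: "(l * c, False) \<approx> (int l' * c, False)" for c
    using l' by (simp add: left_diff_distrib[symmetric])
  note * = F_rot_mult_nat[OF assms, of l']
  show "F t (l * c, False) \<approx> (l * c', False)"
    using F_cong[OF e] * e[of c'] by (meson dih_eq_sym dih_eq_trans)
  show "d dvd P t (l * c, False) - t" using P_cong[OF e] conjunct2[OF *] by (rule dvd_diff_trans)
qed

text \<open>The rotations with exponent divisible by \<open>m\<close> and the reflections with
  exponent congruent to \<open>s i0\<close> form a subgroup containing \<open>X\<close>. Since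
  \<open>X\<close> generates the rotation \<open>a\<close>, the modulus is a unit.\<close>

lemma gen_dvd:
  assumes "m dvd n" "rho i0" "\<And>j. \<not> rho j \<Longrightarrow> m dvd s j" "\<And>i. rho i \<Longrightarrow> m dvd s i - s i0"
  shows "m dvd 1"
proof -
  define Q where "Q g \<longleftrightarrow> (if snd g then m dvd fst g - s i0 else m dvd fst g)" for g
  have "Q (1, False)"
  proof (rule gen[of Q])
    fix g h assume gh: "g \<approx> h" and g: "Q g"
    have "m dvd fst g - fst h" using gh assms(1) by (auto simp: dih_eq_def intro: dvd_trans)
    then have "m dvd fst h - fst g" by (simp add: dvd_diff_commute)
    moreover have "snd g = snd h" using gh by (simp add: dih_eq_def)
    ultimately show "Q h" using g dvd_diff_trans[of m "fst h" "fst g" "s i0"]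
        dvd_diff_trans[of m "fst h" "fst g" 0] by (auto simp: Q_def)
  next
    fix g i assume g: "Q g"
    show "Q (dmul g (x i))"
    proof (cases "snd g"; cases "rho i")
      assume *: "snd g" "rho i"
      then have "m dvd fst g - s i0" "m dvd s i - s i0" using g assms by (auto simp: Q_def)
      then have "m dvd fst g - s i" by (rule dvd_comb2[where a = 1 and b = "-1"]) simp
      then show ?thesis using * by (simp add: Q_def dmul_def)
    next
      assume *: "snd g" "\<not> rho i"
      then have "m dvd fst g - s i0" "m dvd s i" using g assms by (auto simp: Q_def)
      then have "m dvd fst g - s i - s i0" by (rule dvd_comb2[where a = 1 and b = "-1"]) simp
      then show ?thesis using * by (simp add: Q_def dmul_def)
    next
      assume *: "\<not> snd g" "rho i"
      then have "m dvd fst g" "m dvd s i - s i0" using g assms by (auto simp: Q_def)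
      then have "m dvd fst g + s i - s i0" by (rule dvd_comb2[where a = 1 and b = "1"]) simp
      then show ?thesis using * by (simp add: Q_def dmul_def)
    next
      assume *: "\<not> snd g" "\<not> rho i"
      then have "m dvd fst g" "m dvd s i" using g assms by (auto simp: Q_def)
      then show ?thesis using * by (simp add: Q_def dmul_def)
    qed
  qed (simp add: Q_def)
  then show ?thesis by (simp add: Q_def)
qed

end

section \<open>The orientation-reversing automorphism\<close>

locale rskew = skew +
  fixes G :: "int \<times> bool \<Rightarrow> int \<times> bool" and S :: "int \<times> bool \<Rightarrow> int"
  assumes G_cong: "\<And>g h. g \<approx> h \<Longrightarrow> G g \<approx> G h"
    and S_cong: "\<And>g h. g \<approx> h \<Longrightarrow> d dvd S g - S h"
    and G_one: "G (0, False) \<approx> (0, False)"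
    and S_one: "d dvd S (0, False)"
    and G_step: "\<And>g i. G (dmul g (x i)) \<approx> dmul (G g) (x (S g - i))"
    and S_step: "\<And>g i. d dvd S (dmul g (x i)) - (chi (S g - i) + chi i)"
begin

text \<open>Seen from \<open>g\<close> and brought back to 1, the mirror sends index
  \<open>i\<close> to \<open>S g - i\<close>; so it acts as \<open>G\<close> followed by
  \<open>F (S g)\<close>.\<close>

lemma GS_mult: "G (dmul g h) \<approx> dmul (G g) (F (S g) (G h)) \<and>
    d dvd S (dmul g h) - (S h + P (S g) (G h))"
proof (induction h rule: gen)
  case (1 h k)
  have e: "dmul g h \<approx> dmul g k" using 1 by (intro dih_eq_dmul) auto
  have e': "G h \<approx> G k" by (rule G_cong[OF 1(1)])
  have "G (dmul g k) \<approx> G (dmul g h)" by (rule dih_eq_sym, rule G_cong[OF e])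
  also have "\<dots> \<approx> dmul (G g) (F (S g) (G h))" using 1 by simp
  also have "\<dots> \<approx> dmul (G g) (F (S g) (G k))" by (intro dih_eq_dmul dih_eq_refl F_cong e')
  finally have "G (dmul g k) \<approx> dmul (G g) (F (S g) (G k))" .
  moreover have "d dvd S (dmul g k) - (S k + P (S g) (G k))"
    using conjunct2[OF 1(2)] S_cong[OF e] S_cong[OF 1(1)] P_cong[OF e', of "S g"]
    by (rule dvd_comb4[where a = 1 and b = "-1" and c = 1 and e = 1]) simp
  ultimately show ?case by simp
next
  case 2
  have "F (S g) (G (0, False)) \<approx> F (S g) (0, False)" by (rule F_cong[OF G_one])
  also have "\<dots> \<approx> (0, False)" by (rule F_one)
  finally have "dmul (G g) (F (S g) (G (0, False))) \<approx> dmul (G g) (0, False)"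
    by (intro dih_eq_dmul) auto
  moreover have "d dvd S g - (S (0, False) + P (S g) (G (0, False)))"
    using S_one P_cong[OF G_one, of "S g"] P_one[of "S g"]
    by (rule dvd_comb3[where a = "-1" and b = "-1" and c = "-1"]) simp
  ultimately show ?case by (simp add: dih_eq_sym)
next
  case (3 h i)
  let ?p = "P (S g) (G h)"
  have ab: "d dvd (S (dmul g h) - i) - (S h - i + ?p)" using 3 by (simp add: algebra_simps)
  have "G (dmul (dmul g h) (x i)) \<approx> dmul (G (dmul g h)) (x (S (dmul g h) - i))" by (rule G_step)
  also have "\<dots> \<approx> dmul (dmul (G g) (F (S g) (G h))) (x (S h - i + ?p))"
    using 3 x_cong[OF ab] by (intro dih_eq_dmul) auto
  also have "\<dots> = dmul (G g) (dmul (F (S g) (G h)) (x (S h - i + ?p)))" by (simp add: dmul_assoc)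
  also have "\<dots> \<approx> dmul (G g) (F (S g) (dmul (G h) (x (S h - i))))"
    by (intro dih_eq_dmul dih_eq_refl dih_eq_sym[OF F_step])
  also have "\<dots> \<approx> dmul (G g) (F (S g) (G (dmul h (x i))))"
    by (intro dih_eq_dmul dih_eq_refl F_cong dih_eq_sym[OF G_step])
  finally have "G (dmul g (dmul h (x i))) \<approx> dmul (G g) (F (S g) (G (dmul h (x i))))"
    by (simp add: dmul_assoc)
  moreover have "d dvd S (dmul g (dmul h (x i))) - (S (dmul h (x i)) + P (S g) (G (dmul h (x i))))"
  proof -
    have "d dvd P (S g) (G (dmul h (x i))) - (chi (S h - i + ?p) - chi (S h - i))"
      using P_cong[OF G_step[of h i], of "S g"] P_step[of "S g" "G h" "S h - i"]
      by (rule dvd_diff_trans)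
    with S_step[of "dmul g h" i, unfolded dmul_assoc] S_step[of h i] chi_cong[OF ab] show ?thesis
      by (rule dvd_comb4[where a = 1 and b = "-1" and c = 1 and e = "-1"]) simp
  qed
  ultimately show ?case by simp
qed

text \<open>A mirror conjugates the rotation about 1 to its inverse. The second half compares the
  offsets of the two composites.\<close>

lemma GS_F: "G (F t g) \<approx> F (- t) (G g) \<and> d dvd (S (F t g) - P t g) - (S g + P (- t) (G g))"
proof (induction g rule: gen)
  case (1 g h)
  have e: "F t g \<approx> F t h" "G g \<approx> G h" using F_cong[OF 1(1)] G_cong[OF 1(1)] by auto
  have "G (F t h) \<approx> G (F t g)" by (rule dih_eq_sym, rule G_cong[OF e(1)])
  also have "\<dots> \<approx> F (- t) (G g)" using 1 by simp
  also have "\<dots> \<approx> F (- t) (G h)" by (rule F_cong[OF e(2)])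
  finally have "G (F t h) \<approx> F (- t) (G h)" .
  moreover have "d dvd (S (F t h) - P t h) - (S h + P (- t) (G h))"
    using conjunct2[OF 1(2)] S_cong[OF e(1)] P_cong[OF 1(1), of t] S_cong[OF 1(1)] P_cong[OF e(2), of "- t"]
    by (rule dvd_comb5[where a = 1 and b = "-1" and c = 1 and e = 1 and f = 1]) simp
  ultimately show ?case by simp
next
  case 2
  have "G (F t (0, False)) \<approx> (0, False)" using dih_eq_trans[OF G_cong[OF F_one] G_one] .
  moreover have "F (- t) (G (0, False)) \<approx> (0, False)"
    using dih_eq_trans[OF F_cong[OF G_one] F_one] .
  ultimately have "G (F t (0, False)) \<approx> F (- t) (G (0, False))" by (metis dih_eq_sym dih_eq_trans)
  moreover have "d dvd P (- t) (G (0, False)) - (- t)"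
    using P_cong[OF G_one] P_one by (rule dvd_diff_trans)
  from this S_cong[OF F_one[of t]] P_one[of t]
  have "d dvd (S (F t (0, False)) - P t (0, False)) - (S (0, False) + P (- t) (G (0, False)))"
    by (rule dvd_comb3[where a = "-1" and b = 1 and c = "-1"]) simp
  ultimately show ?case by simp
next
  case (3 g i)
  let ?a = "S (F t g) - (i + P t g)" and ?b = "S g - i + P (- t) (G g)"
  have ab: "d dvd ?a - ?b" using 3 by (simp add: algebra_simps)
  have "G (F t (dmul g (x i))) \<approx> G (dmul (F t g) (x (i + P t g)))" by (rule G_cong, rule F_step)
  also have "\<dots> \<approx> dmul (G (F t g)) (x ?a)" by (rule G_step)
  also have "\<dots> \<approx> dmul (F (- t) (G g)) (x ?b)" using 3 x_cong[OF ab] by (intro dih_eq_dmul) auto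
  also have "\<dots> \<approx> F (- t) (dmul (G g) (x (S g - i)))" by (rule dih_eq_sym, rule F_step)
  also have "\<dots> \<approx> F (- t) (G (dmul g (x i)))" by (rule F_cong, rule dih_eq_sym, rule G_step)
  finally have "G (F t (dmul g (x i))) \<approx> F (- t) (G (dmul g (x i)))" .
  moreover have "d dvd (S (F t (dmul g (x i))) - P t (dmul g (x i))) - (S (dmul g (x i)) + P (- t) (G (dmul g (x i))))"
  proof -
    have 1: "d dvd S (F t (dmul g (x i))) - (chi ?a + chi (i + P t g))"
      using S_cong[OF F_step[of t g i]] S_step[of "F t g" "i + P t g"] by (rule dvd_diff_trans)
    have 2: "d dvd P (- t) (G (dmul g (x i))) - (chi ?b - chi (S g - i))"
      using P_cong[OF G_step[of g i], of "- t"] P_step[of "- t" "G g" "S g - i"] by (rule dvd_diff_trans)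
    show ?thesis
      using 1 2 P_step[of t g i] S_step[of g i] chi_cong[OF ab]
      by (rule dvd_comb5[where a = 1 and b = "-1" and c = "-1" and e = "-1" and f = 1]) simp
  qed
  ultimately show ?case by simp
qed

lemma G_x: "G (x i) \<approx> x (- i)"
proof -
  have "G (dmul (0, False) (x i)) \<approx> dmul (G (0, False)) (x (S (0, False) - i))" by (rule G_step)
  also have "\<dots> \<approx> dmul (0, False) (x (- i))"
    using S_one by (intro dih_eq_dmul G_one x_cong) simp
  finally show ?thesis by simp
qed

lemma S_x: "d dvd S (x i) - (chi (- i) + chi i)"
proof -
  have "d dvd chi (S (0, False) - i) - chi (- i)" using S_one by (intro chi_cong) simp
  with S_step[of "(0, False)" i] show ?thesis by (simp, rule dvd_comb2[where a = 1 and b = 1]) auto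
qed

lemma G_x2: "G (dmul (x i) (x j)) \<approx> dmul (x (- i)) (x (chi (- i) + chi i - j))"
proof -
  have "G (dmul (x i) (x j)) \<approx> dmul (G (x i)) (x (S (x i) - j))" by (rule G_step)
  also have "\<dots> \<approx> dmul (x (- i)) (x (chi (- i) + chi i - j))"
    by (intro dih_eq_dmul G_x x_cong, rule dvd_comb1[OF S_x[of i], where a = 1]) simp
  finally show ?thesis .
qed

lemma S_x2: "d dvd S (dmul (x i) (x j)) - (chi (chi (- i) + chi i - j) + chi j)"
proof -
  have "d dvd chi (S (x i) - j) - chi (chi (- i) + chi i - j)"
    by (rule chi_cong, rule dvd_comb1[OF S_x[of i], where a = 1]) simp
  with S_step[of "x i" j] show ?thesis by (rule dvd_comb2[where a = 1 and b = 1]) simp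
qed

lemma G_rot_mult:
  assumes "G (c, False) \<approx> (c', False)" "d dvd S (c, False)"
  shows "G (l * c, False) \<approx> (l * c', False)" "d dvd S (l * c, False)"
proof -
  have nat: "G (int l * c, False) \<approx> (int l * c', False) \<and> d dvd S (int l * c, False)" for l
  proof (induction l)
    case 0
    then show ?case using G_one S_one by simp
  next
    case (Suc l)
    let ?h = "(int l * c, False)"
    have F0: "F (S (c, False)) (G ?h) \<approx> (int l * c', False)"
      using F_index[of "S (c, False)" 0 "G ?h" "(int l * c', False)"] assms(2) Suc FP_zero[of "(int l * c', False)"]
      by (auto intro: dih_eq_trans)
    have "G (dmul (c, False) ?h) \<approx> dmul (G (c, False)) (F (S (c, False)) (G ?h))"
      using GS_mult by blast
    also have "\<dots> \<approx> dmul (c', False) (int l * c', False)" by (intro dih_eq_dmul assms(1) F0)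
    finally have 1: "G (c + int l * c, False) \<approx> (c' + int l * c', False)" by simp
    have "d dvd P (S (c, False)) (G ?h) - P 0 (G ?h)" using assms(2) by (intro P_index) auto
    moreover have "d dvd P 0 (G ?h)" using FP_zero by blast
    ultimately have "d dvd P (S (c, False)) (G ?h)" by (rule dvd_comb2[where a = 1 and b = 1]) simp
    with conjunct2[OF GS_mult[of "(c, False)" ?h]] conjunct2[OF Suc]
    have "d dvd S (dmul (c, False) ?h)" by (rule dvd_comb3[where a = 1 and b = 1 and c = 1]) simp
    with 1 show ?case by (simp add: algebra_simps)
  qed
  define l' where "l' = nat (l mod n)"
  have l': "n dvd l - int l'" unfolding l'_def by (rule nat_rep_n)
  have e: "(l * c, False) \<approx> (int l' * c, False)" for c
    using l' by (simp add: left_diff_distrib[symmetric])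
  show "G (l * c, False) \<approx> (l * c', False)"
    using G_cong[OF e] nat[of l'] e[of c'] by (meson dih_eq_sym dih_eq_trans)
  show "d dvd S (l * c, False)"
    using S_cong[OF e, of c] conjunct2[OF nat[of l']] by (rule dvd_comb2[where a = 1 and b = 1]) simp
qed

text \<open>The reflection inverts the rotation about \<open>1\<close>, so both act alike on the abelian core.\<close>

lemma reflected_scalar:
  assumes "inN c" "G (c, False) \<approx> (c', False)" "d dvd S (c, False)" "inN c'"
  shows "n dvd nr * nr * c' - c'"
proof -
  have "(nr * c', False) \<approx> G (nr * c, False)" by (rule dih_eq_sym, rule G_rot_mult[OF assms(2,3)])
  also have "\<dots> \<approx> G (F 1 (c, False))" by (rule G_cong, rule dih_eq_sym, rule F1_scalar[OF assms(1)])
  also have "\<dots> \<approx> F (- 1) (G (c, False))" using GS_F by blast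
  also have "\<dots> \<approx> F (- 1) (c', False)" by (rule F_cong[OF assms(2)])
  finally have "F 1 (nr * c', False) \<approx> F 1 (F (- 1) (c', False))" by (rule F_cong)
  also have "\<dots> \<approx> F (1 + - 1) (c', False)" by (rule dih_eq_sym, rule F_add)
  also have "\<dots> \<approx> (c', False)" using FP_zero by simp
  finally have "F 1 (nr * c', False) \<approx> (c', False)" .
  moreover have "F 1 (nr * c', False) \<approx> (nr * (nr * c'), False)"
    by (rule F1_scalar, rule inN_mult[OF assms(4)])
  ultimately have "(nr * (nr * c'), False) \<approx> (c', False)" by (metis dih_eq_sym dih_eq_trans)
  then show ?thesis by (simp add: mult.assoc)
qed

lemma G_ref_pair:
  assumes "rho 0" "rho i" "rho (- i)"
  shows "G (s i - s 0, False) \<approx> (s (- i) - s 0, False)" "d dvd S (s i - s 0, False)"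
proof -
  have e: "dmul (x i) (x 0) = (s i - s 0, False)" using assms by (simp add: dmul_x_ref)
  have c: "d dvd (chi (- i) + chi i - 0) - 0"
    using chi_refl[OF assms(2)] chi_refl[OF assms(3)] by (rule dvd_comb2[where a = 1 and b = 1]) simp
  have "G (dmul (x i) (x 0)) \<approx> dmul (x (- i)) (x 0)"
    using dih_eq_trans[OF G_x2 dih_eq_dmul[OF dih_eq_refl x_cong[OF c]]] .
  then show "G (s i - s 0, False) \<approx> (s (- i) - s 0, False)"
    unfolding e using assms by (simp add: dmul_x_ref)
  show "d dvd S (s i - s 0, False)"
    using S_x2[of i 0, unfolded e] chi_cong[OF c] chi_refl[OF assms(1)]
    by (rule dvd_comb3[where a = 1 and b = 1 and c = 2]) simp
qed


text \<open>All differences of exponents lie in the core, so one scalar \<open>nr\<close> relates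
  consecutive differences and the exponents become geometric sums. The mirror takes the difference
  at 1 to the one at \<open>- 1\<close>, which makes \<open>nr\<close> square to one on
  \<open>s 1 - s 0\<close>, a unit by \<open>gen_dvd\<close>.\<close>

lemma all_ref_scalar:
  assumes Y: "\<And>i. rho i"
  obtains l where "n dvd l\<^sup>2 - 1" "coprime (s 1 - s 0) n"
    "\<And>k::nat. n dvd s (int k) - (s 0 + (s 1 - s 0) * (\<Sum>i<k. l ^ i))"
proof -
  define c where "c = s 1 - s 0"
  have N: "inN (s i - s j)" for i j using ref_pairs_N Y by blast
  have shift: "n dvd s (i + 1) - s (j + 1) - nr * (s i - s j)" for i j
  proof -
    have "F 1 (s i - s j, False) \<approx> dmul (x (i + 1)) (x (j + 1))" using ref_pair_ref(1) Y by blast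
    also have "\<dots> = (s (i + 1) - s (j + 1), False)" using Y by (simp add: dmul_x_ref)
    finally have "(s (i + 1) - s (j + 1), False) \<approx> (nr * (s i - s j), False)"
      using F1_scalar[OF N[of i j]] by (rule dih_eq_eucl)
    then show ?thesis by simp
  qed
  have sum: "n dvd s (int k) - (s 0 + c * (\<Sum>i<k. nr ^ i)) \<and> n dvd s (int k + 1) - s (int k) - c * nr ^ k" for k
  proof (induction k)
    case 0
    then show ?case by (simp add: c_def)
  next
    case (Suc k)
    have "n dvd s (int k + 1) - (s 0 + c * (\<Sum>i<Suc k. nr ^ i))"
      using conjunct1[OF Suc] conjunct2[OF Suc]
      by (rule dvd_comb2[where a = 1 and b = 1]) (simp add: algebra_simps)
    moreover have "n dvd s (int k + 1 + 1) - s (int k + 1) - c * nr ^ Suc k"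
      using shift[of "int k + 1" "int k"] conjunct2[OF Suc]
      by (rule dvd_comb2[where a = 1 and b = nr]) (simp add: algebra_simps)
    ultimately show ?case by (simp add: add.commute add.left_commute)
  qed
  have cop: "coprime c n"
  proof (rule coprimeI)
    fix m assume m: "m dvd c" "m dvd n"
    have "m dvd s i - s 0" for i
    proof -
      have "m dvd s i - s (int (nat (i mod d)))"
        using s_cong[OF nat_rep_d[of i]] m(2) dvd_trans by blast
      moreover have "m dvd s (int (nat (i mod d))) - (s 0 + c * (\<Sum>j<nat (i mod d). nr ^ j))"
        using sum m(2) dvd_trans by blast
      moreover have "m dvd c * (\<Sum>j<nat (i mod d). nr ^ j)" using m(1) by simp
      ultimately show ?thesis by (rule dvd_comb3[where a = 1 and b = 1 and c = 1]) simp
    qed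
    then show "is_unit m" by (intro gen_dvd[of m 0]) (use m(2) Y in auto)
  qed
  have "n dvd nr * nr * (s (- 1) - s 0) - (s (- 1) - s 0)"
    using reflected_scalar[OF N[of 1 0] _ _ N[of "-1" 0]] G_ref_pair[of 1] Y by simp
  moreover have "n dvd c - nr * (s 0 - s (- 1))" using shift[of 0 "-1"] by (simp add: c_def)
  ultimately have "n dvd (nr\<^sup>2 - 1) * c"
    by (rule dvd_comb2[where a = "- nr" and b = "nr\<^sup>2 - 1"]) (simp add: power2_eq_square algebra_simps)
  then have "n dvd nr\<^sup>2 - 1" using cop by (simp add: coprime_dvd_mult_left_iff coprime_commute)
  then show ?thesis using that[of nr] cop sum by (simp add: c_def)
qed

lemma ref_shift:
  assumes "rho i" "rho j" "rho (i + t)" "rho (j + t)"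
  shows "F t (s i - s j, False) \<approx> (s (i + t) - s (j + t), False)" "d dvd P t (s i - s j, False) - t"
proof -
  show "F t (s i - s j, False) \<approx> (s (i + t) - s (j + t), False)"
    using ref_pair_ref(1)[OF assms(1-3)] assms by (simp add: dmul_x_ref)
  show "d dvd P t (s i - s j, False) - t"
    using ref_pair_ref(2)[OF assms(1-3)] chi_refl[OF assms(4)]
    by (rule dvd_comb2[where a = 1 and b = 1]) simp
qed

text \<open>
  For \<open>c = s p - s 0\<close> the relation \<open>R a\<^sup>c R\<^sup>-\<^sup>1 = a\<^sup>z\<^sup>c R\<^sup>q\<close> holds in the group generated by the dihedral
  group and the rotation \<open>R\<close> about \<open>1\<close>, because \<open>C\<close> has only one subgroup of each order. Comparing
  it with its mirror image restricts \<open>z\<close> and \<open>q\<close>.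
\<close>

lemma one_in_p_structure:
  assumes p: "1 < p" and pat: "one_in_p p x chi 0"
  defines "c \<equiv> s p - s 0"
  defines "q \<equiv> chi (chi (p + 1) - p) - 1"
  obtains z l where "\<And>m. F 1 (m * c, False) \<approx> (m * z * c, False)"
    "\<And>m. d dvd P 1 (m * c, False) - (1 + m * q)"
    "\<And>m. n dvd m * c \<Longrightarrow> d dvd m * q"
    "n dvd (z * z - 1) * c" "d dvd (1 + z * l) * q" "n dvd (l * l - 1) * c"
    "F p (c, False) \<approx> (l * c, False)" "d dvd P p (c, False) - p"
    "n dvd s (p + p) - s p - l * c"
    "n dvd s (p + 1) + s (chi (p + 1) - p) - z * c"
proof -
  have Y: "rho i \<longleftrightarrow> p dvd i" for i using pat by (simp add: one_in_p_def)
  have chi: "p dvd chi i + i" for i using pat by (simp add: one_in_p_def)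
  have np: "\<not> p dvd 1" using p by auto
  \<comment> \<open>The difference just before \<open>c\<close>: \<open>F p\<close> takes
    \<open>c'\<close> to \<open>c\<close>, and the mirror takes \<open>c\<close> to
    \<open>- c'\<close>.\<close>
  define c' where "c' = s 0 - s (- p)"
  have "F p (s 0 - s (- p), False) \<approx> (s (0 + p) - s (- p + p), False)" "d dvd P p (s 0 - s (- p), False) - p"
    by (rule ref_shift; simp add: Y)+
  then have Fc': "F p (c', False) \<approx> (c, False)" "d dvd P p (c', False) - p" by (simp_all add: c'_def c_def)
  have "n dvd m * c" if "n dvd m * c'" for m
  proof -
    have "F p (m * c', False) \<approx> (m * c, False)" by (rule F_rot_mult[OF Fc'])
    moreover have "F p (m * c', False) \<approx> F p (0, False)" using that by (intro F_cong) simp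
    ultimately have "(0, False) \<approx> (m * c, False)" using F_one[of p] by (metis dih_eq_sym dih_eq_trans)
    then show ?thesis by simp
  qed
  then obtain l where l: "n dvd c - l * c'" using dvd_scalar[OF n_pos] by blast
  have "F p (c, False) \<approx> F p (l * c', False)" using l by (intro F_cong) simp
  also have "\<dots> \<approx> (l * c, False)" by (rule F_rot_mult[OF Fc'])
  finally have Fc: "F p (c, False) \<approx> (l * c, False)" .
  have "F p (s p - s 0, False) \<approx> (s (p + p) - s (0 + p), False)" and Pc: "d dvd P p (s p - s 0, False) - p"
    by (rule ref_shift; simp add: Y)+
  then have cp: "n dvd s (p + p) - s p - l * c"
    using Fc unfolding c_def by (metis (no_types, lifting) add_0 dih_eq_rot dih_eq_sym dih_eq_trans)
  have Pc: "d dvd P p (c, False) - p" using Pc by (simp add: c_def)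
  have Gc: "G (c, False) \<approx> (- c', False)" "d dvd S (c, False)"
    using G_ref_pair[of p] by (simp_all add: c_def c'_def Y)
  \<comment> \<open>Commuting \<open>G\<close> with \<open>F p\<close> reverses the relation
    \<open>c = l * c'\<close>, so \<open>l\<close> squares to one on \<open>c\<close>.\<close>
  have c'l: "n dvd c' - l * c"
  proof -
    have "(l * (- c'), False) \<approx> G (l * c, False)" by (rule dih_eq_sym, rule G_rot_mult[OF Gc])
    also have "\<dots> \<approx> G (F p (c, False))" by (rule G_cong, rule dih_eq_sym, rule Fc)
    also have "\<dots> \<approx> F (- p) (G (c, False))" using GS_F by blast
    also have "\<dots> \<approx> F (- p) (- c', False)" by (rule F_cong[OF Gc(1)])
    finally have "F p (l * (- c'), False) \<approx> F p (F (- p) (- c', False))" by (rule F_cong)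
    also have "\<dots> \<approx> F (p + - p) (- c', False)" by (rule dih_eq_sym, rule F_add)
    also have "\<dots> \<approx> (- c', False)" using FP_zero by simp
    finally have "F p ((- l) * c', False) \<approx> (- c', False)" by simp
    moreover have "F p ((- l) * c', False) \<approx> ((- l) * c, False)" by (rule F_rot_mult[OF Fc'])
    ultimately have "((- l) * c, False) \<approx> (- c', False)" by (metis dih_eq_sym dih_eq_trans)
    then show ?thesis by simp
  qed
  have ll: "n dvd (l * l - 1) * c"
    using l c'l by (rule dvd_comb2[where a = "-1" and b = "- l"]) (simp add: algebra_simps)
  define a where "a = chi (p + 1) - p"
  define y where "y = s (p + 1) + s a"
  have r1: "\<not> rho (p + 1)" using np by (simp add: Y)
  have ra: "\<not> rho a"
  proof
    assume "rho a"
    then have "p dvd chi (p + 1)" using dvd_add[of p "chi (p + 1) - p" p] by (simp add: Y a_def)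
    then have "rho (p + 1)" using Y rho_chi by blast
    then show False using r1 by simp
  qed
  have q: "chi a = 1 + q" by (simp add: q_def a_def)
  have pq: "p dvd q"
    using chi[of a] chi[of "p + 1"] dvd_refl[of p]
    by (rule dvd_comb3[where a = 1 and b = "-1" and c = 2]) (simp add: q_def a_def)
  have F1c: "F 1 (c, False) \<approx> (y, False)"
  proof -
    have "F 1 (c, False) \<approx> dmul (x (p + 1)) (x (0 - p + chi (p + 1)))"
      unfolding c_def by (rule ref_pair(1)) (simp_all add: Y)
    moreover have "0 - p + chi (p + 1) = a" by (simp add: a_def)
    ultimately show ?thesis using r1 ra by (simp add: dmul_x_rot y_def)
  qed
  have P1c: "d dvd P 1 (c, False) - (1 + q)"
  proof -
    have "d dvd P 1 (c, False) - (chi (0 - p + chi (p + 1)) - 0)"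
      unfolding c_def by (rule ref_pair(2)) (simp_all add: Y)
    moreover have "0 - p + chi (p + 1) = a" by (simp add: a_def)
    ultimately show ?thesis by (simp add: q)
  qed
  \<comment> \<open>The mixed relation with the rotation \<open>p + 1\<close> is used for the
    reflections \<open>p\<close> and \<open>p + p\<close>; subtraction removes the unknown exponents
    \<open>s 1\<close> and \<open>s a\<close>. The result is that \<open>F q\<close> fixes
    \<open>a^c\<close>.\<close>
  have cq: "n dvd s (p + q) - s q - c"
  proof -
    have tr: "n dvd (s (i - p) - s 1) - (s a + s (i - p + q))" if i: "p dvd i" for i
    proof -
      have ri: "rho i" "rho (i - p)" using i by (simp_all add: Y)
      have e1: "chi (p + 1) + - p = a" and e2: "i - (p + 1) + chi a = i - p + q"
        by (simp_all add: a_def q_def)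
      have "dmul (x (i + - p)) (x (p + 1 - i + chi (i + - p))) \<approx>
          dmul (x (chi (p + 1) + - p)) (x (i - (p + 1) + chi (chi (p + 1) + - p)))"
        by (rule ref_rot_transfer[OF ri(1) r1])
      then have e: "dmul (x (i - p)) (x (p + 1 - i + chi (i - p))) \<approx> dmul (x a) (x (i - p + q))"
        unfolding e1 e2 by simp
      have d1: "d dvd (p + 1 - i + chi (i - p)) - 1"
        using chi_refl[OF ri(2)] by (rule dvd_comb1[where a = 1]) simp
      from e have "n dvd (s (i - p) - s (p + 1 - i + chi (i - p))) - (s a + s (i - p + q))"
        using ri ra by (simp add: dmul_x_ref dmul_x_rot)
      with s_cong[OF d1] show ?thesis by (rule dvd_comb2[where a = 1 and b = 1]) simp
    qed
    show ?thesis using tr[of p] tr[of "p + p"]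
      by (simp add: c_def) (rule dvd_comb2[where a = 1 and b = "-1"], assumption+, simp)
  qed
  have Fq: "F q (c, False) \<approx> (c, False)" "d dvd P q (c, False) - q"
  proof -
    have "F q (s p - s 0, False) \<approx> (s (p + q) - s (0 + q), False)" "d dvd P q (s p - s 0, False) - q"
      by (rule ref_shift; simp add: Y pq)+
    moreover have "(s (p + q) - s q, False) \<approx> (c, False)" using cq by simp
    ultimately show "F q (c, False) \<approx> (c, False)" "d dvd P q (c, False) - q"
      unfolding c_def by (auto intro: dih_eq_trans)
  qed
  have nat: "F 1 (int m * c, False) \<approx> (int m * y, False) \<and> d dvd P 1 (int m * c, False) - (1 + int m * q)" for m
  proof (induction m)
    case 0
    then show ?case using F_one[of 1] P_one[of 1] by simp
  next
    case (Suc m)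
    note Fqm = F_rot_mult[OF Fq, of "int m"]
    have 1: "F (1 + q) (int m * c, False) \<approx> (int m * y, False)"
      using F_add[of 1 q "(int m * c, False)"] F_cong[OF Fqm(1), of 1] Suc by (metis dih_eq_trans)
    have 2: "d dvd P (1 + q) (int m * c, False) - (1 + q + int m * q)"
      using P_add[of 1 q "(int m * c, False)"] P_cong[OF Fqm(1), of 1] Fqm(2) conjunct2[OF Suc]
      by (rule dvd_comb4[where a = 1 and b = 1 and c = 1 and e = 1]) simp
    note * = F_rot_add[OF F1c P1c 1]
    have "d dvd P 1 (c + int m * c, False) - (1 + q + int m * q)" using *(2) 2 by (rule dvd_diff_trans)
    with *(1) show ?case by (simp add: algebra_simps)
  qed
  have zero: "n dvd int m * y \<and> d dvd int m * q" if "n dvd int m * c" for m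
  proof -
    have "(int m * c, False) \<approx> (0, False)" using that by simp
    from F_cong[OF this, of 1] P_cong[OF this, of 1] nat[of m] F_one[of 1] P_one[of 1]
    have "(int m * y, False) \<approx> (0, False)" and
      *: "d dvd P 1 (int m * c, False) - P 1 (0, False)" "d dvd P 1 (int m * c, False) - (1 + int m * q)" "d dvd P 1 (0, False) - 1"
      by (metis dih_eq_sym dih_eq_trans)+
    moreover have "d dvd int m * q" using * by (rule dvd_comb3[where a = 1 and b = "-1" and c = 1]) simp
    ultimately show ?thesis by simp
  qed
  have nq: "d dvd n * q" using zero[of "nat n"] n_pos by simp
  have zero': "n dvd m * y \<and> d dvd m * q" if "n dvd m * c" for m
  proof -
    obtain k where k: "m - int (nat (m mod n)) = n * k" using nat_rep_n[of m] by auto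
    have mk: "m = int (nat (m mod n)) + n * k" using k by simp
    have "n dvd int (nat (m mod n)) * c" using that mk by (metis dvd_add_left_iff dvd_triv_left distrib_right mult.assoc)
    from zero[OF this] show ?thesis
      using nq by (subst mk, subst (2) mk) (simp add: distrib_right mult.assoc dvd_mult mult.left_commute)
  qed
  obtain z where z: "n dvd y - z * c" using dvd_scalar[OF n_pos] zero' by blast
  have Fm: "F 1 (m * c, False) \<approx> (m * z * c, False)" and Pm: "d dvd P 1 (m * c, False) - (1 + m * q)" for m
  proof -
    obtain k where k: "m - int (nat (m mod n)) = n * k" using nat_rep_n[of m] by auto
    have mk: "m = int (nat (m mod n)) + n * k" using k by simp
    define m' where "m' = int (nat (m mod n))"
    have mm: "m = m' + n * k" using mk by (simp add: m'_def)
    have e: "(m * c, False) \<approx> (m' * c, False)" by (simp add: mm distrib_right mult.assoc)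
    have e2: "(m' * y, False) \<approx> (m * z * c, False)"
      using dvd_mult[OF z, of m'] by (simp add: mm algebra_simps)
        (rule dvd_comb2[where a = 1 and b = "- k * z * c", OF _ dvd_refl], assumption, simp add: algebra_simps)
    show "F 1 (m * c, False) \<approx> (m * z * c, False)"
      using F_cong[OF e, of 1] nat[of "nat (m mod n)"] e2 unfolding m'_def by (meson dih_eq_trans)
    have "d dvd P 1 (m' * c, False) - (1 + m' * q)" using nat[of "nat (m mod n)"] by (simp add: m'_def)
    with P_cong[OF e, of 1] nq show "d dvd P 1 (m * c, False) - (1 + m * q)"
      by (rule dvd_comb3[where a = 1 and b = "- k" and c = 1]) (simp add: mm algebra_simps)
  qed
  \<comment> \<open>The mirror image of the relation for \<open>F 1\<close>. Its composite with the
    relation itself is trivial: the exponents give \<open>zz\<close>, the rotation amounts give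
    \<open>zl\<close>.\<close>
  have Fm1: "F (- 1) (- l * c, False) \<approx> (- l * z * c, False)"
    and Pm1: "d dvd P (- 1) (- l * c, False) + (1 + q)"
  proof -
    have Gcl: "G (c, False) \<approx> (- l * c, False)"
    proof -
      have "(- c', False) \<approx> (- l * c, False)" using c'l by (simp add: dvd_diff_commute)
      with Gc(1) show ?thesis by (rule dih_eq_trans)
    qed
    have F1z: "F 1 (c, False) \<approx> (z * c, False)" using Fm[of 1] by simp
    note Gz = G_rot_mult[OF Gcl Gc(2), of z]
    have "F (- 1) (- l * c, False) \<approx> F (- 1) (G (c, False))" by (rule F_cong, rule dih_eq_sym, rule Gcl)
    also have "\<dots> \<approx> G (F 1 (c, False))" using GS_F[of 1 "(c, False)"] dih_eq_sym by auto
    also have "\<dots> \<approx> G (z * c, False)" by (rule G_cong[OF F1z])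
    also have "\<dots> \<approx> (z * (- l * c), False)" by (rule Gz)
    finally show "F (- 1) (- l * c, False) \<approx> (- l * z * c, False)" by (simp add: algebra_simps)
    have "d dvd (S (F 1 (c, False)) - P 1 (c, False)) - (S (c, False) + P (- 1) (G (c, False)))"
      using GS_F by blast
    from this S_cong[OF F1z] Gz(2) Pm[of 1, simplified] Gc(2)
    have "d dvd P (- 1) (G (c, False)) + (1 + q)"
      by (rule dvd_comb5[where a = "-1" and b = 1 and c = 1 and e = "-1" and f = "-1"]) simp
    with P_cong[OF Gcl, of "-1"] show "d dvd P (- 1) (- l * c, False) + (1 + q)"
      by (rule dvd_comb2[where a = "-1" and b = 1]) simp
  qed
  have zz: "n dvd (z * z - 1) * c"
  proof -
    have "(- l * c, False) \<approx> F (1 + - 1) (- l * c, False)" using FP_zero dih_eq_sym by simp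
    also have "\<dots> \<approx> F 1 (F (- 1) (- l * c, False))" by (rule F_add)
    also have "\<dots> \<approx> F 1 ((- l * z) * c, False)" by (rule F_cong[OF Fm1])
    also have "\<dots> \<approx> ((- l * z) * z * c, False)" by (rule Fm)
    finally have "n dvd - l * c - (- l * z) * z * c" by simp
    with ll show ?thesis
      by (rule dvd_comb2[where a = "- (z * z - 1)" and b = l]) (simp add: algebra_simps)
  qed
  have zl: "d dvd (1 + z * l) * q"
  proof -
    have "d dvd P (1 + - 1) (- l * c, False) - (P (- 1) (- l * c, False) + P 1 (F (- 1) (- l * c, False)))"
      by (rule P_add)
    from this conjunct2[OF FP_zero[of "(- l * c, False)"]] Pm1 P_cong[OF Fm1, of 1] Pm[of "- l * z"]
    show ?thesis
      by (rule dvd_comb5[where a = 1 and b = "-1" and c = 1 and e = 1 and f = 1]) (simp add: algebra_simps)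
  qed
  show ?thesis
    using that[of z l] Fm Pm zero' zz zl ll Fc Pc cp z by (simp add: y_def a_def)
qed

end

lemma coprime_3: "\<not> 3 dvd k \<Longrightarrow> coprime k (3::int)"
proof (rule coprimeI)
  fix g assume k: "\<not> 3 dvd k" and g: "g dvd k" "g dvd 3"
  have "k = 3 * (k div 3) + 1 \<or> k = 3 * (k div 3) + 2" using k by presburger
  then obtain j where j: "k = 3 * j + 1 \<or> k = 3 * j + 2" by blast
  then show "is_unit g"
  proof
    assume "k = 3 * j + 1"
    then show ?thesis using g by (intro dvd_comb2[OF g, where a = 1 and b = "- j"]) simp
  next
    assume "k = 3 * j + 2"
    then show ?thesis using g by (intro dvd_comb2[OF g, where a = "- 1" and b = "j + 1"]) simp
  qed
qed

section \<open>Exponents of the cycle in each pattern\<close>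

context rskew
begin

lemma F_even_odd:
  assumes "inN c" "n dvd nr * nr * c - c"
  shows "even t \<Longrightarrow> F t (c, False) \<approx> (c, False)" "odd t \<Longrightarrow> F t (c, False) \<approx> (nr * c, False)"
proof -
  have F1: "F 1 (m * c, False) \<approx> (nr * (m * c), False)" for m by (rule F1_scalar, rule inN_mult[OF assms(1)])
  have "F (1 + 1) (c, False) \<approx> F 1 (F 1 (c, False))" by (rule F_add)
  also have "\<dots> \<approx> F 1 (nr * c, False)" by (rule F_cong, rule F1_scalar[OF assms(1)])
  also have "\<dots> \<approx> (nr * (nr * c), False)" by (rule F1)
  also have "\<dots> \<approx> (c, False)" using assms(2) by (simp add: mult.assoc)
  finally have F2: "F 2 (c, False) \<approx> (c, False)" by simp
  have ev: "F (u * 2) (c, False) \<approx> (c, False)" for u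
  proof -
    have "F (u * 2) (c, False) \<approx> F (int (nat (u mod d)) * 2) (c, False)"
      by (rule F_index, rule dvd_comb1[OF nat_rep_d[of u], where a = 2]) simp_all
    then show ?thesis using F_multiple[OF F2] dih_eq_trans by blast
  qed
  then show "even t \<Longrightarrow> F t (c, False) \<approx> (c, False)" by (metis evenE mult.commute)
  assume "odd t"
  then obtain u where u: "t = 1 + u * 2" by (metis oddE add.commute mult.commute)
  have "F t (c, False) \<approx> F 1 (F (u * 2) (c, False))" unfolding u by (rule F_add)
  also have "\<dots> \<approx> F 1 (c, False)" by (rule F_cong[OF ev])
  also have "\<dots> \<approx> (nr * c, False)" by (rule F1_scalar[OF assms(1)])
  finally show "F t (c, False) \<approx> (nr * c, False)" .
qed

text \<open>A rotation in \<open>X\<close> centralizes the core while a reflection inverts it; both are conjugate up to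
  powers of the rotation about \<open>1\<close>.\<close>

lemma comm_sign:
  assumes "inN c" "n dvd nr * nr * c - c" "rho 0" "\<not> rho j"
  shows "n dvd nr * c + c" "even (j + chi j) \<Longrightarrow> n dvd 2 * c"
proof -
  obtain u where u: "F (- j) (c, False) \<approx> (u, False)" using F_scalar[OF assms(1)] by blast
  obtain v where v: "F (- chi j) (c, False) \<approx> (v, False)" using F_scalar[OF assms(1)] by blast
  have xj: "x j = (s j, False)" and x0: "x 0 = (s 0, True)" using assms by (auto intro: x_rot x_ref)
  have e: "dmul (c, False) (x j) \<approx> dmul (x j) (c, False)" by (subst (1 2) xj) simp
  have "F (- j) (dmul (c, False) (x j)) \<approx> dmul (F (- j) (c, False)) (F (P (- j) (c, False)) (x j))"
    by (rule F_mult)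
  also have "\<dots> \<approx> dmul (u, False) (x 0)"
    using F_index[OF P_scalar[OF assms(1), of "- j"] dih_eq_refl, of "x j"] F_x[of "- j" j]
    by (intro dih_eq_dmul u) (simp, metis dih_eq_trans)
  finally have 1: "F (- j) (dmul (c, False) (x j)) \<approx> (u + s 0, True)" by (subst (asm) x0) simp
  have p: "d dvd P (- j) (x j) - (- chi j)"
    using P_x[of "- j" j] chi_refl[OF assms(3)] by (simp, rule dvd_comb2[where a = 1 and b = 1]) simp_all
  have "F (- j) (dmul (x j) (c, False)) \<approx> dmul (F (- j) (x j)) (F (P (- j) (x j)) (c, False))"
    by (rule F_mult)
  also have "\<dots> \<approx> dmul (x 0) (v, False)"
    using dih_eq_trans[OF F_index[OF p dih_eq_refl] v] F_x[of "- j" j] by (intro dih_eq_dmul) simp_all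
  finally have 2: "F (- j) (dmul (x j) (c, False)) \<approx> (s 0 - v, True)" by (subst (asm) x0) simp
  have "(u + s 0, True) \<approx> (s 0 - v, True)"
    using dih_eq_eucl[OF 1] F_cong[OF e, of "- j"] 2 dih_eq_trans by blast
  then have uv: "n dvd u + v" by simp
  note eo = F_even_odd[OF assms(1,2)]
  have u': "n dvd u - (if even j then c else nr * c)"
    using dih_eq_eucl[OF u] eo[of "- j"] by (auto simp: dih_eq_def)
  have v': "n dvd v - (if even (chi j) then c else nr * c)"
    using dih_eq_eucl[OF v] eo[of "- chi j"] by (auto simp: dih_eq_def)
  have two: "n dvd 2 * c" if "even (j + chi j)"
  proof (cases "even j")
    case True
    then have "n dvd u - c" "n dvd v - c" using that u' v' by auto
    then show ?thesis using uv by (rule dvd_comb3[where a = "-1" and b = "-1" and c = 1]) simp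
  next
    case False
    then have "n dvd u - nr * c" "n dvd v - nr * c" using that u' v' by auto
    then have "n dvd 2 * (nr * c)" using uv by (rule dvd_comb3[where a = "-1" and b = "-1" and c = 1]) simp
    from this assms(2) show ?thesis by (rule dvd_comb2[where a = nr and b = "-2"]) (simp add: algebra_simps)
  qed
  then show "even (j + chi j) \<Longrightarrow> n dvd 2 * c" .
  show "n dvd nr * c + c"
  proof (cases "even (j + chi j)")
    case True
    note two = two[OF True]
    show ?thesis
    proof (cases "even nr")
      case True
      then obtain k where k: "nr = 2 * k" by blast
      show ?thesis using two assms(2)
        by (rule dvd_comb2[where a = "k + nr * k" and b = "- 1"]) (simp add: k algebra_simps)
    next
      case False
      then obtain k where k: "nr = 2 * k + 1" by (metis oddE)
      show ?thesis using two by (rule dvd_comb1[where a = "k + 1"]) (simp add: k algebra_simps)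
    qed
  next
    case False
    then show ?thesis
    proof (cases "even j")
      case True
      then have "n dvd u - c" "n dvd v - nr * c" using False u' v' by auto
      then show ?thesis using uv by (rule dvd_comb3[where a = "-1" and b = "-1" and c = 1]) simp
    next
      case odd: False
      then have "n dvd u - nr * c" "n dvd v - c" using False u' v' by auto
      then show ?thesis using uv by (rule dvd_comb3[where a = "-1" and b = "-1" and c = 1]) simp
    qed
  qed
qed

text \<open>At a core element the rotation amount is \<open>t\<close>. Compared with the general
  amount at a product of two reflections, this shows that inversion commutes with the shift by
  \<open>p\<close>. The second factor of the image is then the inverse of \<open>x t\<close>, so
  \<open>x (p + t)\<close> and \<open>x t\<close> have the same type.\<close>

lemma core_shift:
  assumes "rho 0" "rho p" "inN (s p - s 0)"
  shows "d dvd chi (p + t) - (p + chi t)" "F t (s p - s 0, False) \<approx> (s (p + t) - s t, False)"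
proof -
  have "d dvd P t (s p - s 0, False) - (chi (0 - p + chi (p + t)) - 0)" by (rule ref_pair(2)[OF assms(2,1)])
  moreover have "d dvd P t (s p - s 0, False) - t" by (rule P_scalar[OF assms(3)])
  ultimately have "d dvd chi (0 - p + chi (p + t)) - t" by (rule dvd_comb2[where a = "-1" and b = 1]) simp
  from chi_swap[OF this] have c: "d dvd (0 - p + chi (p + t)) - chi t" by (simp add: dvd_diff_commute)
  then show "d dvd chi (p + t) - (p + chi t)" by (simp add: algebra_simps)
  have "F t (s p - s 0, False) \<approx> dmul (x (p + t)) (x (0 - p + chi (p + t)))" by (rule ref_pair(1)[OF assms(2,1)])
  also have "\<dots> \<approx> dmul (x (p + t)) (x (chi t))" by (intro dih_eq_dmul dih_eq_refl x_cong c)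
  finally have e: "F t (s p - s 0, False) \<approx> dmul (x (p + t)) (x (chi t))" .
  moreover have "\<not> snd (F t (s p - s 0, False))" using F_scalar[OF assms(3), of t] by (simp add: dih_eq_def)
  ultimately have r: "rho (p + t) = rho t" by (auto simp: dih_eq_def dmul_def)
  have "dmul (x (p + t)) (x (chi t)) \<approx> (s (p + t) - s t, False)"
  proof (cases "rho t")
    case True
    then show ?thesis using r s_cong[OF chi_refl[OF True]] by (simp add: dmul_x_ref dvd_diff_commute)
  next
    case False
    then show ?thesis using r s_chi[OF False] by (simp add: dmul_x_rot algebra_simps)
  qed
  with e show "F t (s p - s 0, False) \<approx> (s (p + t) - s t, False)" by (rule dih_eq_trans)
qed

lemma core_shift_sign:
  assumes "rho 0" "rho p" "inN (s p - s 0)"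
    and sq: "n dvd nr * nr * (s p - s 0) - (s p - s 0)" and sign: "n dvd nr * (s p - s 0) + (s p - s 0)"
  shows "even t \<Longrightarrow> n dvd s (p + t) - s t - (s p - s 0)" "odd t \<Longrightarrow> n dvd s (p + t) - s t + (s p - s 0)"
proof -
  note F = core_shift(2)[OF assms(1-3), of t]
  show "even t \<Longrightarrow> n dvd s (p + t) - s t - (s p - s 0)"
    using dih_eq_eucl[OF F] F_even_odd(1)[OF assms(3) sq, of t] by (auto simp: dih_eq_def)
  assume "odd t"
  then have "n dvd s (p + t) - s t - nr * (s p - s 0)"
    using dih_eq_eucl[OF F] F_even_odd(2)[OF assms(3) sq, of t] by (auto simp: dih_eq_def)
  with sign show "n dvd s (p + t) - s t + (s p - s 0)" by (rule dvd_comb2[where a = 1 and b = 1]) simp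
qed

text \<open>\<open>reflected_scalar\<close> gives the square relation for the mirror image
  \<open>s (- p) - s 0\<close>. \<open>F p\<close> takes its negative to \<open>s p - s 0\<close>,
  while acting on the core as a power of \<open>nr\<close>.\<close>

lemma two_in_square:
  assumes "rho 0" "rho p" "rho (- p)" "inN (s p - s 0)" "inN (s (- p) - s 0)"
  shows "n dvd nr * nr * (s p - s 0) - (s p - s 0)"
proof -
  let ?c' = "s (- p) - s 0"
  have 1: "n dvd nr * nr * ?c' - ?c'"
    by (rule reflected_scalar[OF assms(4) G_ref_pair assms(5)]) (use assms in auto)
  have "F p (s 0 - s (- p), False) \<approx> (s (0 + p) - s (- p + p), False)"
    by (rule ref_shift) (use assms in auto)
  then have "F p (- ?c', False) \<approx> (s p - s 0, False)" by simp
  moreover have "F p (- ?c', False) \<approx> (nr ^ nat (p mod d) * (- ?c'), False)"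
    by (rule F_scalar, rule inN_minus[OF assms(5)])
  ultimately have "(s p - s 0, False) \<approx> (nr ^ nat (p mod d) * (- ?c'), False)" by (rule dih_eq_eucl)
  then have "n dvd (s p - s 0) - nr ^ nat (p mod d) * (- ?c')" by simp
  from this 1 show ?thesis
    by (rule dvd_comb2[where a = "nr * nr - 1" and b = "- (nr ^ nat (p mod d))"]) (simp add: algebra_simps)
qed


text \<open>A priori the valency may be a larger multiple of 4, measured by the core element
  \<open>c = s 4 - s 0\<close>. The word \<open>x 0 x 1 x 2\<close> gives a second core element
  \<open>w\<close>. The mirror inverts \<open>c\<close> and turns out to fix \<open>w\<close>,
  \<open>3 * c\<close> vanishes, and \<open>c\<close> is a multiple of \<open>w\<close>; so
  \<open>c\<close> vanishes and \<open>d = 4\<close>.\<close>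

lemma two_in_4_case:
  assumes pat: "two_in_4 x chi 0"
  shows "d = 4 \<and> 3 dvd n \<and> coprime (s 2) n \<and> n dvd s 1 - (s 0 - 2 * s 2) \<and> n dvd s 3 + s 2"
proof -
  have Y: "rho i \<longleftrightarrow> 4 dvd i \<or> 4 dvd i - 1" for i using pat by (simp add: two_in_4_def)
  have chi4: "4 dvd chi i + i - 5" if "\<not> rho i" for i using pat that by (auto simp: two_in_4_def)
  have r: "rho 0" "rho 1" "rho 4" "rho 5" "rho (- 4)" "rho (- 3)" "\<not> rho 2" "\<not> rho 3" "\<not> rho 6" "\<not> rho (- 1)"
    by (simp_all add: Y)
  have d4: "4 dvd d"
    using rho_cong[of d 0] rho_cong[of "1 + d" 1] r unfolding Y by simp presburger
  define c where "c = s 4 - s 0"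
  have N: "inN c" unfolding c_def by (rule ref_pairs_N) (simp_all add: Y)
  have N': "inN (s (- 4) - s 0)" by (rule ref_pairs_N) (simp_all add: Y)
  have sq: "n dvd nr * nr * c - c"
    unfolding c_def by (rule two_in_square) (use r N N' in \<open>auto simp: c_def\<close>)
  have sign: "n dvd nr * c + c" by (rule comm_sign(1)[OF N sq r(1) r(7)])
  have step: "n dvd s (4 + t) - s t - (if even t then c else - c)" for t
    using core_shift_sign[OF r(1,3), folded c_def, OF N sq sign, of t] by auto
  have sh: "n dvd s (t + 4 * k) - s t - (if even t then k * c else - (k * c))" for t k
  proof (induction k rule: int_induct[where k = 0])
    case base
    then show ?case by simp
  next
    case (step1 i)
    have "even (t + 4 * i) = even t" by simp
    then show ?case using step[of "t + 4 * i"] step1(2)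
      by (cases "even t") (simp_all, (rule dvd_comb2[where a = 1 and b = 1], assumption, assumption, simp add: algebra_simps)+)
  next
    case (step2 i)
    have "even (t + 4 * (i - 1)) = even t" by simp
    then show ?case using step[of "t + 4 * (i - 1)"] step2(2)
      by (cases "even t") (simp_all, (rule dvd_comb2[where a = "-1" and b = 1], assumption, assumption, simp add: algebra_simps)+)
  qed
  have chish: "d dvd chi (t + 4 * k) - (chi t + 4 * k)" for t k
  proof (induction k rule: int_induct[where k = 0])
    case base
    then show ?case by simp
  next
    case (step1 i)
    from core_shift(1)[OF r(1,3), folded c_def, OF N, of "t + 4 * i"] step1(2)
    show ?case by (rule dvd_comb2[where a = 1 and b = 1]) (simp add: algebra_simps)
  next
    case (step2 i)
    from core_shift(1)[OF r(1,3), folded c_def, OF N, of "t + 4 * (i - 1)"] step2(2)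
    show ?case by (rule dvd_comb2[where a = "-1" and b = 1]) (simp add: algebra_simps)
  qed
  obtain al where al: "chi 2 = 3 + 4 * al" 
  proof -
    obtain k where "chi 2 + 2 - 5 = 4 * k" using chi4[OF r(7)] by (rule dvdE)
    then show ?thesis using that[of k] by simp
  qed
  \<comment> \<open>\<open>F 1\<close> rotates by \<open>chi 2 - 1\<close> before the last letter of
    \<open>x 0 x 1 x 2\<close>, which therefore goes to the reflection with index
    \<open>2 + (chi 2 - 1) = 4 * u\<close>.\<close>
  define u where "u = 1 + al"
  have chi3: "d dvd chi (3 + 4 * al) - 2" using chi_chi[of 2] al by simp
  have chim1: "d dvd chi (- 1) - (2 - 4 * u)"
    using chish[of "3 + 4 * al" "- u"] chi3
    by (simp add: u_def) (rule dvd_comb2[where a = 1 and b = 1], assumption, assumption, simp)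
  have s3: "n dvd s (3 + 4 * al) + s 2" using s_chi[OF r(7)] al by (simp add: add.commute)
  define w where "w = s 0 - s 1 + s 2"
  define v where "v = (s 0 - s 1, False)"
  have x2: "x 2 = (s 2, False)" using r(7) by (rule x_rot)
  have vw: "dmul v (x 2) = (w, False)" by (subst x2) (simp add: v_def w_def)
  have r4u: "rho (4 * u)" by (simp add: Y)
  have F1v: "F 1 v \<approx> dmul (x 1) (x 2)" and P1v: "d dvd P 1 v - (chi 2 - 1)"
    using ref_pair_ref[of 0 1 1] r by (simp_all add: v_def)
  have i1: "d dvd (2 + P 1 v) - 4 * u"
    using P1v by (rule dvd_comb1[where a = 1]) (simp add: al u_def)
  have F1w: "F 1 (w, False) \<approx> (s 1 - s 2 - s (4 * u), False)"
  proof -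
    have "F 1 (dmul v (x 2)) \<approx> dmul (F 1 v) (x (2 + P 1 v))" by (rule F_step)
    also have "\<dots> \<approx> dmul (dmul (x 1) (x 2)) (x (4 * u))" by (intro dih_eq_dmul F1v x_cong i1)
    also have "\<dots> = (s 1 - s 2 - s (4 * u), False)" using r r4u by (simp add: dmul_def)
    finally show ?thesis by (simp add: vw)
  qed
  have Nw: "inN w"
  proof -
    have "d dvd P 1 (w, False) - 1"
      using P_step[of 1 v 2, unfolded vw] chi_cong[OF i1] chi_refl[OF r4u]
      by (rule dvd_comb3[where a = 1 and b = 1 and c = 1]) (simp add: al u_def)
    then show ?thesis using F1w by (simp add: inN_def dih_eq_def)
  qed
  have su: "n dvd s (4 * u) - s 0 - u * c" using sh[of 0 u] by simp
  have nw: "n dvd nr * w + w + u * c"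
  proof -
    have "n dvd (s 1 - s 2 - s (4 * u)) - nr * w"
      using dih_eq_eucl[OF F1w F1_scalar[OF Nw]] by simp
    from this su show ?thesis by (rule dvd_comb2[where a = "-1" and b = "-1"]) (simp add: w_def)
  qed
  have nw2: "n dvd nr * nr * w - w - 2 * u * c"
    using nw sign by (rule dvd_comb2[where a = "nr - 1" and b = "- u"]) (simp add: algebra_simps)
  \<comment> \<open>\<open>F 4\<close> is evaluated on \<open>w\<close> twice: letter by letter it
    adds \<open>3 * c\<close>, as the fourth power of the scalar it adds
    \<open>4 * u * c\<close>.\<close>
  have A: "n dvd 4 * u * c - 3 * c"
  proof -
    have F4v: "F 4 v \<approx> (s 4 - s 5, False)" and P4v: "d dvd P 4 v - 4"
      using ref_shift[of 0 1 4] r by (simp_all add: v_def)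
    have x6: "x 6 = (s 6, False)" using r(9) by (rule x_rot)
    have "F 4 (dmul v (x 2)) \<approx> dmul (F 4 v) (x (2 + P 4 v))" by (rule F_step)
    also have "\<dots> \<approx> dmul (s 4 - s 5, False) (x 6)" using P4v by (intro dih_eq_dmul F4v x_cong) simp
    also have "\<dots> = (s 4 - s 5 + s 6, False)" by (subst x6) simp
    finally have "F 4 (w, False) \<approx> (s 4 - s 5 + s 6, False)" by (simp add: vw)
    moreover have "F 4 (w, False) \<approx> (nr ^ 4 * w, False)" using FP_scalar_nat[OF Nw, of 4] by simp
    ultimately have "(s 4 - s 5 + s 6, False) \<approx> (nr ^ 4 * w, False)" by (rule dih_eq_eucl)
    then have "n dvd (s 4 - s 5 + s 6) - nr ^ 4 * w" by simp
    moreover have "n dvd s 4 - s 0 - c" "n dvd s 5 - s 1 + c" "n dvd s 6 - s 2 - c"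
      using step[of 0] step[of 1] step[of 2] by simp_all
    ultimately have "n dvd w + 3 * c - nr ^ 4 * w"
      by (rule dvd_comb4[where a = 1 and b = "-1" and c = 1 and e = "-1"]) (simp add: w_def)
    moreover have "n dvd nr ^ 4 * w - w - 4 * u * c"
      using nw2 sq by (rule dvd_comb2[where a = "nr * nr + 1" and b = "2 * u"])
        (simp add: algebra_simps power4_eq_xxxx)
    ultimately show ?thesis by (rule dvd_comb2[where a = "-1" and b = "-1"]) simp
  qed
  have Gw: "G (w, False) \<approx> (w - 2 * u * c, False)" and Sw: "d dvd S (w, False)"
  proof -
    have v': "dmul (x 0) (x 1) = v" using r by (simp add: v_def dmul_x_ref)
    have j1: "d dvd (chi (- 0) + chi 0 - 1) - (- 1)"
      using chi_refl[OF r(1)] by (rule dvd_comb1[where a = 2]) simp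
    have Gv: "G v \<approx> dmul (x 0) (x (- 1))"
      using dih_eq_trans[OF G_x2[of 0 1] dih_eq_dmul[OF dih_eq_refl x_cong[OF j1]]] by (simp add: v')
    have Sv: "d dvd S v - (3 - 4 * u)"
      using S_x2[of 0 1, unfolded v'] chi_cong[OF j1] chim1 chi_refl[OF r(2)]
      by (rule dvd_comb4[where a = 1 and b = 1 and c = 1 and e = 1]) simp
    have j2: "d dvd (S v - 2) - (1 - 4 * u)" using Sv by (simp add: algebra_simps)
    have r1u: "rho (1 - 4 * u)" by (simp add: Y)
    have "G (dmul v (x 2)) \<approx> dmul (G v) (x (S v - 2))" by (rule G_step)
    also have "\<dots> \<approx> dmul (dmul (x 0) (x (- 1))) (x (1 - 4 * u))" by (intro dih_eq_dmul Gv x_cong j2)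
    also have "\<dots> = (s 0 - s (- 1) - s (1 - 4 * u), False)" using r r1u by (simp add: dmul_def)
    also have "\<dots> \<approx> (w - 2 * u * c, False)"
    proof -
      have e: "3 + 4 * al + 4 * (- u) = - 1" by (simp add: u_def)
      have "n dvd s (- 1) - s (3 + 4 * al) - u * c"
        using sh[of "3 + 4 * al" "- u"] unfolding e by simp
      moreover have "n dvd s (1 - 4 * u) - s 1 - u * c" using sh[of 1 "- u"] by simp
      ultimately have "n dvd (s 0 - s (- 1) - s (1 - 4 * u)) - (w - 2 * u * c)"
        using s3 by (rule dvd_comb3[where a = "-1" and b = "-1" and c = "-1"]) (simp add: w_def)
      then show ?thesis by simp
    qed
    finally show "G (w, False) \<approx> (w - 2 * u * c, False)" by (simp add: vw)
    show "d dvd S (w, False)"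
      using S_step[of v 2, unfolded vw] chi_cong[OF j2] chi_refl[OF r1u]
      by (rule dvd_comb3[where a = 1 and b = 1 and c = 1]) (simp add: al u_def)
  qed
  \<comment> \<open>On the mirror image \<open>w - 2 * u * c\<close> of \<open>w\<close> the scalar
    squares to one, whereas on \<open>w\<close> itself the square adds
    \<open>2 * u * c\<close>.\<close>
  have B: "n dvd 2 * u * c"
  proof -
    have "inN (w - 2 * u * c)"
      using inN_add[OF Nw inN_mult[OF N, of "- 2 * u"]] by simp
    from reflected_scalar[OF Nw Gw Sw this] nw2 sq show ?thesis
      by (rule dvd_comb3[where a = "1" and b = "- 1" and c = "2 * u"]) (simp add: algebra_simps)
  qed
  have c3: "n dvd 3 * c" using A B by (rule dvd_comb2[where a = "-1" and b = 2]) simp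
  have Gw': "G (w, False) \<approx> (w, False)"
    using dih_eq_trans[OF Gw, of "(w, False)"] B by simp
  have Gc: "G (c, False) \<approx> (- c, False)" and Sc: "d dvd S (c, False)"
  proof -
    have "G (c, False) \<approx> (s (- 4) - s 0, False)" unfolding c_def by (rule G_ref_pair) (use r in auto)
    also have "\<dots> \<approx> (- c, False)" using step[of "- 4"] by (simp add: c_def algebra_simps dvd_diff_commute)
    finally show "G (c, False) \<approx> (- c, False)" .
    show "d dvd S (c, False)" unfolding c_def by (rule G_ref_pair) (use r in auto)
  qed
  have e01: "n dvd (s 0 - s 1) - 2 * s 2"
  proof -
    have "dmul (x (1 + - 1)) (x (2 - 1 + chi (1 + - 1))) \<approx> dmul (x (chi 2 + - 1)) (x (1 - 2 + chi (chi 2 + - 1)))"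
      by (rule ref_rot_transfer[OF r(2,7)])
    then have e: "dmul (x 0) (x (1 + chi 0)) \<approx> dmul (x (2 + 4 * al)) (x (chi (2 + 4 * al) - 1))"
      by (simp add: al)
    have r2: "\<not> rho (2 + 4 * al)" by (simp add: Y) presburger
    have k1: "d dvd (1 + chi 0) - 1" using chi_refl[OF r(1)] by simp
    have k2: "d dvd (chi (2 + 4 * al) - 1) - (2 + 4 * (2 * al))"
      using chish[of 2 al] by (rule dvd_comb1[where a = 1]) (simp add: al)
    have "rho (1 + chi 0)" using rho_cong[OF k1] r(2) by simp
    then have "n dvd (s 0 - s (1 + chi 0)) - (s (2 + 4 * al) + s (chi (2 + 4 * al) - 1))"
      using e r(1) r2 by (simp add: dmul_x_ref dmul_x_rot)
    moreover have "n dvd s (2 + 4 * al) - s 2 - al * c" "n dvd s (2 + 4 * (2 * al)) - s 2 - 2 * al * c"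
      using sh[of 2 al] sh[of 2 "2 * al"] by simp_all
    moreover note s_cong[OF k1] s_cong[OF k2] c3
    ultimately have "n dvd (s 0 - s 1) - (s (2 + 4 * al) + s (2 + 4 * (2 * al)))"
      "n dvd s (2 + 4 * al) + s (2 + 4 * (2 * al)) - 2 * s 2"
      by - (rule dvd_comb3[where a = 1 and b = 1 and c = 1], assumption, assumption, assumption, simp,
          rule dvd_comb3[where a = 1 and b = 1 and c = al], assumption, assumption, assumption, simp)
    then show ?thesis by (rule dvd_comb2[where a = 1 and b = 1]) simp
  qed
  have w3: "n dvd w - 3 * s 2" using e01 by (simp add: w_def algebra_simps)
  obtain k where k: "0 < k" "k dvd n" "\<And>c. inN c \<longleftrightarrow> k dvd c" by (rule inN_generator) blast
  have k3s: "k dvd 3 * s 2"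
    using dvd_trans[OF k(2) w3] k(3)[THEN iffD1, OF Nw] by (rule dvd_comb2[where a = "-1" and b = 1]) simp
  have ks: "\<not> k dvd s 2" using rotation_notin_N[OF r(7,1)] k(3) by simp
  \<comment> \<open>Otherwise 3 could be cancelled from the core element \<open>3 * s 2\<close>, and
    the rotation \<open>x 2\<close> would lie in the core.\<close>
  have "3 dvd k"
  proof (rule ccontr)
    assume "\<not> 3 dvd k"
    then have "coprime k 3" by (rule coprime_3)
    then show False using k3s ks by (simp add: coprime_dvd_mult_right_iff)
  qed
  then have n3: "3 dvd n" and c3': "3 dvd c" using k N dvd_trans by blast+
  have cop: "is_unit m" if m: "m dvd s 2" "m dvd c" "m dvd n" for m
  proof (rule gen_dvd[OF m(3) r(1)])
    have mn: "m dvd z" if "n dvd z" for z using that m(3) dvd_trans by blast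
    have sht: "m dvd s (t + 4 * k) - s t" for t k
    proof -
      have "m dvd (if even t then k * c else - (k * c))" using m(2) by simp
      with mn[OF sh[of t k]] show ?thesis by (rule dvd_comb2[where a = 1 and b = 1]) simp
    qed
    have m3: "m dvd s (3 + 4 * al)"
      using mn[OF s3] m(1) by (rule dvd_comb2[where a = 1 and b = "-1"]) simp
    fix j
    {
      assume "\<not> rho j"
      then have "4 dvd j - 2 \<or> 4 dvd j - (3 + 4 * al)" unfolding Y by presburger
      then obtain t k where t: "t = 2 \<or> t = 3 + 4 * al" "j = t + 4 * k"
        by (metis dvdE diff_add_cancel add.commute)
      have "m dvd s t" using t(1) m(1) m3 by auto
      then show "m dvd s j" using sht[of t k] t(2) dvd_add[of m "s j - s t" "s t"] by simp
    }
    assume "rho j"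
    then have "4 dvd j - 0 \<or> 4 dvd j - 1" unfolding Y by simp
    then obtain t k where t: "t = 0 \<or> t = 1" "j = t + 4 * k"
      by (metis dvdE diff_add_cancel add.commute)
    have "m dvd s 1 - s 0" using mn[OF e01] m(1) by (rule dvd_comb2[where a = "-1" and b = "-2"]) simp
    then have "m dvd s t - s 0" using t(1) by auto
    then show "m dvd s j - s 0" using sht[of t k] t(2) dvd_diff_trans by simp
  qed
  have cop2: "coprime (s 2) n"
  proof (rule coprimeI)
    fix m assume m: "m dvd s 2" "m dvd n"
    show "is_unit m"
    proof (cases "3 dvd m")
      case True
      then have "3 dvd s 2" using m dvd_trans by blast
      then have "is_unit (3::int)" using cop[OF _ c3' n3] by blast
      then show ?thesis by simp
    next
      case False
      then have "coprime m 3" by (rule coprime_3)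
      moreover have "m dvd 3 * c" using c3 m(2) dvd_trans by blast
      ultimately have "m dvd c" by (simp add: coprime_dvd_mult_right_iff)
      then show ?thesis using cop m by blast
    qed
  qed
  \<comment> \<open>As \<open>s 2\<close> is a unit, \<open>w = 3 * s 2\<close>, and 3 divides
    \<open>c\<close>, the exponent \<open>c\<close> is a multiple of \<open>w\<close>; hence the
    mirror both fixes and inverts it. Then \<open>2 * c\<close> and \<open>3 * c\<close>
    vanish.\<close>
  have nc: "n dvd c"
  proof -
    obtain c1 where c1: "c = 3 * c1" using c3' by auto
    obtain t where t: "[s 2 * t = 1] (mod n)" using cop2 cong_solve_coprime_int by blast
    then have t': "n dvd s 2 * t - 1" by (simp add: cong_iff_dvd_diff)
    have cw: "n dvd c - t * c1 * w"
      using t' w3 by (rule dvd_comb2[where a = "- 3 * c1" and b = "- t * c1"]) (simp add: c1 algebra_simps)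
    have "G (c, False) \<approx> G (t * c1 * w, False)" using cw by (intro G_cong) simp
    also have "\<dots> \<approx> (t * c1 * w, False)" by (rule G_rot_mult(1)[OF Gw' Sw])
    also have "\<dots> \<approx> (c, False)" using cw by (simp add: dvd_diff_commute)
    finally have "(- c, False) \<approx> (c, False)" using Gc dih_eq_eucl by blast
    then have "n dvd - c - c" by simp
    with c3 show ?thesis by (rule dvd_comb2[where a = 1 and b = 1]) simp
  qed
  then have "d dvd 4 - 0" using r unfolding c_def by (intro eq_index) auto
  then have d: "d = 4" using d4 d_pos by (simp add: zdvd_antisym_nonneg)
  have "d dvd (3 + 4 * al) - 3" by (simp add: d)
  from s_cong[OF this] s3 have "n dvd s 3 + s 2" by (rule dvd_comb2[where a = "-1" and b = 1]) simp
  moreover have "n dvd s 1 - (s 0 - 2 * s 2)" using e01 by (rule dvd_comb1[where a = "-1"]) simp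
  ultimately show ?thesis using d n3 cop2 by simp
qed


lemma divisor_3_or_6:
  assumes "d dvd 6" "3 dvd d"
  shows "d = 3 \<or> d = 6"
proof -
  obtain k where k: "d = 3 * k" using assms(2) by auto
  have "d \<le> 6" using assms(1) by (simp add: zdvd_imp_le)
  then have "k = 1 \<or> k = 2" using k d_pos by linarith
  then show ?thesis using k by auto
qed

lemma even_half:
  assumes "n dvd 2 * v" "\<not> n dvd v"
  obtains m where "n = 2 * m" "n dvd v - m"
proof -
  obtain q where q: "2 * v = n * q" using assms(1) by auto
  have "odd q" using assms(2) q by (auto elim!: evenE)
  then have "even n" using q by (metis dvd_triv_left even_mult_iff)
  then obtain m where m: "n = 2 * m" by auto
  obtain k where k: "q = 2 * k + 1" using \<open>odd q\<close> by (rule oddE)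
  have "v = m * q" using q m by simp
  then have "v - m = n * k" by (simp add: m k algebra_simps)
  then show ?thesis using that[OF m] by simp
qed

lemma inN_gcd:
  assumes "inN c"
  shows "inN (gcd c n)"
proof -
  obtain u v where uv: "u * c + v * n = gcd c n" using bezout_int by blast
  have "inN (u * c + v * n)" by (rule inN_add; rule inN_mult) (use assms inN_n in auto)
  then show ?thesis by (simp add: uv)
qed

text \<open>A shift by three indices adds \<open>c\<close> or \<open>- c\<close> according to
  parity, so six indices lead back and \<open>d\<close> is 3 or 6. For 3, \<open>x 2\<close> is
  self-inverse. For 6, \<open>x 2\<close> and \<open>x 5\<close> are inverse to each other, since
  two self-inverse rotations cannot coexist, and the exponents depend on \<open>s 0\<close>,
  \<open>s 2\<close> and the half \<open>m\<close> of \<open>n\<close> only.\<close>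

lemma two_in_3_case:
  assumes pat: "two_in_3 x 0"
  shows "d = 3 \<and> n = 2 \<and> odd (s 1 - s 0) \<and> odd (s 2) \<or>
    d = 6 \<and> (\<exists>m. n = 2 * m \<and> odd m \<and> 1 < m \<and> coprime (s 2) n \<and> n dvd s 1 - (s 0 + m - 2 * s 2) \<and>
      n dvd s 3 - (s 0 - 2 * s 2) \<and> n dvd s 4 - (s 0 + m) \<and> n dvd s 5 + s 2)"
proof -
  have Y: "rho i \<longleftrightarrow> \<not> 3 dvd i - 2" for i using pat by (simp add: two_in_3_def)
  have r: "rho 0" "rho 1" "rho 3" "rho 4" "rho (- 3)" "rho (- 2)" "\<not> rho 2" "\<not> rho 5"
    by (simp_all add: Y)
  have d3: "3 dvd d" using rho_cong[of "2 + d" 2] r unfolding Y by simp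
  define c where "c = s 3 - s 0"
  have N: "inN c" unfolding c_def by (rule ref_pairs_N) (simp_all add: Y)
  have N': "inN (s (- 3) - s 0)" by (rule ref_pairs_N) (simp_all add: Y)
  have sq: "n dvd nr * nr * c - c"
    unfolding c_def by (rule two_in_square) (use r N N' in \<open>auto simp: c_def\<close>)
  have sign: "n dvd nr * c + c" by (rule comm_sign(1)[OF N sq r(1) r(7)])
  have step: "n dvd s (3 + t) - s t - (if even t then c else - c)" for t
    using core_shift_sign[OF r(1,3), folded c_def, OF N sq sign, of t] by auto
  have "n dvd s 6 - s 0" using step[of 0] step[of 3]
    by simp (rule dvd_comb2[where a = 1 and b = 1], assumption, assumption, simp)
  then have "d dvd 6 - 0" using r Y[of 6] by (intro eq_index) auto
  then have "d = 3 \<or> d = 6" using divisor_3_or_6 d3 by simp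
  then show ?thesis
  proof
    assume d: "d = 3"
    have chi2: "d dvd chi 2 - 2"
    proof -
      have "3 dvd chi 2 - 2" using Y[of "chi 2"] r(7) by simp
      then show ?thesis by (simp add: d)
    qed
    have h2: "n dvd 2 * s 2" "\<not> n dvd s 2"
    proof -
      show "n dvd 2 * s 2" using s_chi[OF r(7)] s_cong[OF chi2]
        by (rule dvd_comb2[where a = 1 and b = "-1"]) simp
      show "\<not> n dvd s 2" using rotation_notin_N[OF r(7,1)] inN_cong[of "s 2" 0] inN_0 by auto
    qed
    have "dmul (x (1 + - 1)) (x (2 - 1 + chi (1 + - 1))) \<approx> dmul (x (chi 2 + - 1)) (x (1 - 2 + chi (chi 2 + - 1)))"
      by (rule ref_rot_transfer[OF r(2,7)])
    then have e: "dmul (x 0) (x (1 + chi 0)) \<approx> dmul (x (chi 2 - 1)) (x (chi (chi 2 - 1) - 1))" by simp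
    have k1: "d dvd (1 + chi 0) - 1" using chi_refl[OF r(1)] by simp
    have k2: "d dvd (chi 2 - 1) - 1" using chi2 by simp
    have k3: "d dvd (chi (chi 2 - 1) - 1) - 0"
      using chi_cong[OF k2] chi_refl[OF r(2)] by (rule dvd_comb2[where a = 1 and b = 1]) simp
    have "n dvd (s 0 - s (1 + chi 0)) - (s (chi 2 - 1) - s (chi (chi 2 - 1) - 1))"
      using e r rho_cong[OF k1] rho_cong[OF k2] rho_cong[OF k3] by (simp add: dmul_x_ref)
    from this s_cong[OF k1] s_cong[OF k2] s_cong[OF k3] have h1: "n dvd 2 * (s 1 - s 0)"
      by (rule dvd_comb4[where a = "-1" and b = "-1" and c = "-1" and e = 1]) simp
    have h1': "\<not> n dvd s 1 - s 0"
    proof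
      assume "n dvd s 1 - s 0"
      then have "d dvd 1 - 0" using r by (intro eq_index) auto
      then show False by (simp add: d)
    qed
    obtain m where m: "n = 2 * m" "n dvd s 2 - m" using even_half[OF h2] .
    have sm: "n dvd (s 1 - s 0) - s 2" by (rule half_unique[OF h1 h1' h2])
    \<comment> \<open>Modulo \<open>n = 2 * m\<close>, both \<open>s 2\<close> and
      \<open>s 1 - s 0\<close> equal \<open>m\<close>, so modulo \<open>m\<close> nothing but the
      identity and one reflection is generated.\<close>
    have "m dvd 1"
    proof (rule gen_dvd[of m 0])
      show mn: "m dvd n" by (simp add: m)
      have m2: "m dvd s 2"
        using dvd_trans[OF mn m(2)] dvd_refl[of m] by (rule dvd_comb2[where a = 1 and b = 1]) simp
      have m1: "m dvd s 1 - s 0"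
        using dvd_trans[OF mn sm] m2 by (rule dvd_comb2[where a = 1 and b = 1]) simp
      show "rho 0" by fact
      fix j
      {
        assume "\<not> rho j"
        then have "d dvd j - 2" using Y d by simp
        from dvd_trans[OF mn s_cong[OF this]] m2 show "m dvd s j" by (rule dvd_comb2[where a = 1 and b = 1]) simp
      }
      assume "rho j"
      then have "3 dvd j - 0 \<or> 3 dvd j - 1" unfolding Y by presburger
      then have "d dvd j - 0 \<or> d dvd j - 1" using d by simp
      then show "m dvd s j - s 0"
      proof
        assume "d dvd j - 0"
        from dvd_trans[OF mn s_cong[OF this]] show ?thesis by simp
      next
        assume "d dvd j - 1"
        from dvd_trans[OF mn s_cong[OF this]] m1 show ?thesis by (rule dvd_diff_trans)
      qed
    qed
    then have "m = 1" using m n_pos by simp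
    then have n2: "n = 2" using m by simp
    moreover have "odd (s 1 - s 0)" "odd (s 2)" using h1' h2(2) n2 by simp_all
    ultimately show ?thesis using d by simp
  next
    assume d: "d = 6"
    have t2: "n dvd s 5 - s 2 - c" and t1: "n dvd s 4 - s 1 + c" using step[of 2] step[of 1] by simp_all
    have nc: "\<not> n dvd c"
    proof
      assume "n dvd c"
      then have "d dvd 3 - 0" using r unfolding c_def by (intro eq_index) auto
      then show False by (simp add: d)
    qed
    have c5: "d dvd chi 5 - (3 + chi 2)"
      using core_shift(1)[OF r(1,3), folded c_def, OF N, of 2] by simp
    have chi2: "d dvd chi 2 - 5"
    proof -
      have "3 dvd chi 2 - 2" using Y[of "chi 2"] r(7) by simp
      then have "6 dvd chi 2 - 2 \<or> 6 dvd chi 2 - 5" by presburger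
      moreover have False if "6 dvd chi 2 - 2"
      proof -
        have f2: "d dvd chi 2 - 2" using that d by simp
        from c5 this have f5: "d dvd chi 5 - 5" by (rule dvd_comb2[where a = 1 and b = 1]) simp
        have "d dvd 2 - 5" by (rule involution_unique[OF r(1) r(7) r(8) f2 f5])
        then show False by (simp add: d)
      qed
      ultimately show ?thesis using d by auto
    qed
    have s5: "n dvd s 5 + s 2" using s_chi[OF r(7)] s_cong[OF chi2]
      by (rule dvd_comb2[where a = 1 and b = "-1"]) simp
    have cs: "n dvd c + 2 * s 2" using s5 t2 by (rule dvd_comb2[where a = 1 and b = "-1"]) simp
    have "dmul (x (1 + - 1)) (x (2 - 1 + chi (1 + - 1))) \<approx> dmul (x (chi 2 + - 1)) (x (1 - 2 + chi (chi 2 + - 1)))"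
      by (rule ref_rot_transfer[OF r(2,7)])
    then have e: "dmul (x 0) (x (1 + chi 0)) \<approx> dmul (x (chi 2 - 1)) (x (chi (chi 2 - 1) - 1))" by simp
    have k1: "d dvd (1 + chi 0) - 1" using chi_refl[OF r(1)] by simp
    have k2: "d dvd (chi 2 - 1) - 4" using chi2 by simp
    have k3: "d dvd (chi (chi 2 - 1) - 1) - 3"
      using chi_cong[OF k2] chi_refl[OF r(4)] by (rule dvd_comb2[where a = 1 and b = 1]) simp
    have "n dvd (s 0 - s (1 + chi 0)) - (s (chi 2 - 1) - s (chi (chi 2 - 1) - 1))"
      using e r rho_cong[OF k1] rho_cong[OF k2] rho_cong[OF k3] by (simp add: dmul_x_ref)
    from this s_cong[OF k1] s_cong[OF k2] s_cong[OF k3]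
    have e1: "n dvd (s 0 - s 1) - (s 4 - s 3)"
      by (rule dvd_comb4[where a = 1 and b = 1 and c = 1 and e = "-1"]) simp
    \<comment> \<open>\<open>v\<close> measures the remaining freedom in \<open>s 1\<close>: twice
      \<open>v\<close> vanishes, and \<open>v\<close> itself would identify the indices 1 and
      3.\<close>
    define v where "v = s 1 - s 0 + 2 * s 2"
    have v2: "n dvd 2 * v"
      using e1 t1 cs by (rule dvd_comb3[where a = "-1" and b = "-1" and c = 2]) (simp add: v_def c_def)
    have v1: "\<not> n dvd v"
    proof
      assume "n dvd v"
      from this cs have "n dvd s 1 - s 3" by (rule dvd_comb2[where a = 1 and b = "-1"]) (simp add: v_def c_def)
      then have "d dvd 1 - 3" using r by (intro eq_index) auto
      then show False by (simp add: d)
    qed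
    obtain m where m: "n = 2 * m" "n dvd v - m" using even_half[OF v2 v1] .
    have f1: "n dvd s 1 - (s 0 + m - 2 * s 2)" using m(2) by (rule dvd_comb1[where a = 1]) (simp add: v_def)
    have f3: "n dvd s 3 - (s 0 - 2 * s 2)" using cs by (rule dvd_comb1[where a = 1]) (simp add: c_def)
    have f4: "n dvd s 4 - (s 0 + m)" using t1 f1 cs
      by (rule dvd_comb3[where a = 1 and b = 1 and c = "-1"]) simp
    have unit: "is_unit g" if g: "g dvd s 2" "g dvd m" for g
    proof (rule gen_dvd[of g 0])
      show gn: "g dvd n" using g(2) m by simp
      have gn': "g dvd z" if "n dvd z" for z using that gn dvd_trans by blast
      show "rho 0" by fact
      have g1: "g dvd s 1 - s 0" using gn'[OF f1] g by (rule dvd_comb3[where a = 1 and b = "-2" and c = 1]) simp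
      have g3: "g dvd s 3 - s 0" using gn'[OF f3] g(1) by (rule dvd_comb2[where a = 1 and b = "-2"]) simp
      have g4: "g dvd s 4 - s 0" using gn'[OF f4] g(2) by (rule dvd_comb2[where a = 1 and b = 1]) simp
      have g5: "g dvd s 5" using gn'[OF s5] g(1) by (rule dvd_comb2[where a = 1 and b = "-1"]) simp
      fix j
      {
        assume "\<not> rho j"
        then have "6 dvd j - 2 \<or> 6 dvd j - 5" unfolding Y by presburger
        then obtain i where i: "i = 2 \<or> i = 5" "d dvd j - i" unfolding d by blast
        from i(1) have "g dvd s i" using g(1) g5 by auto
        with gn'[OF s_cong[OF i(2)]] show "g dvd s j" by (rule dvd_comb2[where a = 1 and b = 1]) simp
      }
      assume "rho j"
      then have "6 dvd j - 0 \<or> 6 dvd j - 1 \<or> 6 dvd j - 3 \<or> 6 dvd j - 4" unfolding Y by presburger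
      then obtain i where i: "i = 0 \<or> i = 1 \<or> i = 3 \<or> i = 4" "d dvd j - i" unfolding d by blast
      from i(1) have "g dvd s i - s 0" using g1 g3 g4 by auto
      with gn'[OF s_cong[OF i(2)]] show "g dvd s j - s 0" by (rule dvd_diff_trans)
    qed
    \<comment> \<open>Modulo \<open>n\<close>, \<open>c\<close> is \<open>- 2 * s 2\<close>, and
      \<open>s 2\<close> has no factor in common with \<open>m\<close>. So the core contains every
      even exponent, and reduction modulo 2 then yields the parities.\<close>
    have g2: "gcd c n dvd 2"
    proof -
      have "gcd c n dvd 2 * s 2" "gcd c n dvd 2 * m"
        using dvd_trans[OF gcd_dvd2[of c n] cs] m by (simp_all add: dvd_add_right_iff)
      then have "gcd c n dvd gcd (2 * s 2) (2 * m)" by simp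
      also have "gcd (2 * s 2) (2 * m) = 2 * gcd (s 2) m" by (simp add: gcd_mult_left)
      also have "gcd (s 2) m = 1" using unit[of "gcd (s 2) m"] by (simp add: is_unit_gcd_iff)
      finally show ?thesis by simp
    qed
    have g2': "2 dvd gcd c n"
    proof -
      have "2 dvd n" using m by simp
      moreover have "2 dvd c" using dvd_trans[OF \<open>2 dvd n\<close> cs] by simp
      ultimately show ?thesis by simp
    qed
    have gcn: "gcd c n = 2" using g2 g2' by (simp add: zdvd_antisym_nonneg)
    have N2: "inN 2" using inN_gcd[OF N] gcn by simp
    have n2: "2 dvd n" using m by simp
    have odd1: "odd (s 1 - s 0)"
    proof
      assume "even (s 1 - s 0)"
      then have "dih_eq 2 (x 1) (x 0)" using r by (simp add: dih_eq_def)
      from x_quotient_shift[OF N2 n2 this, of 1] show False using r by (simp add: dih_eq_def)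
    qed
    have odd2: "odd (s 2)"
    proof
      assume "even (s 2)"
      then obtain k where "s 2 = k * 2" by (metis evenE mult.commute)
      then have "inN (s 2)" using inN_mult[OF N2, of k] by simp
      then show False using rotation_notin_N[OF r(7,1)] by simp
    qed
    have oddm: "odd m" using odd1 dvd_trans[OF n2 f1] by auto
    have cop: "coprime (s 2) n"
    proof -
      have "coprime (s 2) m" using unit by (intro coprimeI) auto
      moreover have "coprime (s 2) 2" using odd2 by (simp add: coprime_right_2_iff_odd)
      ultimately show ?thesis using m by simp
    qed
    have "m \<noteq> 1"
    proof
      assume "m = 1"
      then have "n dvd c" using m(1) g2' by auto
      then show False using nc by simp
    qed
    then have "1 < m" using m n_pos by linarith
    then show ?thesis using d m f1 f3 f4 s5 cop oddm by blast
  qed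
qed


text \<open>Three single steps make up \<open>F 3\<close>. On the exponents, with
  \<open>z * z = 1\<close>, this gives \<open>l = z\<close> on \<open>c\<close>; on the rotation
  amounts it gives \<open>(1 + z + z * z) * q = 0\<close>. Together with
  \<open>(1 + z * l) * q = 0\<close> these force \<open>q = 0\<close>, which is membership in the
  core.\<close>

lemma one_in_3_core:
  assumes pat: "one_in_p 3 x chi 0"
  shows "inN (s 3 - s 0)" "n dvd nr * nr * (s 3 - s 0) - (s 3 - s 0)"
proof -
  define c where "c = s 3 - s 0"
  define q where "q = chi (chi (3 + 1) - 3) - 1"
  obtain z l where zl: "\<And>m. F 1 (m * c, False) \<approx> (m * z * c, False)"
    "\<And>m. d dvd P 1 (m * c, False) - (1 + m * q)"
    "\<And>m. n dvd m * c \<Longrightarrow> d dvd m * q"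
    "n dvd (z * z - 1) * c" "d dvd (1 + z * l) * q" "n dvd (l * l - 1) * c"
    "F 3 (c, False) \<approx> (l * c, False)" "d dvd P 3 (c, False) - 3"
    using one_in_p_structure[OF _ pat] unfolding c_def[symmetric] q_def[symmetric]
    by (metis one_less_numeral_iff semiring_norm(77))
  have F1c: "F 1 (c, False) \<approx> (z * c, False)" using zl(1)[of 1] by simp
  have F2c: "F 2 (c, False) \<approx> (z * z * c, False)"
    using dih_eq_trans[OF F_add[of 1 1 "(c, False)"] dih_eq_trans[OF F_cong[OF F1c] zl(1)]] by simp
  have F3c: "F 3 (c, False) \<approx> (z * z * z * c, False)"
    using dih_eq_trans[OF F_add[of 1 2 "(c, False)"] dih_eq_trans[OF F_cong[OF F2c] zl(1)]] by simp
  have P2c: "d dvd P 2 (c, False) - (2 + q + z * q)"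
    using P_add[of 1 1 "(c, False)"] P_cong[OF F1c, of 1] zl(2)[of 1] zl(2)[of z]
    by simp (rule dvd_comb4[where a = 1 and b = 1 and c = 1 and e = 1], assumption+, simp add: algebra_simps)
  have P3c: "d dvd P 3 (c, False) - (3 + q + z * q + z * z * q)"
    using P_add[of 1 2 "(c, False)"] P_cong[OF F2c, of 1] P2c zl(2)[of "z * z"]
    by simp (rule dvd_comb4[where a = 1 and b = 1 and c = 1 and e = 1], assumption+, simp add: algebra_simps)
  have lz: "n dvd (l - z) * c"
  proof -
    have "n dvd l * c - z * z * z * c" using dih_eq_eucl[OF zl(7) F3c] by simp
    from this zl(4) show ?thesis by (rule dvd_comb2[where a = 1 and b = z]) (simp add: algebra_simps)
  qed
  have zq: "d dvd (z * z - 1) * q" and lq: "d dvd (l - z) * q" using zl(3)[OF zl(4)] zl(3)[OF lz] .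
  have q2: "d dvd 2 * q" using zl(5) lq zq
    by (rule dvd_comb3[where a = 1 and b = "- z" and c = "- 1"]) (simp add: algebra_simps)
  have "d dvd (1 + z + z * z) * q" using P3c zl(8)
    by (rule dvd_comb2[where a = "- 1" and b = 1]) (simp add: algebra_simps)
  from this zq q2 have zq': "d dvd z * q"
    by (rule dvd_comb3[where a = 1 and b = "- 1" and c = "- 1"]) (simp add: algebra_simps)
  have q0: "d dvd q" using zq' zq by (rule dvd_comb2[where a = z and b = "- 1"]) (simp add: algebra_simps)
  have "d dvd P 1 (c, False) - 1" using zl(2)[of 1] q0
    by simp (rule dvd_comb2[where a = 1 and b = 1], assumption+, simp)
  then have N: "inN c" using F1c by (simp add: inN_def dih_eq_def)
  then show "inN (s 3 - s 0)" by (simp add: c_def)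
  have zr: "n dvd z * c - nr * c" using dih_eq_eucl[OF F1c F1_scalar[OF N]] by simp
  have "n dvd nr * nr * c - c" using zr zl(4)
    by (rule dvd_comb2[where a = "- z - nr" and b = 1]) (simp add: algebra_simps)
  then show "n dvd nr * nr * (s 3 - s 0) - (s 3 - s 0)" by (simp add: c_def)
qed

text \<open>Again \<open>d\<close> is 3 or 6, and \<open>x 1\<close> is inverse to
  \<open>x 2\<close> or, for 6, possibly to \<open>x 5\<close>. In the latter case the parity part
  of \<open>comm_sign\<close> makes \<open>2 * c\<close> vanish; then \<open>c\<close> and
  \<open>2 * s 1\<close> are the same element of order two and the indices 4 and 5 coincide.\<close>

lemma one_in_3_case:
  assumes pat: "one_in_p 3 x chi 0"
  shows "d = 3 \<and> n = 4 \<and> coprime (s 1) n \<and> n dvd s 2 + s 1 \<or>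
    d = 6 \<and> (\<exists>m. n = 2 * m \<and> 4 dvd m - 2 \<and> 2 < m \<and> coprime (s 5) n \<and> n dvd s 4 + s 5 \<and>
      n dvd s 1 - (m + s 5) \<and> n dvd s 2 - (m - s 5) \<and> n dvd s 3 - (s 0 + m + 2 * s 5))"
proof -
  have Y: "rho i \<longleftrightarrow> 3 dvd i" for i using pat by (simp add: one_in_p_def)
  have chi3: "3 dvd chi i + i" for i using pat by (simp add: one_in_p_def)
  have r: "rho 0" "rho 3" "\<not> rho 1" "\<not> rho 2" "\<not> rho 4" "\<not> rho 5" by (simp_all add: Y)
  have d3: "3 dvd d" using rho_cong[of d 0] unfolding Y by simp
  define c where "c = s 3 - s 0"
  have N: "inN c" and sq: "n dvd nr * nr * c - c" using one_in_3_core[OF pat] by (simp_all add: c_def)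
  have sign: "n dvd nr * c + c" and even2: "even (1 + chi 1) \<Longrightarrow> n dvd 2 * c"
    using comm_sign[OF N sq r(1) r(3)] .
  have step: "n dvd s (3 + t) - s t - (if even t then c else - c)" for t
    using core_shift_sign[OF r(1,2), folded c_def, OF N sq sign, of t] by auto
  have cs: "d dvd chi (3 + t) - (3 + chi t)" for t
    using core_shift(1)[OF r(1,2), folded c_def, OF N, of t] .
  have "n dvd s 6 - s 0" using step[of 0] step[of 3]
    by simp (rule dvd_comb2[where a = 1 and b = 1], assumption, assumption, simp)
  then have "d dvd 6 - 0" using r Y[of 6] by (intro eq_index) auto
  then have d36: "d = 3 \<or> d = 6" using divisor_3_or_6 d3 by simp
  have t1: "n dvd s 4 - s 1 + c" and t2: "n dvd s 5 - s 2 - c" using step[of 1] step[of 2] by simp_all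
  have "dmul (x (0 + 2)) (x (1 - 0 + chi (0 + 2))) \<approx> dmul (x (chi 1 + 2)) (x (0 - 1 + chi (chi 1 + 2)))"
    by (rule ref_rot_transfer[OF r(1,3)])
  then have e: "dmul (x 2) (x (1 + chi 2)) \<approx> dmul (x (chi 1 + 2)) (x (chi (chi 1 + 2) - 1))" by simp
  have main: "n dvd s 2 + s 1 \<and> n dvd 4 * s 1 - 2 * c" if chi1: "d dvd chi 1 - 2"
  proof -
    have k1: "d dvd (1 + chi 2) - 2" using chi_swap[OF chi1] by simp
    have k2: "d dvd (chi 1 + 2) - 4" using chi1 by simp
    have k3: "d dvd (chi (chi 1 + 2) - 1) - 4"
      using chi_cong[OF k2] cs[of 1] chi1 by simp (rule dvd_comb3[where a = 1 and b = 1 and c = 1], assumption+, simp)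
    have "n dvd (s 2 + s (1 + chi 2)) - (s (chi 1 + 2) + s (chi (chi 1 + 2) - 1))"
      using e r rho_cong[OF k1] rho_cong[OF k2] rho_cong[OF k3] by (simp add: dmul_x_rot)
    from this s_cong[OF k1] s_cong[OF k2] s_cong[OF k3] have a: "n dvd 2 * s 2 - 2 * s 4"
      by (rule dvd_comb4[where a = 1 and b = "-1" and c = 1 and e = 1]) simp
    have b: "n dvd s 2 + s 1" using s_chi[OF r(3)] s_cong[OF chi1]
      by (rule dvd_comb2[where a = 1 and b = "-1"]) simp
    have "n dvd 4 * s 1 - 2 * c" using a b t1
      by (rule dvd_comb3[where a = "- 1" and b = 2 and c = "- 2"]) simp
    with b show ?thesis by simp
  qed
  from d36 show ?thesis
  proof
    assume d: "d = 3"
    have chi1: "d dvd chi 1 - 2" using chi3[of 1] d by presburger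
    have b: "n dvd s 2 + s 1" and q: "n dvd 4 * s 1 - 2 * c" using main[OF chi1] by auto
    have "d dvd 3 - 0" by (simp add: d)
    from s_cong[OF this] have "n dvd c" by (simp add: c_def)
    with q have n4: "n dvd 4 * s 1" by (rule dvd_comb2[where a = 1 and b = 2]) simp
    have cop: "coprime (s 1) n"
    proof (rule coprimeI)
      fix g assume g: "g dvd s 1" "g dvd n"
      have gn: "g dvd z" if "n dvd z" for z using that g dvd_trans by blast
      show "is_unit g"
      proof (rule gen_dvd[OF g(2) r(1)])
        have g2: "g dvd s 2" using gn[OF b] g(1) by (rule dvd_comb2[where a = 1 and b = "- 1"]) simp
        fix j
        {
          assume "\<not> rho j"
          then have "3 dvd j - 1 \<or> 3 dvd j - 2" unfolding Y by presburger
          then obtain i where i: "i = 1 \<or> i = 2" "d dvd j - i" unfolding d by blast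
          from i(1) have "g dvd s i" using g(1) g2 by auto
          with gn[OF s_cong[OF i(2)]] show "g dvd s j" by (rule dvd_comb2[where a = 1 and b = 1]) simp
        }
        assume "rho j"
        then have "d dvd j - 0" using Y d by simp
        from gn[OF s_cong[OF this]] show "g dvd s j - s 0" .
      qed
    qed
    then have "n dvd 4" using n4 by (simp add: coprime_dvd_mult_left_iff coprime_commute)
    moreover have "\<not> n dvd 2"
    proof
      assume "n dvd 2"
      then have "n dvd 2 * s 1" by simp
      with b have "n dvd s 1 - s 2" by (rule dvd_comb2[where a = "- 1" and b = 1]) simp
      then have "d dvd 1 - 2" using r by (intro eq_index) auto
      then show False by (simp add: d)
    qed
    moreover have "n \<le> 4" using \<open>n dvd 4\<close> by (simp add: zdvd_imp_le)
    moreover have "n \<noteq> 3" using \<open>n dvd 4\<close> by auto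
    ultimately have "n = 4" using n_pos by (cases "n = 1 \<or> n = 2") auto
    then show ?thesis using d cop b by simp
  next
    assume d: "d = 6"
    have nc: "\<not> n dvd c"
    proof
      assume "n dvd c"
      then have "d dvd 3 - 0" using r unfolding c_def by (intro eq_index) auto
      then show False by (simp add: d)
    qed
    have chi1: "d dvd chi 1 - 2"
    proof (rule ccontr)
      assume "\<not> d dvd chi 1 - 2"
      then have c15: "d dvd chi 1 - 5" using chi3[of 1] d by presburger
      then have ev: "even (1 + chi 1)" using d by presburger
      have c2: "n dvd 2 * c" using even2[OF ev] .
      have c4: "d dvd chi 4 - 2"
      proof -
        have "d dvd chi 4 - (3 + chi 1)" using cs[of 1] by simp
        moreover have "d dvd 6" by (simp add: d)
        ultimately show ?thesis using c15 by (rule dvd_comb3[where a = 1 and b = 1 and c = 1]) simp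
      qed
      have k1: "d dvd (1 + chi 2) - 5" using chi_swap[OF c4] by simp
      have k2: "d dvd (chi 1 + 2) - 1" using c15 d by presburger
      have k3: "d dvd (chi (chi 1 + 2) - 1) - 4" using chi_cong[OF k2] c15
        by (rule dvd_comb2[where a = 1 and b = 1]) simp
      have "n dvd (s 2 + s (1 + chi 2)) - (s (chi 1 + 2) + s (chi (chi 1 + 2) - 1))"
        using e r rho_cong[OF k1] rho_cong[OF k2] rho_cong[OF k3] by (simp add: dmul_x_rot)
      from this s_cong[OF k1] s_cong[OF k2] s_cong[OF k3] have a: "n dvd s 2 + s 5 - s 1 - s 4"
        by (rule dvd_comb4[where a = 1 and b = "-1" and c = 1 and e = 1]) simp
      have b: "n dvd s 1 + s 5" using s_chi[OF r(3)] s_cong[OF c15]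
        by (rule dvd_comb2[where a = 1 and b = "-1"]) simp
      have s4: "n dvd 4 * s 1" using a b t1 t2
        by (rule dvd_comb4[where a = "- 1" and b = 2 and c = "- 1" and e = "- 1"]) simp
      have s2: "\<not> n dvd 2 * s 1"
      proof
        assume "n dvd 2 * s 1"
        from this b have "n dvd s 1 - s 5" by (rule dvd_comb2[where a = 1 and b = "- 1"]) simp
        then have "d dvd 1 - 5" using r by (intro eq_index) auto
        then show False by (simp add: d)
      qed
      have "n dvd 2 * (2 * s 1)" using s4 by simp
      from half_unique[OF this s2 c2 nc] t1 b have "n dvd s 4 - s 5"
        by (rule dvd_comb3[where a = 1 and b = 1 and c = "- 1"]) simp
      then have "d dvd 4 - 5" using r by (intro eq_index) auto
      then show False by (simp add: d)
    qed
    have b: "n dvd s 2 + s 1" and q: "n dvd 4 * s 1 - 2 * c" using main[OF chi1] by auto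
    define v where "v = c - 2 * s 1"
    have v2: "n dvd 2 * v" using q by (rule dvd_comb1[where a = "- 1"]) (simp add: v_def)
    have v1: "\<not> n dvd v"
    proof
      assume "n dvd v"
      from this t1 b have "n dvd s 4 - s 2" by (rule dvd_comb3[where a = "- 1" and b = 1 and c = "- 1"]) (simp add: v_def)
      then have "d dvd 4 - 2" using r by (intro eq_index) auto
      then show False by (simp add: d)
    qed
    obtain m where m: "n = 2 * m" "n dvd v - m" using even_half[OF v2 v1] .
    have nm: "n dvd 2 * m" using m by simp
    have f5: "n dvd s 5 - (s 1 + m)" using t2 b m(2) by (rule dvd_comb3[where a = 1 and b = 1 and c = 1]) (simp add: v_def)
    have f1: "n dvd s 1 - (m + s 5)" using f5 nm by (rule dvd_comb2[where a = "- 1" and b = "- 1"]) simp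
    have f4: "n dvd s 4 + s 5" using t1 f5 m(2) by (rule dvd_comb3[where a = 1 and b = 1 and c = "- 1"]) (simp add: v_def)
    have f2: "n dvd s 2 - (m - s 5)" using b f5 by (rule dvd_comb2[where a = 1 and b = 1]) simp
    have f3: "n dvd s 3 - (s 0 + m + 2 * s 5)" using m(2) f5 nm
      by (rule dvd_comb3[where a = 1 and b = "- 2" and c = "- 1"]) (simp add: v_def c_def)
    have fc: "n dvd c - (m + 2 * s 5)" using f3 by (simp add: c_def algebra_simps)
    have unit: "is_unit g" if g: "g dvd s 5" "g dvd m" for g
    proof (rule gen_dvd[of g 0])
      show gn: "g dvd n" using g(2) m by simp
      have gn': "g dvd z" if "n dvd z" for z using that gn dvd_trans by blast
      show "rho 0" by fact
      have g1: "g dvd s 1" using gn'[OF f1] g by (rule dvd_comb3[where a = 1 and b = 1 and c = 1]) simp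
      have g2: "g dvd s 2" using gn'[OF f2] g by (rule dvd_comb3[where a = 1 and b = "- 1" and c = 1]) simp
      have g3: "g dvd s 3 - s 0" using gn'[OF f3] g by (rule dvd_comb3[where a = 1 and b = 2 and c = 1]) simp
      have g4: "g dvd s 4" using gn'[OF f4] g(1) by (rule dvd_comb2[where a = 1 and b = "-1"]) simp
      fix j
      {
        assume "\<not> rho j"
        then have "6 dvd j - 1 \<or> 6 dvd j - 2 \<or> 6 dvd j - 4 \<or> 6 dvd j - 5" unfolding Y by presburger
        then obtain i where i: "i = 1 \<or> i = 2 \<or> i = 4 \<or> i = 5" "d dvd j - i" unfolding d by blast
        from i(1) have "g dvd s i" using g(1) g1 g2 g4 by auto
        with gn'[OF s_cong[OF i(2)]] show "g dvd s j" by (rule dvd_comb2[where a = 1 and b = 1]) simp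
      }
      assume "rho j"
      then have "6 dvd j - 0 \<or> 6 dvd j - 3" unfolding Y by presburger
      then obtain i where i: "i = 0 \<or> i = 3" "d dvd j - i" unfolding d by blast
      from i(1) have "g dvd s i - s 0" using g3 by auto
      with gn'[OF s_cong[OF i(2)]] show "g dvd s j - s 0" by (rule dvd_diff_trans)
    qed
    define k where "k = gcd c n"
    have kn: "k dvd n" "inN k" using inN_gcd[OF N] by (simp_all add: k_def)
    have kc: "k dvd c" by (simp add: k_def)
    have kf: "k dvd m + 2 * s 5"
      using dvd_trans[OF kn(1) fc] kc by (rule dvd_comb2[where a = "- 1" and b = 1]) simp
    \<comment> \<open>Otherwise \<open>x 1\<close> and \<open>x 2\<close> would agree modulo the
      core element \<open>k\<close>, and one step later so would a rotation and the reflection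
      \<open>x 3\<close>.\<close>
    have k2: "\<not> k dvd 2 * s 5"
    proof
      assume a: "k dvd 2 * s 5"
      have "k dvd s 1 - s 2"
        using dvd_trans[OF kn(1) f1] dvd_trans[OF kn(1) f2] a by (rule dvd_comb3[where a = 1 and b = "- 1" and c = 1]) simp
      then have "dih_eq k (x 1) (x 2)" using r by (simp add: dih_eq_def)
      from x_quotient_shift[OF kn(2,1) this, of 1] show False using r by (simp add: dih_eq_def)
    qed
    have k4: "k dvd 4 * s 5" using kf kn(1) by (rule dvd_comb2[where a = 2 and b = "- 1"]) (simp add: m)
    \<comment> \<open>\<open>k\<close> divides \<open>4 * s 5\<close> but not
      \<open>2 * s 5\<close>, which is impossible unless it is a multiple of 4.\<close>
    have k_4: "4 dvd k"
    proof (rule ccontr)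
      assume "\<not> 4 dvd k"
      then have "odd k \<or> k = 2 * (k div 2) \<and> odd (k div 2)" by presburger
      then consider "odd k" | j where "k = 2 * j" "odd j" by blast
      then show False
      proof cases
        case 1
        then have "coprime k 2" by simp
        moreover have "k dvd 2 * (2 * s 5)" using k4 by simp
        ultimately show False using k2 coprime_dvd_mult_right_iff by blast
      next
        case (2 j)
        have "2 * j dvd 2 * (2 * s 5)" using k4 2(1) by simp
        then have "j dvd 2 * s 5" by (simp only: dvd_mult_cancel_left) simp
        then have "j dvd s 5" using 2(2) by (simp add: coprime_dvd_mult_right_iff coprime_right_2_iff_odd)
        then show False using k2 2(1) by simp
      qed
    qed
    have m4: "4 dvd m + 2 * s 5" using dvd_trans[OF k_4 kf] .
    have "odd (s 5)"
    proof
      assume a: "even (s 5)"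
      then have "even m" using m4 by presburger
      then show False using unit[of 2] a by simp
    qed
    then have m42: "4 dvd m - 2" using m4 by presburger
    have cop: "coprime (s 5) n"
    proof -
      have "coprime (s 5) m" using unit by (intro coprimeI) auto
      moreover have "coprime (s 5) 2" using \<open>odd (s 5)\<close> by (simp add: coprime_right_2_iff_odd)
      ultimately show ?thesis using m by simp
    qed
    have "m \<noteq> 2"
    proof
      assume "m = 2"
      then have "n dvd m + 2 * s 5" using m4 m by simp
      with fc have "n dvd c" by (rule dvd_comb2[where a = 1 and b = 1]) simp
      then show False using nc by simp
    qed
    moreover have "0 < m" using m(1) n_pos by simp
    ultimately have "2 < m" using m42 by presburger
    then show ?thesis using d m f1 f2 f3 f4 cop m42 by blast
  qed
qed


text \<open>As \<open>z\<close> squares to one on \<open>c\<close>, \<open>F 2\<close> fixes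
  \<open>a^c\<close>. So the exponents of the reflections form an arithmetic progression with
  difference \<open>c\<close>, whose order is therefore governed by \<open>d\<close>.\<close>

lemma one_in_2_linear:
  assumes pat: "one_in_p 2 x chi 0"
  defines "c \<equiv> s 2 - s 0"
  defines "q \<equiv> chi (chi 3 - 2) - 1"
  obtains z where "\<And>j. n dvd s (2 * j) - (s 0 + j * c)" "\<And>j. n dvd j * c \<longleftrightarrow> d dvd 2 * j"
    "n dvd (z * z - 1) * c" "d dvd (1 + z) * q" "n dvd s 3 + s (chi 3 - 2) - z * c"
proof -
  have Y: "rho i \<longleftrightarrow> even i" for i using pat by (simp add: one_in_p_def)
  obtain z l where zl: "\<And>m. F 1 (m * c, False) \<approx> (m * z * c, False)"
    "\<And>m. d dvd P 1 (m * c, False) - (1 + m * q)"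
    "n dvd (z * z - 1) * c"
    "F 2 (c, False) \<approx> (l * c, False)" "d dvd P 2 (c, False) - 2"
    "n dvd s 3 + s (chi 3 - 2) - z * c"
  proof (rule one_in_p_structure[OF _ pat])
    fix z l
    assume a: "\<And>m. F 1 (m * (s 2 - s 0), False) \<approx> (m * z * (s 2 - s 0), False)"
      "\<And>m. d dvd P 1 (m * (s 2 - s 0), False) - (1 + m * (chi (chi (2 + 1) - 2) - 1))"
      "n dvd (z * z - 1) * (s 2 - s 0)"
      "F 2 (s 2 - s 0, False) \<approx> (l * (s 2 - s 0), False)" "d dvd P 2 (s 2 - s 0, False) - 2"
      "n dvd s (2 + 1) + s (chi (2 + 1) - 2) - z * (s 2 - s 0)"
    show thesis
      by (rule that[of z l]) (use a in \<open>simp_all add: c_def q_def\<close>)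
  qed simp
  have F1c: "F 1 (c, False) \<approx> (z * c, False)" using zl(1)[of 1] by simp
  have F2c: "F 2 (c, False) \<approx> (z * z * c, False)"
    using dih_eq_trans[OF F_add[of 1 1 "(c, False)"] dih_eq_trans[OF F_cong[OF F1c] zl(1)]] by simp
  have "(z * z * c, False) \<approx> (c, False)" using zl(3) by (simp add: algebra_simps)
  with F2c have F2: "F 2 (c, False) \<approx> (c, False)" by (rule dih_eq_trans)
  have P2c: "d dvd P 2 (c, False) - (2 + q + z * q)"
    using P_add[of 1 1 "(c, False)"] P_cong[OF F1c, of 1] zl(2)[of 1] zl(2)[of z]
    by simp (rule dvd_comb4[where a = 1 and b = 1 and c = 1 and e = 1], assumption+, simp add: algebra_simps)
  have zq: "d dvd (1 + z) * q" using P2c zl(5)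
    by (rule dvd_comb2[where a = "- 1" and b = 1]) (simp add: algebra_simps)
  have step: "n dvd s (2 + 2 * j) - s (2 * j) - c" for j
  proof -
    have "F (2 * j) (s 2 - s 0, False) \<approx> (s (2 + 2 * j) - s (0 + 2 * j), False)"
      by (rule ref_shift) (simp_all add: Y)
    moreover have "F (2 * j) (c, False) \<approx> (c, False)"
    proof -
      have "F (2 * j) (c, False) \<approx> F (int (nat (j mod d)) * 2) (c, False)"
        by (rule F_index, rule dvd_comb1[OF nat_rep_d[of j], where a = 2]) simp_all
      then show ?thesis using F_multiple[OF F2] dih_eq_trans by blast
    qed
    ultimately have "(s (2 + 2 * j) - s (0 + 2 * j), False) \<approx> (c, False)"
      unfolding c_def by (rule dih_eq_eucl)
    then show ?thesis by simp
  qed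
  have lin: "n dvd s (2 * j) - (s 0 + j * c)" for j
  proof (induction j rule: int_induct[where k = 0])
    case base
    then show ?case by simp
  next
    case (step1 i)
    from step[of i] step1(2) show ?case
      by (rule dvd_comb2[where a = 1 and b = 1]) (simp add: algebra_simps)
  next
    case (step2 i)
    from step[of "i - 1"] step2(2) show ?case
      by (rule dvd_comb2[where a = "- 1" and b = 1]) (simp add: algebra_simps)
  qed
  have ord: "n dvd j * c \<longleftrightarrow> d dvd 2 * j" for j
  proof
    assume "n dvd j * c"
    with lin[of j] have "n dvd s (2 * j) - s 0" by (rule dvd_comb2[where a = 1 and b = 1]) simp
    then have "d dvd 2 * j - 0" by (intro eq_index) (simp_all add: Y)
    then show "d dvd 2 * j" by simp
  next
    assume "d dvd 2 * j"
    then have "n dvd s (2 * j) - s 0" by (intro s_cong) simp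
    with lin[of j] show "n dvd j * c" by (rule dvd_comb2[where a = "- 1" and b = 1]) simp
  qed
  show ?thesis using that[OF lin ord zl(3) zq zl(6)] .
qed

text \<open>Commuting two rotations and moving the first of them to index 0 shows that
  \<open>chi j + j\<close> is constant on odd \<open>j\<close>. To move the center to 0 without
  changing the parity of reflections, the constant must be twice an even number modulo
  \<open>d\<close>. If it is not divisible by 4, either \<open>d\<close> may be added to it, or
  \<open>4 dvd d\<close> and there would be two self-inverse rotations at distance
  \<open>d / 2\<close>.\<close>

lemma one_in_2_center:
  assumes pat: "one_in_p 2 x chi 0"
  obtains a where "even a" "\<And>j. odd j \<Longrightarrow> d dvd chi j + j - 2 * a"
proof -
  have Y: "rho i \<longleftrightarrow> even i" for i using pat by (simp add: one_in_p_def)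
  have chi2: "even (chi i + i)" for i using pat by (simp add: one_in_p_def)
  have d2: "even d" using rho_cong[of d 0] Y[of d] Y[of 0] by simp
  define c where "c = s 2 - s 0"
  obtain z where lin: "\<And>j. n dvd s (2 * j) - (s 0 + j * c)" and ord: "\<And>j. n dvd j * c \<longleftrightarrow> d dvd 2 * j"
    using one_in_2_linear[OF pat] unfolding c_def by metis
  have const: "d dvd (k + chi k) - (j + chi j)" if j: "odd j" and k: "odd k" for j k
  proof -
    have jr: "\<not> rho j" "\<not> rho k" using j k by (simp_all add: Y)
    have "dmul (x (j + - j)) (x (k + chi (j + - j) - chi j)) \<approx> dmul (x (k + - j)) (x (j + chi (k + - j) - chi k))"
      by (rule rot_rot_transfer[OF jr])
    then have e: "dmul (x 0) (x (k + chi 0 - chi j)) \<approx> dmul (x (k - j)) (x (j + chi (k - j) - chi k))" by simp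
    have r0: "rho 0" "rho (k - j)" using j k by (simp_all add: Y)
    have k1: "d dvd (k + chi 0 - chi j) - (k - chi j)"
      using chi_refl[OF r0(1)] by (rule dvd_comb1[where a = 1]) simp
    have k2: "d dvd (j + chi (k - j) - chi k) - (k - chi k)"
      using chi_refl[OF r0(2)] by (rule dvd_comb1[where a = 1]) simp
    obtain a b e where abe: "k - chi j = 2 * a" "k - j = 2 * b" "k - chi k = 2 * e"
    proof -
      have "even (k - chi j)" "even (k - j)" "even (k - chi k)" using j k chi2[of j] chi2[of k] by presburger+
      then show ?thesis using that by (metis evenE)
    qed
    have "n dvd (s 0 - s (k + chi 0 - chi j)) - (s (k - j) - s (j + chi (k - j) - chi k))"
      using \<open>dmul (x 0) _ \<approx> _\<close> r0 rho_cong[OF k1] rho_cong[OF k2] Y[of "k - chi j"] Y[of "k - chi k"] abe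
      by (simp add: dmul_x_ref)
    from this s_cong[OF k1] s_cong[OF k2]
    have "n dvd (s 0 - s (2 * a)) - (s (2 * b) - s (2 * e))"
      unfolding abe by (rule dvd_comb3[where a = 1 and b = 1 and c = "- 1"]) simp
    from this lin[of a] lin[of b] lin[of e] have "n dvd (a + b - e) * c"
      by (rule dvd_comb4[where a = "- 1" and b = "- 1" and c = "- 1" and e = 1]) (simp add: algebra_simps)
    then have "d dvd 2 * (a + b - e)" by (simp add: ord)
    moreover have "2 * (a + b - e) = (k + chi k) - (j + chi j)" using abe by simp
    ultimately show ?thesis by simp
  qed
  define y where "y = chi 1 + 1"
  have y: "d dvd chi j + j - y" if "odd j" for j using const[of 1 j] that by (simp add: y_def add.commute)
  have evy: "even y" using chi2[of 1] by (simp add: y_def)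
  show ?thesis
  proof (cases "4 dvd y")
    case True
    then obtain a where a: "y = 4 * a" by auto
    show ?thesis using that[of "2 * a"] y a by simp
  next
    case False
    show ?thesis
    proof (cases "4 dvd d")
      case True
      define j where "j = y div 2"
      have yj: "y = 2 * j" using evy by (simp add: j_def)
      have oj: "odd j" using False yj by presburger
      obtain e where e: "d = 4 * e" using True by auto
      have f1: "d dvd chi j - j" using y[OF oj] yj by (simp add: algebra_simps)
      have oj': "odd (j + 2 * e)" using oj by simp
      have f2: "d dvd chi (j + 2 * e) - (j + 2 * e)"
      proof -
        have "d dvd chi (j + 2 * e) + (j + 2 * e) - 2 * j" using y[OF oj'] yj by simp
        moreover have "d dvd 4 * e" using e by simp
        ultimately show ?thesis by (rule dvd_comb2[where a = 1 and b = "- 1"]) simp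
      qed
      have "d dvd j - (j + 2 * e)"
        by (rule involution_unique[of 0, OF _ _ _ f1 f2]) (use oj oj' in \<open>simp_all add: Y\<close>)
      then have "d dvd 2 * e" by simp
      then have "d \<le> 2 * e" using d_pos e by (intro zdvd_imp_le) auto
      then show ?thesis using d_pos e by simp
    next
      case nd: False
      have "4 dvd y + d" using False nd evy d2 by presburger
      then obtain a where a: "y + d = 4 * a" by auto
      have "d dvd chi j + j - 2 * (2 * a)" if "odd j" for j
        using y[OF that] dvd_refl[of d] by (rule dvd_comb2[where a = 1 and b = "- 1"]) (use a in simp)
      then show ?thesis using that[of "2 * a"] by simp
    qed
  qed
qed


text \<open>Once centered, inversion negates odd indices, and the mixed relation makes the rotations
  progress by \<open>2 * c\<close> every four indices. The scalars from
  \<open>one_in_2_linear\<close> leave \<open>4 * (l - 1)\<close> divisible by \<open>d\<close>; the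
  two alternatives, the second and the third family, depend on whether \<open>2 * (l - 1)\<close> is
  already divisible.\<close>

lemma one_in_2_case:
  assumes pat: "one_in_p 2 x chi 0" and center: "\<And>j. odd j \<Longrightarrow> d dvd chi j + j"
  shows "n = d \<and> even n \<and> coprime (s 1) n \<and> (\<forall>j. odd j \<longrightarrow> n dvd s j - j * s 1) \<and>
    ((\<forall>i. n dvd s (2 * i) - (s 0 + 2 * i * s 1)) \<or>
     8 dvd n \<and> (\<forall>i. n dvd s (2 * i) - (s 0 + i * (2 + n div 2) * s 1)))"
proof -
  have Y: "rho i \<longleftrightarrow> even i" for i using pat by (simp add: one_in_p_def)
  have d2: "even d" using rho_cong[of d 0] Y[of d] Y[of 0] by simp
  define c where "c = s 2 - s 0"
  define q where "q = chi (chi 3 - 2) - 1"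
  obtain z where lin: "\<And>j. n dvd s (2 * j) - (s 0 + j * c)" and ord: "\<And>j. n dvd j * c \<longleftrightarrow> d dvd 2 * j"
    and zz: "n dvd (z * z - 1) * c" and zq: "d dvd (1 + z) * q" and zc: "n dvd s 3 + s (chi 3 - 2) - z * c"
    using one_in_2_linear[OF pat] unfolding c_def q_def by metis
  have chim: "d dvd chi j - (- j)" if "odd j" for j using center[OF that] by simp
  have sm: "n dvd s (- j) + s j" if "odd j" for j
  proof -
    have "\<not> rho j" using that by (simp add: Y)
    from s_chi[OF this] s_cong[OF chim[OF that]] show ?thesis
      by (rule dvd_comb2[where a = 1 and b = "- 1"]) simp
  qed
  have step: "n dvd s (j + 2) - s (j - 2) - 2 * c" if j: "odd j" for j
  proof -
    have jr: "rho 0" "\<not> rho j" "rho 2" using j by (simp_all add: Y)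
    have "dmul (x (0 + 2)) (x (j - 0 + chi (0 + 2))) \<approx> dmul (x (chi j + 2)) (x (0 - j + chi (chi j + 2)))"
      by (rule ref_rot_transfer[OF jr(1,2)])
    then have e: "dmul (x 2) (x (j + chi 2)) \<approx> dmul (x (chi j + 2)) (x (chi (chi j + 2) - j))" by simp
    have k1: "d dvd (j + chi 2) - (j + 2)" using chi_refl[OF jr(3)] by simp
    have k2: "d dvd (chi j + 2) - (- (j - 2))" using chim[OF j] by simp
    have oj: "odd (- (j - 2))" using j by simp
    have k3: "d dvd (chi (chi j + 2) - j) - (- 2)"
      using chi_cong[OF k2] chim[OF oj] by (rule dvd_comb2[where a = 1 and b = 1]) simp
    have "n dvd (s 2 - s (j + chi 2)) - (s (chi j + 2) + s (chi (chi j + 2) - j))"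
      using e jr rho_cong[OF k1] rho_cong[OF k2] rho_cong[OF k3] Y[of "j + 2"] Y[of "- (j - 2)"] Y[of "- 2"] j
      by (simp add: dmul_x_ref dmul_x_rot)
    from this s_cong[OF k1] s_cong[OF k2] s_cong[OF k3] sm[of "j - 2"] j
    have "n dvd s 2 - s (j + 2) + s (j - 2) - s (- 2)"
      by - (rule dvd_comb5[where a = 1 and b = 1 and c = 1 and e = 1 and f = 1], assumption, assumption,
          assumption, assumption, simp, simp)
    from this lin[of 1] lin[of "- 1"] show ?thesis
      by simp (rule dvd_comb3[where a = "- 1" and b = 1 and c = "- 1"], assumption+, simp)
  qed
  have odd1: "n dvd s (1 + 4 * k) - (s 1 + 2 * k * c)" for k
  proof (induction k rule: int_induct[where k = 0])
    case base
    then show ?case by simp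
  next
    case (step1 i)
    have "odd (3 + 4 * i)" by simp
    from step[OF this] step1(2) show ?case
      by simp (rule dvd_comb2[where a = 1 and b = 1], assumption+, simp add: algebra_simps)
  next
    case (step2 i)
    have "odd (4 * i - 1)" by simp
    from step[OF this] step2(2) show ?case
      by (rule dvd_comb2[where a = "- 1" and b = 1]) (simp add: algebra_simps)
  qed
  have odd3: "n dvd s (4 * k - 1) - (2 * k * c - s 1)" for k
  proof -
    have "odd (1 + 4 * (- k))" by simp
    from sm[OF this] odd1[of "- k"] show ?thesis
      by (rule dvd_comb2[where a = 1 and b = "- 1"]) (simp add: algebra_simps)
  qed
  \<comment> \<open>With inversion negating odd indices, \<open>q\<close> evaluates to 4, so
    \<open>(1 + z) * q = 0\<close> becomes a condition on \<open>l = - z\<close>.\<close>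
  have q4: "d dvd q - 4" and s35: "n dvd s 3 + s (chi 3 - 2) + 2 * s 1"
  proof -
    have k: "d dvd (chi 3 - 2) - (- 5)" using chim[of 3] by (simp add: add.commute)
    have "d dvd chi (- 5) - 5" using chim[of "- 5"] by simp
    with chi_cong[OF k] show "d dvd q - 4" by (rule dvd_comb2[where a = 1 and b = 1]) (simp add: q_def)
    from odd3[of 1] odd3[of "- 1"] s_cong[OF k] show "n dvd s 3 + s (chi 3 - 2) + 2 * s 1"
      by simp (rule dvd_comb3[where a = 1 and b = 1 and c = 1], assumption+, simp)
  qed
  define l where "l = - z"
  have lc: "n dvd 2 * s 1 - l * c" using s35 zc by (rule dvd_comb2[where a = 1 and b = "- 1"]) (simp add: l_def)
  have l2: "n dvd (l * l - 1) * c" using zz by (simp add: l_def)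
  have l4: "d dvd 4 * (l - 1)" using zq q4
    by (rule dvd_comb2[where a = "- 1" and b = "1 + z"]) (simp add: l_def algebra_simps)
  have cl: "n dvd c - 2 * l * s 1" using lc l2
    by (rule dvd_comb2[where a = "- l" and b = "- 1"]) (simp add: algebra_simps)
  have form: "\<exists>k. j = 1 + 4 * k \<or> j = 4 * k - 1" if "odd j" for j :: int using that by presburger
  have cop: "coprime (s 1) n"
  proof (rule coprimeI)
    fix g assume g: "g dvd s 1" "g dvd n"
    have gn: "g dvd t" if "n dvd t" for t using that g dvd_trans by blast
    have gc: "g dvd c" using gn[OF cl] g(1) by (rule dvd_comb2[where a = 1 and b = "2 * l"]) simp
    show "is_unit g"
    proof (rule gen_dvd[OF g(2)])
      show "rho 0" by (simp add: Y)
      fix j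
      {
        assume "\<not> rho j"
        then obtain k where "j = 1 + 4 * k \<or> j = 4 * k - 1" using form Y by blast
        then show "g dvd s j"
        proof
          assume j: "j = 1 + 4 * k"
          from gn[OF odd1[of k]] g(1) gc show ?thesis
            unfolding j by (rule dvd_comb3[where a = 1 and b = 1 and c = "2 * k"]) simp
        next
          assume j: "j = 4 * k - 1"
          from gn[OF odd3[of k]] g(1) gc show ?thesis
            unfolding j by (rule dvd_comb3[where a = 1 and b = "- 1" and c = "2 * k"]) simp
        qed
      }
      assume "rho j"
      then obtain k where j: "j = 2 * k" using Y by auto
      from gn[OF lin[of k]] gc show "g dvd s j - s 0"
        unfolding j by (rule dvd_comb2[where a = 1 and b = k]) simp
    qed
  qed
  have n2l: "n dvd 2 * (l * l - 1)"
  proof -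
    have "n dvd 2 * (l * l - 1) * s 1" using lc cl
      by (rule dvd_comb2[where a = "- 1" and b = "- l"]) (simp add: algebra_simps)
    then show ?thesis using cop by (simp add: coprime_dvd_mult_left_iff coprime_commute)
  qed
  \<comment> \<open>\<open>c\<close> equals \<open>2 * l * s 1\<close>, where \<open>s 1\<close> is
    a unit and \<open>l\<close> acts invertibly on even numbers; so \<open>n\<close> and
    \<open>d\<close> divide the same even numbers.\<close>
  have dn: "d dvd 2 * j \<longleftrightarrow> n dvd 2 * j" for j
  proof -
    have "n dvd j * c \<longleftrightarrow> n dvd j * (2 * l * s 1)"
    proof -
      have "n dvd j * c - j * (2 * l * s 1)" using dvd_mult[OF cl, of j] by (simp add: right_diff_distrib)
      from dvd_diff_cong[OF this, of 0] show ?thesis by simp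
    qed
    also have "\<dots> \<longleftrightarrow> n dvd 2 * j * l"
      using cop coprime_dvd_mult_left_iff[of n "s 1" "2 * j * l"] by (simp add: coprime_commute algebra_simps)
    also have "\<dots> \<longleftrightarrow> n dvd 2 * j"
    proof
      assume "n dvd 2 * j * l"
      from this n2l show "n dvd 2 * j" by (rule dvd_comb2[where a = l and b = "- j"]) (simp add: algebra_simps)
    qed simp
    finally show ?thesis by (simp add: ord)
  qed
  have jodd: "n dvd s j - j * s 1" if j: "odd j" and c4: "n dvd 2 * c - 4 * s 1" for j
  proof -
    obtain k where "j = 1 + 4 * k \<or> j = 4 * k - 1" using form[OF j] by blast
    then show ?thesis
    proof
      assume j: "j = 1 + 4 * k"
      from odd1[of k] c4 show ?thesis
        unfolding j by (rule dvd_comb2[where a = 1 and b = k]) (simp add: algebra_simps)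
    next
      assume j: "j = 4 * k - 1"
      from odd3[of k] c4 show ?thesis
        unfolding j by (rule dvd_comb2[where a = 1 and b = k]) (simp add: algebra_simps)
    qed
  qed
  have evn: "n = d" if c4: "n dvd 2 * c - 4 * s 1"
  proof -
    have nd: "n dvd d"
    proof -
      obtain e where "d = 2 * e" using d2 by auto
      then show ?thesis using dn[of e] by simp
    qed
    \<comment> \<open>For odd \<open>n\<close> the rotation with index \<open>n\<close> would have
      trivial exponent.\<close>
    have en: "even n"
    proof (rule ccontr)
      assume o: "odd n"
      then have "n dvd s n" using jodd[OF o c4] dvd_add[of n "s n - n * s 1" "n * s 1"] by simp
      then have "inN (s n)" using inN_cong[of "s n" 0] inN_0 by simp
      moreover have "\<not> rho n" "rho 0" using o by (simp_all add: Y)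
      ultimately show False using rotation_notin_N by blast
    qed
    then obtain e where e: "n = 2 * e" by auto
    then have "d dvd n" using dn[of e] by simp
    then show "n = d" using nd n_pos d_pos by (simp add: zdvd_antisym_nonneg)
  qed
  show ?thesis
  proof (cases "d dvd 2 * (l - 1)")
    case True
    then have "n dvd (l - 1) * c" by (simp add: ord)
    with lc have c2: "n dvd c - 2 * s 1" by (rule dvd_comb2[where a = "- 1" and b = "- 1"]) (simp add: algebra_simps)
    then have c4: "n dvd 2 * c - 4 * s 1" by (rule dvd_comb1[where a = 2]) simp
    have "n dvd s (2 * i) - (s 0 + 2 * i * s 1)" for i
      using lin[of i] c2 by (rule dvd_comb2[where a = 1 and b = i]) (simp add: algebra_simps)
    then show ?thesis using evn[OF c4] jodd[OF _ c4] cop d2 by simp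
  next
    case False
    obtain e where e: "d = 2 * e" using d2 by auto
    have "2 * e dvd 2 * (2 * (l - 1))" using l4 e by simp
    then have h1: "e dvd 2 * (l - 1)" by (simp only: dvd_mult_cancel_left) simp
    have h2: "\<not> e dvd l - 1"
    proof
      assume "e dvd l - 1"
      then have "2 * e dvd 2 * (l - 1)" by (simp only: dvd_mult_cancel_left) simp
      then show False using False e by simp
    qed
    \<comment> \<open>After two halvings \<open>l - 1\<close> is an odd multiple of
      \<open>f = d / 4\<close>. The relation \<open>l * l = 1\<close> makes \<open>l\<close> odd, so
      \<open>f\<close> is even and 8 divides \<open>d\<close>.\<close>
    obtain k where k: "2 * (l - 1) = e * k" using h1 by auto
    have "odd k"
    proof
      assume "even k"
      then obtain k' where "k = 2 * k'" by auto
      then have "l - 1 = e * k'" using k by simp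
      then show False using h2 by simp
    qed
    then have "even e" using k by (metis dvd_triv_left even_mult_iff)
    then obtain f where f: "e = 2 * f" by auto
    have lk: "l - 1 = f * k" using k f by simp
    have "2 * e dvd 2 * (l * l - 1)" using l2 ord e by blast
    then have "e dvd l * l - 1" by (simp only: dvd_mult_cancel_left) simp
    moreover have "l * l - 1 = f * (k * (l + 1))"
    proof -
      have "l * l - 1 = (l - 1) * (l + 1)" by (simp add: algebra_simps)
      then show ?thesis by (simp add: lk mult.assoc)
    qed
    moreover have f0: "f \<noteq> 0" using e f d_pos by auto
    ultimately have "2 dvd k * (l + 1)" using f by (simp add: mult.commute[of 2])
    then have "odd l" using \<open>odd k\<close> by simp
    then have "even (l - 1)" by simp
    then have "even (f * k)" by (simp only: lk)
    then have "even f" using \<open>odd k\<close> by simp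
    then have d8: "8 dvd d" using e f by auto
    obtain k' where k': "k = 2 * k' + 1" using \<open>odd k\<close> by (rule oddE)
    have c2: "d dvd 2 * l - (2 + e)"
    proof -
      have "2 * l - (2 + e) = d * k'" using lk k' e f by (simp add: algebra_simps)
      then show ?thesis by simp
    qed
    have nd: "n dvd d"
      using dn[of e] e by simp
    have ce: "n dvd c - (2 + e) * s 1"
      using cl dvd_trans[OF nd c2] by (rule dvd_comb2[where a = 1 and b = "s 1"]) (simp add: algebra_simps)
    have c4: "n dvd 2 * c - 4 * s 1"
      using ce nd by (rule dvd_comb2[where a = 2 and b = "s 1"]) (simp add: e algebra_simps)
    have n: "n = d" by (rule evn[OF c4])
    have "n dvd s (2 * i) - (s 0 + i * (2 + n div 2) * s 1)" for i
      using lin[of i] ce by (rule dvd_comb2[where a = 1 and b = i]) (simp add: n e algebra_simps)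
    then show ?thesis using n d8 jodd[OF _ c4] cop d2 by simp
  qed
qed

end

section \<open>Change of the base index\<close>

lemma skew_shift:
  assumes "skew n d x chi F P"
  shows "skew n d (\<lambda>i. x (i + a)) (\<lambda>i. chi (i + a) - a) F P"
proof -
  interpret skew n d x chi F P by fact
  show ?thesis
  proof
    show "0 < n" "0 < d" by (fact n_pos d_pos)+
    show "dih_eq n (x (i + a)) (x (j + a)) = (d dvd i - j)" for i j by (simp add: x_eq)
    show "dih_eq n (dmul (x (i + a)) (x (chi (i + a) - a + a))) (0, False)" for i
      using chi_inv[of "i + a"] by simp
    show "dih_eq n (F t g) (F t h)" "d dvd P t g - P t h" if "dih_eq n g h" for t g h
      using that F_cong P_cong by auto
    show "dih_eq n (F t (0, False)) (0, False)" "d dvd P t (0, False) - t" for t by (fact F_one P_one)+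
    show "dih_eq n (F t (dmul g (x (i + a)))) (dmul (F t g) (x (i + P t g + a)))" for t g i
      using F_step[of t g "i + a"] by (simp add: add.commute add.left_commute add.assoc)
    show "d dvd P t (dmul g (x (i + a))) - (chi (i + P t g + a) - a - (chi (i + a) - a))" for t g i
      using P_step[of t g "i + a"] by (simp add: add.commute add.left_commute add.assoc)
    show "Q g" if "\<And>g h. dih_eq n g h \<Longrightarrow> Q g \<Longrightarrow> Q h" "Q (0, False)"
      "\<And>g i. Q g \<Longrightarrow> Q (dmul g (x (i + a)))" for Q g
    proof (rule gen[of Q])
      show "Q h" if "dih_eq n g h" "Q g" for g h using that \<open>\<And>g h. dih_eq n g h \<Longrightarrow> Q g \<Longrightarrow> Q h\<close> by blast
      show "Q (dmul g (x i))" if "Q g" for g i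
        using \<open>\<And>g i. Q g \<Longrightarrow> Q (dmul g (x (i + a)))\<close>[OF that, of "i - a"] by simp
    qed fact
  qed
qed

text \<open>
  A reflection whose value \<open>S (0, False)\<close> is arbitrary can be composed with a rotation about \<open>1\<close>, and
  the indices can be shifted at the same time.
\<close>

lemma rskew_shift:
  assumes "skew n d x chi F P"
    and G_cong: "\<And>g h. dih_eq n g h \<Longrightarrow> dih_eq n (G g) (G h)"
    and S_cong: "\<And>g h. dih_eq n g h \<Longrightarrow> d dvd S g - S h"
    and G_one: "dih_eq n (G (0, False)) (0, False)"
    and G_step: "\<And>g i. dih_eq n (G (dmul g (x i))) (dmul (G g) (x (S g - i)))"
    and S_step: "\<And>g i. d dvd S (dmul g (x i)) - (chi (S g - i) + chi i)"
  shows "\<exists>G S. rskew n d (\<lambda>i. x (i + a)) (\<lambda>i. chi (i + a) - a) F P G S"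
proof -
  interpret skew n d x chi F P by fact
  interpret sh: skew n d "\<lambda>i. x (i + a)" "\<lambda>i. chi (i + a) - a" F P by (rule skew_shift) fact
  define t where "t = 2 * a - S (0, False)"
  define G' where "G' g = F t (G g)" for g
  define S' where "S' g = S g + P t (G g) - 2 * a" for g
  have "rskew n d (\<lambda>i. x (i + a)) (\<lambda>i. chi (i + a) - a) F P G' S'"
  proof
    show "dih_eq n (G' g) (G' h)" "d dvd S' g - S' h" if "dih_eq n g h" for g h
    proof -
      show "dih_eq n (G' g) (G' h)" unfolding G'_def by (intro F_cong G_cong that)
      show "d dvd S' g - S' h"
        using S_cong[OF that] P_cong[OF G_cong[OF that], of t]
        by (rule dvd_comb2[where a = 1 and b = 1]) (simp add: S'_def)
    qed
    show "dih_eq n (G' (0, False)) (0, False)"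
      unfolding G'_def by (rule dih_eq_trans[OF F_cong[OF G_one] F_one])
    show "d dvd S' (0, False)"
      using P_cong[OF G_one, of t] P_one[of t]
      by (rule dvd_comb2[where a = 1 and b = 1]) (simp add: S'_def t_def)
    show "dih_eq n (G' (dmul g (x (i + a)))) (dmul (G' g) (x (S' g - i + a)))" for g i
    proof -
      have "dih_eq n (G' (dmul g (x (i + a)))) (F t (dmul (G g) (x (S g - (i + a)))))"
        unfolding G'_def by (intro F_cong G_step)
      also have "dih_eq n \<dots> (dmul (F t (G g)) (x (S g - (i + a) + P t (G g))))" by (rule F_step)
      also have "S g - (i + a) + P t (G g) = S' g - i + a" by (simp add: S'_def)
      finally show ?thesis by (simp add: G'_def)
    qed
    show "d dvd S' (dmul g (x (i + a))) - (chi (S' g - i + a) - a + (chi (i + a) - a))" for g i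
    proof -
      have e: "S g - (i + a) + P t (G g) = S' g - i + a" by (simp add: S'_def)
      have "d dvd P t (G (dmul g (x (i + a)))) - (chi (S' g - i + a) - chi (S g - (i + a)))"
        using P_cong[OF G_step[of g "i + a"], of t] P_step[of t "G g" "S g - (i + a)"]
        unfolding e by (rule dvd_diff_trans)
      with S_step[of g "i + a"] show ?thesis
        by (rule dvd_comb2[where a = 1 and b = 1]) (simp add: S'_def)
    qed
  qed
  then show ?thesis by blast
qed

section \<open>From Cayley maps to skew morphisms\<close>

definition dred :: "nat \<Rightarrow> int \<times> bool \<Rightarrow> int \<times> bool" where
  "dred n g = (fst g mod int n, snd g)"

lemma mult_dihedral: "g \<otimes>\<^bsub>dihedral n\<^esub> h = dred n (dmul g h)"
  by (auto simp: dihedral_def dred_def dmul_def split: prod.splits)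

lemma one_dihedral: "\<one>\<^bsub>dihedral n\<^esub> = (0, False)"
  by (simp add: dihedral_def)

lemma dred_closed: "0 < n \<Longrightarrow> dred n g \<in> carrier (dihedral n)"
  by (simp add: dihedral_def dred_def)

lemma dred_eq: "dred n g = dred n h \<longleftrightarrow> dih_eq (int n) g h"
  by (auto simp: dred_def dih_eq_def mod_eq_dvd_iff)

lemma dih_eq_dred: "dih_eq (int n) (dred n g) g" "dih_eq (int n) g (dred n g)"
  by (auto simp: dred_eq[symmetric]) (auto simp: dred_def)

lemma dred_id: "g \<in> carrier (dihedral n) \<Longrightarrow> dred n g = g"
  by (cases g) (auto simp: dihedral_def dred_def)

lemma dih_eq_carrier:
  "g \<in> carrier (dihedral n) \<Longrightarrow> h \<in> carrier (dihedral n) \<Longrightarrow> dih_eq (int n) g h \<longleftrightarrow> g = h"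
  using dred_eq[of n g h] by (simp add: dred_id)

lemma dred_mult: "0 < n \<Longrightarrow> dred n (dmul g h) = dred n g \<otimes>\<^bsub>dihedral n\<^esub> dred n h"
  unfolding mult_dihedral dred_eq by (intro dih_eq_dmul dih_eq_dred)

lemma finite_dihedral: "finite (carrier (dihedral n))"
  by (simp add: dihedral_def)

lemma cycle_of_list_nth:
  assumes "distinct ys" "k < length ys"
  shows "cycle_of_list ys (ys ! k) = ys ! (Suc k mod length ys)"
  using arg_cong[OF cyclic_rotation[OF assms(1), of 1], of "\<lambda>zs. zs ! k"] assms(2)
  by (simp add: nth_rotate1)

locale cayley_dihedral =
  fixes n :: nat and X :: "(int \<times> bool) set" and p :: "int \<times> bool \<Rightarrow> int \<times> bool"
  assumes n_pos: "0 < n" and data: "cayley_map_data (dihedral n) X p"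
begin

abbreviation "D \<equiv> dihedral n"

sublocale D: group D
  using n_pos by (rule group_dihedral)

abbreviation d :: int where "d \<equiv> int (card X)"

lemma X: "X \<subseteq> carrier D" "(0, False) \<notin> X" "(\<lambda>x. inv\<^bsub>D\<^esub> x) ` X = X" "generate D X = carrier D"
  "p permutes X" "cyclic_on p X" "finite X"
  using data finite_subset[OF _ finite_dihedral, of X n] by (auto simp: cayley_map_data_def one_dihedral)

definition x0 :: "int \<times> bool" where "x0 = (SOME x. x \<in> X)"

definition x :: "int \<Rightarrow> int \<times> bool" where "x i = (p ^^ nat (i mod d)) x0"

lemma x0: "x0 \<in> X"
  using X(6) unfolding x0_def cyclic_on_def by (metis someI)

lemma card_X_pos: "0 < card X"
  using x0 X(7) by (auto simp: card_gt_0_iff)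

lemma orbit_x0: "X = (\<lambda>k. (p ^^ k) x0) ` {0..<card X}" "inj_on (\<lambda>k. (p ^^ k) x0) {0..<card X}"
  "(p ^^ card X) x0 = x0"
proof -
  have o: "X = orbit p x0" using X(6) x0 by (simp add: cyclic_on_alldef)
  then have in_o: "x0 \<in> orbit p x0" using x0 by simp
  define m where "m = funpow_dist1 p x0 x0"
  have 1: "X = (\<lambda>k. (p ^^ k) x0) ` {0..<m}"
    unfolding m_def using o orbit_conv_funpow_dist1[OF in_o] by simp
  have 2: "inj_on (\<lambda>k. (p ^^ k) x0) {0..<m}" unfolding m_def by (rule inj_on_funpow_dist1[OF in_o])
  have m: "card X = m" using card_image[OF 2] 1 by simp
  show "X = (\<lambda>k. (p ^^ k) x0) ` {0..<card X}" "inj_on (\<lambda>k. (p ^^ k) x0) {0..<card X}"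
    using 1 2 unfolding m by simp_all
  show "(p ^^ card X) x0 = x0" unfolding m m_def by (rule funpow_dist1_prop[OF in_o])
qed

lemma x_eq_iff: "x i = x j \<longleftrightarrow> d dvd i - j"
proof -
  have "nat (i mod d) \<in> {0..<card X}" for i using card_X_pos by (simp add: nat_less_iff)
  then have "x i = x j \<longleftrightarrow> nat (i mod d) = nat (j mod d)"
    unfolding x_def using orbit_x0(2) by (auto simp: inj_on_def)
  also have "\<dots> \<longleftrightarrow> i mod d = j mod d" using card_X_pos by (simp add: eq_nat_nat_iff)
  finally show ?thesis by (simp add: mod_eq_dvd_iff)
qed

lemma x_in: "x i \<in> X"
  unfolding x_def using X(6) x0 by (rule cyclic_on_funpow_in)

lemma x_carrier: "x i \<in> carrier D"
  using x_in X(1) by blast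

lemma x_surj: "y \<in> X \<Longrightarrow> \<exists>i. y = x i"
proof -
  assume "y \<in> X"
  then have "y \<in> (\<lambda>k. (p ^^ k) x0) ` {0..<card X}" by (subst (asm) orbit_x0(1))
  then obtain k where k: "k < card X" "y = (p ^^ k) x0" by auto
  then have "y = x (int k)" by (simp add: x_def)
  then show ?thesis ..
qed

lemma p_x: "p (x i) = x (i + 1)"
proof -
  define k where "k = nat (i mod d)"
  have k: "i mod d = int k" "k < card X" using card_X_pos by (auto simp: k_def nat_less_iff)
  have e: "(i + 1) mod d = int (Suc k) mod d" using k(1) by (metis mod_add_left_eq of_nat_Suc add.commute)
  show ?thesis
  proof (cases "Suc k = card X")
    case True
    have "x (i + 1) = x0" using True e by (simp add: x_def)
    moreover have "p (x i) = (p ^^ Suc k) x0" by (simp add: x_def k_def)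
    ultimately show ?thesis using True orbit_x0(3) by simp
  next
    case False
    then have "(i + 1) mod d = int (Suc k)" using e k(2) by simp
    then have "nat ((i + 1) mod d) = Suc k" by simp
    then show ?thesis by (simp add: x_def k_def)
  qed
qed

definition chi :: "int \<Rightarrow> int" where "chi i = (SOME j. x j = inv\<^bsub>D\<^esub> (x i))"

lemma x_chi: "x (chi i) = inv\<^bsub>D\<^esub> (x i)"
proof -
  have "inv\<^bsub>D\<^esub> (x i) \<in> X" using X(3) x_in by blast
  then have "\<exists>j. x j = inv\<^bsub>D\<^esub> (x i)" using x_surj by metis
  then show ?thesis unfolding chi_def by (rule someI_ex)
qed

lemma x_mult: "dred n (dmul g (x i)) = dred n g \<otimes>\<^bsub>D\<^esub> x i"
  using dred_mult[OF n_pos, of g "x i"] dred_id[OF x_carrier[of i]] by simp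

lemma gen_induct:
  assumes cong: "\<And>g h. dih_eq (int n) g h \<Longrightarrow> Q g \<Longrightarrow> Q h" and one: "Q (0, False)"
    and step: "\<And>g i. Q g \<Longrightarrow> Q (dmul g (x i))"
  shows "Q g"
proof -
  have stepD: "Q (g \<otimes>\<^bsub>D\<^esub> y)" if "Q g" "y \<in> X" for g y
  proof -
    obtain i where "y = x i" using x_surj \<open>y \<in> X\<close> by blast
    then have "Q (dmul g y)" using step \<open>Q g\<close> by simp
    then show ?thesis unfolding mult_dihedral by (rule cong[OF dih_eq_dred(2)])
  qed
  have "Q (g \<otimes>\<^bsub>D\<^esub> h)" if "h \<in> generate D X" "g \<in> carrier D" "Q g" for g h
    using that
  proof (induction h arbitrary: g rule: generate.induct)
    case one
    then show ?case by simp
  next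
    case (incl h)
    then show ?case using stepD by blast
  next
    case (inv h)
    then have "inv\<^bsub>D\<^esub> h \<in> X" using X(3) by blast
    then show ?case using stepD inv by blast
  next
    case (eng h1 h2)
    have c: "h1 \<in> carrier D" "h2 \<in> carrier D" using eng(1,2) X(4) by auto
    then have "Q (g \<otimes>\<^bsub>D\<^esub> h1 \<otimes>\<^bsub>D\<^esub> h2)" using eng by blast
    then show ?case using c eng by (simp add: D.m_assoc)
  qed
  from this[of "dred n g" "\<one>\<^bsub>D\<^esub>"] have "Q (dred n g)"
    using dred_closed[OF n_pos] one unfolding X(4) one_dihedral[of n, symmetric] by simp
  then show ?thesis by (rule cong[OF dih_eq_dred(1)])
qed

text \<open>The offset is read off at the single neighbour \<open>g x 0\<close>; preservation or
  reversal of the cyclic order extends it to all neighbours.\<close>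

definition off :: "(int \<times> bool \<Rightarrow> int \<times> bool) \<Rightarrow> int \<times> bool \<Rightarrow> int" where
  "off f g = (SOME i. f (g \<otimes>\<^bsub>D\<^esub> x 0) = f g \<otimes>\<^bsub>D\<^esub> x i)"

lemma graph_iso_closed:
  assumes "graph_iso (CM D X p) (CM D X p) f" "g \<in> carrier D"
  shows "f g \<in> carrier D"
  using assms by (auto simp: graph_iso_def CM_def bij_betw_def)

lemma graph_iso_nbr:
  assumes "graph_iso (CM D X p) (CM D X p) f" "g \<in> carrier D"
  shows "\<exists>i. f (g \<otimes>\<^bsub>D\<^esub> x k) = f g \<otimes>\<^bsub>D\<^esub> x i"
proof -
  have c: "f g \<in> carrier D" "f (g \<otimes>\<^bsub>D\<^esub> x k) \<in> carrier D" "g \<otimes>\<^bsub>D\<^esub> x k \<in> carrier D"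
    using graph_iso_closed[OF assms(1)] assms(2) x_carrier by auto
  have "inv\<^bsub>D\<^esub> g \<otimes>\<^bsub>D\<^esub> (g \<otimes>\<^bsub>D\<^esub> x k) \<in> X"
    using assms(2) x_carrier x_in by (simp add: D.m_assoc[symmetric])
  then have "inv\<^bsub>D\<^esub> (f g) \<otimes>\<^bsub>D\<^esub> f (g \<otimes>\<^bsub>D\<^esub> x k) \<in> X"
    using assms c by (simp add: graph_iso_def CM_def)
  then obtain i where i: "inv\<^bsub>D\<^esub> (f g) \<otimes>\<^bsub>D\<^esub> f (g \<otimes>\<^bsub>D\<^esub> x k) = x i" using x_surj by metis
  then have "f g \<otimes>\<^bsub>D\<^esub> x i = f (g \<otimes>\<^bsub>D\<^esub> x k)"
    using c by (simp add: D.m_assoc[symmetric] flip: i)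
  then show ?thesis by metis
qed

lemma off:
  assumes "graph_iso (CM D X p) (CM D X p) f" "g \<in> carrier D"
  shows "f (g \<otimes>\<^bsub>D\<^esub> x 0) = f g \<otimes>\<^bsub>D\<^esub> x (off f g)"
  unfolding off_def using graph_iso_nbr[OF assms] by (rule someI_ex)

lemma cancel: "g \<in> carrier D \<Longrightarrow> inv\<^bsub>D\<^esub> g \<otimes>\<^bsub>D\<^esub> (g \<otimes>\<^bsub>D\<^esub> x k) = x k"
  using x_carrier by (simp add: D.m_assoc[symmetric])

lemma pres_step:
  assumes "pres_iso (CM D X p) (CM D X p) f" "g \<in> carrier D"
  shows "f (g \<otimes>\<^bsub>D\<^esub> x k) = f g \<otimes>\<^bsub>D\<^esub> x (k + off f g)"
proof -
  have gi: "graph_iso (CM D X p) (CM D X p) f" using assms(1) by (simp add: pres_iso_def)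
  have rot: "f (g \<otimes>\<^bsub>D\<^esub> x (k + 1)) = f g \<otimes>\<^bsub>D\<^esub> p (inv\<^bsub>D\<^esub> (f g) \<otimes>\<^bsub>D\<^esub> f (g \<otimes>\<^bsub>D\<^esub> x k))" for k
  proof -
    have c: "g \<otimes>\<^bsub>D\<^esub> x k \<in> carrier D" using assms(2) x_carrier by simp
    have "f (g \<otimes>\<^bsub>D\<^esub> p (inv\<^bsub>D\<^esub> g \<otimes>\<^bsub>D\<^esub> (g \<otimes>\<^bsub>D\<^esub> x k))) =
        f g \<otimes>\<^bsub>D\<^esub> p (inv\<^bsub>D\<^esub> (f g) \<otimes>\<^bsub>D\<^esub> f (g \<otimes>\<^bsub>D\<^esub> x k))"
    proof -
      have "\<forall>v\<in>carrier D. \<forall>w\<in>carrier D. inv\<^bsub>D\<^esub> v \<otimes>\<^bsub>D\<^esub> w \<in> X \<longrightarrow> f (v \<otimes>\<^bsub>D\<^esub> p (inv\<^bsub>D\<^esub> v \<otimes>\<^bsub>D\<^esub> w)) = f v \<otimes>\<^bsub>D\<^esub> p (inv\<^bsub>D\<^esub> (f v) \<otimes>\<^bsub>D\<^esub> f w)"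
        using assms(1) by (simp add: pres_iso_def CM_def)
      from this[rule_format, OF assms(2) c] show ?thesis using cancel[OF assms(2), of k] x_in by simp
    qed
    then show ?thesis by (simp add: cancel[OF assms(2)] p_x)
  qed
  have nat: "f (g \<otimes>\<^bsub>D\<^esub> x (int k)) = f g \<otimes>\<^bsub>D\<^esub> x (int k + off f g)" for k
  proof (induction k)
    case 0
    then show ?case using off[OF gi assms(2)] by simp
  next
    case (Suc k)
    have "f (g \<otimes>\<^bsub>D\<^esub> x (int k + 1)) = f g \<otimes>\<^bsub>D\<^esub> x (int k + off f g + 1)"
      using rot[of "int k"] Suc cancel[OF graph_iso_closed[OF gi assms(2)]] by (simp add: p_x)
    then show ?case by (simp add: algebra_simps)
  qed
  have "d dvd k - int (nat (k mod d))" using card_X_pos by (simp add: mod_eq_dvd_iff[symmetric])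
  then have "x k = x (int (nat (k mod d)))" "x (k + off f g) = x (int (nat (k mod d)) + off f g)"
    by (simp_all add: x_eq_iff)
  then show ?thesis using nat[of "nat (k mod d)"] by (simp only:)
qed

lemma rev_step:
  assumes "rev_iso (CM D X p) (CM D X p) f" "g \<in> carrier D"
  shows "f (g \<otimes>\<^bsub>D\<^esub> x k) = f g \<otimes>\<^bsub>D\<^esub> x (off f g - k)"
proof -
  have gi: "graph_iso (CM D X p) (CM D X p) f" using assms(1) by (simp add: rev_iso_def)
  note fc = graph_iso_closed[OF gi assms(2)]
  have rot: "f g \<otimes>\<^bsub>D\<^esub> p (inv\<^bsub>D\<^esub> (f g) \<otimes>\<^bsub>D\<^esub> f (g \<otimes>\<^bsub>D\<^esub> x (k + 1))) = f (g \<otimes>\<^bsub>D\<^esub> x k)" for k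
  proof -
    have c: "g \<otimes>\<^bsub>D\<^esub> x k \<in> carrier D" using assms(2) x_carrier by simp
    have "f g \<otimes>\<^bsub>D\<^esub> p (inv\<^bsub>D\<^esub> (f g) \<otimes>\<^bsub>D\<^esub> f (g \<otimes>\<^bsub>D\<^esub> p (inv\<^bsub>D\<^esub> g \<otimes>\<^bsub>D\<^esub> (g \<otimes>\<^bsub>D\<^esub> x k)))) =
        f (g \<otimes>\<^bsub>D\<^esub> x k)"
    proof -
      have "\<forall>v\<in>carrier D. \<forall>w\<in>carrier D. inv\<^bsub>D\<^esub> v \<otimes>\<^bsub>D\<^esub> w \<in> X \<longrightarrow> f v \<otimes>\<^bsub>D\<^esub> p (inv\<^bsub>D\<^esub> (f v) \<otimes>\<^bsub>D\<^esub> f (v \<otimes>\<^bsub>D\<^esub> p (inv\<^bsub>D\<^esub> v \<otimes>\<^bsub>D\<^esub> w))) = f w"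
        using assms(1) by (simp add: rev_iso_def CM_def)
      from this[rule_format, OF assms(2) c] show ?thesis using cancel[OF assms(2), of k] x_in by simp
    qed
    then show ?thesis by (simp add: cancel[OF assms(2)] p_x)
  qed
  have nat: "f (g \<otimes>\<^bsub>D\<^esub> x (int k)) = f g \<otimes>\<^bsub>D\<^esub> x (off f g - int k)" for k
  proof (induction k)
    case 0
    then show ?case using off[OF gi assms(2)] by simp
  next
    case (Suc k)
    obtain i where i: "f (g \<otimes>\<^bsub>D\<^esub> x (int k + 1)) = f g \<otimes>\<^bsub>D\<^esub> x i"
      using graph_iso_nbr[OF gi assms(2)] by blast
    have "f g \<otimes>\<^bsub>D\<^esub> x (i + 1) = f g \<otimes>\<^bsub>D\<^esub> x (off f g - int k)"
      using rot[of "int k"] Suc cancel[OF fc] by (simp add: i p_x)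
    then have "x (i + 1) = x (off f g - int k)" using fc x_carrier by simp
    then have "x i = x (off f g - (int k + 1))" by (simp add: x_eq_iff algebra_simps)
    then show ?case using i by (simp add: algebra_simps)
  qed
  have "d dvd k - int (nat (k mod d))" using card_X_pos by (simp add: mod_eq_dvd_iff[symmetric])
  then have "x k = x (int (nat (k mod d)))" "x (off f g - k) = x (off f g - int (nat (k mod d)))"
    by (simp_all add: x_eq_iff dvd_diff_commute)
  then show ?thesis using nat[of "nat (k mod d)"] by (simp only:)
qed

lemma x_inv: "x i \<otimes>\<^bsub>D\<^esub> x (chi i) = \<one>\<^bsub>D\<^esub>"
  using x_carrier by (simp add: x_chi)

text \<open>Going along \<open>x i\<close> and back along \<open>x (chi i)\<close> returns to
  \<open>g\<close>; the image of this closed walk determines the offset at the neighbour. The sign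
  \<open>e\<close> treats both orientations at once.\<close>

lemma off_step:
  assumes f: "graph_iso (CM D X p) (CM D X p) f" and g: "g \<in> carrier D" and e: "e = 1 \<or> e = - 1"
    and step: "\<And>g k. g \<in> carrier D \<Longrightarrow> f (g \<otimes>\<^bsub>D\<^esub> x k) = f g \<otimes>\<^bsub>D\<^esub> x (e * k + off f g)"
  shows "d dvd off f (g \<otimes>\<^bsub>D\<^esub> x i) - (chi (e * i + off f g) - e * chi i)"
proof -
  let ?h = "g \<otimes>\<^bsub>D\<^esub> x i"
  have hc: "?h \<in> carrier D" using g x_carrier by simp
  note fg = graph_iso_closed[OF f g]
  have "?h \<otimes>\<^bsub>D\<^esub> x (chi i) = g" using g x_carrier x_inv by (simp add: D.m_assoc)
  then have "f g = f ?h \<otimes>\<^bsub>D\<^esub> x (e * chi i + off f ?h)" using step[OF hc, of "chi i"] by simp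
  also have "\<dots> = f g \<otimes>\<^bsub>D\<^esub> x (e * i + off f g) \<otimes>\<^bsub>D\<^esub> x (e * chi i + off f ?h)" using step[OF g] by simp
  finally have "f g \<otimes>\<^bsub>D\<^esub> \<one>\<^bsub>D\<^esub> = f g \<otimes>\<^bsub>D\<^esub> (x (e * i + off f g) \<otimes>\<^bsub>D\<^esub> x (e * chi i + off f ?h))"
    using fg x_carrier by (simp add: D.m_assoc)
  then have "x (e * i + off f g) \<otimes>\<^bsub>D\<^esub> x (e * chi i + off f ?h) = x (e * i + off f g) \<otimes>\<^bsub>D\<^esub> x (chi (e * i + off f g))"
    using fg x_carrier by (simp add: x_inv del: D.r_one)
  then have "x (e * chi i + off f ?h) = x (chi (e * i + off f g))" using x_carrier by simp
  then show ?thesis by (simp add: x_eq_iff algebra_simps)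
qed

text \<open>For each \<open>t\<close> an automorphism taking the arc \<open>x 0\<close> at 1 to the
  arc \<open>x t\<close> is chosen independently. Their coherence, such as \<open>FP_add\<close>, is
  a consequence of the step equations.\<close>

lemma skew_system:
  assumes "regular_map (CM D X p)"
  shows "\<exists>F P. skew (int n) d x chi F P"
proof -
  have ex: "\<exists>f. pres_iso (CM D X p) (CM D X p) f \<and> f (0, False) = (0, False) \<and> f (x 0) = x t" for t
  proof -
    have one: "\<one>\<^bsub>D\<^esub> \<in> carrier D" by simp
    have arc: "(\<one>\<^bsub>D\<^esub>, {\<one>\<^bsub>D\<^esub>, x t}) \<in> arcs (CM D X p)" for t
    proof -
      have "\<one>\<^bsub>D\<^esub> \<in> verts (CM D X p) \<and> x t \<in> verts (CM D X p) \<and> adj (CM D X p) \<one>\<^bsub>D\<^esub> (x t)"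
        using x_carrier x_in by (simp add: CM_def)
      then show ?thesis unfolding arcs_def by blast
    qed
    obtain f where f: "pres_iso (CM D X p) (CM D X p) f" "f \<one>\<^bsub>D\<^esub> = \<one>\<^bsub>D\<^esub>" "f ` {\<one>\<^bsub>D\<^esub>, x 0} = {\<one>\<^bsub>D\<^esub>, x t}"
      using bspec[OF bspec[OF assms[unfolded regular_map_def] arc[of 0], unfolded prod.case] arc[of t], unfolded prod.case]
      by blast
    have "x t \<noteq> \<one>\<^bsub>D\<^esub>" using x_in X(2) by (metis one_dihedral)
    then have "f (x 0) = x t" using f by auto
    then show ?thesis using f by (auto simp: one_dihedral)
  qed
  define f where "f t = (SOME f. pres_iso (CM D X p) (CM D X p) f \<and> f (0, False) = (0, False) \<and> f (x 0) = x t)" for t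
  have f: "pres_iso (CM D X p) (CM D X p) (f t)" "f t (0, False) = (0, False)" "f t (x 0) = x t" for t
    using someI_ex[OF ex[of t]] unfolding f_def by auto
  have gi: "graph_iso (CM D X p) (CM D X p) (f t)" for t using f(1) by (simp add: pres_iso_def)
  define F where "F t g = f t (dred n g)" for t g
  define P where "P t g = off (f t) (dred n g)" for t g
  note dc = dred_closed[OF n_pos]
  have "skew (int n) d x chi F P"
  proof
    show "0 < int n" "0 < d" using n_pos card_X_pos by simp_all
    show "dih_eq (int n) (x i) (x j) \<longleftrightarrow> d dvd i - j" for i j
      using dih_eq_carrier[OF x_carrier x_carrier] x_eq_iff by simp
    show "dih_eq (int n) (dmul (x i) (x (chi i))) (0, False)" for i
      using x_inv[of i] dih_eq_dred(2) unfolding mult_dihedral one_dihedral by metis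
    show "dih_eq (int n) (F t g) (F t h)" "d dvd P t g - P t h" if "dih_eq (int n) g h" for t g h
      using that by (simp_all add: F_def P_def dred_eq[symmetric])
    show "dih_eq (int n) (F t (0, False)) (0, False)" for t
      using f(2) by (simp add: F_def dred_def)
    show "d dvd P t (0, False) - t" for t
    proof -
      have "f t (\<one>\<^bsub>D\<^esub> \<otimes>\<^bsub>D\<^esub> x 0) = f t \<one>\<^bsub>D\<^esub> \<otimes>\<^bsub>D\<^esub> x (off (f t) \<one>\<^bsub>D\<^esub>)" by (rule off[OF gi]) simp
      then have "x t = x (off (f t) \<one>\<^bsub>D\<^esub>)" using f(2,3) x_carrier by (simp add: one_dihedral[of n, symmetric])
      then show ?thesis by (simp add: P_def dred_def one_dihedral x_eq_iff dvd_diff_commute)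
    qed
    show "dih_eq (int n) (F t (dmul g (x i))) (dmul (F t g) (x (i + P t g)))" for t g i
      unfolding F_def P_def x_mult pres_step[OF f(1) dc] unfolding mult_dihedral by (rule dih_eq_dred(1))
    show "d dvd P t (dmul g (x i)) - (chi (i + P t g) - chi i)" for t g i
      using off_step[OF gi dc, of 1 t g i] pres_step[OF f(1), of _ t] by (simp add: P_def x_mult)
    show "Q g" if "\<And>g h. dih_eq (int n) g h \<Longrightarrow> Q g \<Longrightarrow> Q h" "Q (0, False)"
      "\<And>g i. Q g \<Longrightarrow> Q (dmul g (x i))" for Q g
      by (rule gen_induct[of Q]) (use that in blast)+
  qed
  then show ?thesis by blast
qed

lemma rskew_system:
  assumes "reflexible_regular_map (CM D X p)"
  shows "\<exists>F P. skew (int n) d x chi F P \<and>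
    (\<forall>a. \<exists>G S. rskew (int n) d (\<lambda>i. x (i + a)) (\<lambda>i. chi (i + a) - a) F P G S)"
proof -
  obtain F P where sk: "skew (int n) d x chi F P"
    using skew_system assms by (auto simp: reflexible_regular_map_def)
  obtain f where f: "rev_iso (CM D X p) (CM D X p) f" using assms by (auto simp: reflexible_regular_map_def)
  then have gi: "graph_iso (CM D X p) (CM D X p) f" by (simp add: rev_iso_def)
  \<comment> \<open>The reversing automorphism may move 1; a left translation brings it back without
    changing the offsets.\<close>
  define g0 where "g0 = inv\<^bsub>D\<^esub> (f \<one>\<^bsub>D\<^esub>)"
  have g0: "g0 \<in> carrier D" using graph_iso_closed[OF gi] by (simp add: g0_def)
  define G where "G g = g0 \<otimes>\<^bsub>D\<^esub> f (dred n g)" for g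
  define S where "S g = off f (dred n g)" for g
  note dc = dred_closed[OF n_pos]
  have "\<exists>G S. rskew (int n) d (\<lambda>i. x (i + a)) (\<lambda>i. chi (i + a) - a) F P G S" for a
  proof (rule rskew_shift[OF sk, where G = G and S = S])
    show "dih_eq (int n) (G g) (G h)" "d dvd S g - S h" if "dih_eq (int n) g h" for g h
      using that by (simp_all add: G_def S_def dred_eq[symmetric])
    show "dih_eq (int n) (G (0, False)) (0, False)"
      using graph_iso_closed[OF gi, of "\<one>\<^bsub>D\<^esub>"]
      by (simp add: G_def dred_def g0_def one_dihedral[of n, symmetric]) (simp add: one_dihedral)
    show "dih_eq (int n) (G (dmul g (x i))) (dmul (G g) (x (S g - i)))" for g i
    proof -
      have "G (dmul g (x i)) = G g \<otimes>\<^bsub>D\<^esub> x (S g - i)"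
        using rev_step[OF f dc, of g i] g0 graph_iso_closed[OF gi dc, of g] x_carrier
        by (simp add: G_def S_def x_mult D.m_assoc)
      then show ?thesis unfolding mult_dihedral by (simp only: dih_eq_dred(1))
    qed
    show "d dvd S (dmul g (x i)) - (chi (S g - i) + chi i)" for g i
      using off_step[OF gi dc, of "- 1" g i] rev_step[OF f] by (simp add: S_def x_mult algebra_simps)
  qed
  with sk show ?thesis by blast
qed

section \<open>Identification with the listed cycles\<close>

lemma isomorphicI:
  assumes len: "length ys = card X" and dist: "distinct ys"
    and bij: "bij_betw f (carrier D) (carrier D)"
    and hom: "\<And>g h. g \<in> carrier D \<Longrightarrow> h \<in> carrier D \<Longrightarrow> f (g \<otimes>\<^bsub>D\<^esub> h) = f g \<otimes>\<^bsub>D\<^esub> f h"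
    and fx: "\<And>k. k < card X \<Longrightarrow> f (x (a + int k)) = ys ! k"
  shows "CM D X p \<simeq>\<^sub>m CM_cycle D ys"
proof -
  have fc: "f g \<in> carrier D" if "g \<in> carrier D" for g using bij that by (auto simp: bij_betw_def)
  have f1: "f \<one>\<^bsub>D\<^esub> = \<one>\<^bsub>D\<^esub>"
    using hom[of "\<one>\<^bsub>D\<^esub>" "\<one>\<^bsub>D\<^esub>"] fc[of "\<one>\<^bsub>D\<^esub>"] by (simp add: D.l_cancel_one)
  have finv: "f (inv\<^bsub>D\<^esub> g \<otimes>\<^bsub>D\<^esub> h) = inv\<^bsub>D\<^esub> (f g) \<otimes>\<^bsub>D\<^esub> f h" if "g \<in> carrier D" "h \<in> carrier D" for g h
  proof -
    have "f (inv\<^bsub>D\<^esub> g) \<otimes>\<^bsub>D\<^esub> f g = \<one>\<^bsub>D\<^esub>" using hom[of "inv\<^bsub>D\<^esub> g" g] that f1 by simp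
    then have "inv\<^bsub>D\<^esub> (f g) = f (inv\<^bsub>D\<^esub> g)" using fc that by (intro D.inv_equality) auto
    then show ?thesis using hom that by simp
  qed
  have idx: "\<exists>k<card X. y = x (a + int k)" if "y \<in> X" for y
  proof -
    obtain i where i: "y = x i" using x_surj \<open>y \<in> X\<close> by blast
    define k where "k = nat ((i - a) mod d)"
    have k: "k < card X" using card_X_pos by (simp add: k_def nat_less_iff)
    have "d dvd i - (a + int k)"
      using card_X_pos by (simp add: k_def mod_eq_dvd_iff[symmetric] mod_add_right_eq)
    then show ?thesis using k i x_eq_iff by blast
  qed
  have img: "f ` X = set ys"
  proof
    show "f ` X \<subseteq> set ys" using idx fx len by (auto simp: set_conv_nth) metis
    show "set ys \<subseteq> f ` X" using fx len x_in by (auto simp: set_conv_nth image_def) metis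
  qed
  have inX: "y \<in> X \<longleftrightarrow> f y \<in> set ys" if "y \<in> carrier D" for y
    using that X(1) bij unfolding img[symmetric] by (auto simp: bij_betw_def inj_on_def)
  have fp: "f (p y) = cycle_of_list ys (f y)" if y: "y \<in> X" for y
  proof -
    obtain k where k: "k < card X" "y = x (a + int k)" using idx[OF y] by blast
    have "cycle_of_list ys (f y) = ys ! (Suc k mod card X)"
      using fx[OF k(1)] k cycle_of_list_nth[OF dist] len by simp
    also have "\<dots> = f (x (a + int (Suc k mod card X)))" using fx[of "Suc k mod card X"] card_X_pos by simp
    also have "x (a + int (Suc k mod card X)) = x (a + int (Suc k))"
      unfolding x_eq_iff by (simp add: zmod_int mod_eq_dvd_iff[symmetric])
    also have "\<dots> = p y" by (simp add: k p_x algebra_simps)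
    finally show ?thesis by simp
  qed
  have "pres_iso (CM D X p) (CM_cycle D ys) f"
    unfolding pres_iso_def graph_iso_def
  proof (intro conjI ballI impI)
    show "bij_betw f (verts (CM D X p)) (verts (CM_cycle D ys))"
      using bij by (simp add: CM_def CM_cycle_def)
    fix v w assume v: "v \<in> verts (CM D X p)" and w: "w \<in> verts (CM D X p)"
    then have c: "v \<in> carrier D" "w \<in> carrier D" by (simp_all add: CM_def)
    then have c': "inv\<^bsub>D\<^esub> v \<otimes>\<^bsub>D\<^esub> w \<in> carrier D" by simp
    show "adj (CM D X p) v w = adj (CM_cycle D ys) (f v) (f w)"
      using c fc inX[OF c'] finv by (simp add: CM_def CM_cycle_def)
    assume "adj (CM D X p) v w"
    then have y: "inv\<^bsub>D\<^esub> v \<otimes>\<^bsub>D\<^esub> w \<in> X" by (simp add: CM_def)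
    have "p (inv\<^bsub>D\<^esub> v \<otimes>\<^bsub>D\<^esub> w) \<in> X" using y permutes_in_image[OF X(5)] by simp
    then have "p (inv\<^bsub>D\<^esub> v \<otimes>\<^bsub>D\<^esub> w) \<in> carrier D" using X(1) by auto
    then show "f (rot (CM D X p) v w) = rot (CM_cycle D ys) (f v) (f w)"
      using fp[OF y] hom[of v "p (inv\<^bsub>D\<^esub> v \<otimes>\<^bsub>D\<^esub> w)"] finv c by (simp add: CM_def CM_cycle_def)
  qed
  then show ?thesis unfolding map_isomorphic_def by blast
qed

end

lemma one_in_p_shift:
  assumes "one_in_p p x chi b" "p dvd a - b"
  shows "one_in_p p (\<lambda>i. x (i + a)) (\<lambda>i. chi (i + a) - a) 0"
proof -
  have "snd (x (i + a)) \<longleftrightarrow> p dvd i" for i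
  proof -
    have "snd (x (i + a)) \<longleftrightarrow> p dvd i + (a - b)" using assms(1) by (simp add: one_in_p_def algebra_simps)
    then show ?thesis using assms(2) by (simp add: dvd_add_left_iff)
  qed
  moreover have "p dvd chi (i + a) - a + i" for i
  proof -
    have "p dvd chi (i + a) + (i + a) - 2 * b" using assms(1) by (simp add: one_in_p_def)
    then show ?thesis using assms(2) by (rule dvd_comb2[where a = 1 and b = "- 2"]) simp
  qed
  ultimately show ?thesis by (simp add: one_in_p_def)
qed

lemma two_in_4_shift:
  assumes "two_in_4 x chi a"
  shows "two_in_4 (\<lambda>i. x (i + a)) (\<lambda>i. chi (i + a) - a) 0"
  unfolding two_in_4_def
proof (intro conjI allI impI)
  show "snd (x (i + a)) \<longleftrightarrow> 4 dvd i - 0 \<or> 4 dvd i - 0 - 1" for i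
    using assms by (simp add: two_in_4_def)
  show "4 dvd chi (i + a) - a + i - 2 * 0 - 5" if "\<not> snd (x (i + a))" for i
  proof -
    have "4 dvd chi (i + a) + (i + a) - 2 * a - 5" using assms that unfolding two_in_4_def by blast
    then show ?thesis by (simp add: algebra_simps)
  qed
qed

context cayley_dihedral
begin

text \<open>The map isomorphism \<open>f\<close> is the inverse of the group automorphism taking
  \<open>a\<close> to \<open>a^\<beta>\<close> and \<open>b\<close> to \<open>a^c b\<close>. Thus
  the exponents of the given map may be the listed ones up to a unit and, on reflections, a
  translation.\<close>

lemma isomorphic_affine:
  assumes cop: "coprime \<beta> (int n)" and len: "length ys = card X"
    and ys: "\<And>k. k < card X \<Longrightarrow> ys ! k = (if snd (x (int k + a)) then apow_b n (t k) else apow n (t k))"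
    and t: "\<And>k. k < card X \<Longrightarrow>
      int n dvd fst (x (int k + a)) - ((if snd (x (int k + a)) then c else 0) + \<beta> * t k)"
  shows "CM D X p \<simeq>\<^sub>m CM_cycle D ys"
proof -
  obtain \<gamma> where "[\<beta> * \<gamma> = 1] (mod int n)" using cop cong_solve_coprime_int by blast
  then have \<gamma>: "int n dvd \<beta> * \<gamma> - 1" by (simp add: cong_iff_dvd_diff)
  define f where "f g = (\<gamma> * (fst g - (if snd g then c else 0)) mod int n, snd g)" for g :: "int \<times> bool"
  have fc: "f g \<in> carrier D" for g using n_pos by (simp add: f_def dihedral_def)
  have f_dred: "f (dred n g) = f g" for g
  proof -
    have "int n dvd \<gamma> * (fst g mod int n - e) - \<gamma> * (fst g - e)" for e
    proof -
      have "\<gamma> * (fst g mod int n - e) - \<gamma> * (fst g - e) = int n * (- \<gamma> * (fst g div int n))"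
        unfolding minus_mult_div_eq_mod[symmetric] by (simp add: algebra_simps)
      then show ?thesis by simp
    qed
    then show ?thesis by (simp add: f_def dred_def mod_eq_dvd_iff)
  qed
  have hom: "f (g \<otimes>\<^bsub>D\<^esub> h) = f g \<otimes>\<^bsub>D\<^esub> f h" for g h
    unfolding mult_dihedral f_dred
    by (cases g; cases h) (auto simp: f_def dred_def dmul_def mod_simps; simp add: algebra_simps)
  have inj: "inj_on f (carrier D)"
  proof (rule inj_onI)
    fix g h assume gh: "g \<in> carrier D" "h \<in> carrier D" "f g = f h"
    then have s: "snd g = snd h" by (simp add: f_def)
    with gh(3) have "int n dvd \<gamma> * (fst g - fst h)"
      by (auto simp: f_def mod_eq_dvd_iff algebra_simps split: if_splits)
    with \<gamma> have "int n dvd fst g - fst h"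
      by (rule dvd_comb2[where a = "- (fst g - fst h)" and b = \<beta>]) (simp add: algebra_simps)
    with s show "g = h" using dih_eq_carrier[OF gh(1,2)] by (simp add: dih_eq_def)
  qed
  have bij: "bij_betw f (carrier D) (carrier D)"
    unfolding bij_betw_def using inj fc endo_inj_surj[OF finite_dihedral _ inj] by blast
  have fx: "f (x (a + int k)) = ys ! k" if k: "k < card X" for k
  proof -
    have "int n dvd \<gamma> * (fst (x (a + int k)) - (if snd (x (a + int k)) then c else 0)) - t k"
      using t[OF k] \<gamma> by (rule dvd_comb2[where a = \<gamma> and b = "t k"]) (simp add: algebra_simps)
    then show ?thesis using ys[OF k] n_pos
      by (auto simp: f_def apow_eq apow_b_eq mod_eq_dvd_iff add.commute)
  qed
  have "distinct ys"
    unfolding distinct_conv_nth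
  proof (intro allI impI)
    fix i j assume ij: "i < length ys" "j < length ys" "i \<noteq> j"
    have "x (a + int i) \<noteq> x (a + int j)"
    proof
      assume "x (a + int i) = x (a + int j)"
      then have "int i mod d = int j mod d" by (simp add: x_eq_iff mod_eq_dvd_iff)
      then show False using ij len by simp
    qed
    then have "f (x (a + int i)) \<noteq> f (x (a + int j))"
      using inj x_carrier by (auto simp: inj_on_def)
    then show "ys ! i \<noteq> ys ! j" using fx ij len by simp
  qed
  then show ?thesis using isomorphicI[OF len _ bij hom fx] by blast
qed

lemma all_reflections:
  assumes refl: "reflexible_regular_map (CM D X p)" and Y: "\<And>i. snd (x i)"
  obtains l where "[l\<^sup>2 = 1] (mod int n)" "least_geom_sum_zero n l (card X)"
    "CM D X p \<simeq>\<^sub>m CM_cycle D (cyc1 n l (card X))"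
proof -
  obtain F P G S where "rskew (int n) d (\<lambda>i. x (i + 0)) (\<lambda>i. chi (i + 0) - 0) F P G S"
    using rskew_system[OF refl] by blast
  then have rs: "rskew (int n) d x chi F P G S" by simp
  define \<beta> where "\<beta> = fst (x 1) - fst (x 0)"
  obtain l where l: "int n dvd l\<^sup>2 - 1" and cop: "coprime \<beta> (int n)"
    and lin: "\<And>k::nat. int n dvd fst (x (int k)) - (fst (x 0) + \<beta> * (\<Sum>i<k. l ^ i))"
    unfolding \<beta>_def by (rule rskew.all_ref_scalar[OF rs Y]) blast
  \<comment> \<open>Two entries coincide exactly when a geometric sum vanishes, so the minimality in
    \<open>least_geom_sum_zero\<close> is the statement that \<open>card X\<close> is the period of
    the cycle.\<close>
  have zero: "int n dvd (\<Sum>i<k. l ^ i) \<longleftrightarrow> d dvd int k" for k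
  proof -
    have "d dvd int k \<longleftrightarrow> x (int k) = x 0" by (simp add: x_eq_iff)
    also have "\<dots> \<longleftrightarrow> int n dvd fst (x (int k)) - fst (x 0)"
      using dih_eq_carrier[OF x_carrier x_carrier, of "int k" 0] Y by (simp add: dih_eq_def)
    also have "\<dots> \<longleftrightarrow> int n dvd \<beta> * (\<Sum>i<k. l ^ i)"
    proof
      assume "int n dvd fst (x (int k)) - fst (x 0)"
      with lin[of k] show "int n dvd \<beta> * (\<Sum>i<k. l ^ i)"
        by (rule dvd_comb2[where a = "- 1" and b = 1]) simp
    next
      assume "int n dvd \<beta> * (\<Sum>i<k. l ^ i)"
      with lin[of k] show "int n dvd fst (x (int k)) - fst (x 0)"
        by (rule dvd_comb2[where a = 1 and b = 1]) simp
    qed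
    also have "\<dots> \<longleftrightarrow> int n dvd (\<Sum>i<k. l ^ i)"
      using cop by (simp add: coprime_dvd_mult_right_iff coprime_commute)
    finally show ?thesis by simp
  qed
  have "least_geom_sum_zero n l (card X)"
    unfolding least_geom_sum_zero_def cong_0_iff zero using card_X_pos by (auto dest: dvd_imp_le)
  moreover have "CM D X p \<simeq>\<^sub>m CM_cycle D (cyc1 n l (card X))"
  proof (rule isomorphic_affine[OF cop, where a = 0 and c = "fst (x 0)" and t = "\<lambda>k. \<Sum>i<k. l ^ i"])
    show "int n dvd fst (x (int k + 0)) - ((if snd (x (int k + 0)) then fst (x 0) else 0) + \<beta> * (\<Sum>i<k. l ^ i))" for k
      using lin[of k] Y by simp
  qed (use Y in \<open>simp_all add: cyc1_def\<close>)
  moreover have "[l\<^sup>2 = 1] (mod int n)" using l by (simp add: cong_iff_dvd_diff)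
  ultimately show thesis using that by blast
qed

lemma two_in_4_isomorphic:
  assumes rs: "rskew (int n) d (\<lambda>i. x (i + a)) (\<lambda>i. chi (i + a) - a) F P G S"
    and pat: "two_in_4 x chi a"
  shows "card X = 4 \<and> 3 dvd n \<and> CM D X p \<simeq>\<^sub>m CM_cycle D (cyc4 n)"
proof -
  have pat': "two_in_4 (\<lambda>i. x (i + a)) (\<lambda>i. chi (i + a) - a) 0"
    using pat by (rule two_in_4_shift)
  have d: "d = 4" and n3: "3 dvd int n" and cop: "coprime (fst (x (2 + a))) (int n)"
    and s1: "int n dvd fst (x (1 + a)) - (fst (x (0 + a)) - 2 * fst (x (2 + a)))"
    and s3: "int n dvd fst (x (3 + a)) + fst (x (2 + a))"
    using rskew.two_in_4_case[OF rs pat'] by simp_all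
  have c: "card X = 4" using d by simp
  have s1': "int n dvd fst (x (1 + a)) - (fst (x a) + - fst (x (2 + a)) * 2)"
    using s1 by (simp add: algebra_simps)
  have Y: "snd (x (i + a)) \<longleftrightarrow> 4 dvd i \<or> 4 dvd i - 1" for i
    using pat by (simp add: two_in_4_def)
  have per: "x (4 + a) = x a" "x (5 + a) = x (1 + a)" by (simp_all add: x_eq_iff d)
  \<comment> \<open>The listed cycle starts with its two rotations, hence the base index
    \<open>2 + a\<close>; the sign of the unit makes the first entry \<open>a^-1\<close>.\<close>
  have "CM D X p \<simeq>\<^sub>m CM_cycle D (cyc4 n)"
  proof (rule isomorphic_affine[where \<beta> = "- fst (x (2 + a))" and a = "2 + a" and c = "fst (x a)" and t = "(!) [-1, 1, 0, 2]"])
    show "coprime (- fst (x (2 + a))) (int n)" using cop by simp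
    show "length (cyc4 n) = card X" by (simp add: cyc4_def c)
    fix k assume "k < card X"
    then have k: "k = 0 \<or> k = 1 \<or> k = 2 \<or> k = 3" unfolding c by auto
    then show "cyc4 n ! k = (if snd (x (int k + (2 + a))) then apow_b n ([- 1, 1, 0, 2] ! k)
        else apow n ([- 1, 1, 0, 2] ! k))"
      by (elim disjE) (simp_all add: cyc4_def Y add.assoc[symmetric] per Y[of 0, simplified])
    show "int n dvd fst (x (int k + (2 + a))) - ((if snd (x (int k + (2 + a))) then fst (x a) else 0) +
        - fst (x (2 + a)) * [- 1, 1, 0, 2] ! k)"
      using k s1' s3 by (elim disjE) (simp_all add: Y add.assoc[symmetric] per Y[of 0, simplified])
  qed
  then show ?thesis using c n3 by presburger
qed

lemma dvd_half_odd: "int n = 2 * m \<Longrightarrow> odd b \<Longrightarrow> int n dvd m * b - m"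
  by (elim oddE) (simp add: algebra_simps)

lemma coprime_even_odd: "coprime b (int n) \<Longrightarrow> int n = 2 * m \<Longrightarrow> odd b"
  by auto

lemma two_in_3_isomorphic:
  assumes rs: "rskew (int n) d (\<lambda>i. x (i + a)) (\<lambda>i. chi (i + a) - a) F P G S"
    and pat: "two_in_3 x a"
  shows "card X = 3 \<and> CM D X p \<simeq>\<^sub>m CM_cycle (dihedral 2) [apow_b 2 0, apow_b 2 1, apow 2 1] \<or>
    card X = 6 \<and> (\<exists>m k. 0 < k \<and> n = 2 * m \<and> n = 4 * k + 2 \<and> CM D X p \<simeq>\<^sub>m CM_cycle D (cyc6 n m))"
proof -
  have pat': "two_in_3 (\<lambda>i. x (i + a)) 0"
    using pat by (auto simp: two_in_3_def algebra_simps)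
  have Y: "snd (x (i + a)) \<longleftrightarrow> \<not> 3 dvd i - 2" for i
    using pat by (simp add: two_in_3_def)
  consider (1) "d = 3" "int n = 2" "odd (fst (x (1 + a)) - fst (x (0 + a)))" "odd (fst (x (2 + a)))"
    | (2) m where "d = 6" "int n = 2 * m" "odd m" "1 < m" "coprime (fst (x (2 + a))) (int n)"
      "int n dvd fst (x (1 + a)) - (fst (x (0 + a)) + m - 2 * fst (x (2 + a)))"
      "int n dvd fst (x (3 + a)) - (fst (x (0 + a)) - 2 * fst (x (2 + a)))"
      "int n dvd fst (x (4 + a)) - (fst (x (0 + a)) + m)" "int n dvd fst (x (5 + a)) + fst (x (2 + a))"
    using rskew.two_in_3_case[OF rs pat'] by blast
  then show ?thesis
  proof cases
    case 1
    then have c: "card X = 3" "n = 2" by simp_all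
    have "CM D X p \<simeq>\<^sub>m CM_cycle D [apow_b n 0, apow_b n 1, apow n 1]"
    proof (rule isomorphic_affine[where \<beta> = 1 and a = a and c = "fst (x a)" and t = "(!) [0, 1, 1]"])
      show "coprime 1 (int n)" "length [apow_b n 0, apow_b n 1, apow n 1] = card X" by (simp_all add: c)
      fix k assume "k < card X"
      then have k: "k = 0 \<or> k = 1 \<or> k = 2" unfolding c by auto
      then show "[apow_b n 0, apow_b n 1, apow n 1] ! k =
          (if snd (x (int k + a)) then apow_b n ([0, 1, 1] ! k) else apow n ([0, 1, 1] ! k))"
        by (elim disjE) (simp_all add: Y Y[of 0, simplified])
      show "int n dvd fst (x (int k + a)) - ((if snd (x (int k + a)) then fst (x a) else 0) + 1 * [0, 1, 1] ! k)"
        using k 1 by (elim disjE) (simp_all add: Y Y[of 0, simplified])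
    qed
    then show ?thesis using c by simp
  next
    case (2 m)
    have c: "card X = 6" using 2(1) by simp
    obtain q where q: "m = int q" using 2(4) by (metis zero_le_imp_eq_int less_imp_le zero_less_one less_trans)
    have n: "n = 2 * q" using 2(2) q by linarith
    have "odd q" "1 < q" using 2(3,4) q by simp_all
    then obtain k where k: "q = 2 * k + 1" "0 < k" by (auto elim: oddE)
    \<comment> \<open>The unit is odd, so multiplying the half \<open>m\<close> of \<open>n\<close>
      by it changes nothing modulo \<open>n\<close>.\<close>
    have h: "int n dvd m * fst (x (2 + a)) - m"
      using dvd_half_odd[OF 2(2)] coprime_even_odd[OF 2(5,2)] by simp
    note f1 = 2(6) and f3 = 2(7) and f4 = 2(8) and f5 = 2(9)
    have g1: "int n dvd fst (x (1 + a)) - (fst (x a) + fst (x (2 + a)) * (m - 2))"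
      using f1 h by (rule dvd_comb2[where a = 1 and b = "- 1"]) (simp add: algebra_simps)
    have g4: "int n dvd fst (x (4 + a)) - (fst (x a) + fst (x (2 + a)) * m)"
      using f4 h by (rule dvd_comb2[where a = 1 and b = "- 1"]) (simp add: algebra_simps)
    have "CM D X p \<simeq>\<^sub>m CM_cycle D (cyc6 n q)"
    proof (rule isomorphic_affine[where \<beta> = "fst (x (2 + a))" and a = a and c = "fst (x a)" and t = "(!) [0, m - 2, 1, -2, m, -1]", OF 2(5)])
      show "length (cyc6 n q) = card X" by (simp add: cyc6_def c)
      fix k assume "k < card X"
      then have k: "k = 0 \<or> k = 1 \<or> k = 2 \<or> k = 3 \<or> k = 4 \<or> k = 5" unfolding c by auto
      then show "cyc6 n q ! k = (if snd (x (int k + a)) then apow_b n ([0, m - 2, 1, -2, m, -1] ! k)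
          else apow n ([0, m - 2, 1, -2, m, -1] ! k))"
        by (elim disjE) (simp_all add: Y Y[of 0, simplified] cyc6_def q)
      show "int n dvd fst (x (int k + a)) - ((if snd (x (int k + a)) then fst (x a) else 0) +
          fst (x (2 + a)) * [0, m - 2, 1, -2, m, -1] ! k)"
        using k g1 f3 g4 f5 by (elim disjE) (simp_all add: Y Y[of 0, simplified] mult.commute)
    qed
    then show ?thesis using c n k by fastforce
  qed
qed

lemma one_in_3_isomorphic:
  assumes rs: "rskew (int n) d (\<lambda>i. x (i + a)) (\<lambda>i. chi (i + a) - a) F P G S"
    and pat: "one_in_p 3 x chi a"
  shows "card X = 3 \<and> CM D X p \<simeq>\<^sub>m CM_cycle (dihedral 4) [apow_b 4 0, apow 4 1, apow 4 (- 1)] \<or>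
    card X = 6 \<and> (\<exists>m k. 0 < k \<and> n = 2 * m \<and> n = 8 * k + 4 \<and> CM D X p \<simeq>\<^sub>m CM_cycle D (cyc5 n m))"
proof -
  have pat': "one_in_p 3 (\<lambda>i. x (i + a)) (\<lambda>i. chi (i + a) - a) 0"
    using pat by (rule one_in_p_shift) simp
  have Y: "snd (x (i + a)) \<longleftrightarrow> 3 dvd i" for i
    using pat by (simp add: one_in_p_def)
  consider (1) "d = 3" "int n = 4" "coprime (fst (x (1 + a))) (int n)" "int n dvd fst (x (2 + a)) + fst (x (1 + a))"
    | (2) m where "d = 6" "int n = 2 * m" "4 dvd m - 2" "2 < m" "coprime (fst (x (5 + a))) (int n)"
      "int n dvd fst (x (4 + a)) + fst (x (5 + a))"
      "int n dvd fst (x (1 + a)) - (m + fst (x (5 + a)))" "int n dvd fst (x (2 + a)) - (m - fst (x (5 + a)))"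
      "int n dvd fst (x (3 + a)) - (fst (x (0 + a)) + m + 2 * fst (x (5 + a)))"
    using rskew.one_in_3_case[OF rs pat'] by blast
  then show ?thesis
  proof cases
    case 1
    then have c: "card X = 3" "n = 4" by simp_all
    have "CM D X p \<simeq>\<^sub>m CM_cycle D [apow_b n 0, apow n 1, apow n (- 1)]"
    proof (rule isomorphic_affine[where a = a and c = "fst (x a)" and t = "(!) [0, 1, -1]", OF 1(3)])
      show "length [apow_b n 0, apow n 1, apow n (- 1)] = card X" by (simp add: c)
      fix k assume "k < card X"
      then have k: "k = 0 \<or> k = 1 \<or> k = 2" unfolding c by auto
      then show "[apow_b n 0, apow n 1, apow n (- 1)] ! k =
          (if snd (x (int k + a)) then apow_b n ([0, 1, - 1] ! k) else apow n ([0, 1, - 1] ! k))"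
        by (elim disjE) (simp_all add: Y Y[of 0, simplified])
      show "int n dvd fst (x (int k + a)) - ((if snd (x (int k + a)) then fst (x a) else 0) +
          fst (x (1 + a)) * [0, 1, - 1] ! k)"
        using k 1(4) by (elim disjE) (simp_all add: Y Y[of 0, simplified])
    qed
    then show ?thesis using c by simp
  next
    case (2 m)
    have c: "card X = 6" using 2(1) by simp
    obtain q where q: "m = int q" using 2(4) by (metis zero_le_imp_eq_int less_imp_le zero_less_numeral less_trans)
    have n: "n = 2 * q" using 2(2) q by linarith
    have "4 dvd int q - 2" "2 < q" using 2(3,4) q by simp_all
    then obtain k where k: "q = 4 * k + 2" "0 < k"
      by (metis add.commute add_0 dvdE gr_zeroI less_irrefl less_imp_le mult_0_right
          of_nat_dvd_iff of_nat_diff of_nat_numeral le_add_diff_inverse)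
    have h: "int n dvd m * fst (x (5 + a)) - m"
      using dvd_half_odd[OF 2(2)] coprime_even_odd[OF 2(5,2)] by simp
    note f4 = 2(6) and f1 = 2(7) and f2 = 2(8) and f3 = 2(9)
    have g1: "int n dvd fst (x (1 + a)) - fst (x (5 + a)) * (m + 1)"
      using f1 h by (rule dvd_comb2[where a = 1 and b = "- 1"]) (simp add: algebra_simps)
    have g2: "int n dvd fst (x (2 + a)) - fst (x (5 + a)) * (m - 1)"
      using f2 h by (rule dvd_comb2[where a = 1 and b = "- 1"]) (simp add: algebra_simps)
    have g3: "int n dvd fst (x (3 + a)) - (fst (x a) + fst (x (5 + a)) * (m + 2))"
      using f3 h by (rule dvd_comb2[where a = 1 and b = "- 1"]) (simp add: algebra_simps)
    have per: "x (6 + a) = x a" "x (7 + a) = x (1 + a)" "x (8 + a) = x (2 + a)" "x (9 + a) = x (3 + a)"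
      by (simp_all add: x_eq_iff 2(1))
    \<comment> \<open>The listed cycle starts with the mutually inverse rotations at the indices 4
      and 5, and the exponent of the second serves as the unit.\<close>
    have "CM D X p \<simeq>\<^sub>m CM_cycle D (cyc5 n q)"
    proof (rule isomorphic_affine[where \<beta> = "fst (x (5 + a))" and a = "4 + a" and c = "fst (x a)" and
          t = "(!) [-1, 1, 0, m + 1, m - 1, m + 2]", OF 2(5)])
      show "length (cyc5 n q) = card X" by (simp add: cyc5_def c)
      fix k assume "k < card X"
      then have k: "k = 0 \<or> k = 1 \<or> k = 2 \<or> k = 3 \<or> k = 4 \<or> k = 5" unfolding c by auto
      then show "cyc5 n q ! k = (if snd (x (int k + (4 + a))) then apow_b n ([-1, 1, 0, m + 1, m - 1, m + 2] ! k)
          else apow n ([-1, 1, 0, m + 1, m - 1, m + 2] ! k))"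
        by (elim disjE) (simp_all add: Y Y[of 0, simplified] cyc5_def q add.assoc[symmetric] per)
      show "int n dvd fst (x (int k + (4 + a))) - ((if snd (x (int k + (4 + a))) then fst (x a) else 0) +
          fst (x (5 + a)) * [-1, 1, 0, m + 1, m - 1, m + 2] ! k)"
        using k f4 g1 g2 g3 by (elim disjE) (simp_all add: Y Y[of 0, simplified] add.assoc[symmetric] per)
    qed
    then show ?thesis using c n k by fastforce
  qed
qed

text \<open>The cycles \<open>(b, a)\<close> and \<open>(b, ab)\<close> are related by the
  automorphism that fixes \<open>b\<close> and takes \<open>a\<close> to \<open>ab\<close>. It mixes
  rotations with reflections, which is special to the Klein four-group, so
  \<open>isomorphic_affine\<close> does not cover it.\<close>

lemma klein_isomorphic:
  assumes n: "n = 2" and c: "card X = 2" and x0: "snd (x a)" and x1: "\<not> snd (x (1 + a))" "odd (fst (x (1 + a)))"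
  shows "CM D X p \<simeq>\<^sub>m CM_cycle D [apow_b n 0, apow_b n 1]"
proof -
  define u where "u g = fst g - (if snd g then fst (x a) else 0)" for g :: "int \<times> bool"
  define f where "f g = (u g mod 2, snd g \<noteq> odd (u g))" for g :: "int \<times> bool"
  have hom: "f (g \<otimes>\<^bsub>D\<^esub> h) = f g \<otimes>\<^bsub>D\<^esub> f h" for g h
    by (cases g; cases h) (auto simp: n f_def u_def dihedral_def mod_simps algebra_simps; presburger)
  have inj: "inj_on f (carrier D)"
  proof (rule inj_onI)
    fix g h assume gh: "g \<in> carrier D" "h \<in> carrier D" "f g = f h"
    then have u: "2 dvd u g - u h" by (simp add: f_def mod_eq_dvd_iff)
    then have "odd (u g) \<longleftrightarrow> odd (u h)" by simp
    with gh(3) have s: "snd g = snd h" by (simp add: f_def) blast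
    with u have "2 dvd fst g - fst h" by (auto simp: u_def split: if_splits)
    with s show "g = h" using dih_eq_carrier[OF gh(1,2)] by (simp add: dih_eq_def n)
  qed
  have "f g \<in> carrier D" for g by (simp add: f_def dihedral_def n)
  then have bij: "bij_betw f (carrier D) (carrier D)"
    unfolding bij_betw_def using inj endo_inj_surj[OF finite_dihedral _ inj] by blast
  show ?thesis
  proof (rule isomorphicI[OF _ _ bij hom, of _ a])
    show "length [apow_b n 0, apow_b n 1] = card X" "distinct [apow_b n 0, apow_b n 1]"
      by (simp_all add: c n apow_b_eq)
    fix k assume "k < card X"
    then have "k = 0 \<or> k = 1" unfolding c by auto
    then show "f (x (a + int k)) = [apow_b n 0, apow_b n 1] ! k"
      using x0 x1 by (elim disjE) (auto simp: f_def u_def n apow_b_eq add.commute odd_iff_mod_2_eq_one)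
  qed
qed

lemma one_in_2_isomorphic:
  assumes refl: "reflexible_regular_map (CM D X p)" and pat: "one_in_p 2 x chi b"
  shows "card X = n \<and> even n \<and> (n = 2 \<longrightarrow> CM D X p \<simeq>\<^sub>m CM_cycle D [apow_b n 0, apow_b n 1]) \<and>
    (CM D X p \<simeq>\<^sub>m CM_cycle D (cyc2 n) \<or>
     (\<exists>m. n = 2 * m \<and> 8 dvd n \<and> CM D X p \<simeq>\<^sub>m CM_cycle D (cyc3 n m)))"
proof -
  obtain F P where sys: "\<And>a. \<exists>G S. rskew (int n) d (\<lambda>i. x (i + a)) (\<lambda>i. chi (i + a) - a) F P G S"
    using rskew_system[OF refl] by blast
  obtain G S where "rskew (int n) d (\<lambda>i. x (i + b)) (\<lambda>i. chi (i + b) - b) F P G S" using sys by blast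
  moreover have "one_in_p 2 (\<lambda>i. x (i + b)) (\<lambda>i. chi (i + b) - b) 0"
    using pat by (rule one_in_p_shift) simp
  ultimately obtain e where e: "even e" and ctr: "\<And>j. odd j \<Longrightarrow> d dvd chi (j + b) - b + j - 2 * e"
    by (rule rskew.one_in_2_center) blast
  define a where "a = e + b"
  have pat': "one_in_p 2 (\<lambda>i. x (i + a)) (\<lambda>i. chi (i + a) - a) 0"
    using pat by (rule one_in_p_shift) (simp add: a_def e)
  have ctr': "d dvd chi (j + a) - a + j" if "odd j" for j
    using ctr[of "j + e"] that e by (simp add: a_def algebra_simps)
  obtain G S where "rskew (int n) d (\<lambda>i. x (i + a)) (\<lambda>i. chi (i + a) - a) F P G S" using sys by blast
  from rskew.one_in_2_case[OF this pat' ctr'] have nd: "int n = d" and ev: "even (int n)"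
    and cop: "coprime (fst (x (1 + a))) (int n)"
    and od: "\<And>j. odd j \<Longrightarrow> int n dvd fst (x (j + a)) - j * fst (x (1 + a))"
    and alt: "(\<forall>i. int n dvd fst (x (2 * i + a)) - (fst (x (0 + a)) + 2 * i * fst (x (1 + a)))) \<or>
      8 dvd int n \<and> (\<forall>i. int n dvd fst (x (2 * i + a)) - (fst (x (0 + a)) + i * (2 + int n div 2) * fst (x (1 + a))))"
    by blast+
  have c: "card X = n" using nd by simp
  have Y: "snd (x (i + a)) \<longleftrightarrow> even i" for i
    using pat' by (simp add: one_in_p_def)
  have "CM D X p \<simeq>\<^sub>m CM_cycle D [apow_b n 0, apow_b n 1]" if n2: "n = 2"
  proof (rule klein_isomorphic[OF n2])
    show "odd (fst (x (1 + a)))" using cop n2 by auto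
    show "card X = 2" "snd (x a)" "\<not> snd (x (1 + a))" using c n2 Y[of 0] Y[of 1] by simp_all
  qed
  moreover have "CM D X p \<simeq>\<^sub>m CM_cycle D (cyc2 n) \<or>
     (\<exists>m. n = 2 * m \<and> 8 dvd n \<and> CM D X p \<simeq>\<^sub>m CM_cycle D (cyc3 n m))"
    using alt
  proof
    assume lin: "\<forall>i. int n dvd fst (x (2 * i + a)) - (fst (x (0 + a)) + 2 * i * fst (x (1 + a)))"
    have "CM D X p \<simeq>\<^sub>m CM_cycle D (cyc2 n)"
    proof (rule isomorphic_affine[where a = a and c = "fst (x a)" and t = int, OF cop])
      show "length (cyc2 n) = card X" by (simp add: cyc2_def c)
      fix k assume k: "k < card X"
      then show "cyc2 n ! k = (if snd (x (int k + a)) then apow_b n (int k) else apow n (int k))"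
        by (simp add: cyc2_def c Y)
      show "int n dvd fst (x (int k + a)) - ((if snd (x (int k + a)) then fst (x a) else 0) + fst (x (1 + a)) * int k)"
        using od[of "int k"] spec[OF lin, of "int k div 2"] by (auto simp: Y mult.commute)
    qed
    then show ?thesis ..
  next
    assume lin: "8 dvd int n \<and> (\<forall>i. int n dvd fst (x (2 * i + a)) - (fst (x (0 + a)) + i * (2 + int n div 2) * fst (x (1 + a))))"
    obtain m where m: "n = 2 * m" using ev by auto
    have "CM D X p \<simeq>\<^sub>m CM_cycle D (cyc3 n m)"
    proof (rule isomorphic_affine[where a = a and c = "fst (x a)" and
          t = "\<lambda>k. if even k then int (k + (k div 2) * m) else int k", OF cop])
      show "length (cyc3 n m) = card X" by (simp add: cyc3_def c)
      fix k assume k: "k < card X"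
      then show "cyc3 n m ! k = (if snd (x (int k + a)) then apow_b n (if even k then int (k + (k div 2) * m) else int k)
          else apow n (if even k then int (k + (k div 2) * m) else int k))"
        by (simp add: cyc3_def c Y)
      show "int n dvd fst (x (int k + a)) - ((if snd (x (int k + a)) then fst (x a) else 0) +
          fst (x (1 + a)) * (if even k then int (k + (k div 2) * m) else int k))"
      proof (cases "even k")
        case True
        then obtain h where h: "k = 2 * h" by blast
        show ?thesis using spec[OF conjunct2[OF lin], of "int h"] Y[of "2 * int h"] by (simp add: h m algebra_simps)
      next
        case False
        then show ?thesis using od[of "int k"] by (simp add: Y mult.commute)
      qed
    qed
    moreover have "8 dvd n" using conjunct1[OF lin] by presburger
    ultimately show ?thesis using m by blast
  qed
  ultimately show ?thesis using c ev by simp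
qed

end

lemma classification:
  assumes n2: "2 \<le> n" and R: "reflexible_regular_CM (dihedral n) X p" and d: "d = card X"
  shows "(d = 2 \<longrightarrow> CM (dihedral n) X p \<simeq>\<^sub>m CM_cycle (dihedral n) [apow_b n 0, apow_b n 1]) \<and>
        (d = 3 \<longrightarrow>
           CM (dihedral n) X p \<simeq>\<^sub>m CM_cycle (dihedral 2) [apow_b 2 0, apow_b 2 1, apow 2 1] \<or>
           CM (dihedral n) X p \<simeq>\<^sub>m CM_cycle (dihedral 3) [apow_b 3 0, apow_b 3 1, apow_b 3 2] \<or>
           CM (dihedral n) X p \<simeq>\<^sub>m CM_cycle (dihedral 4) [apow_b 4 0, apow 4 1, apow 4 (- 1)]) \<and>
        (d \<ge> 4 \<longrightarrow>
           (\<exists>l::int. [l\<^sup>2 = 1] (mod int n) \<and> least_geom_sum_zero n l d \<and>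
              CM (dihedral n) X p \<simeq>\<^sub>m CM_cycle (dihedral n) (cyc1 n l d)) \<or>
           (even n \<and> CM (dihedral n) X p \<simeq>\<^sub>m CM_cycle (dihedral n) (cyc2 n)) \<or>
           (\<exists>m. n = 2 * m \<and> 8 dvd n \<and>
              CM (dihedral n) X p \<simeq>\<^sub>m CM_cycle (dihedral n) (cyc3 n m)) \<or>
           (\<exists>k>0. n = 3 * k \<and>
              CM (dihedral n) X p \<simeq>\<^sub>m CM_cycle (dihedral n) (cyc4 n)) \<or>
           (\<exists>m. \<exists>k>0. n = 2 * m \<and> n = 8 * k + 4 \<and>
              CM (dihedral n) X p \<simeq>\<^sub>m CM_cycle (dihedral n) (cyc5 n m)) \<or>
           (\<exists>m. \<exists>k>0. n = 2 * m \<and> n = 4 * k + 2 \<and>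
              CM (dihedral n) X p \<simeq>\<^sub>m CM_cycle (dihedral n) (cyc6 n m)))"
    (is "?G2 \<and> ?G3 \<and> ?G4")
proof -
  interpret cayley_dihedral n X p
    using n2 R by unfold_locales (auto simp: reflexible_regular_CM_def)
  have refl: "reflexible_regular_map (CM D X p)" using R by (simp add: reflexible_regular_CM_def)
  show ?thesis
  proof (cases "\<forall>i. snd (x i)")
    case True
    then obtain l where l: "[l\<^sup>2 = 1] (mod int n)" "least_geom_sum_zero n l d"
      "CM D X p \<simeq>\<^sub>m CM_cycle D (cyc1 n l d)"
      using all_reflections[OF refl] d by metis
    have ?G2
    proof
      assume "d = 2"
      then have "cyc1 n l d = [apow_b n 0, apow_b n 1]" by (simp add: cyc1_def upt_rec numeral_2_eq_2)
      then show "CM D X p \<simeq>\<^sub>m CM_cycle D [apow_b n 0, apow_b n 1]" using l(3) by simp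
    qed
    moreover have "CM D X p \<simeq>\<^sub>m CM_cycle (dihedral 3) [apow_b 3 0, apow_b 3 1, apow_b 3 2]" if d3: "d = 3"
    proof -
      \<comment> \<open>\<open>1 + l + l * l = 0\<close> and \<open>l * l = 1\<close> give
        \<open>l = - 2\<close>, and then \<open>n\<close> divides 3.\<close>
      have sum: "(\<Sum>i<(3::nat). l ^ i) = 1 + l + l * l" by (simp add: numeral_3_eq_3)
      have 1: "int n dvd 1 + l + l * l" using l(2) sum by (simp add: least_geom_sum_zero_def d3 cong_0_iff)
      have 2: "int n dvd l * l - 1" using l(1) by (simp add: cong_iff_dvd_diff power2_eq_square)
      have 3: "int n dvd l + 2" using 1 2 by (rule dvd_comb2[where a = 1 and b = "- 1"]) simp
      have "int n dvd 3" using 2 3 by (rule dvd_comb2[where a = 1 and b = "2 - l"]) (simp add: algebra_simps)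
      then have "n dvd 3" by (metis of_nat_dvd_iff of_nat_numeral)
      then have "n \<le> 3" by (rule dvd_imp_le) simp
      moreover have "n \<noteq> 2"
      proof
        assume "n = 2"
        with \<open>n dvd 3\<close> have "even (3::nat)" by simp
        then show False by simp
      qed
      ultimately have n3: "n = 3" using n2 by linarith
      have "(1 + l) mod 3 = 2" using 3 n3 by presburger
      then have "cyc1 n l d = [apow_b 3 0, apow_b 3 1, apow_b 3 2]"
        by (simp add: cyc1_def d3 n3 upt_rec numeral_3_eq_3 apow_b_eq)
      then show ?thesis using l(3) n3 by simp
    qed
    ultimately show ?thesis using l by blast
  next
    case False
    then obtain j where j: "\<not> snd (x j)" by blast
    obtain F P where sk: "skew (int n) (int (card X)) x chi F P"
      and sys: "\<And>a. \<exists>G S. rskew (int n) (int (card X)) (\<lambda>i. x (i + a)) (\<lambda>i. chi (i + a) - a) F P G S"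
      using rskew_system[OF refl] by blast
    have "\<exists>i. snd (x i)"
    proof (rule ccontr)
      assume no: "\<nexists>i. snd (x i)"
      have "\<not> snd g" for g :: "int \<times> bool"
      proof (rule gen_induct[of "\<lambda>g. \<not> snd g"])
        show "\<not> snd h" if "dih_eq (int n) g h" "\<not> snd g" for g h using that by (simp add: dih_eq_def)
        show "\<not> snd (dmul g (x i))" if "\<not> snd g" for g i using that no by (simp add: dmul_def)
      qed simp
      from this[of "(0, True)"] show False by simp
    qed
    then obtain i where i: "snd (x i)" by blast
    obtain a where "skew.pattern x chi a" using skew_pattern[OF sk i j] by blast
    then consider (12) "one_in_p 2 x chi a" | (13) "one_in_p 3 x chi a" | (23) "two_in_3 x a" | (24) "two_in_4 x chi a"
      using skew.pattern_def[OF sk] by blast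
    moreover obtain G S where rs: "rskew (int n) (int (card X)) (\<lambda>i. x (i + a)) (\<lambda>i. chi (i + a) - a) F P G S"
      using sys[of a] by blast
    ultimately show ?thesis
    proof cases
      case 12
      note * = one_in_2_isomorphic[OF refl 12]
      then show ?thesis using d by auto
    next
      case 13
      then show ?thesis using one_in_3_isomorphic[OF rs 13] d by auto
    next
      case 23
      then show ?thesis using two_in_3_isomorphic[OF rs 23] d by auto
    next
      case 24
      then have "card X = 4" "3 dvd n" "CM D X p \<simeq>\<^sub>m CM_cycle D (cyc4 n)"
        using two_in_4_isomorphic[OF rs 24] by auto
      moreover obtain k where "n = 3 * k" "0 < k" using \<open>3 dvd n\<close> n2 by (auto elim!: dvdE)
      ultimately show ?thesis using d by auto
    qed
  qed
qed

section \<open>Reflexibility and regularity of the listed maps\<close>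

text \<open>\<open>y\<close> extends the list to all integer indices by representatives in the
  infinite dihedral group, so that closed formulas for the exponents can be used without reduction
  modulo \<open>n\<close>.\<close>

locale cycle_system =
  fixes n d :: nat and ys :: "(int \<times> bool) list" and y :: "int \<Rightarrow> int \<times> bool" and chi :: "int \<Rightarrow> int"
  assumes n_pos: "0 < n" and d_pos: "0 < d"
    and ys_length: "length ys = d" and ys_nth: "\<And>k. k < d \<Longrightarrow> ys ! k = dred n (y (int k))"
    and y_eq: "\<And>i j. dih_eq (int n) (y i) (y j) \<longleftrightarrow> int d dvd i - j"
    and y_one: "\<And>i. \<not> dih_eq (int n) (y i) (0, False)"
    and y_inv: "\<And>i. dih_eq (int n) (dmul (y i) (y (chi i))) (0, False)"
    and y_gen: "\<And>Q g. (\<And>g h. dih_eq (int n) g h \<Longrightarrow> Q g \<Longrightarrow> Q h) \<Longrightarrow> Q (0, False) \<Longrightarrow>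
      (\<And>g i. Q g \<Longrightarrow> Q (dmul g (y i))) \<Longrightarrow> Q g"
begin

abbreviation "D \<equiv> dihedral n"

sublocale D: group D
  using n_pos by (rule group_dihedral)

abbreviation "z i \<equiv> dred n (y i)"

lemma z_eq: "z i = z j \<longleftrightarrow> int d dvd i - j"
  by (simp add: dred_eq y_eq)

lemma z_closed: "z i \<in> carrier D"
  using n_pos by (rule dred_closed)

lemma z_mod: "z (int (nat (i mod int d))) = z i"
  unfolding z_eq using d_pos by (simp add: mod_eq_dvd_iff[symmetric])

lemma nth_z: "ys ! nat (i mod int d) = z i"
proof -
  have "nat (i mod int d) < d" using d_pos by (simp add: nat_less_iff)
  then show ?thesis using ys_nth z_mod by simp
qed

lemma set_ys: "set ys = range z"
proof
  show "set ys \<subseteq> range z" using ys_length ys_nth by (auto simp: set_conv_nth)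
  show "range z \<subseteq> set ys"
  proof
    fix v assume "v \<in> range z"
    then obtain i where "v = z i" by blast
    moreover have "nat (i mod int d) < length ys" using d_pos ys_length by (simp add: nat_less_iff)
    ultimately show "v \<in> set ys" using nth_z[of i] nth_mem by metis
  qed
qed

lemma distinct_ys: "distinct ys"
  unfolding distinct_conv_nth
proof (intro allI impI)
  fix i j assume ij: "i < length ys" "j < length ys" "i \<noteq> j"
  have "\<not> int d dvd int i - int j"
    using ij ys_length by (simp add: mod_eq_dvd_iff[symmetric])
  then show "ys ! i \<noteq> ys ! j" using ij ys_length ys_nth by (simp add: z_eq)
qed

abbreviation "p \<equiv> cycle_of_list ys"

lemma p_z: "p (z i) = z (i + 1)"
proof -
  define k where "k = nat (i mod int d)"
  have k: "k < d" using d_pos by (simp add: k_def nat_less_iff)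
  have "p (z i) = ys ! (Suc k mod d)"
    using cycle_of_list_nth[OF distinct_ys, of k] k ys_length nth_z[of i] by (simp add: k_def)
  also have "\<dots> = z (int (Suc k mod d))" using d_pos ys_nth by simp
  also have "\<dots> = z (i + 1)"
  proof -
    have "int (Suc k mod d) mod int d = (i mod int d + 1) mod int d"
      using d_pos by (simp add: zmod_int k_def mod_simps add.commute)
    then show ?thesis unfolding z_eq by (simp add: mod_eq_dvd_iff[symmetric] mod_simps)
  qed
  finally show ?thesis .
qed

lemma inv_z: "inv\<^bsub>D\<^esub> (z i) = z (chi i)"
proof -
  have "z i \<otimes>\<^bsub>D\<^esub> z (chi i) = \<one>\<^bsub>D\<^esub>"
    using y_inv[of i] unfolding dred_mult[OF n_pos, symmetric] dred_eq[symmetric]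
    by (simp add: one_dihedral) (simp add: dred_def)
  then have "inv\<^bsub>D\<^esub> (z (chi i)) = z i" using z_closed by (intro D.inv_equality) auto
  then show ?thesis using z_closed D.inv_inv by metis
qed

lemma z_mult: "dred n (dmul g (y i)) = dred n g \<otimes>\<^bsub>D\<^esub> z i"
  by (rule dred_mult[OF n_pos])

lemma z_induct:
  assumes "g \<in> carrier D" "Q \<one>\<^bsub>D\<^esub>" "\<And>g i. g \<in> carrier D \<Longrightarrow> Q g \<Longrightarrow> Q (g \<otimes>\<^bsub>D\<^esub> z i)"
  shows "Q g"
proof -
  have "Q (dred n g)"
  proof (rule y_gen[of "\<lambda>g. Q (dred n g)"])
    show "Q (dred n h)" if "dih_eq (int n) g h" "Q (dred n g)" for g h
      using that by (simp add: dred_eq[symmetric])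
    show "Q (dred n (0, False))" using assms(2) by (simp add: one_dihedral) (simp add: dred_def)
    show "Q (dred n (dmul g (y i)))" if "Q (dred n g)" for g i
      using assms(3)[OF dred_closed[OF n_pos] that] by (simp add: z_mult)
  qed
  then show ?thesis using dred_id[OF assms(1)] by simp
qed

lemma p_funpow: "(p ^^ k) (z i) = z (i + int k)"
  by (induction k) (simp_all add: p_z algebra_simps)

lemma data: "cayley_map_data D (set ys) p"
proof -
  have "\<one>\<^bsub>D\<^esub> \<notin> set ys"
  proof
    assume "\<one>\<^bsub>D\<^esub> \<in> set ys"
    then obtain i where "z i = \<one>\<^bsub>D\<^esub>" unfolding set_ys by force
    then have "z i = dred n (0, False)" by (simp add: one_dihedral) (simp add: dred_def)
    then show False using y_one by (simp add: dred_eq)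
  qed
  moreover have "(\<lambda>x. inv\<^bsub>D\<^esub> x) ` set ys = set ys"
  proof
    show "(\<lambda>x. inv\<^bsub>D\<^esub> x) ` set ys \<subseteq> set ys" unfolding set_ys by (auto simp: inv_z)
    show "set ys \<subseteq> (\<lambda>x. inv\<^bsub>D\<^esub> x) ` set ys"
    proof
      fix v assume "v \<in> set ys"
      then obtain i where "v = z i" unfolding set_ys by blast
      then have "v = inv\<^bsub>D\<^esub> (z (chi i))" using z_closed by (simp add: inv_z[symmetric])
      then show "v \<in> (\<lambda>x. inv\<^bsub>D\<^esub> x) ` set ys" unfolding set_ys by blast
    qed
  qed
  moreover have "generate D (set ys) = carrier D"
  proof
    show "generate D (set ys) \<subseteq> carrier D"
      by (rule D.generate_incl) (use z_closed in \<open>auto simp: set_ys\<close>)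
    show "carrier D \<subseteq> generate D (set ys)"
    proof
      fix g assume "g \<in> carrier D"
      then show "g \<in> generate D (set ys)"
      proof (rule z_induct)
        show "\<one>\<^bsub>D\<^esub> \<in> generate D (set ys)" by (rule generate.one)
        show "g \<otimes>\<^bsub>D\<^esub> z i \<in> generate D (set ys)" if "g \<in> generate D (set ys)" for g i
          by (rule generate.eng[OF that generate.incl]) (simp add: set_ys)
      qed
    qed
  qed
  moreover have "cyclic_on p (set ys)"
  proof -
    have "orbit p (z 0) = range z"
    proof
      show "orbit p (z 0) \<subseteq> range z" by (auto simp: orbit_altdef p_funpow)
      show "range z \<subseteq> orbit p (z 0)"
      proof
        fix v assume "v \<in> range z"
        then obtain i where i: "v = z i" by blast
        define k where "k = nat (i mod int d) + d"
        have "(p ^^ k) (z 0) = z i"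
          unfolding p_funpow z_eq using d_pos
          by (simp add: k_def mod_eq_dvd_iff[symmetric])
        moreover have "0 < k" using d_pos by (simp add: k_def)
        ultimately show "v \<in> orbit p (z 0)" unfolding i orbit_altdef by (metis (mono_tags, lifting) mem_Collect_eq)
      qed
    qed
    then show ?thesis unfolding cyclic_on_def set_ys by blast
  qed
  ultimately show ?thesis
    unfolding cayley_map_data_def using finite_dihedral cycle_permutes[of ys] z_closed
    by (auto simp: set_ys D.is_group)
qed

text \<open>The local form of a map automorphism: the indices around each vertex are preserved or
  reversed up to an offset. Bijectivity is not demanded, since it follows from generation by
  \<open>X\<close>.\<close>

definition step :: "int \<Rightarrow> (int \<times> bool \<Rightarrow> int \<times> bool) \<Rightarrow> bool" where
  "step e h \<longleftrightarrow> (\<forall>g \<in> carrier D. h g \<in> carrier D \<and> (\<exists>r. \<forall>i. h (g \<otimes>\<^bsub>D\<^esub> z i) = h g \<otimes>\<^bsub>D\<^esub> z (e * i + r)))"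

lemma adj_iff: "adj (CM D (set ys) p) v w \<longleftrightarrow> v \<in> carrier D \<and> (\<exists>i. w = v \<otimes>\<^bsub>D\<^esub> z i)"
proof -
  have "w = v \<otimes>\<^bsub>D\<^esub> z i" if "v \<in> carrier D" "w \<in> carrier D" "inv\<^bsub>D\<^esub> v \<otimes>\<^bsub>D\<^esub> w = z i" for i
    using that by (metis D.inv_solve_left z_closed)
  moreover have "inv\<^bsub>D\<^esub> v \<otimes>\<^bsub>D\<^esub> (v \<otimes>\<^bsub>D\<^esub> z i) = z i" if "v \<in> carrier D" for i
    using that z_closed by (simp add: D.m_assoc[symmetric])
  ultimately show ?thesis using z_closed unfolding CM_def set_ys by (auto simp: image_iff)
qed

lemma rot_z: "v \<in> carrier D \<Longrightarrow> rot (CM D (set ys) p) v (v \<otimes>\<^bsub>D\<^esub> z i) = v \<otimes>\<^bsub>D\<^esub> z (i + 1)"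
  using z_closed by (simp add: CM_def D.m_assoc[symmetric] p_z)

text \<open>As \<open>e\<close> is invertible, every neighbour of an image vertex is itself an
  image. So the image is closed under right multiplication by \<open>X\<close> and is the whole
  group; finiteness then gives injectivity.\<close>

lemma step_graph_iso:
  assumes h: "step e h" and e: "e * e = 1"
  shows "graph_iso (CM D (set ys) p) (CM D (set ys) p) h"
proof -
  have hc: "h g \<in> carrier D" if "g \<in> carrier D" for g using h that by (simp add: step_def)
  have st: "\<exists>r. \<forall>i. h (g \<otimes>\<^bsub>D\<^esub> z i) = h g \<otimes>\<^bsub>D\<^esub> z (e * i + r)" if "g \<in> carrier D" for g
    using h that by (simp add: step_def)
  have preim: "\<exists>i. h v \<otimes>\<^bsub>D\<^esub> z j = h (v \<otimes>\<^bsub>D\<^esub> z i)" if v: "v \<in> carrier D" for v j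
  proof -
    obtain r where "\<forall>i. h (v \<otimes>\<^bsub>D\<^esub> z i) = h v \<otimes>\<^bsub>D\<^esub> z (e * i + r)" using st[OF v] by blast
    moreover have "e * (e * (j - r)) + r = j" using e by (simp add: mult.assoc[symmetric])
    ultimately show ?thesis by metis
  qed
  have "h ` carrier D = carrier D"
  proof
    show "h ` carrier D \<subseteq> carrier D" using hc by blast
    show "carrier D \<subseteq> h ` carrier D"
    proof
      fix w assume w: "w \<in> carrier D"
      have "h \<one>\<^bsub>D\<^esub> \<otimes>\<^bsub>D\<^esub> g \<in> h ` carrier D" if "g \<in> carrier D" for g
        using that
      proof (rule z_induct)
        show "h \<one>\<^bsub>D\<^esub> \<otimes>\<^bsub>D\<^esub> \<one>\<^bsub>D\<^esub> \<in> h ` carrier D" using hc by simp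
        fix g i assume g: "g \<in> carrier D" "h \<one>\<^bsub>D\<^esub> \<otimes>\<^bsub>D\<^esub> g \<in> h ` carrier D"
        then obtain v where v: "v \<in> carrier D" "h \<one>\<^bsub>D\<^esub> \<otimes>\<^bsub>D\<^esub> g = h v" by blast
        obtain j where "h v \<otimes>\<^bsub>D\<^esub> z i = h (v \<otimes>\<^bsub>D\<^esub> z j)" using preim[OF v(1)] by blast
        then have "h \<one>\<^bsub>D\<^esub> \<otimes>\<^bsub>D\<^esub> (g \<otimes>\<^bsub>D\<^esub> z i) = h (v \<otimes>\<^bsub>D\<^esub> z j)"
          using v(2) hc g(1) z_closed by (simp add: D.m_assoc[symmetric])
        then show "h \<one>\<^bsub>D\<^esub> \<otimes>\<^bsub>D\<^esub> (g \<otimes>\<^bsub>D\<^esub> z i) \<in> h ` carrier D" using v(1) z_closed by simp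
      qed
      from this[of "inv\<^bsub>D\<^esub> (h \<one>\<^bsub>D\<^esub>) \<otimes>\<^bsub>D\<^esub> w"] show "w \<in> h ` carrier D"
        using hc w by (simp add: D.m_assoc[symmetric])
    qed
  qed
  moreover from this have "inj_on h (carrier D)"
    by (intro eq_card_imp_inj_on finite_dihedral) simp
  ultimately have bij: "bij_betw h (carrier D) (carrier D)" by (simp add: bij_betw_def)
  have "(\<exists>i. w = v \<otimes>\<^bsub>D\<^esub> z i) \<longleftrightarrow> (\<exists>i. h w = h v \<otimes>\<^bsub>D\<^esub> z i)"
    if v: "v \<in> carrier D" and w: "w \<in> carrier D" for v w
  proof
    show "\<exists>i. w = v \<otimes>\<^bsub>D\<^esub> z i" if hw: "\<exists>i. h w = h v \<otimes>\<^bsub>D\<^esub> z i"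
    proof -
      obtain i where "h w = h (v \<otimes>\<^bsub>D\<^esub> z i)" using hw preim[OF v] by metis
      then have "w = v \<otimes>\<^bsub>D\<^esub> z i" using bij v w z_closed by (auto simp: bij_betw_def dest: inj_onD)
      then show ?thesis by blast
    qed
  qed (use st[OF v] in blast)
  then show ?thesis
    unfolding graph_iso_def adj_iff using bij hc by (simp add: CM_def)
qed

lemma step_pres_iso: "step 1 h \<Longrightarrow> pres_iso (CM D (set ys) p) (CM D (set ys) p) h"
  unfolding pres_iso_def
proof (intro conjI ballI impI)
  assume h: "step 1 h"
  show "graph_iso (CM D (set ys) p) (CM D (set ys) p) h" by (rule step_graph_iso[OF h]) simp
  fix v w assume "adj (CM D (set ys) p) v w"
  then obtain i where v: "v \<in> carrier D" and w: "w = v \<otimes>\<^bsub>D\<^esub> z i" unfolding adj_iff by blast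
  obtain r where r: "\<And>i. h (v \<otimes>\<^bsub>D\<^esub> z i) = h v \<otimes>\<^bsub>D\<^esub> z (i + r)" and hv: "h v \<in> carrier D"
    using h v unfolding step_def by auto
  show "h (rot (CM D (set ys) p) v w) = rot (CM D (set ys) p) (h v) (h w)"
    unfolding w rot_z[OF v] r rot_z[OF hv] by (simp add: algebra_simps)
qed

lemma step_rev_iso: "step (- 1) h \<Longrightarrow> rev_iso (CM D (set ys) p) (CM D (set ys) p) h"
  unfolding rev_iso_def
proof (intro conjI ballI impI)
  assume h: "step (- 1) h"
  show "graph_iso (CM D (set ys) p) (CM D (set ys) p) h" by (rule step_graph_iso[OF h]) simp
  fix v w assume "adj (CM D (set ys) p) v w"
  then obtain i where v: "v \<in> carrier D" and w: "w = v \<otimes>\<^bsub>D\<^esub> z i" unfolding adj_iff by blast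
  obtain r where r: "\<And>i. h (v \<otimes>\<^bsub>D\<^esub> z i) = h v \<otimes>\<^bsub>D\<^esub> z (- i + r)" and hv: "h v \<in> carrier D"
    using h v unfolding step_def by auto
  show "rot (CM D (set ys) p) (h v) (h (rot (CM D (set ys) p) v w)) = h w"
    unfolding w rot_z[OF v] r rot_z[OF hv] by simp
qed

lemma step_comp: "step 1 h \<Longrightarrow> step 1 k \<Longrightarrow> step 1 (\<lambda>g. k (h g))"
  unfolding step_def
proof (intro ballI conjI)
  fix g
  assume h: "\<forall>g\<in>carrier D. h g \<in> carrier D \<and> (\<exists>r. \<forall>i. h (g \<otimes>\<^bsub>D\<^esub> z i) = h g \<otimes>\<^bsub>D\<^esub> z (1 * i + r))"
    and k: "\<forall>g\<in>carrier D. k g \<in> carrier D \<and> (\<exists>r. \<forall>i. k (g \<otimes>\<^bsub>D\<^esub> z i) = k g \<otimes>\<^bsub>D\<^esub> z (1 * i + r))"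
    and g: "g \<in> carrier D"
  then show "k (h g) \<in> carrier D" by blast
  obtain r where r: "\<forall>i. h (g \<otimes>\<^bsub>D\<^esub> z i) = h g \<otimes>\<^bsub>D\<^esub> z (1 * i + r)" using h g by blast
  obtain t where t: "\<forall>i. k (h g \<otimes>\<^bsub>D\<^esub> z i) = k (h g) \<otimes>\<^bsub>D\<^esub> z (1 * i + t)" using h k g by blast
  have "\<forall>i. k (h (g \<otimes>\<^bsub>D\<^esub> z i)) = k (h g) \<otimes>\<^bsub>D\<^esub> z (1 * i + (r + t))"
    using r t by (simp add: add.assoc)
  then show "\<exists>r. \<forall>i. k (h (g \<otimes>\<^bsub>D\<^esub> z i)) = k (h g) \<otimes>\<^bsub>D\<^esub> z (1 * i + r)" by blast
qed

lemma step_translation: "u \<in> carrier D \<Longrightarrow> step 1 (\<lambda>g. u \<otimes>\<^bsub>D\<^esub> g)"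
  unfolding step_def using z_closed
  by (auto simp: D.m_assoc intro!: exI[of _ 0])

text \<open>One rotation about 1 and the left translations act transitively on arcs. The mirror is
  required as a group automorphism, \<open>a\<close> to \<open>a^\<mu>\<close> and \<open>b\<close>
  to \<open>a^\<nu> b\<close>, that reverses the cycle.\<close>

lemma reflexible_regular:
  assumes f_cong: "\<And>g h. dih_eq (int n) g h \<Longrightarrow> dih_eq (int n) (f g) (f h)"
    and f_one: "dih_eq (int n) (f (0, False)) (0, False)"
    and f_step: "\<And>g i. dih_eq (int n) (f (dmul g (y i))) (dmul (f g) (y (i + \<pi> g)))"
    and \<pi>_one: "\<pi> (0, False) = 1"
    and refl: "\<And>i. dih_eq (int n) (\<mu> * fst (y i) + (if snd (y i) then \<nu> else 0), snd (y i)) (y (c - i))"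
  shows "reflexible_regular_CM_cycle D ys"
proof -
  define F where "F g = dred n (f g)" for g
  have F_step: "F (g \<otimes>\<^bsub>D\<^esub> z i) = F g \<otimes>\<^bsub>D\<^esub> z (i + \<pi> g)" for g i
  proof -
    have "dih_eq (int n) (g \<otimes>\<^bsub>D\<^esub> z i) (dmul g (y i))"
      unfolding mult_dihedral
      by (rule dih_eq_trans[OF dih_eq_dred(1)]) (intro dih_eq_dmul dih_eq_refl dih_eq_dred)
    from dih_eq_trans[OF f_cong[OF this] f_step] show ?thesis
      unfolding F_def z_mult[symmetric] dred_eq .
  qed
  have "step 1 F"
    unfolding step_def
  proof (intro ballI conjI)
    show "F g \<in> carrier D" for g using n_pos by (simp add: F_def dred_closed)
    have "\<forall>i. F (g \<otimes>\<^bsub>D\<^esub> z i) = F g \<otimes>\<^bsub>D\<^esub> z (1 * i + \<pi> g)" for g by (simp add: F_step)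
    then show "\<exists>r. \<forall>i. F (g \<otimes>\<^bsub>D\<^esub> z i) = F g \<otimes>\<^bsub>D\<^esub> z (1 * i + r)" for g by blast
  qed
  have one: "dred n (0, False) = \<one>\<^bsub>D\<^esub>" by (simp add: one_dihedral) (simp add: dred_def)
  have F1: "F \<one>\<^bsub>D\<^esub> = \<one>\<^bsub>D\<^esub>" unfolding F_def one[symmetric] dred_eq
    using f_one by (simp add: dred_def)
  have Fz: "F (z i) = z (i + 1)" for i
    using F_step[of "\<one>\<^bsub>D\<^esub>" i] F1 z_closed \<pi>_one[folded one_dihedral[of n]] by simp
  have pow: "step 1 (F ^^ k) \<and> (F ^^ k) \<one>\<^bsub>D\<^esub> = \<one>\<^bsub>D\<^esub> \<and> (\<forall>i. (F ^^ k) (z i) = z (i + int k))" for k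
  proof (induction k)
    case 0
    have "step 1 (\<lambda>g. \<one>\<^bsub>D\<^esub> \<otimes>\<^bsub>D\<^esub> g)" by (rule step_translation) simp
    then have "step 1 id" unfolding step_def using z_closed by simp
    then show ?case by (simp add: id_def)
  next
    case (Suc k)
    then show ?case using step_comp[of "F ^^ k" F] \<open>step 1 F\<close> F1 by (simp add: Fz o_def algebra_simps)
  qed
  have "regular_map (CM D (set ys) p)"
    unfolding regular_map_def
  proof (clarify)
    fix a b A a' b' A' assume A: "((a, b), A) \<in> arcs (CM D (set ys) p)" and A': "((a', b'), A') \<in> arcs (CM D (set ys) p)"
    define v where "v = (a, b)"
    define v' where "v' = (a', b')"
    obtain i where v: "v \<in> carrier D" and i: "A = {v, v \<otimes>\<^bsub>D\<^esub> z i}" using A unfolding arcs_def adj_iff v_def by auto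
    obtain j where v': "v' \<in> carrier D" and j: "A' = {v', v' \<otimes>\<^bsub>D\<^esub> z j}" using A' unfolding arcs_def adj_iff v'_def by auto
    define k where "k = nat ((j - i) mod int d)"
    define h where "h g = v' \<otimes>\<^bsub>D\<^esub> (F ^^ k) (inv\<^bsub>D\<^esub> v \<otimes>\<^bsub>D\<^esub> g)" for g
    have "step 1 h"
    proof -
      have "step 1 (\<lambda>g. inv\<^bsub>D\<^esub> v \<otimes>\<^bsub>D\<^esub> g)" using v by (intro step_translation) simp
      then have "step 1 (\<lambda>g. (F ^^ k) (inv\<^bsub>D\<^esub> v \<otimes>\<^bsub>D\<^esub> g))" by (rule step_comp) (simp add: pow)
      then show ?thesis unfolding h_def by (rule step_comp) (rule step_translation[OF v'])
    qed
    moreover have "h v = v'" using v v' pow[of k] by (simp add: h_def)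
    moreover have "h (v \<otimes>\<^bsub>D\<^esub> z i) = v' \<otimes>\<^bsub>D\<^esub> z j"
    proof -
      have "z (i + int k) = z j"
        unfolding z_eq using d_pos by (simp add: k_def mod_eq_dvd_iff[symmetric] mod_simps)
      then show ?thesis using v pow[of k] z_closed by (simp add: h_def D.m_assoc[symmetric])
    qed
    ultimately show "\<exists>f. pres_iso (CM D (set ys) p) (CM D (set ys) p) f \<and> f (a, b) = (a', b') \<and> f ` A = A'"
      using step_pres_iso[of h] unfolding i j v_def v'_def by auto
  qed
  moreover have "rev_iso (CM D (set ys) p) (CM D (set ys) p)
      (\<lambda>g. dred n (\<mu> * fst g + (if snd g then \<nu> else 0), snd g))"
  proof (rule step_rev_iso)
    let ?\<alpha> = "\<lambda>g. (\<mu> * fst g + (if snd g then \<nu> else 0), snd g)"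
    have hom: "?\<alpha> (dmul g h) = dmul (?\<alpha> g) (?\<alpha> h)" for g h
      by (cases g; cases h) (auto simp: dmul_def algebra_simps)
    have "dred n (?\<alpha> (g \<otimes>\<^bsub>D\<^esub> z i)) = dred n (?\<alpha> g) \<otimes>\<^bsub>D\<^esub> z (- 1 * i + c)" for g i
    proof -
      have "dih_eq (int n) (g \<otimes>\<^bsub>D\<^esub> z i) (dmul g (y i))"
        unfolding mult_dihedral
        by (rule dih_eq_trans[OF dih_eq_dred(1)]) (intro dih_eq_dmul dih_eq_refl dih_eq_dred)
      then have "dih_eq (int n) (?\<alpha> (g \<otimes>\<^bsub>D\<^esub> z i)) (?\<alpha> (dmul g (y i)))"
        by (auto simp: dih_eq_def right_diff_distrib[symmetric])
      also have "?\<alpha> (dmul g (y i)) = dmul (?\<alpha> g) (?\<alpha> (y i))" by (rule hom)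
      also have "dih_eq (int n) \<dots> (dmul (?\<alpha> g) (y (c - i)))"
        by (intro dih_eq_dmul dih_eq_refl refl)
      finally show ?thesis unfolding z_mult[symmetric] dred_eq by simp
    qed
    then show "step (- 1) (\<lambda>g. dred n (?\<alpha> g))"
      unfolding step_def using dred_closed[OF n_pos] by blast
  qed
  ultimately show ?thesis
    unfolding reflexible_regular_CM_cycle_def reflexible_regular_CM_def reflexible_regular_map_def
    using data distinct_ys by blast
qed

end

section \<open>The six families are reflexible and regular\<close>

lemma dihedral_induct:
  assumes "Q (0, False)" "\<And>g. Q g \<Longrightarrow> Q (dmul g (0, True))" "\<And>g. Q g \<Longrightarrow> Q (dmul g (1, False))"
  shows "Q g"
proof -
  have preim: "Q (j - 1, False)" if "Q (j, False)" for j
    using assms(2)[OF assms(3)[OF assms(2)[OF that]]] by simp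
  have rot: "Q (j, False)" for j
  proof (induction j rule: int_induct[where k = 0])
    case base
    show ?case by (rule assms(1))
  next
    case (step1 i)
    then show ?case using assms(3)[of "(i, False)"] by simp
  next
    case (step2 i)
    then show ?case using preim by simp
  qed
  then have "Q (j, True)" for j using assms(2)[OF rot[of j]] by simp
  with rot show ?thesis by (cases g) (metis (full_types))
qed

text \<open>As \<open>l * l = 1\<close>, the geometric sum depends on half the index and its parity
  only; \<open>\<sigma>\<close> is this formula on all integers. The rule
  \<open>\<sigma> (i + j) = \<sigma> j + \<epsilon> j * \<sigma> i\<close> makes its zeros the
  multiples of the least positive one. The rotation is a group automorphism, \<open>a\<close> to
  \<open>a^l\<close> and \<open>b\<close> to \<open>ab\<close>.\<close>

lemma reflexible_regular_cyc1:
  assumes n: "0 < n" and l: "[l\<^sup>2 = 1] (mod int n)" and least: "least_geom_sum_zero n l d"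
  shows "reflexible_regular_CM_cycle (dihedral n) (cyc1 n l d)"
proof -
  define \<sigma> where "\<sigma> i = i div 2 * (1 + l) + i mod 2" for i :: int
  define \<epsilon> where "\<epsilon> i = (if even i then 1 else l)" for i :: int
  have L: "int n dvd l * l - 1" using l by (simp add: cong_iff_dvd_diff power2_eq_square)
  have \<sigma>_even: "\<sigma> (2 * h) = h * (1 + l)" and \<sigma>_odd: "\<sigma> (2 * h + 1) = h * (1 + l) + 1" for h
    by (simp_all add: \<sigma>_def)
  have \<sigma>_add: "int n dvd \<sigma> (i + j) - (\<sigma> j + \<epsilon> j * \<sigma> i)" for i j
  proof -
    consider h k where "i = 2 * h" "j = 2 * k" | h k where "i = 2 * h + 1" "j = 2 * k"
      | h k where "i = 2 * h" "j = 2 * k + 1" | h k where "i = 2 * h + 1" "j = 2 * k + 1"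
      by (metis evenE oddE)
    then show ?thesis
    proof cases
      case 1
      have "\<sigma> (i + j) = \<sigma> (2 * (h + k))" by (simp add: 1 algebra_simps)
      then show ?thesis unfolding 1 \<sigma>_even by (simp add: \<epsilon>_def algebra_simps)
    next
      case 2
      have "\<sigma> (i + j) = \<sigma> (2 * (h + k) + 1)" by (simp add: 2 algebra_simps)
      then show ?thesis unfolding 2 \<sigma>_even \<sigma>_odd by (simp add: \<epsilon>_def algebra_simps)
    next
      case 3
      have e: "\<sigma> (i + j) = \<sigma> (2 * (h + k) + 1)" by (simp add: 3 algebra_simps)
      show ?thesis
        using L unfolding e unfolding 3 \<sigma>_even \<sigma>_odd
        by (rule dvd_comb1[where a = "- h"]) (simp add: \<epsilon>_def algebra_simps)
    next
      case 4
      have e: "\<sigma> (i + j) = \<sigma> (2 * (h + k + 1))" by (simp add: 4 algebra_simps)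
      show ?thesis
        using L unfolding e unfolding 4 \<sigma>_even \<sigma>_odd
        by (rule dvd_comb1[where a = "- h"]) (simp add: \<epsilon>_def algebra_simps)
    qed
  qed
  have \<epsilon>_unit: "int n dvd \<epsilon> j * w \<longleftrightarrow> int n dvd w" for j w
  proof
    have e: "int n dvd \<epsilon> j * \<epsilon> j - 1" using L by (simp add: \<epsilon>_def)
    assume "int n dvd \<epsilon> j * w"
    with e show "int n dvd w" by (rule dvd_comb2[where a = "- w" and b = "\<epsilon> j"]) (simp add: algebra_simps)
  qed simp
  have period: "int n dvd \<sigma> (i + j) \<longleftrightarrow> int n dvd \<sigma> i" if j: "int n dvd \<sigma> j" for i j
  proof -
    have "int n dvd \<sigma> (i + j) \<longleftrightarrow> int n dvd \<epsilon> j * \<sigma> i"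
    proof
      assume "int n dvd \<sigma> (i + j)"
      with \<sigma>_add[of i j] j show "int n dvd \<epsilon> j * \<sigma> i"
        by (rule dvd_comb3[where a = "- 1" and b = "- 1" and c = 1]) simp
    next
      assume "int n dvd \<epsilon> j * \<sigma> i"
      with \<sigma>_add[of i j] j show "int n dvd \<sigma> (i + j)"
        by (rule dvd_comb3[where a = 1 and b = 1 and c = 1]) simp
    qed
    then show ?thesis by (simp add: \<epsilon>_unit)
  qed
  have succ: "int n dvd \<sigma> (i + 1) - (1 + l * \<sigma> i)" for i
    using \<sigma>_add[of i 1] \<sigma>_odd[of 0] by (simp add: \<epsilon>_def)
  have geom: "int n dvd \<sigma> (int k) - (\<Sum>i<k. l ^ i)" for k
  proof (induction k)
    case 0
    then show ?case using \<sigma>_even[of 0] by simp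
  next
    case (Suc k)
    have "(\<Sum>i<Suc k. l ^ i) = 1 + l * (\<Sum>i<k. l ^ i)"
      unfolding sum.lessThan_Suc_shift by (simp add: sum_distrib_left)
    with Suc succ[of "int k"] show ?case
      by (intro dvd_comb2[where a = l and b = 1, OF Suc succ[of "int k"]]) (simp add: algebra_simps)
  qed
  have geom0: "int n dvd \<sigma> (int k) \<longleftrightarrow> [(\<Sum>i<k. l ^ i) = 0] (mod int n)" for k
    using dvd_diff_cong[OF geom[of k], of 0] by (simp add: cong_0_iff)
  have d: "0 < d" "int n dvd \<sigma> (int d)" "\<And>k. 0 < k \<Longrightarrow> k < d \<Longrightarrow> \<not> int n dvd \<sigma> (int k)"
    using least unfolding least_geom_sum_zero_def geom0 by auto
  have mult_d: "int n dvd \<sigma> (int d * q)" for q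
  proof (induction q rule: int_induct[where k = 0])
    case base
    then show ?case using \<sigma>_even[of 0] by simp
  next
    case (step1 q)
    then show ?case using period[OF d(2), of "int d * q"] by (simp add: algebra_simps)
  next
    case (step2 q)
    then show ?case using period[OF d(2), of "int d * (q - 1)"] by (simp add: algebra_simps)
  qed
  have zero: "int n dvd \<sigma> i \<longleftrightarrow> int d dvd i" for i
  proof -
    define k where "k = nat (i mod int d)"
    have k: "int k = i mod int d" "k < d" using d(1) by (simp_all add: k_def nat_less_iff)
    have "int n dvd \<sigma> i \<longleftrightarrow> int n dvd \<sigma> (int k)"
      using period[OF mult_d, of "int k" "i div int d"] k by simp
    also have "\<dots> \<longleftrightarrow> k = 0" using d(3)[of k] k \<sigma>_even[of 0] by auto
    also have "\<dots> \<longleftrightarrow> int k = 0" by simp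
    finally show ?thesis unfolding k(1) by (simp add: dvd_eq_mod_eq_0)
  qed
  define y where "y i = (\<sigma> i, True)" for i
  interpret cycle_system n d "cyc1 n l d" y "\<lambda>i. i"
  proof
    show "cyc1 n l d ! k = dred n (y (int k))" if "k < d" for k
      using that n geom[of k]
      by (simp add: cyc1_def y_def apow_b_eq dred_def mod_eq_dvd_iff dvd_diff_commute)
    show "dih_eq (int n) (y i) (y j) \<longleftrightarrow> int d dvd i - j" for i j
    proof -
      have "int n dvd \<sigma> i - (\<sigma> j + \<epsilon> j * \<sigma> (i - j))" using \<sigma>_add[of "i - j" j] by simp
      then have "int n dvd \<sigma> i - \<sigma> j - \<epsilon> j * \<sigma> (i - j)" by (simp add: algebra_simps)
      from dvd_diff_cong[OF this, of 0] show ?thesis by (simp add: y_def \<epsilon>_unit zero)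
    qed
    show "Q g" if "Q (0, False)" "\<And>g i. Q g \<Longrightarrow> Q (dmul g (y i))" for Q g
    proof (rule dihedral_induct[of Q])
      have y0: "y 0 = (0, True)" and y1: "y 1 = (1, True)" using \<sigma>_even[of 0] \<sigma>_odd[of 0] by (simp_all add: y_def)
      show "Q (dmul g (0, True))" if "Q g" for g using \<open>\<And>g i. Q g \<Longrightarrow> Q (dmul g (y i))\<close>[OF that, of 0] y0 by simp
      show "Q (dmul g (1, False))" if "Q g" for g
      proof -
        have "Q (dmul (dmul g (y 1)) (y 0))" using that \<open>\<And>g i. Q g \<Longrightarrow> Q (dmul g (y i))\<close> by blast
        then show ?thesis unfolding dmul_assoc y0 y1 by simp
      qed
    qed (rule that(1))
  qed (use n d in \<open>simp_all add: cyc1_def y_def\<close>)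
  show ?thesis
  proof (rule reflexible_regular[where f = "\<lambda>g. (l * fst g + (if snd g then 1 else 0), snd g)" and \<pi> = "\<lambda>_. 1" and
        \<mu> = "- l" and \<nu> = 0 and c = 0])
    show "dih_eq (int n) (l * fst g + (if snd g then 1 else 0), snd g) (l * fst h + (if snd h then 1 else 0), snd h)"
      if "dih_eq (int n) g h" for g h
      using that by (auto simp: dih_eq_def right_diff_distrib[symmetric])
    show "dih_eq (int n) (l * fst (dmul g (y i)) + (if snd (dmul g (y i)) then 1 else 0), snd (dmul g (y i)))
        (dmul (l * fst g + (if snd g then 1 else 0), snd g) (y (i + 1)))" for g i
    proof (cases g)
      case (Pair j e)
      have "int n dvd 1 + l * \<sigma> i - \<sigma> (i + 1)" using succ[of i] by (simp add: dvd_diff_commute)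
      moreover have "int n dvd \<sigma> (i + 1) - (1 + l * \<sigma> i)" by (rule succ)
      ultimately show ?thesis by (cases e) (simp_all add: Pair y_def algebra_simps)
    qed
    show "dih_eq (int n) (- l * fst (y i) + (if snd (y i) then 0 else 0), snd (y i)) (y (0 - i))" for i
    proof -
      have a: "int n dvd 0 - (\<sigma> i + \<epsilon> i * \<sigma> (- i))" using \<sigma>_add[of "- i" i] \<sigma>_even[of 0] by simp
      have b: "int n dvd l * \<sigma> i - \<epsilon> i * \<sigma> i"
      proof (cases "even i")
        case True
        then obtain h where h: "i = 2 * h" by blast
        show ?thesis using L unfolding h \<sigma>_even by (rule dvd_comb1[where a = h]) (simp add: \<epsilon>_def algebra_simps)
      qed (simp add: \<epsilon>_def)
      have e: "int n dvd \<epsilon> i * \<epsilon> i - 1" using L by (simp add: \<epsilon>_def)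
      have "int n dvd - l * \<sigma> i - \<sigma> (- i)"
        using a b e by (rule dvd_comb3[where a = "\<epsilon> i" and b = "- 1" and c = "\<sigma> (- i)"]) (simp add: algebra_simps)
      then show ?thesis by (simp add: y_def)
    qed
  qed simp_all
qed

text \<open>Both families whose cycles alternate between reflections and rotations: \<open>\<kappa> = 0\<close> for the second,
  \<open>\<kappa> = n / 8\<close> for the third.\<close>

lemma reflexible_regular_alternating:
  fixes \<kappa> :: int
  assumes n: "0 < n" "even n" and \<kappa>: "int n dvd 8 * \<kappa>" and len: "length ys = n"
    and ys: "\<And>k. k < n \<Longrightarrow> ys ! k = (if even k then ((int k + int (k div 2) * (4 * \<kappa>)) mod int n, True) else (int k mod int n, False))"
  shows "reflexible_regular_CM_cycle (dihedral n) ys"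
proof -
  define K where "K = 2 + 4 * \<kappa>"
  define y where "y i = (if even i then (i div 2 * K, True) else (i, False))" for i :: int
  have y_even: "y (2 * u) = (u * K, True)" and y_odd: "y (2 * u + 1) = (2 * u + 1, False)" for u
    by (simp_all add: y_def)
  have evn: "even w" if "int n dvd w" for w using n(2) that by (meson dvd_trans even_of_nat)
  \<comment> \<open>\<open>(1 - 2 * \<kappa>) * K\<close> differs from 2 by a multiple of
    \<open>8 * \<kappa>\<close>, so \<open>K\<close> and 2 have the same annihilator modulo
    \<open>n\<close>.\<close>
  have K_unit: "int n dvd w * K \<longleftrightarrow> int n dvd 2 * w" for w
  proof
    assume "int n dvd w * K"
    then show "int n dvd 2 * w" using \<kappa>
      by (rule dvd_comb2[where a = "1 - 2 * \<kappa>" and b = "w * \<kappa>"]) (simp add: K_def algebra_simps)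
  next
    assume "int n dvd 2 * w"
    then show "int n dvd w * K" by (rule dvd_comb1[where a = "1 + 2 * \<kappa>"]) (simp add: K_def algebra_simps)
  qed
  interpret cycle_system n n ys y "\<lambda>i. if even i then i else - i"
  proof
    show "0 < n" by (rule n(1))
    show "length ys = n" by (rule len)
    show "ys ! k = dred n (y (int k))" if "k < n" for k
    proof (cases "even k")
      case True
      then obtain h where "k = 2 * h" by blast
      then show ?thesis using ys[OF that] by (simp add: y_def dred_def K_def algebra_simps)
    qed (simp add: ys[OF that] y_def dred_def)
    show "dih_eq (int n) (y i) (y j) \<longleftrightarrow> int n dvd i - j" for i j
    proof (cases "even i \<longleftrightarrow> even j")
      case False
      then show ?thesis using evn[of "i - j"] by (auto simp: y_def)
    next
      case True
      show ?thesis
      proof (cases "even i")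
        case ev: True
        then obtain h k where hk: "i = 2 * h" "j = 2 * k" using True by blast
        show ?thesis using K_unit[of "h - k"] unfolding hk y_even by (simp add: algebra_simps)
      next
        case False
        then show ?thesis using True by (simp add: y_def)
      qed
    qed
    show "\<not> dih_eq (int n) (y i) (0, False)" for i using evn[of i] by (auto simp: y_def)
    show "dih_eq (int n) (dmul (y i) (y (if even i then i else - i))) (0, False)" for i by (simp add: y_def)
    show "Q g" if "Q (0, False)" "\<And>g i. Q g \<Longrightarrow> Q (dmul g (y i))" for Q g
    proof (rule dihedral_induct[of Q])
      have y0: "y 0 = (0, True)" and y1: "y 1 = (1, False)" by (simp_all add: y_def)
      show "Q (dmul g (0, True))" if "Q g" for g using \<open>\<And>g i. Q g \<Longrightarrow> Q (dmul g (y i))\<close>[OF that, of 0] y0 by simp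
      show "Q (dmul g (1, False))" if "Q g" for g using \<open>\<And>g i. Q g \<Longrightarrow> Q (dmul g (y i))\<close>[OF that, of 1] y1 by simp
    qed (rule that(1))
  qed
  \<comment> \<open>The extension of \<open>y i\<close> to \<open>y (i + 1)\<close> along words.
    Whether the image is a reflection depends on the parity of the exponent alone, which is why the
    definition splits there.\<close>
  define f where "f g = (let h = fst g div 2 in
    if even (fst g) then if snd g then (1 + 4 * h - h * K, False) else (- h * K, False)
    else if snd g then ((h + 1) * K - 4 * h - 3, True) else ((h + 1) * K, True))" for g :: "int \<times> bool"
  \<comment> \<open>On the generators this is the forced amount \<open>chi (i + 1) - chi i\<close>:
    modulo \<open>n\<close>, \<open>2 * i + 1\<close> at odd and \<open>- 2 * i - 1\<close> at even
    indices.\<close>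
  define \<pi> where "\<pi> g = (if snd g then - 1 - 2 * fst g else 1 + 2 * fst g)" for g :: "int \<times> bool"
  have f: "f (2 * h, False) = (- h * K, False)" "f (2 * h + 1, False) = ((h + 1) * K, True)"
    "f (2 * h, True) = (1 + 4 * h - h * K, False)" "f (2 * h + 1, True) = ((h + 1) * K - 4 * h - 3, True)" for h
    by (simp_all add: f_def)
  show ?thesis
  proof (rule reflexible_regular[where f = f and \<pi> = \<pi> and \<mu> = "- 1" and \<nu> = 0 and c = 0])
    show "dih_eq (int n) (f g) (f g')" if "dih_eq (int n) g g'" for g g'
    proof -
      obtain j e j' where g: "g = (j, e)" "g' = (j', e)" and jj: "int n dvd j - j'"
        using \<open>dih_eq (int n) g g'\<close> by (cases g; cases g') auto
      have "even j \<longleftrightarrow> even j'" using evn[OF jj] by simp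
      then consider h h' where "j = 2 * h" "j' = 2 * h'" | h h' where "j = 2 * h + 1" "j' = 2 * h' + 1"
        by (metis evenE oddE)
      then show ?thesis
      proof cases
        case 1
        have 2: "int n dvd 2 * (h - h')" using jj 1 by (simp add: algebra_simps)
        then have k: "int n dvd (h - h') * K" by (simp add: K_unit)
        have "int n dvd - h * K - (- h' * K)" using k by (rule dvd_comb1[where a = "- 1"]) (simp add: algebra_simps)
        moreover have "int n dvd (1 + 4 * h - h * K) - (1 + 4 * h' - h' * K)"
          using k 2 by (rule dvd_comb2[where a = "- 1" and b = 2]) (simp add: algebra_simps)
        ultimately show ?thesis unfolding g 1 by (cases e) (simp_all only: f dih_eq_rot)
      next
        case 2
        have 3: "int n dvd 2 * (h - h')" using jj 2 by (simp add: algebra_simps)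
        then have k: "int n dvd (h - h') * K" by (simp add: K_unit)
        have "int n dvd (h + 1) * K - (h' + 1) * K" using k by (rule dvd_comb1[where a = 1]) (simp add: algebra_simps)
        moreover have "int n dvd ((h + 1) * K - 4 * h - 3) - ((h' + 1) * K - 4 * h' - 3)"
          using k 3 by (rule dvd_comb2[where a = 1 and b = "- 2"]) (simp add: algebra_simps)
        ultimately show ?thesis unfolding g 2 by (cases e) (simp_all only: f dih_eq_rot)
      qed
    qed
    show "dih_eq (int n) (f (0, False)) (0, False)" "\<pi> (0, False) = 1"
      by (simp_all add: f_def \<pi>_def)
    show "dih_eq (int n) (f (dmul g (y i))) (dmul (f g) (y (i + \<pi> g)))" for g i
    proof -
      obtain j e where g: "g = (j, e)" by (cases g)
      \<comment> \<open>In each of the eight cases the two exponents differ by some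
        \<open>8 * \<kappa> * a\<close>, which vanishes modulo \<open>n\<close>.\<close>
      have cong: "int n dvd w" if "w = 8 * \<kappa> * a" for w a
        using \<kappa> that by simp
      note eqs = f y_even y_odd dmul_rot dmul_ref dih_eq_rot
      consider (ee) h u where "j = 2 * h" "i = 2 * u" | (eo) h u where "j = 2 * h" "i = 2 * u + 1"
        | (oe) h u where "j = 2 * h + 1" "i = 2 * u" | (oo) h u where "j = 2 * h + 1" "i = 2 * u + 1"
        by (metis evenE oddE)
      then show ?thesis
      proof cases
        case ee
        show ?thesis
        proof (cases e)
          case False
          then have e: "e = False" by simp
          have "dmul g (y i) = (2 * (h + u + 2 * u * \<kappa>), True)" "i + \<pi> g = 2 * (u + 2 * h) + 1"
            unfolding g e ee y_even by (simp_all add: \<pi>_def K_def algebra_simps)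
          then show ?thesis unfolding g e ee
            by (simp only: eqs) (intro conjI refl cong[where a = "- u * \<kappa>"], simp_all add: K_def algebra_simps)
        next
          case True
          then have e: "e = True" by simp
          have "dmul g (y i) = (2 * (h - u - 2 * u * \<kappa>), False)" "i + \<pi> g = 2 * (u - 1 - 2 * h) + 1"
            unfolding g e ee y_even by (simp_all add: \<pi>_def K_def algebra_simps)
          then show ?thesis unfolding g e ee
            by (simp only: eqs) (intro conjI refl cong[where a = "u * \<kappa> + u"], simp_all add: K_def algebra_simps)
        qed
      next
        case eo
        show ?thesis
        proof (cases e)
          case False
          then have e: "e = False" by simp
          have "dmul g (y i) = (2 * (h + u) + 1, False)" "i + \<pi> g = 2 * (u + 1 + 2 * h)"
            unfolding g e eo y_odd by (simp_all add: \<pi>_def algebra_simps)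
          then show ?thesis unfolding g e eo
            by (simp only: eqs) (intro conjI refl cong[where a = 0], simp_all add: K_def algebra_simps)
        next
          case True
          then have e: "e = True" by simp
          have "dmul g (y i) = (2 * (h - u - 1) + 1, True)" "i + \<pi> g = 2 * (u - 2 * h)"
            unfolding g e eo y_odd by (simp_all add: \<pi>_def algebra_simps)
          then show ?thesis unfolding g e eo
            by (simp only: eqs) (intro conjI refl cong[where a = "2 * h - u"], simp_all add: K_def algebra_simps)
        qed
      next
        case oe
        show ?thesis
        proof (cases e)
          case False
          then have e: "e = False" by simp
          have "dmul g (y i) = (2 * (h + u + 2 * u * \<kappa>) + 1, True)" "i + \<pi> g = 2 * (u + 1 + 2 * h) + 1"
            unfolding g e oe y_even by (simp_all add: \<pi>_def K_def algebra_simps)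
          then show ?thesis unfolding g e oe
            by (simp only: eqs) (intro conjI refl cong[where a = "u * \<kappa>"], simp_all add: K_def algebra_simps)
        next
          case True
          then have e: "e = True" by simp
          have "dmul g (y i) = (2 * (h - u - 2 * u * \<kappa>) + 1, False)" "i + \<pi> g = 2 * (u - 2 - 2 * h) + 1"
            unfolding g e oe y_even by (simp_all add: \<pi>_def K_def algebra_simps)
          then show ?thesis unfolding g e oe
            by (simp only: eqs) (intro conjI refl cong[where a = "- u * \<kappa> - u"], simp_all add: K_def algebra_simps)
        qed
      next
        case oo
        show ?thesis
        proof (cases e)
          case False
          then have e: "e = False" by simp
          have "dmul g (y i) = (2 * (h + u + 1), False)" "i + \<pi> g = 2 * (u + 2 + 2 * h)"
            unfolding g e oo y_odd by (simp_all add: \<pi>_def algebra_simps)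
          then show ?thesis unfolding g e oo
            by (simp only: eqs) (intro conjI refl cong[where a = 0], simp_all add: K_def algebra_simps)
        next
          case True
          then have e: "e = True" by simp
          have "dmul g (y i) = (2 * (h - u), True)" "i + \<pi> g = 2 * (u - 1 - 2 * h)"
            unfolding g e oo y_odd by (simp_all add: \<pi>_def algebra_simps)
          then show ?thesis unfolding g e oo
            by (simp only: eqs) (intro conjI refl cong[where a = "u - 2 * h - 1"], simp_all add: K_def algebra_simps)
        qed
      qed
    qed
    show "dih_eq (int n) (- 1 * fst (y i) + (if snd (y i) then 0 else 0), snd (y i)) (y (0 - i))" for i
    proof (cases "even i")
      case True
      then obtain h where "i = 2 * h" by blast
      then show ?thesis using y_even[of "- h"] by (simp add: y_even)
    qed (simp add: y_def)
  qed
qed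

lemma reflexible_regular_cyc2:
  assumes "0 < n" "even n"
  shows "reflexible_regular_CM_cycle (dihedral n) (cyc2 n)"
  by (rule reflexible_regular_alternating[where \<kappa> = 0])
    (use assms in \<open>simp_all add: cyc2_def apow_eq apow_b_eq\<close>)

lemma reflexible_regular_cyc3:
  assumes "0 < n" "n = 2 * m" "8 dvd n"
  shows "reflexible_regular_CM_cycle (dihedral n) (cyc3 n m)"
proof -
  obtain q where q: "n = 8 * q" using assms(3) by blast
  then have m: "m = 4 * q" using assms(2) by simp
  show ?thesis
    by (rule reflexible_regular_alternating[where \<kappa> = "int q"])
      (use assms(1) in \<open>simp_all add: cyc3_def apow_eq apow_b_eq q m\<close>)
qed

text \<open>
  Here the rotation about \<open>1\<close> inverts the subgroup generated by \<open>a\<^sup>M\<close>, so it is given by a table on the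
  cosets: \<open>a\<^sup>jb\<^sup>e\<close> with \<open>j \<equiv> r (mod M)\<close> has the image \<open>(C r e - j, E r e)\<close> and is rotated by \<open>J r e\<close>. The
  list \<open>R\<close> contains the residues of the exponents in \<open>L\<close>, and the mirror symmetry maps index \<open>u\<close> to \<open>1 - u\<close>.
\<close>

lemma reflexible_regular_table:
  fixes L :: "(int \<times> bool) list" and C :: "int \<Rightarrow> bool \<Rightarrow> int" and E :: "int \<Rightarrow> bool \<Rightarrow> bool"
    and J :: "int \<Rightarrow> bool \<Rightarrow> nat" and R :: "int list" and M :: int and \<chi> :: "nat list"
  assumes n: "0 < n" and ys: "ys = map (dred n) L"
    and dist: "\<And>u v. u < v \<Longrightarrow> v < length L \<Longrightarrow> \<not> dih_eq (int n) (L ! u) (L ! v)"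
    and one: "\<And>g. g \<in> set L \<Longrightarrow> \<not> dih_eq (int n) g (0, False)"
    and inv: "\<And>u. u < length L \<Longrightarrow> \<chi> ! u < length L \<and> dih_eq (int n) (dmul (L ! u) (L ! (\<chi> ! u))) (0, False)"
    and gens: "(0, True) \<in> set L" "(1, False) \<in> set L"
    and M: "0 < M" "M dvd int n" and R: "\<And>u. u < length L \<Longrightarrow> M dvd fst (L ! u) - R ! u"
    and init: "C 0 False = 0" "E 0 False = False" "J 0 False = 1"
    and table: "\<And>r e u r' w. 0 \<le> r \<Longrightarrow> r < M \<Longrightarrow> u < length L \<Longrightarrow>
      r' = (if e then r - R ! u else r + R ! u) mod M \<Longrightarrow> w = snd (L ! u) \<Longrightarrow>
      dih_eq (int n) (C r' (e \<noteq> w) - (if e then - fst (L ! u) else fst (L ! u)), E r' (e \<noteq> w))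
        (dmul (C r e, E r e) (L ! ((u + J r e) mod length L)))"
    and refl: "\<And>u. u < length L \<Longrightarrow>
      dih_eq (int n) (- fst (L ! u) + (if snd (L ! u) then \<nu> else 0), snd (L ! u)) (L ! ((1 + length L - u) mod length L))"
  shows "reflexible_regular_CM_cycle (dihedral n) ys"
proof -
  define d where "d = length L"
  have d: "0 < d" using gens(1) by (auto simp: d_def)
  define ix where "ix i = nat (i mod int d)" for i
  have ix: "ix i < d" "int (ix i) = i mod int d" for i using d by (simp_all add: ix_def nat_less_iff)
  have ix_int: "ix (int k) = k mod d" for k by (simp add: ix_def nat_mod_as_int)
  have ix_eq: "ix i = ix j \<longleftrightarrow> int d dvd i - j" for i j
    by (metis ix(2) ix_def mod_eq_dvd_iff)
  have ix_plus: "ix (i + int k) = (ix i + k) mod d" for i k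
  proof -
    have "ix (i + int k) = ix (int (ix i + k))"
      unfolding ix_eq by (simp add: ix(2) mod_eq_dvd_iff[symmetric])
    then show ?thesis by (simp only: ix_int)
  qed
  define y where "y i = L ! ix i" for i
  have y_set: "y i \<in> set L" for i using ix(1) by (simp add: y_def d_def)
  have gen_y: "\<exists>i. g = y i" if g: "g \<in> set L" for g
  proof -
    obtain k where "k < d" "g = L ! k" using g by (auto simp: d_def in_set_conv_nth)
    then have "g = y (int k)" by (simp add: y_def ix_int)
    then show ?thesis ..
  qed
  interpret cycle_system n d ys y "\<lambda>i. int (\<chi> ! ix i)"
  proof
    show "0 < n" "0 < d" by (fact n d)+
    show "length ys = d" by (simp add: ys d_def)
    show "ys ! k = dred n (y (int k))" if "k < d" for k using that by (simp add: ys y_def ix_int d_def)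
    show "dih_eq (int n) (y i) (y j) \<longleftrightarrow> int d dvd i - j" for i j
    proof -
      have "dih_eq (int n) (y i) (y j) \<longleftrightarrow> ix i = ix j"
      proof (cases "ix i" "ix j" rule: linorder_cases)
        case less
        then show ?thesis using dist[OF less] ix(1) by (simp add: y_def d_def)
      next
        case greater
        then show ?thesis using dist[OF greater] ix(1) dih_eq_sym[of "int n" "L ! ix i" "L ! ix j"] by (auto simp: y_def d_def)
      qed (simp add: y_def)
      then show ?thesis by (simp add: ix_eq)
    qed
    show "\<not> dih_eq (int n) (y i) (0, False)" for i using one y_set by blast
    show "dih_eq (int n) (dmul (y i) (y (int (\<chi> ! ix i)))) (0, False)" for i
      using inv[of "ix i"] ix(1)[of i] by (simp add: y_def ix_int d_def)
    show "Q g" if Q: "Q (0, False)" "\<And>g i. Q g \<Longrightarrow> Q (dmul g (y i))" for Q g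
    proof (rule dihedral_induct[of Q])
      show "Q (0, False)" by (rule Q(1))
      show "Q (dmul g (0, True))" "Q (dmul g (1, False))" if "Q g" for g
        using gen_y[OF gens(1)] gen_y[OF gens(2)] Q(2)[OF that] by metis+
    qed
  qed
  define f where "f g = (C (fst g mod M) (snd g) - fst g, E (fst g mod M) (snd g))" for g
  define \<pi> where "\<pi> g = int (J (fst g mod M) (snd g))" for g
  show ?thesis
  proof (rule reflexible_regular[where f = f and \<pi> = \<pi> and \<mu> = "- 1" and \<nu> = \<nu> and c = 1])
    show "dih_eq (int n) (f g) (f h)" if "dih_eq (int n) g h" for g h
    proof -
      have e: "snd g = snd h" and gh: "int n dvd fst g - fst h" using that by (simp_all add: dih_eq_def)
      have "fst g mod M = fst h mod M" unfolding mod_eq_dvd_iff using M(2) gh by (rule dvd_trans)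
      then show ?thesis using e gh by (simp add: f_def dvd_diff_commute)
    qed
    show "dih_eq (int n) (f (0, False)) (0, False)" "\<pi> (0, False) = 1" using init by (simp_all add: f_def \<pi>_def)
    show "dih_eq (int n) (f (dmul g (y i))) (dmul (f g) (y (i + \<pi> g)))" for g i
    proof -
      obtain j e where g: "g = (j, e)" by (cases g)
      define r where "r = j mod M"
      define u where "u = ix i"
      define r' where "r' = (if e then r - R ! u else r + R ! u) mod M"
      have u: "u < length L" using ix(1) by (simp add: u_def d_def)
      have r: "0 \<le> r" "r < M" using M(1) by (simp_all add: r_def)
      have R': "fst (L ! u) mod M = (R ! u) mod M" using R[OF u] by (simp add: mod_eq_dvd_iff)
      have "(if e then j - fst (L ! u) else j + fst (L ! u)) mod M = r'"
        unfolding r'_def r_def by (simp add: mod_simps) (metis R' mod_add_cong mod_diff_cong)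
      \<comment> \<open>The summand \<open>- j\<close> splits off on both sides, since
        multiplication on the right leaves the sign of the first exponent alone. What remains is a
        condition on the residue \<open>r\<close>, that is, the finite table.\<close>
      then have "f (dmul g (y i)) = (C r' (e \<noteq> snd (L ! u)) - (if e then - fst (L ! u) else fst (L ! u)) - j, E r' (e \<noteq> snd (L ! u)))"
        by (cases e) (simp_all add: f_def g dmul_def y_def u_def)
      moreover have "dmul (f g) (y (i + \<pi> g)) =
          (fst (dmul (C r e, E r e) (L ! ((u + J r e) mod d))) - j, snd (dmul (C r e, E r e) (L ! ((u + J r e) mod d))))"
        by (simp add: f_def g dmul_def y_def \<pi>_def r_def u_def ix_plus)
      ultimately show ?thesis
        using table[OF r u r'_def HOL.refl] by (cases e) (simp_all add: dih_eq_def d_def algebra_simps)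
    qed
    show "dih_eq (int n) (- 1 * fst (y i) + (if snd (y i) then \<nu> else 0), snd (y i)) (y (1 - i))" for i
    proof -
      have "ix (1 - i) = ix (int (1 + d - ix i))"
        unfolding ix_eq using ix(1)[of i]
        by (simp add: of_nat_diff ix(2) mod_eq_dvd_iff[symmetric] mod_simps)
      then have "ix (1 - i) = (1 + length L - ix i) mod length L" by (simp add: ix_int d_def)
      then show ?thesis using refl[of "ix i"] ix(1)[of i] by (simp add: y_def d_def)
    qed
  qed
qed

lemma less_4_cases: "(k::nat) < 4 \<Longrightarrow> k = 0 \<or> k = 1 \<or> k = 2 \<or> k = 3"
  by auto

lemma less_6_cases: "(k::nat) < 6 \<Longrightarrow> k = 0 \<or> k = 1 \<or> k = 2 \<or> k = 3 \<or> k = 4 \<or> k = 5"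
  by auto

lemma small_not_dvd: "0 < \<bar>c\<bar> \<Longrightarrow> \<bar>c\<bar> < N \<Longrightarrow> \<not> N dvd (c::int)"
  using zdvd_imp_le[of N "\<bar>c\<bar>"] by auto

text \<open>The six cosets modulo 3 carry the table, obtained by propagating the rotation from 1
  along the generators. The mirror takes \<open>a\<close> to \<open>a^-1\<close> and
  \<open>b\<close> to \<open>a^2 b\<close>, exchanging the first two and the last two
  entries.\<close>

lemma reflexible_regular_cyc4:
  assumes "0 < k" "n = 3 * k"
  shows "reflexible_regular_CM_cycle (dihedral n) (cyc4 n)"
proof -
  have n: "2 < n" using assms by simp
  let ?L = "[(- 1, False), (1, False), (0, True), (2, True)] :: (int \<times> bool) list"
  let ?C = "\<lambda>r e. (if e then [2, 2, 1] else [0, 1, 0]) ! nat r :: int"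
  let ?E = "\<lambda>r e. (if e then [True, True, False] else [False, True, False]) ! nat r"
  let ?P = "\<lambda>r e. (if e then [1, 3, 2] else [1, 2, 3]) ! nat r :: nat"
  show ?thesis
  proof (rule reflexible_regular_table[where L = ?L and C = ?C and E = ?E and J = ?P and M = 3 and
        R = "[2, 1, 0, 2]" and \<chi> = "[1, 0, 2, 3]" and \<nu> = 2])
    show "0 < n" using n by simp
    show "cyc4 n = map (dred n) ?L" using n by (simp add: cyc4_def apow_eq apow_b_eq dred_def)
    show "\<not> dih_eq (int n) (?L ! u) (?L ! v)" if "u < v" "v < length ?L" for u v
    proof -
      have "v = 0 \<or> v = 1 \<or> v = 2 \<or> v = 3" "u = 0 \<or> u = 1 \<or> u = 2 \<or> u = 3"
        using that less_4_cases[of v] less_4_cases[of u] by simp_all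
      then show ?thesis using that n by (elim disjE) (simp_all add: small_not_dvd)
    qed
    show "\<not> dih_eq (int n) g (0, False)" if "g \<in> set ?L" for g
      using that n by (auto simp: small_not_dvd)
    show "3 dvd int n" using assms by simp
    fix u assume "u < length ?L"
    then have u: "u = 0 \<or> u = 1 \<or> u = 2 \<or> u = 3" using less_4_cases[of u] by simp
    show "[1, 0, 2, 3] ! u < length ?L \<and> dih_eq (int n) (dmul (?L ! u) (?L ! ([1, 0, 2, 3] ! u))) (0, False)"
      using u by (elim disjE) simp_all
    show "3 dvd fst (?L ! u) - [2, 1, 0, 2] ! u" using u by (elim disjE) simp_all
    show "dih_eq (int n) (- fst (?L ! u) + (if snd (?L ! u) then 2 else 0), snd (?L ! u)) (?L ! ((1 + length ?L - u) mod length ?L))"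
      using u by (elim disjE) simp_all
    fix r r' :: int and e w assume r: "0 \<le> r" "r < 3" and r': "r' = (if e then r - [2, 1, 0, 2] ! u else r + [2, 1, 0, 2] ! u) mod 3"
      and w: "w = snd (?L ! u)"
    have "r = 0 \<or> r = 1 \<or> r = 2" using r by linarith
    then show "dih_eq (int n) (?C r' (e \<noteq> w) - (if e then - fst (?L ! u) else fst (?L ! u)), ?E r' (e \<noteq> w))
        (dmul (?C r e, ?E r e) (?L ! ((u + ?P r e) mod length ?L)))"
      using u unfolding r' w by (elim disjE; cases e) simp_all
  qed simp_all
qed

text \<open>Here \<open>m\<close> is 2 modulo 4, which fixes the residues \<open>R\<close> of the
  entries that involve \<open>m\<close> and lets a table modulo 4 suffice. Positive \<open>k\<close>
  keeps \<open>a^(m - 1)\<close> apart from \<open>a\<close>.\<close>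

lemma reflexible_regular_cyc5:
  assumes "0 < k" "n = 2 * m" "n = 8 * k + 4"
  shows "reflexible_regular_CM_cycle (dihedral n) (cyc5 n m)"
proof -
  have mk: "int m = 4 * int k + 2" using assms by simp
  have m: "6 \<le> int m" using mk assms(1) by simp
  let ?m = "int m"
  let ?L = "[(- 1, False), (1, False), (0, True), (?m + 1, False), (?m - 1, False), (?m + 2, True)] :: (int \<times> bool) list"
  let ?C = "\<lambda>r e. (if e then [1 + ?m, 2 + ?m, 2 + ?m, 1] else [0, 1, 1 + ?m, 0]) ! nat r :: int"
  let ?E = "\<lambda>r e. (if e then [False, True, True, False] else [False, True, True, False]) ! nat r"
  let ?P = "\<lambda>r e. (if e then [2, 1, 5, 4] else [1, 2, 4, 5]) ! nat r :: nat"
  have n: "int n = 2 * ?m" using assms(2) by simp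
  show ?thesis
  proof (rule reflexible_regular_table[where L = ?L and C = ?C and E = ?E and J = ?P and M = 4 and
        R = "[3, 1, 0, 3, 1, 0]" and \<chi> = "[1, 0, 2, 4, 3, 5]" and \<nu> = "int m + 2"])
    show n0: "0 < n" using assms by simp
    show "cyc5 n m = map (dred n) ?L" by (simp add: n0 cyc5_def apow_eq apow_b_eq dred_def)
    show "\<not> dih_eq (int n) (?L ! u) (?L ! v)" if "u < v" "v < length ?L" for u v
    proof -
      have "v = 0 \<or> v = 1 \<or> v = 2 \<or> v = 3 \<or> v = 4 \<or> v = 5" "u = 0 \<or> u = 1 \<or> u = 2 \<or> u = 3 \<or> u = 4 \<or> u = 5"
        using that less_6_cases[of v] less_6_cases[of u] by simp_all
      then show ?thesis using that m by (elim disjE) (simp_all add: n small_not_dvd)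
    qed
    show "\<not> dih_eq (int n) g (0, False)" if "g \<in> set ?L" for g
      using that m by (auto simp: n small_not_dvd)
    show "4 dvd int n" using assms(3) by presburger
    fix u assume "u < length ?L"
    then have u: "u = 0 \<or> u = 1 \<or> u = 2 \<or> u = 3 \<or> u = 4 \<or> u = 5" using less_6_cases[of u] by simp
    show "[1, 0, 2, 4, 3, 5] ! u < length ?L \<and> dih_eq (int n) (dmul (?L ! u) (?L ! ([1, 0, 2, 4, 3, 5] ! u))) (0, False)"
      using u by (elim disjE) (simp_all add: n)
    show "4 dvd fst (?L ! u) - [3, 1, 0, 3, 1, 0] ! u" using u mk by (elim disjE) simp_all
    show "dih_eq (int n) (- fst (?L ! u) + (if snd (?L ! u) then int m + 2 else 0), snd (?L ! u)) (?L ! ((1 + length ?L - u) mod length ?L))"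
      using u by (elim disjE) (simp_all add: n)
    fix r r' :: int and e w assume r: "0 \<le> r" "r < 4" and r': "r' = (if e then r - [3, 1, 0, 3, 1, 0] ! u else r + [3, 1, 0, 3, 1, 0] ! u) mod 4"
      and w: "w = snd (?L ! u)"
    have "r = 0 \<or> r = 1 \<or> r = 2 \<or> r = 3" using r by linarith
    then show "dih_eq (int n) (?C r' (e \<noteq> w) - (if e then - fst (?L ! u) else fst (?L ! u)), ?E r' (e \<noteq> w))
        (dmul (?C r e, ?E r e) (?L ! ((u + ?P r e) mod length ?L)))"
      using u unfolding r' w by (elim disjE; cases e) (simp_all add: n)
  qed simp_all
qed

text \<open>Since \<open>m\<close> is odd, parity of the exponent is enough for the table; positive
  \<open>k\<close> gives \<open>m\<close> at least 3 and with it distinct entries.\<close>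

lemma reflexible_regular_cyc6:
  assumes "0 < k" "n = 2 * m" "n = 4 * k + 2"
  shows "reflexible_regular_CM_cycle (dihedral n) (cyc6 n m)"
proof -
  have mk: "int m = 2 * int k + 1" using assms by simp
  have m: "3 \<le> int m" using mk assms(1) by simp
  let ?m = "int m"
  let ?L = "[(0, True), (?m - 2, True), (1, False), (- 2, True), (?m, True), (- 1, False)] :: (int \<times> bool) list"
  let ?C = "\<lambda>r e. (if e then [?m - 2, ?m - 1] else [0, - 1]) ! nat r :: int"
  let ?E = "\<lambda>r e. (if e then [True, False] else [False, True]) ! nat r"
  let ?P = "\<lambda>r e. (if e then [1, 4] else [1, 4]) ! nat r :: nat"
  have n: "int n = 2 * ?m" using assms(2) by simp
  show ?thesis
  proof (rule reflexible_regular_table[where L = ?L and C = ?C and E = ?E and J = ?P and M = 2 and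
        R = "[0, 1, 1, 0, 1, 1]" and \<chi> = "[0, 1, 5, 3, 4, 2]" and \<nu> = "int m - 2"])
    show n0: "0 < n" using assms by simp
    show "cyc6 n m = map (dred n) ?L" by (simp add: n0 cyc6_def apow_eq apow_b_eq dred_def)
    show "\<not> dih_eq (int n) (?L ! u) (?L ! v)" if "u < v" "v < length ?L" for u v
    proof -
      have "v = 0 \<or> v = 1 \<or> v = 2 \<or> v = 3 \<or> v = 4 \<or> v = 5" "u = 0 \<or> u = 1 \<or> u = 2 \<or> u = 3 \<or> u = 4 \<or> u = 5"
        using that less_6_cases[of v] less_6_cases[of u] by simp_all
      then show ?thesis using that m by (elim disjE) (simp_all add: n small_not_dvd)
    qed
    show "\<not> dih_eq (int n) g (0, False)" if "g \<in> set ?L" for g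
      using that m by (auto simp: n small_not_dvd)
    show "2 dvd int n" using assms by simp
    fix u assume "u < length ?L"
    then have u: "u = 0 \<or> u = 1 \<or> u = 2 \<or> u = 3 \<or> u = 4 \<or> u = 5" using less_6_cases[of u] by simp
    show "[0, 1, 5, 3, 4, 2] ! u < length ?L \<and> dih_eq (int n) (dmul (?L ! u) (?L ! ([0, 1, 5, 3, 4, 2] ! u))) (0, False)"
      using u by (elim disjE) (simp_all add: n)
    show "2 dvd fst (?L ! u) - [0, 1, 1, 0, 1, 1] ! u" using u mk by (elim disjE) simp_all
    show "dih_eq (int n) (- fst (?L ! u) + (if snd (?L ! u) then int m - 2 else 0), snd (?L ! u)) (?L ! ((1 + length ?L - u) mod length ?L))"
      using u by (elim disjE) (simp_all add: n)
    fix r r' :: int and e w assume r: "0 \<le> r" "r < 2" and r': "r' = (if e then r - [0, 1, 1, 0, 1, 1] ! u else r + [0, 1, 1, 0, 1, 1] ! u) mod 2"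
      and w: "w = snd (?L ! u)"
    have "r = 0 \<or> r = 1" using r by linarith
    then show "dih_eq (int n) (?C r' (e \<noteq> w) - (if e then - fst (?L ! u) else fst (?L ! u)), ?E r' (e \<noteq> w))
        (dmul (?C r e, ?E r e) (?L ! ((u + ?P r e) mod length ?L)))"
      using u unfolding r' w by (elim disjE; cases e) (simp_all add: n)
  qed simp_all
qed

theorem theorem1p1:
  fixes n :: nat
  assumes "n \<ge> 2"
  shows
    "(\<forall>X p d. reflexible_regular_CM (dihedral n) X p \<and> d = card X \<longrightarrow>
        (d = 2 \<longrightarrow> CM (dihedral n) X p \<simeq>\<^sub>m CM_cycle (dihedral n) [apow_b n 0, apow_b n 1]) \<and>
        (d = 3 \<longrightarrow>
           CM (dihedral n) X p \<simeq>\<^sub>m CM_cycle (dihedral 2) [apow_b 2 0, apow_b 2 1, apow 2 1] \<or>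
           CM (dihedral n) X p \<simeq>\<^sub>m CM_cycle (dihedral 3) [apow_b 3 0, apow_b 3 1, apow_b 3 2] \<or>
           CM (dihedral n) X p \<simeq>\<^sub>m CM_cycle (dihedral 4) [apow_b 4 0, apow 4 1, apow 4 (- 1)]) \<and>
        (d \<ge> 4 \<longrightarrow>
           (\<exists>l::int. [l\<^sup>2 = 1] (mod int n) \<and> least_geom_sum_zero n l d \<and>
              CM (dihedral n) X p \<simeq>\<^sub>m CM_cycle (dihedral n) (cyc1 n l d)) \<or>
           (even n \<and> CM (dihedral n) X p \<simeq>\<^sub>m CM_cycle (dihedral n) (cyc2 n)) \<or>
           (\<exists>m. n = 2 * m \<and> 8 dvd n \<and>
              CM (dihedral n) X p \<simeq>\<^sub>m CM_cycle (dihedral n) (cyc3 n m)) \<or>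
           (\<exists>k>0. n = 3 * k \<and>
              CM (dihedral n) X p \<simeq>\<^sub>m CM_cycle (dihedral n) (cyc4 n)) \<or>
           (\<exists>m. \<exists>k>0. n = 2 * m \<and> n = 8 * k + 4 \<and>
              CM (dihedral n) X p \<simeq>\<^sub>m CM_cycle (dihedral n) (cyc5 n m)) \<or>
           (\<exists>m. \<exists>k>0. n = 2 * m \<and> n = 4 * k + 2 \<and>
              CM (dihedral n) X p \<simeq>\<^sub>m CM_cycle (dihedral n) (cyc6 n m)))) \<and>
     (\<forall>(l::int) d. [l\<^sup>2 = 1] (mod int n) \<and> least_geom_sum_zero n l d \<longrightarrow>
        reflexible_regular_CM_cycle (dihedral n) (cyc1 n l d)) \<and>
     (even n \<longrightarrow> reflexible_regular_CM_cycle (dihedral n) (cyc2 n)) \<and>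
     (\<forall>m. n = 2 * m \<and> 8 dvd n \<longrightarrow> reflexible_regular_CM_cycle (dihedral n) (cyc3 n m)) \<and>
     (\<forall>k>0. n = 3 * k \<longrightarrow> reflexible_regular_CM_cycle (dihedral n) (cyc4 n)) \<and>
     (\<forall>m. \<forall>k>0. n = 2 * m \<and> n = 8 * k + 4 \<longrightarrow>
        reflexible_regular_CM_cycle (dihedral n) (cyc5 n m)) \<and>
     (\<forall>m. \<forall>k>0. n = 2 * m \<and> n = 4 * k + 2 \<longrightarrow>
        reflexible_regular_CM_cycle (dihedral n) (cyc6 n m))"
proof (intro conjI)
  have n: "0 < n" using assms by simp
  show "\<forall>(l::int) d. [l\<^sup>2 = 1] (mod int n) \<and> least_geom_sum_zero n l d \<longrightarrow>
      reflexible_regular_CM_cycle (dihedral n) (cyc1 n l d)"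
    using reflexible_regular_cyc1[OF n] by blast
  show "even n \<longrightarrow> reflexible_regular_CM_cycle (dihedral n) (cyc2 n)"
    using reflexible_regular_cyc2[OF n] by blast
  show "\<forall>m. n = 2 * m \<and> 8 dvd n \<longrightarrow> reflexible_regular_CM_cycle (dihedral n) (cyc3 n m)"
    using reflexible_regular_cyc3[OF n] by blast
  show "\<forall>k>0. n = 3 * k \<longrightarrow> reflexible_regular_CM_cycle (dihedral n) (cyc4 n)"
    using reflexible_regular_cyc4 by blast
  show "\<forall>m. \<forall>k>0. n = 2 * m \<and> n = 8 * k + 4 \<longrightarrow> reflexible_regular_CM_cycle (dihedral n) (cyc5 n m)"
    using reflexible_regular_cyc5 by blast
  show "\<forall>m. \<forall>k>0. n = 2 * m \<and> n = 4 * k + 2 \<longrightarrow> reflexible_regular_CM_cycle (dihedral n) (cyc6 n m)"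
    using reflexible_regular_cyc6 by blast
qed (intro allI impI, elim conjE, rule classification[OF assms])

end
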